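(* Let $u_1\in\mathscr E(1)\cap L^2(\mathbb R)$. Then the solution $u\in\mathscr E([1/T,T])$ of (mKdV) with $u(1)=u_1$ given by the local existence theorem recalled in the context is unique, and furthermore there is persistence of regularity: $u\in\mathcal C([1/T,T],L^2(\mathbb R))$.
   Context: Fix $\epsilon\in\{+1,-1\}$. (mKdV) is the equation $\partial_t u+\partial_{xxx}u+\epsilon\,\partial_x(u^3)=0$ for real-valued $u=u(t,x)$, $x\in\mathbb R$; solutions are understood in the sense of distributions. All functions/distributions $u(t)$ are real-valued. $\hat v(p)=\int_{\mathbb R}e^{-ipx}v(x)\,dx$ is the Fourier transform in $x$. $\mathcal G(t)$ is the linear KdV group, $\widehat{\mathcal G(t)v}(p)=e^{itp^3}\hat v(p)$. The profile of $u$ is $\tilde u(t,p)=e^{-itp^3}\hat u(t,p)$. For $t>0$, $\|v\|_{\mathscr E(t)}=\|\widehat{\mathcal G(-t)v}\|_{L^\infty(\mathbb R)}+t^{-1/6}\|\partial_p\widehat{\mathcal G(-t)v}\|_{L^2((0,+\infty))}$, where the derivative is taken on $(0,+\infty)$ only (a jump at $p=0$ is allowed). $\mathscr E(1)=\{v\in\mathcal S'(\mathbb R):\|v\|_{\mathscr E(1)}<+\infty\}$. For an interval $I\subset(0,+\infty)$, $$\mathscr E(I)=\{u:I\to\mathcal S'(\mathbb R):\ \tilde u\in\mathcal C(I,\mathcal C_b((0,+\infty))),\ \partial_p\tilde u\in L^\infty(I,L^2((0,+\infty)))\},$$ with norm $\|u\|_{\mathscr E(I)}=\sup_{t\in I}\|u(t)\|_{\mathscr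 E(t)}$. Local existence theorem: for every $u_1\in\mathscr E(1)$ there exist $T>1$ and a solution $u\in\mathscr E([1/T,T])$ of (mKdV) such that $u(1)=u_1$. (This solution is constructed as a limit of solutions of approximate problems in which the nonlinearity and the data are smoothly truncated at high frequencies.) The $T$ and $u$ in the claim are those of this theorem. *)

theory Defs
  imports "HOL-Probability.Essential_Supremum"
begin

definition dir_deriv ::
    "'a::euclidean_space \<Rightarrow> ('a \<Rightarrow> 'b::real_normed_vector) \<Rightarrow> 'a \<Rightarrow> 'b" where
  "dir_deriv e f = (\<lambda>x. frechet_derivative f (at x) e)"

primrec C_k :: "nat \<Rightarrow> ('a::euclidean_space \<Rightarrow> 'b::real_normed_vector) \<Rightarrow> bool" where
  "C_k 0 f \<longleftrightarrow> continuous_on UNIV f"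
| "C_k (Suc k) f \<longleftrightarrow>
     (\<forall>x. f differentiable (at x)) \<and> (\<forall>e\<in>Basis. C_k k (dir_deriv e f))"

definition smooth :: "('a::euclidean_space \<Rightarrow> 'b::real_normed_vector) \<Rightarrow> bool" where
  "smooth f \<longleftrightarrow> (\<forall>k. C_k k f)"

definition test_fun ::
    "'a::euclidean_space set \<Rightarrow> ('a \<Rightarrow> 'b::real_normed_vector) \<Rightarrow> bool" where
  "test_fun A \<phi> \<longleftrightarrow> smooth \<phi> \<and> (\<exists>K. compact K \<and> K \<subseteq> A \<and> (\<forall>x. x \<notin> K \<longrightarrow> \<phi> x = 0))"

definition locally_integrable ::
    "'a::euclidean_space set \<Rightarrow> ('a \<Rightarrow> 'b::{banach, second_countable_topology}) \<Rightarrow> bool" where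
  "locally_integrable A f \<longleftrightarrow> (\<forall>K. compact K \<and> K \<subseteq> A \<longrightarrow> set_integrable lborel K f)"


definition schwartz_seminorm :: "nat \<Rightarrow> nat \<Rightarrow> (real \<Rightarrow> complex) \<Rightarrow> real" where
  "schwartz_seminorm m n \<phi> = (SUP x. \<bar>x\<bar> ^ m * cmod ((dir_deriv 1 ^^ n) \<phi> x))"

definition schwartz :: "(real \<Rightarrow> complex) set" where
  "schwartz = {\<phi>. smooth \<phi> \<and>
     (\<forall>m n. bounded (range (\<lambda>x. \<bar>x\<bar> ^ m * cmod ((dir_deriv 1 ^^ n) \<phi> x))))}"

type_synonym distr = "(real \<Rightarrow> complex) \<Rightarrow> complex"

(* The value 0 is imposed outside the Schwartz space, so that equality of functionals
   is equality of tempered distributions. *)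
definition tempered_distr :: "distr set" where
  "tempered_distr = {S.
     (\<forall>\<phi>\<in>schwartz. \<forall>\<psi>\<in>schwartz. S (\<lambda>x. \<phi> x + \<psi> x) = S \<phi> + S \<psi>) \<and>
     (\<forall>\<phi>\<in>schwartz. \<forall>c. S (\<lambda>x. c * \<phi> x) = c * S \<phi>) \<and>
     (\<exists>C N. \<forall>\<phi>\<in>schwartz. cmod (S \<phi>) \<le> C * (\<Sum>m\<le>N. \<Sum>n\<le>N. schwartz_seminorm m n \<phi>)) \<and>
     (\<forall>\<phi>. \<phi> \<notin> schwartz \<longrightarrow> S \<phi> = 0)}"

definition real_distr :: "distr \<Rightarrow> bool" where
  "real_distr S \<longleftrightarrow> (\<forall>\<phi>\<in>schwartz. S (\<lambda>x. cnj (\<phi> x)) = cnj (S \<phi>))"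

definition fourier :: "(real \<Rightarrow> complex) \<Rightarrow> real \<Rightarrow> complex" where
  "fourier \<phi> p = (LINT x|lborel. exp (- (\<i> * of_real (p * x))) * \<phi> x)"

definition fourier_distr :: "distr \<Rightarrow> distr" where
  "fourier_distr S = (\<lambda>\<phi>. if \<phi> \<in> schwartz then S (fourier \<phi>) else 0)"

definition mult_distr :: "(real \<Rightarrow> complex) \<Rightarrow> distr \<Rightarrow> distr" where
  "mult_distr h S = (\<lambda>\<phi>. S (\<lambda>p. h p * \<phi> p))"

definition deriv_distr :: "distr \<Rightarrow> distr" where
  "deriv_distr S = (\<lambda>\<phi>. - S (dir_deriv 1 \<phi>))"

definition represents :: "real set \<Rightarrow> distr \<Rightarrow> (real \<Rightarrow> complex) \<Rightarrow> bool" where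
  "represents A S g \<longleftrightarrow> locally_integrable A g \<and>
     (\<forall>\<phi>. test_fun A \<phi> \<longrightarrow> S \<phi> = (LINT x|lborel. g x * \<phi> x))"

(* Both norms are infinite when the distribution is not a locally integrable function
   (on A, respectively on the line); the representing function is unique up to null sets. *)
definition Linf_norm :: "distr \<Rightarrow> ennreal" where
  "Linf_norm S = (INF g\<in>{g. represents UNIV S g}. esssup lborel (\<lambda>p. ennreal (cmod (g p))))"

definition L2_norm :: "real set \<Rightarrow> distr \<Rightarrow> ennreal" where
  "L2_norm A S = Inf {c. \<exists>g. represents A S g \<and>
     (\<integral>\<^sup>+p\<in>A. ennreal ((cmod (g p))\<^sup>2) \<partial>lborel) \<le> c\<^sup>2}"


(* The Fourier transform of v carried back to time 0 by the linear KdV group. *)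
definition profile :: "real \<Rightarrow> distr \<Rightarrow> distr" where
  "profile t v = mult_distr (\<lambda>p. exp (- (\<i> * of_real (t * p ^ 3)))) (fourier_distr v)"

definition E_norm :: "real \<Rightarrow> distr \<Rightarrow> ennreal" where
  "E_norm t v = Linf_norm (profile t v)
     + ennreal (t powr (- 1 / 6)) * L2_norm {0<..} (deriv_distr (profile t v))"

definition E_one :: "distr set" where
  "E_one = {v \<in> tempered_distr. real_distr v \<and> E_norm 1 v < \<infinity>}"

definition E_interval_norm :: "real set \<Rightarrow> (real \<Rightarrow> distr) \<Rightarrow> ennreal" where
  "E_interval_norm I u = (SUP t\<in>I. E_norm t (u t))"

(* Finiteness of the norm is a separate conjunct: the other conditions only see the profile
   on the open half-line (and by symmetry on its opposite), not a mass at frequency 0.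
   The values of u outside I play no role. *)
definition E_interval :: "real set \<Rightarrow> (real \<Rightarrow> distr) set" where
  "E_interval I = {u.
     (\<forall>t\<in>I. u t \<in> tempered_distr \<and> real_distr (u t)) \<and>
     (\<exists>F. (\<forall>t\<in>I. represents {0<..} (profile t (u t)) (F t) \<and>
              continuous_on {0<..} (F t) \<and> bounded (F t ` {0<..})) \<and>
          (\<forall>t\<^sub>0\<in>I. uniform_limit {0<..} F (F t\<^sub>0) (at t\<^sub>0 within I))) \<and>
     (\<exists>C<\<infinity>. AE t in lborel. t \<in> I \<longrightarrow> L2_norm {0<..} (deriv_distr (profile t (u t))) \<le> C) \<and>
     E_interval_norm I u < \<infinity>}"

(* The cube is that of a function: U is the function of (t, x) given by u, and the equation
   is tested against smooth compactly supported functions of (t, x); all derivatives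
   falling on the test function come with the same sign. *)
definition mKdV_solution :: "real \<Rightarrow> real set \<Rightarrow> (real \<Rightarrow> distr) \<Rightarrow> bool" where
  "mKdV_solution \<epsilon> I u \<longleftrightarrow> (\<exists>U::real \<times> real \<Rightarrow> real.
     (\<forall>t\<in>I. represents UNIV (u t) (\<lambda>x. of_real (U (t, x)))) \<and>
     locally_integrable (interior I \<times> UNIV) U \<and>
     locally_integrable (interior I \<times> UNIV) (\<lambda>z. U z ^ 3) \<and>
     (\<forall>\<phi>::real \<times> real \<Rightarrow> real. test_fun (interior I \<times> UNIV) \<phi> \<longrightarrow>
        (LINT z|lborel.
           U z * (dir_deriv (1, 0) \<phi> z + (dir_deriv (0, 1) ^^ 3) \<phi> z)
           + \<epsilon> * U z ^ 3 * dir_deriv (0, 1) \<phi> z) = 0))"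

definition continuous_L2 :: "real set \<Rightarrow> (real \<Rightarrow> distr) \<Rightarrow> bool" where
  "continuous_L2 I u \<longleftrightarrow>
     (\<forall>t\<in>I. L2_norm UNIV (u t) < \<infinity>) \<and>
     (\<forall>t\<^sub>0\<in>I. ((\<lambda>t. L2_norm UNIV (\<lambda>\<phi>. u t \<phi> - u t\<^sub>0 \<phi>)) \<longlongrightarrow> 0) (at t\<^sub>0 within I))"

end

theory Submission imports Defs "HOL-Probability.Probability"
begin

text \<open>
  Write \<open>J = x - 3 t \<partial>\<^sub>x\<^sup>2\<close>; on the Fourier side this operator differentiates the profile.
  For \<open>u\<close> in \<open>E(t)\<close> the profile is bounded and its derivative is square integrable on the positive half-line,
  and the method of stationary phase gives
  \<open>\<bar>u\<bar> \<le> C (1 + \<bar>x\<bar>)\<^sup>-\<^sup>1\<^sup>/\<^sup>4\<close>, \<open>\<bar>u\<^sub>x\<bar> \<le> C (1 + \<bar>x\<bar>)\<^sup>1\<^sup>/\<^sup>4\<close>.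
  So \<open>u\<close> need not be square integrable, but \<open>u u\<^sub>x\<close> is bounded.

  The theorem follows from one estimate: two solutions \<open>u\<close>, \<open>v\<close> bounded in this sense satisfy, with \<open>w = u - v\<close>,
  \<open>\<integral> w(t)\<^sup>2 \<le> exp (C \<bar>t - s\<bar>) \<integral> w(s)\<^sup>2\<close> for all times \<open>s\<close>, \<open>t\<close>, whether or not the right-hand side is finite
  (lemma \<open>L2_growth\<close>). With \<open>s = 1\<close> and equal data it is uniqueness. With \<open>v = 0\<close> it shows that the
  square norm of \<open>u(t)\<close> is finite and depends continuously on \<open>t\<close>; as \<open>u\<close> is continuous in \<open>(t, x)\<close>, Scheffe's lemma
  then gives continuity with values in \<open>L\<^sup>2\<close>.

  To prove the estimate, differentiate \<open>\<integral> w\<^sup>2 \<chi>\<close> in time, where \<open>\<chi>(t, x) = \<chi>\<^sub>0(x / (R t))\<close> is a cutoff whose edges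
  move along rays:
  \<open>d/dt \<integral> w\<^sup>2 \<chi> = \<integral> (- 3 w\<^sub>x\<^sup>2 - (x / t) w\<^sup>2) \<chi>\<^sub>x + \<integral> w\<^sup>2 \<chi>\<^sub>x\<^sub>x\<^sub>x - 2 \<epsilon> \<integral> w \<chi> (u\<^sup>3 - v\<^sup>3)\<^sub>x\<close>
  (lemma \<open>energy_identity\<close>, obtained by mollifying in \<open>x\<close>).
  The term \<open>w\<^sub>x\<^sup>2 \<chi>\<^sub>x\<close> has no sign and is not small, since \<open>w\<^sub>x\<close> grows. The motion of the edges
  compensates it: up to a small term in \<open>w\<^sup>2 \<chi>\<^sub>x\<^sub>x\<^sub>x\<close> an integration by parts turns the first integral into
  \<open>- (1 / t) \<integral> w (J w) \<chi>\<^sub>x\<close>, where the second derivative of \<open>w\<close> has disappeared in \<open>J w\<close>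
  (lemma \<open>virial\<close>). Here \<open>J w\<close> is a bounded function, coming from the
  jump of the profile at frequency 0, plus a square integrable function,
  while \<open>\<chi>\<^sub>x\<close> is of size \<open>1 / R\<close> on a set of length \<open>R\<close> where \<open>w\<close> is of size
  \<open>R\<^sup>-\<^sup>1\<^sup>/\<^sup>4\<close>; so this integral tends to 0 as \<open>R\<close> tends to infinity. In the last integral,
  \<open>u\<^sup>3 - v\<^sup>3 = w V\<close> with \<open>V = u\<^sup>2 + u v + v\<^sup>2\<close> and
  \<open>V\<^sub>x\<close> bounded, so that \<open>2 w \<chi> (w V)\<^sub>x\<close> integrates to
  \<open>w\<^sup>2 \<chi> V\<^sub>x - w\<^sup>2 \<chi>\<^sub>x V\<close>, which is \<open>O(w\<^sup>2 \<chi>)\<close> up to a vanishing term (lemma \<open>Q_bound\<close>).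
  Gronwall's lemma and the limit \<open>R \<rightarrow> \<infinity>\<close> finish the proof.

  The rest is translation between distributions and functions: a distribution in \<open>E(t)\<close> is the function
  \<open>Re (\<integral>\<^sub>0\<^sup>\<infinity> exp (i (x p + t p\<^sup>3)) G(p) dp) / \<pi>\<close> (lemma \<open>kdv_represents_weakly\<close>), and the equation in the sense of
  distributions holds when integrated in time against test functions of \<open>x\<close> alone (lemma \<open>weak_kdv_of_solution\<close>).
\<close>

section \<open>Smooth functions\<close>

lemma C_k_Suc_imp: "C_k (Suc k) f \<Longrightarrow> C_k k f"
proof (induction k arbitrary: f)
  case 0
  then show ?case
    by (auto intro!: continuous_at_imp_continuous_on differentiable_imp_continuous_within)
next
  case (Suc k)
  then show ?case by auto
qed

lemma C_k_mono: "C_k k f \<Longrightarrow> j \<le> k \<Longrightarrow> C_k j f"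
  by (induction k arbitrary: j) (auto simp: le_Suc_eq dest: C_k_Suc_imp simp del: C_k.simps)

lemma C_k_continuous: "C_k k f \<Longrightarrow> continuous_on UNIV f"
  using C_k_mono[of k f 0] by simp

lemma dir_deriv_eqI: "(f has_derivative f') (at x) \<Longrightarrow> dir_deriv e f x = f' e"
  unfolding dir_deriv_def by (metis frechet_derivative_at)

lemma C_k_SucI:
  assumes "\<And>x. (f has_derivative f' x) (at x)" "\<And>e. e \<in> Basis \<Longrightarrow> C_k k (\<lambda>x. f' x e)"
  shows "C_k (Suc k) f"
proof -
  have "dir_deriv e f = (\<lambda>x. f' x e)" for e
    using dir_deriv_eqI[OF assms(1)] by auto
  then show ?thesis using assms by (auto simp: differentiable_def)
qed

lemma C_k_Suc_has_derivative:
  "C_k (Suc k) f \<Longrightarrow> (f has_derivative (\<lambda>e. dir_deriv e f x)) (at x)"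
  unfolding dir_deriv_def by (auto simp: frechet_derivative_works)

lemma C_k_add:
  "C_k k f \<Longrightarrow> C_k k g \<Longrightarrow> C_k k (\<lambda>x. f x + g x)"
proof (induction k arbitrary: f g)
  case 0 then show ?case by (auto intro: continuous_intros)
next
  case (Suc k)
  have "C_k k (\<lambda>x. dir_deriv e f x + dir_deriv e g x)" if "e \<in> Basis" for e
    using Suc.prems that by (intro Suc.IH) auto
  then show ?case
    by (rule C_k_SucI[OF has_derivative_add[OF Suc.prems[THEN C_k_Suc_has_derivative]]])
qed

lemma C_k_bilinear:
  assumes "bounded_bilinear B"
  shows "C_k k f \<Longrightarrow> C_k k g \<Longrightarrow> C_k k (\<lambda>x. B (f x) (g x))"
proof (induction k arbitrary: f g)
  case 0 then show ?case
    using bounded_bilinear.continuous_on[OF assms] by auto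
next
  case (Suc k)
  have 1: "C_k k (dir_deriv e f)" "C_k k (dir_deriv e g)" if "e \<in> Basis" for e
    using Suc.prems that by auto
  have 2: "C_k k f" "C_k k g" using Suc.prems C_k_Suc_imp by blast+
  show ?case
    by (rule C_k_SucI[OF bounded_bilinear.FDERIV[OF assms Suc.prems[THEN C_k_Suc_has_derivative]]])
       (rule C_k_add[OF Suc.IH Suc.IH], simp_all add: 1 2)
qed

lemmas C_k_mult = C_k_bilinear[OF bounded_bilinear_mult]
lemmas C_k_scaleR = C_k_bilinear[OF bounded_bilinear_scaleR]

lemma C_k_const [simp]: "C_k k (\<lambda>x. c)"
proof (induction k arbitrary: c)
  case (Suc k)
  show ?case by (rule C_k_SucI[where f' = "\<lambda>x e. 0"]) (use Suc in auto)
qed auto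

lemma C_k_bounded_linear:
  assumes "bounded_linear L" shows "C_k k f \<Longrightarrow> C_k k (\<lambda>x. L (f x))"
proof (induction k arbitrary: f)
  case 0 then show ?case using bounded_linear.continuous_on[OF assms] by auto
next
  case (Suc k)
  show ?case
    by (rule C_k_SucI[where f' = "\<lambda>x e. L (dir_deriv e f x)"])
       (use Suc bounded_linear.has_derivative[OF assms C_k_Suc_has_derivative] in auto)
qed

lemma C_k_compose_affine:
  fixes f :: "real \<Rightarrow> 'b::real_normed_vector" and L :: "'a::euclidean_space \<Rightarrow> real"
  assumes "bounded_linear L"
  shows "C_k k f \<Longrightarrow> C_k k (\<lambda>x. f (c + L x))"
proof (induction k arbitrary: f)
  case 0
  have "continuous_on UNIV (\<lambda>x. c + L x)"
    by (intro continuous_intros linear_continuous_on assms)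
  then show ?case using 0 by (auto intro: continuous_on_compose2)
next
  case (Suc k)
  have "((\<lambda>x. f (c + L x)) has_derivative (\<lambda>e. dir_deriv (L e) f (c + L x))) (at x)" for x
  proof -
    have "((\<lambda>x. c + L x) has_derivative L) (at x)"
      using bounded_linear_imp_has_derivative[OF assms] by (auto intro!: derivative_eq_intros)
    from has_derivative_compose[OF this C_k_Suc_has_derivative[OF Suc.prems]] show ?thesis by simp
  qed
  moreover have "dir_deriv (L e) f (c + L x) = L e *\<^sub>R dir_deriv 1 f (c + L x)" for e x
  proof -
    have "linear (\<lambda>e. dir_deriv e f (c + L x))"
      using C_k_Suc_has_derivative[OF Suc.prems] has_derivative_linear by blast
    from linear_scale[OF this, of "L e" 1] show ?thesis by simp
  qed
  ultimately have d: "((\<lambda>x. f (c + L x)) has_derivative (\<lambda>e. L e *\<^sub>R dir_deriv 1 f (c + L x))) (at x)" for x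
    by simp
  have "C_k k (dir_deriv 1 f)" using Suc.prems by simp
  then have "C_k k (\<lambda>x. dir_deriv 1 f (c + L x))" by (rule Suc.IH)
  then show ?case
    by (intro C_k_SucI[OF d] C_k_scaleR) auto
qed

lemma C_k_iexp:
  fixes \<theta> :: "'a::euclidean_space \<Rightarrow> real"
  shows "C_k k \<theta> \<Longrightarrow> C_k k (\<lambda>x. exp (\<i> * complex_of_real (\<theta> x)))"
proof (induction k)
  case 0 then show ?case by (auto intro!: continuous_intros)
next
  case (Suc k)
  have d: "((\<lambda>x. exp (\<i> * complex_of_real (\<theta> x))) has_derivative
      (\<lambda>e. \<i> * complex_of_real (dir_deriv e \<theta> x) * exp (\<i> * complex_of_real (\<theta> x)))) (at x)" for x
  proof -
    have "((\<lambda>x. complex_of_real (\<theta> x)) has_derivative (\<lambda>e. complex_of_real (dir_deriv e \<theta> x))) (at x)"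
      by (rule bounded_linear.has_derivative[OF bounded_linear_of_real C_k_Suc_has_derivative[OF Suc.prems]])
    from has_derivative_compose[OF has_derivative_mult_right[OF this, of "\<i>"]
        DERIV_exp[THEN has_field_derivative_imp_has_derivative]]
    show ?thesis by (simp add: mult_ac)
  qed
  have "C_k k (\<lambda>x. \<i> * complex_of_real (dir_deriv e \<theta> x) * exp (\<i> * complex_of_real (\<theta> x)))"
    if "e \<in> Basis" for e
    using Suc C_k_Suc_imp[OF Suc.prems] that
    by (intro C_k_mult C_k_bounded_linear[OF bounded_linear_of_real] C_k_const) auto
  then show ?case by (rule C_k_SucI[OF d])
qed

lemma C_k_uminus: "C_k k f \<Longrightarrow> C_k k (\<lambda>x. - f x)"
  using C_k_bounded_linear[OF bounded_linear_minus[OF bounded_linear_ident]] by blast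

lemma C_k_id: "C_k k (\<lambda>x::real. x)"
proof (cases k)
  case (Suc j)
  show ?thesis unfolding Suc
    by (rule C_k_SucI[where f' = "\<lambda>x e. e"]) auto
qed auto

lemma C_k_power:
  fixes f :: "'a::euclidean_space \<Rightarrow> 'b::real_normed_algebra_1"
  shows "C_k k f \<Longrightarrow> C_k k (\<lambda>x. f x ^ n)"
  by (induction n) (auto intro: C_k_mult)

lemma C_k_of_real: "C_k k f \<Longrightarrow> C_k k (\<lambda>x. of_real (f x) :: 'b::real_normed_algebra_1)"
  by (rule C_k_bounded_linear[OF bounded_linear_of_real])

lemma smooth_add: "smooth f \<Longrightarrow> smooth g \<Longrightarrow> smooth (\<lambda>x. f x + g x)"
  by (auto simp: smooth_def intro: C_k_add)
lemma smooth_uminus: "smooth f \<Longrightarrow> smooth (\<lambda>x. - f x)"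
  by (auto simp: smooth_def intro: C_k_uminus)
lemma smooth_diff: "smooth f \<Longrightarrow> smooth g \<Longrightarrow> smooth (\<lambda>x. f x - g x)"
  using smooth_add[OF _ smooth_uminus, of f g] by simp
lemma smooth_mult:
  fixes f :: "'a::euclidean_space \<Rightarrow> 'b::real_normed_algebra"
  shows "smooth f \<Longrightarrow> smooth g \<Longrightarrow> smooth (\<lambda>x. f x * g x)"
  by (auto simp: smooth_def intro: C_k_mult)
lemma smooth_const [simp]: "smooth (\<lambda>x. c)"
  by (auto simp: smooth_def)
lemma smooth_id [simp]: "smooth (\<lambda>x::real. x)"
  by (auto simp: smooth_def C_k_id)
lemma smooth_power:
  fixes f :: "'a::euclidean_space \<Rightarrow> 'b::real_normed_algebra_1"
  shows "smooth f \<Longrightarrow> smooth (\<lambda>x. f x ^ n)"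
  by (auto simp: smooth_def intro: C_k_power)
lemma smooth_of_real:
  "smooth f \<Longrightarrow> smooth (\<lambda>x. of_real (f x) :: 'b::real_normed_algebra_1)"
  by (auto simp: smooth_def intro: C_k_of_real)
lemma smooth_iexp: "smooth \<theta> \<Longrightarrow> smooth (\<lambda>x. exp (\<i> * complex_of_real (\<theta> x)))"
  by (auto simp: smooth_def intro: C_k_iexp)
lemma smooth_compose_affine:
  fixes f :: "real \<Rightarrow> 'b::real_normed_vector" and L :: "'a::euclidean_space \<Rightarrow> real"
  shows "bounded_linear L \<Longrightarrow> smooth f \<Longrightarrow> smooth (\<lambda>x. f (c + L x))"
  by (auto simp: smooth_def intro: C_k_compose_affine)
lemma smooth_bounded_linear: "bounded_linear L \<Longrightarrow> smooth f \<Longrightarrow> smooth (\<lambda>x. L (f x))"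
  by (auto simp: smooth_def intro: C_k_bounded_linear)

lemma smooth_continuous_on: "smooth f \<Longrightarrow> continuous_on A f"
  unfolding smooth_def using C_k_continuous continuous_on_subset by blast

lemma smooth_dir_deriv: "smooth f \<Longrightarrow> e \<in> Basis \<Longrightarrow> smooth (dir_deriv e f)"
  unfolding smooth_def by (metis C_k.simps(2))

lemma smooth_has_derivative: "smooth f \<Longrightarrow> (f has_derivative (\<lambda>e. dir_deriv e f x)) (at x)"
  unfolding smooth_def using C_k_Suc_has_derivative by blast

lemma smooth_has_vector_derivative:
  fixes f :: "real \<Rightarrow> 'b::real_normed_vector"
  assumes "smooth f"
  shows "(f has_vector_derivative dir_deriv 1 f x) (at x within A)"
proof -
  have "linear (\<lambda>e. dir_deriv e f x)"
    using smooth_has_derivative[OF assms] has_derivative_linear by blast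
  then have "(\<lambda>e. dir_deriv e f x) = (\<lambda>e. e *\<^sub>R dir_deriv 1 f x)"
    using linear_scale[of "\<lambda>e. dir_deriv e f x" _ 1] by (metis mult.right_neutral real_scaleR_def)
  then show ?thesis
    using smooth_has_derivative[OF assms, of x]
    unfolding has_vector_derivative_def by (auto intro: has_derivative_at_withinI)
qed

lemma dir_deriv_eq_vector:
  "(f has_vector_derivative f') (at x) \<Longrightarrow> dir_deriv 1 f x = f'"
  unfolding has_vector_derivative_def by (drule dir_deriv_eqI[where e=1]) simp

lemma smooth_vec_derivI:
  fixes f :: "real \<Rightarrow> 'b::real_normed_vector"
  assumes "\<And>x. (f has_vector_derivative f' x) (at x)" "smooth f'"
  shows "smooth f"
  unfolding smooth_def
proof
  fix k
  have "C_k (Suc k) f"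
    by (rule C_k_SucI[where f' = "\<lambda>x e. e *\<^sub>R f' x"])
       (use assms in \<open>auto simp: has_vector_derivative_def smooth_def\<close>)
  then show "C_k k f" by (rule C_k_Suc_imp)
qed

text \<open>Smoothness of functions whose derivatives keep their shape: polynomials in \<open>1/x\<close> times \<open>exp (-1/x)\<close>, and Fourier transforms of Schwartz functions.\<close>

lemma smooth_family:
  fixes F :: "(real \<Rightarrow> 'b::real_normed_vector) set"
  assumes "\<And>f. f \<in> F \<Longrightarrow> \<exists>f'\<in>F. \<forall>x. (f has_vector_derivative f' x) (at x)" "f \<in> F"
  shows "smooth f"
proof -
  have "\<forall>f\<in>F. C_k k f" for k
  proof (induction k)
    case 0
    show ?case
    proof
      fix f assume "f \<in> F"
      then obtain f' where "\<forall>x. (f has_vector_derivative f' x) (at x)" using assms by blast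
      then show "C_k 0 f"
        by (auto intro!: continuous_at_imp_continuous_on has_vector_derivative_continuous)
    qed
  next
    case (Suc k)
    show ?case
    proof
      fix f assume "f \<in> F"
      then obtain f' where f': "\<forall>x. (f has_vector_derivative f' x) (at x)" "f' \<in> F" using assms by blast
      then show "C_k (Suc k) f"
        by (intro C_k_SucI[where f' = "\<lambda>x e. e *\<^sub>R f' x"])
           (use Suc in \<open>auto simp: has_vector_derivative_def smooth_def simp del: C_k.simps\<close>)
    qed
  qed
  then show ?thesis using assms by (auto simp: smooth_def)
qed

section \<open>Bump functions\<close>

text \<open>The polynomial makes the family closed under differentiation: in the variable \<open>y = 1/x\<close> the derivative of
  \<open>P(y) exp (-y)\<close> is \<open>y\<^sup>2 (P - P')(y) exp (-y)\<close>.\<close>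

definition flat :: "real poly \<Rightarrow> real \<Rightarrow> real" where
  "flat P x = (if x > 0 then poly P (1/x) * exp (-1/x) else 0)"

lemma poly_exp_decay: "((\<lambda>y. poly P y * exp (- y)) \<longlongrightarrow> 0) at_top" for P :: "real poly"
proof -
  have "((\<lambda>y. \<Sum>i\<le>degree P. coeff P i * (y ^ i / exp y)) \<longlongrightarrow> (\<Sum>i\<le>degree P. coeff P i * 0)) at_top"
    by (intro tendsto_intros tendsto_power_div_exp_0)
  then show ?thesis
    by (simp add: poly_altdef sum_distrib_right exp_minus divide_inverse mult.assoc)
qed

lemma flat_has_derivative:
  "(flat P has_vector_derivative flat ([:0, 0, 1:] * (P - pderiv P)) x) (at x)"
proof -
  consider "x < 0" | "x > 0" | "x = 0" by linarith
  then show ?thesis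
  proof cases
    case 1
    have "((\<lambda>x. 0) has_vector_derivative flat ([:0, 0, 1:] * (P - pderiv P)) x) (at x)"
      using 1 by (auto simp: flat_def)
    then show ?thesis
      by (rule has_vector_derivative_transform_within_open[where S="{..<0}"])
         (use 1 in \<open>auto simp: flat_def\<close>)
  next
    case 2
    have d: "((\<lambda>x. 1/x) has_real_derivative - 1/(x*x)) (at x)"
      using 2 by (auto intro!: derivative_eq_intros)
    have "((\<lambda>x. poly P (1/x)) has_real_derivative poly (pderiv P) (1/x) * (- 1/(x*x))) (at x)"
      by (rule DERIV_chain2[OF poly_DERIV d])
    moreover have "((\<lambda>x. exp (-1/x)) has_real_derivative exp (-1/x) * (1/(x*x))) (at x)"
      using DERIV_chain2[OF DERIV_exp DERIV_minus[OF d]] by simp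
    ultimately have "((\<lambda>x. poly P (1/x) * exp (-1/x)) has_real_derivative
        poly (pderiv P) (1/x) * (- 1/(x*x)) * exp (-1/x) + exp (-1/x) * (1/(x*x)) * poly P (1/x)) (at x)"
      by (rule DERIV_mult)
    moreover have "poly (pderiv P) (1/x) * (- 1/(x*x)) * exp (-1/x) + exp (-1/x) * (1/(x*x)) * poly P (1/x)
        = flat ([:0, 0, 1:] * (P - pderiv P)) x"
      using 2 by (simp add: flat_def algebra_simps)
    ultimately have "((\<lambda>x. poly P (1/x) * exp (-1/x)) has_real_derivative
        flat ([:0, 0, 1:] * (P - pderiv P)) x) (at x)" by simp
    then show ?thesis
      unfolding has_real_derivative_iff_has_vector_derivative
      by (rule has_vector_derivative_transform_within_open[where S="{0<..}"])
         (use 2 in \<open>auto simp: flat_def\<close>)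
  next
    case 3
    have "((\<lambda>y. poly ([:0,1:] * P) y * exp (- y)) \<longlongrightarrow> 0) at_top" by (rule poly_exp_decay)
    then have "((\<lambda>x. poly ([:0,1:] * P) (inverse x) * exp (- inverse x)) \<longlongrightarrow> 0) (at_right 0)"
      by (rule filterlim_compose) (rule filterlim_inverse_at_top_right)
    then have r: "((\<lambda>x. flat P x / x) \<longlongrightarrow> 0) (at_right 0)"
    proof (rule Lim_transform_eventually)
      show "\<forall>\<^sub>F x in at_right 0. poly ([:0,1:] * P) (inverse x) * exp (- inverse x) = flat P x / x"
        unfolding eventually_at_filter
        by (rule always_eventually) (simp add: flat_def divide_inverse mult_ac)
    qed
    have l: "((\<lambda>x. flat P x / x) \<longlongrightarrow> 0) (at_left 0)"
      by (rule tendsto_eventually) (auto simp: flat_def eventually_at_filter)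
    have "((\<lambda>x. flat P x / x) \<longlongrightarrow> 0) (at 0)"
      using l r filterlim_split_at by blast
    then have "(flat P has_real_derivative 0) (at 0)"
      by (simp add: DERIV_def flat_def)
    then show ?thesis
      using 3 by (simp add: has_real_derivative_iff_has_vector_derivative flat_def)
  qed
qed

lemma smooth_flat: "smooth (flat P)"
proof (rule smooth_family[where F="range flat"])
  fix f assume "f \<in> range flat"
  then obtain P where P: "f = flat P" by auto
  show "\<exists>f'\<in>range flat. \<forall>x. (f has_vector_derivative f' x) (at x)"
    unfolding P by (intro bexI[of _ "flat ([:0, 0, 1:] * (P - pderiv P))"] allI flat_has_derivative rangeI)
qed auto

text \<open>The support lies to the right of 0, so that rescaled bumps average over a one-sided neighbourhood, as is needed at the end points of an interval.\<close>

definition bump :: "real \<Rightarrow> real" where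
  "bump x = flat 1 x * flat 1 (1 - x) / integral {0..1} (\<lambda>x. flat 1 x * flat 1 (1 - x))"

lemma bump_raw:
  "smooth (\<lambda>x. flat 1 x * flat 1 (1 - x))" "integral {0..1} (\<lambda>x. flat 1 x * flat 1 (1 - x)) > 0"
proof -
  have "smooth (\<lambda>x. flat 1 (1 + (- x)))"
    by (rule smooth_compose_affine[OF bounded_linear_minus[OF bounded_linear_ident] smooth_flat])
  then show s: "smooth (\<lambda>x. flat 1 x * flat 1 (1 - x))"
    using smooth_mult[OF smooth_flat] by auto
  have "integral {0..1} (\<lambda>x. flat 1 x * flat 1 (1 - x)) \<noteq> 0"
  proof
    assume *: "integral {0..1} (\<lambda>x. flat 1 x * flat 1 (1 - x)) = 0"
    have "\<forall>x\<in>{0..1}. flat 1 x * flat 1 (1 - x) = 0"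
      by (subst integral_eq_0_iff[of 0 1 "\<lambda>x. flat 1 x * flat 1 (1 - x)", symmetric])
         (use * smooth_continuous_on[OF s] in \<open>auto simp: flat_def\<close>)
    then have "flat 1 (1/2) * flat 1 (1 - 1/2) = 0" by auto
    then show False by (auto simp: flat_def)
  qed
  moreover have "integral {0..1} (\<lambda>x. flat 1 x * flat 1 (1 - x)) \<ge> 0"
    by (intro integral_nonneg integrable_continuous_interval smooth_continuous_on[OF s])
       (auto simp: flat_def)
  ultimately show "integral {0..1} (\<lambda>x. flat 1 x * flat 1 (1 - x)) > 0" by simp
qed

lemma smooth_bump: "smooth bump"
  unfolding bump_def divide_inverse
  by (intro smooth_mult smooth_const bump_raw(1))

lemma bump_nonneg: "bump x \<ge> 0"
  using bump_raw(2) by (auto simp: bump_def flat_def)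

lemma bump_eq_0: "x \<le> 0 \<or> x \<ge> 1 \<Longrightarrow> bump x = 0"
  by (auto simp: bump_def flat_def)

lemma integral_bump_eq_0: "b \<le> 0 \<or> a \<ge> 1 \<Longrightarrow> integral {a..b} bump = 0"
  by (subst integral_cong[of _ _ "\<lambda>_. 0"]) (auto intro!: bump_eq_0)

lemma integral_bump: "integral {0..1} bump = 1"
  using bump_raw(2) unfolding bump_def by simp

text \<open>The integral starts at -1, away from the support of the bump, so that every point where the step varies is interior.\<close>

definition step :: "real \<Rightarrow> real" where
  "step x = integral {-1..x} bump"

lemma step_has_derivative: "(step has_vector_derivative bump x) (at x)"
proof -
  consider "x < 0" | "x > -1" by linarith
  then show ?thesis
  proof cases
    case 1
    have zero: "step y = 0" if "y < 0" for y
      unfolding step_def using that by (intro integral_bump_eq_0) auto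
    have "((\<lambda>x. 0) has_vector_derivative bump x) (at x)"
      using 1 by (auto simp: bump_eq_0)
    then show ?thesis
      by (rule has_vector_derivative_transform_within_open[where S="{..<0}"])
         (use 1 zero in auto)
  next
    case 2
    have "((\<lambda>x. integral {-1..x} bump) has_vector_derivative bump x) (at x within {-1..x+1})"
      by (rule integral_has_vector_derivative) (use 2 smooth_continuous_on[OF smooth_bump] in auto)
    then have "((\<lambda>x. integral {-1..x} bump) has_vector_derivative bump x) (at x within {-1<..<x+1})"
      by (rule has_vector_derivative_within_subset) auto
    then show ?thesis
      using 2 unfolding step_def[abs_def] by (subst (asm) at_within_open) auto
  qed
qed

lemma smooth_step: "smooth step"
  by (rule smooth_vec_derivI[OF step_has_derivative smooth_bump])

lemma step_mono: "x \<le> y \<Longrightarrow> step x \<le> step y"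
  by (rule DERIV_nonneg_imp_nondecreasing)
     (use step_has_derivative bump_nonneg in \<open>auto simp: has_real_derivative_iff_has_vector_derivative\<close>)

lemma step_0: "x \<le> 0 \<Longrightarrow> step x = 0"
  unfolding step_def by (intro integral_bump_eq_0) auto

lemma step_1: assumes "x \<ge> 1" shows "step x = 1"
proof -
  have i: "bump integrable_on {a..b}" for a b
    by (rule integrable_continuous_interval[OF smooth_continuous_on[OF smooth_bump]])
  have "integral {-1..0} bump + integral {0..1} bump = integral {-1..1} bump"
    by (rule Henstock_Kurzweil_Integration.integral_combine) (auto simp: i)
  moreover have "integral {-1..1} bump + integral {1..x} bump = step x"
    unfolding step_def using assms by (intro Henstock_Kurzweil_Integration.integral_combine) (auto simp: i)
  moreover have "integral {-1..0} bump = 0" "integral {1..x} bump = 0"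
    by (auto intro!: integral_bump_eq_0)
  ultimately show ?thesis by (simp add: integral_bump)
qed

lemma step_bounds: "0 \<le> step x" "step x \<le> 1"
  using step_mono[of "min x 0" x] step_mono[of x "max x 1"] by (auto simp: step_0 step_1)

definition plateau :: "real \<Rightarrow> real \<Rightarrow> real \<Rightarrow> real \<Rightarrow> real" where
  "plateau a b d x = step ((x - a) / d) * step ((b - x) / d)"

lemma plateau_bounds: "0 \<le> plateau a b d x" "plateau a b d x \<le> 1"
  unfolding plateau_def using step_bounds by (auto intro: mult_le_one)

lemma plateau_eq_1: "d > 0 \<Longrightarrow> a + d \<le> x \<Longrightarrow> x \<le> b - d \<Longrightarrow> plateau a b d x = 1"
  unfolding plateau_def by (subst (1 2) step_1) (auto simp: field_simps)

lemma plateau_eq_0: "d > 0 \<Longrightarrow> x \<le> a \<or> b \<le> x \<Longrightarrow> plateau a b d x = 0"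
  unfolding plateau_def
  by (metis diff_le_0_iff_le divide_nonpos_pos mult_eq_0_iff step_0)

lemma smooth_affine: "smooth f \<Longrightarrow> smooth (\<lambda>x::real. f (c + k * x))"
  by (rule smooth_compose_affine) (auto intro: bounded_linear_intros)

lemma smooth_plateau: "smooth (plateau a b d)"
proof -
  have "smooth (\<lambda>x. step ((x - a) / d))" "smooth (\<lambda>x. step ((b - x) / d))"
    using smooth_affine[OF smooth_step, of "-a/d" "1/d"] smooth_affine[OF smooth_step, of "b/d" "-1/d"]
    by (auto simp: diff_divide_distrib)
  then show ?thesis unfolding plateau_def[abs_def] by (rule smooth_mult)
qed

lemma test_fun_plateau: "d > 0 \<Longrightarrow> {a..b} \<subseteq> A \<Longrightarrow> test_fun A (plateau a b d)"
  unfolding test_fun_def by (auto simp: smooth_plateau intro!: exI[of _ "{a..b}"] plateau_eq_0)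

section \<open>Schwartz functions\<close>

abbreviation D :: "(real \<Rightarrow> complex) \<Rightarrow> real \<Rightarrow> complex" where
  "D \<equiv> dir_deriv 1"

lemma smooth_D: "smooth f \<Longrightarrow> smooth (D f)"
  by (rule smooth_dir_deriv) auto

lemma smooth_D_pow: "smooth f \<Longrightarrow> smooth ((D ^^ n) f)"
  by (induction n) (auto intro: smooth_D)

lemma D_add: "smooth f \<Longrightarrow> smooth g \<Longrightarrow> D (\<lambda>x. f x + g x) = (\<lambda>x. D f x + D g x)"
  by (rule ext, rule dir_deriv_eq_vector) (intro has_vector_derivative_add smooth_has_vector_derivative)

lemma D_mult: "smooth f \<Longrightarrow> smooth g \<Longrightarrow> D (\<lambda>x. f x * g x) = (\<lambda>x. f x * D g x + D f x * g x)"
  by (rule ext, rule dir_deriv_eq_vector) (intro has_vector_derivative_mult smooth_has_vector_derivative)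

lemma D_const: "D (\<lambda>x. c) = (\<lambda>x. 0)"
  by (rule ext, rule dir_deriv_eq_vector) auto

lemma D_cmult: "smooth f \<Longrightarrow> D (\<lambda>x. c * f x) = (\<lambda>x. c * D f x)"
  by (subst D_mult) (auto simp: D_const)

lemma D_pow_add: "smooth f \<Longrightarrow> smooth g \<Longrightarrow> (D ^^ n) (\<lambda>x. f x + g x) = (\<lambda>x. (D ^^ n) f x + (D ^^ n) g x)"
  by (induction n) (auto simp: D_add smooth_D_pow)

lemma D_pow_cmult: "smooth f \<Longrightarrow> (D ^^ n) (\<lambda>x. c * f x) = (\<lambda>x. c * (D ^^ n) f x)"
  by (induction n) (auto simp: D_cmult smooth_D_pow)

lemma D_of_real: "D complex_of_real = (\<lambda>x. 1)"
  by (rule ext, rule dir_deriv_eq_vector)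
     (auto simp: has_vector_derivative_def scaleR_conv_of_real
       intro!: derivative_eq_intros bounded_linear_imp_has_derivative bounded_linear_of_real)

lemma smooth_cor: "smooth complex_of_real"
  by (rule smooth_of_real[OF smooth_id])

lemma D_pow_mult_id:
  "smooth f \<Longrightarrow> (D ^^ n) (\<lambda>x. of_real x * f x) =
     (\<lambda>x. of_real x * (D ^^ n) f x + of_nat n * (D ^^ (n - 1)) f x)"
proof (induction n)
  case (Suc n)
  have *: "smooth (\<lambda>x. of_real x * (D ^^ n) f x)" "smooth (\<lambda>x. of_nat n * (D ^^ (n-1)) f x)"
    by (intro smooth_mult smooth_cor smooth_const smooth_D_pow Suc.prems)+
  have 1: "(D ^^ Suc n) (\<lambda>x. of_real x * f x) =
    D (\<lambda>x. of_real x * (D ^^ n) f x + of_nat n * (D ^^ (n - 1)) f x)"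
    using Suc by simp
  have 2: "D (\<lambda>x. of_real x * (D ^^ n) f x) = (\<lambda>x. of_real x * D ((D ^^ n) f) x + (D ^^ n) f x)"
    by (subst D_mult) (auto simp: D_of_real smooth_cor smooth_D_pow Suc.prems)
  have 3: "D (\<lambda>x. of_nat n * (D ^^ (n-1)) f x) = (\<lambda>x. of_nat n * D ((D ^^ (n-1)) f) x)"
    by (rule D_cmult) (rule smooth_D_pow[OF Suc.prems])
  have "(D ^^ Suc n) (\<lambda>x. of_real x * f x) =
      (\<lambda>x. (of_real x * D ((D ^^ n) f) x + (D ^^ n) f x) + of_nat n * D ((D ^^ (n-1)) f) x)"
    unfolding 1 D_add[OF *] 2 3 ..
  also have "\<dots> = (\<lambda>x. of_real x * (D ^^ Suc n) f x + of_nat (Suc n) * (D ^^ (Suc n - 1)) f x)"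
    by (cases n) (auto simp: fun_eq_iff algebra_simps)
  finally show ?case .
qed auto

lemma schwartz_iff: "f \<in> schwartz \<longleftrightarrow> smooth f \<and> (\<forall>m n. \<exists>C. \<forall>x. \<bar>x\<bar> ^ m * cmod ((D ^^ n) f x) \<le> C)"
  unfolding schwartz_def bounded_iff by (auto simp: abs_mult power_abs)

lemma schwartz_smooth: "f \<in> schwartz \<Longrightarrow> smooth f"
  by (simp add: schwartz_iff)

lemma schwartz_bound:
  assumes "f \<in> schwartz" obtains C where "C > 0" "\<And>x. \<bar>x\<bar> ^ m * cmod ((D ^^ n) f x) \<le> C"
proof -
  obtain C where "\<And>x. \<bar>x\<bar> ^ m * cmod ((D ^^ n) f x) \<le> C" using assms unfolding schwartz_iff by blast
  then show ?thesis using that[of "max C 1"] by (metis le_max_iff_disj less_max_iff_disj zero_less_one)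
qed

lemma schwartz_D: "f \<in> schwartz \<Longrightarrow> D f \<in> schwartz"
  unfolding schwartz_iff by (metis smooth_D funpow_Suc_right o_apply)

lemma schwartz_D_pow: "f \<in> schwartz \<Longrightarrow> (D ^^ n) f \<in> schwartz"
  by (induction n) (auto intro: schwartz_D)

lemma schwartz_add:
  assumes "f \<in> schwartz" "g \<in> schwartz" shows "(\<lambda>x. f x + g x) \<in> schwartz"
  unfolding schwartz_iff
proof (intro conjI allI)
  fix m n
  obtain C1 C2 where "\<And>x. \<bar>x\<bar> ^ m * cmod ((D ^^ n) f x) \<le> C1" "\<And>x. \<bar>x\<bar> ^ m * cmod ((D ^^ n) g x) \<le> C2"
    using assms schwartz_bound by metis
  then have "\<bar>x\<bar> ^ m * cmod ((D ^^ n) (\<lambda>x. f x + g x) x) \<le> C1 + C2" for x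
    unfolding D_pow_add[OF assms[THEN schwartz_smooth]]
    by (intro order_trans[OF mult_left_mono[OF norm_triangle_ineq]])
       (auto simp: distrib_left intro: add_mono)
  then show "\<exists>C. \<forall>x. \<bar>x\<bar> ^ m * cmod ((D ^^ n) (\<lambda>x. f x + g x) x) \<le> C" by blast
qed (use assms in \<open>auto intro: smooth_add schwartz_smooth\<close>)

lemma schwartz_cmult:
  assumes "f \<in> schwartz" shows "(\<lambda>x. c * f x) \<in> schwartz"
  unfolding schwartz_iff
proof (intro conjI allI)
  fix m n
  obtain C1 where "\<And>x. \<bar>x\<bar> ^ m * cmod ((D ^^ n) f x) \<le> C1"
    using assms schwartz_bound by metis
  then have "\<bar>x\<bar> ^ m * cmod ((D ^^ n) (\<lambda>x. c * f x) x) \<le> cmod c * C1" for x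
    unfolding D_pow_cmult[OF assms[THEN schwartz_smooth]]
    by (auto simp: norm_mult mult.left_commute intro: mult_left_mono)
  then show "\<exists>C. \<forall>x. \<bar>x\<bar> ^ m * cmod ((D ^^ n) (\<lambda>x. c * f x) x) \<le> C" by blast
qed (use assms in \<open>auto intro: smooth_mult schwartz_smooth\<close>)

lemma schwartz_diff: "f \<in> schwartz \<Longrightarrow> g \<in> schwartz \<Longrightarrow> (\<lambda>x. f x - g x) \<in> schwartz"
  using schwartz_add[OF _ schwartz_cmult[of g "-1"], of f] by simp

lemma seminorm_mult_id:
  assumes "smooth f"
  shows "\<bar>x\<bar> ^ m * cmod ((D ^^ n) (\<lambda>x. of_real x * f x) x)
    \<le> \<bar>x\<bar> ^ Suc m * cmod ((D ^^ n) f x) + n * (\<bar>x\<bar> ^ m * cmod ((D ^^ (n-1)) f x))"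
proof -
  have "\<bar>x\<bar> ^ m * cmod ((D ^^ n) (\<lambda>x. of_real x * f x) x)
      \<le> \<bar>x\<bar> ^ m * (cmod (of_real x * (D ^^ n) f x) + cmod (of_nat n * (D ^^ (n - 1)) f x))"
    unfolding D_pow_mult_id[OF assms] by (intro mult_left_mono norm_triangle_ineq) auto
  then show ?thesis by (simp add: norm_mult algebra_simps)
qed

lemma schwartz_mult_id:
  assumes "f \<in> schwartz" shows "(\<lambda>x. of_real x * f x) \<in> schwartz"
  unfolding schwartz_iff
proof (intro conjI allI)
  fix m n
  obtain C1 C2 where C: "\<And>x. \<bar>x\<bar> ^ Suc m * cmod ((D ^^ n) f x) \<le> C1" "\<And>x. \<bar>x\<bar> ^ m * cmod ((D ^^ (n-1)) f x) \<le> C2"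
    using assms schwartz_bound by metis
  have "\<bar>x\<bar> ^ m * cmod ((D ^^ n) (\<lambda>x. of_real x * f x) x) \<le> C1 + n * C2" for x
    by (rule order_trans[OF seminorm_mult_id[OF schwartz_smooth[OF assms]]]) (intro add_mono mult_left_mono C, auto)
  then show "\<exists>C. \<forall>x. \<bar>x\<bar> ^ m * cmod ((D ^^ n) (\<lambda>x. of_real x * f x) x) \<le> C" by blast
qed (use assms in \<open>auto intro: smooth_mult schwartz_smooth smooth_cor\<close>)

lemma D_pow_eq_0_outside:
  assumes "closed K" "\<And>x. x \<notin> K \<Longrightarrow> f x = 0" "x \<notin> K"
  shows "(D ^^ n) f x = 0"
  using assms(3)
proof (induction n arbitrary: x)
  case (Suc n)
  have "((\<lambda>x. 0) has_vector_derivative 0) (at x)" by simp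
  then have "((D ^^ n) f has_vector_derivative 0) (at x)"
    by (rule has_vector_derivative_transform_within_open[of _ _ _ "-K"])
       (use Suc assms in auto)
  then show ?case by (auto dest: dir_deriv_eq_vector)
qed (use assms in auto)

lemma test_fun_schwartz:
  assumes "test_fun A f" shows "f \<in> schwartz"
  unfolding schwartz_iff
proof (intro conjI allI)
  from assms obtain K where s: "smooth f" and K: "compact K" "\<And>x. x \<notin> K \<Longrightarrow> f x = 0"
    unfolding test_fun_def by blast
  show "smooth f" by fact
  fix m n
  have "continuous_on K (\<lambda>x. \<bar>x\<bar> ^ m * cmod ((D ^^ n) f x))"
    by (intro continuous_intros smooth_continuous_on smooth_D_pow s)
  from compact_imp_bounded[OF compact_continuous_image[OF this K(1)]]
  obtain C where C: "\<And>x. x \<in> K \<Longrightarrow> \<bar>x\<bar> ^ m * cmod ((D ^^ n) f x) \<le> C"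
    unfolding bounded_iff by (auto simp: abs_mult)
  have "\<bar>x\<bar> ^ m * cmod ((D ^^ n) f x) \<le> max C 0" for x
  proof (cases "x \<in> K")
    case False
    then have "(D ^^ n) f x = 0" using compact_imp_closed[OF K(1)] K(2) by (intro D_pow_eq_0_outside)
    then show ?thesis by simp
  qed (use C[of x] in auto)
  then show "\<exists>C. \<forall>x. \<bar>x\<bar> ^ m * cmod ((D ^^ n) f x) \<le> C" by blast
qed

lemma integrable_inv_quad: "integrable lborel (\<lambda>x::real. inverse (1 + x\<^sup>2))"
  using integrable_inverse_1_plus_square by (simp add: set_integrable_def einterval_def)

lemma schwartz_bound_quad:
  assumes "f \<in> schwartz" obtains C where "C > 0" "\<And>x. cmod (f x) \<le> C * inverse (1 + x\<^sup>2)"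
proof -
  obtain C1 C2 where C: "C1 > 0" "C2 > 0" "\<And>x. \<bar>x\<bar> ^ 0 * cmod ((D ^^ 0) f x) \<le> C1" "\<And>x. \<bar>x\<bar> ^ 2 * cmod ((D ^^ 0) f x) \<le> C2"
    using assms schwartz_bound by metis
  have "cmod (f x) \<le> (C1 + C2) * inverse (1 + x\<^sup>2)" for x
    using C(3,4)[of x] by (simp add: field_simps add_pos_nonneg)
  then show ?thesis using that[of "C1+C2"] C by auto
qed

lemma schwartz_measurable: "f \<in> schwartz \<Longrightarrow> f \<in> borel_measurable borel"
  by (intro borel_measurable_continuous_onI smooth_continuous_on schwartz_smooth)

lemma schwartz_integrable:
  assumes "f \<in> schwartz" shows "integrable lborel f"
proof -
  obtain C where C: "C > 0" "\<And>x. cmod (f x) \<le> C * inverse (1 + x\<^sup>2)" using schwartz_bound_quad[OF assms] by metis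
  have "integrable lborel (\<lambda>x::real. C * inverse (1 + x\<^sup>2))"
    by (intro integrable_mult_right integrable_inv_quad)
  then show ?thesis
    by (rule Bochner_Integration.integrable_bound)
       (use C schwartz_measurable[OF assms] in \<open>auto intro!: AE_I2 intro: order_trans\<close>)
qed

text \<open>Convergence to zero in the Schwartz space; the rates \<open>c\<close> do not depend on \<open>x\<close>.\<close>

definition schwartz_null :: "(nat \<Rightarrow> real \<Rightarrow> complex) \<Rightarrow> bool" where
  "schwartz_null f \<longleftrightarrow> (\<forall>k. f k \<in> schwartz) \<and>
     (\<forall>m n. \<exists>c. c \<longlonglongrightarrow> 0 \<and> (\<forall>k x. \<bar>x\<bar> ^ m * cmod ((D ^^ n) (f k) x) \<le> c k))"

lemma tempered_null:
  assumes "S \<in> tempered_distr" "schwartz_null f"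
  shows "(\<lambda>k. S (f k)) \<longlonglongrightarrow> 0"
proof -
  obtain C N where CN: "\<And>\<phi>. \<phi> \<in> schwartz \<Longrightarrow> cmod (S \<phi>) \<le> C * (\<Sum>m\<le>N. \<Sum>n\<le>N. schwartz_seminorm m n \<phi>)"
    using assms unfolding tempered_distr_def by blast
  from assms(2) obtain c where f: "\<And>k. f k \<in> schwartz" and
    c: "\<And>m n. c m n \<longlonglongrightarrow> 0" "\<And>m n k x. \<bar>x\<bar> ^ m * cmod ((D ^^ n) (f k) x) \<le> c m n k"
    unfolding schwartz_null_def by metis
  have sm: "0 \<le> schwartz_seminorm m n (f k)" "schwartz_seminorm m n (f k) \<le> c m n k" for m n k
  proof -
    show "schwartz_seminorm m n (f k) \<le> c m n k"
      unfolding schwartz_seminorm_def by (intro cSUP_least c) auto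
    have "0 \<le> \<bar>0\<bar> ^ m * cmod ((D ^^ n) (f k) 0)" by simp
    also have "\<dots> \<le> schwartz_seminorm m n (f k)"
      unfolding schwartz_seminorm_def
      by (rule cSUP_upper) (auto intro!: bdd_aboveI2[where M="c m n k"] c)
    finally show "0 \<le> schwartz_seminorm m n (f k)" .
  qed
  have 1: "cmod (S (f k)) \<le> max C 0 * (\<Sum>m\<le>N. \<Sum>n\<le>N. c m n k)" for k
    by (rule order_trans[OF CN[OF f]]) (intro mult_mono sum_mono sm sum_nonneg, auto)
  have 2: "(\<lambda>k. max C 0 * (\<Sum>m\<le>N. \<Sum>n\<le>N. c m n k)) \<longlonglongrightarrow> max C 0 * (\<Sum>m\<le>N. \<Sum>n\<le>N. 0)"
    by (intro tendsto_intros c)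
  show ?thesis
    by (rule tendsto_norm_zero_cancel, rule tendsto_sandwich[OF _ _ tendsto_const])
       (use 1 2 in auto)
qed

lemma tempered_add: "S \<in> tempered_distr \<Longrightarrow> f \<in> schwartz \<Longrightarrow> g \<in> schwartz \<Longrightarrow> S (\<lambda>x. f x + g x) = S f + S g"
  by (auto simp: tempered_distr_def)

lemma tempered_cmult: "S \<in> tempered_distr \<Longrightarrow> f \<in> schwartz \<Longrightarrow> S (\<lambda>x. c * f x) = c * S f"
  by (auto simp: tempered_distr_def)

lemma tempered_diff: "S \<in> tempered_distr \<Longrightarrow> f \<in> schwartz \<Longrightarrow> g \<in> schwartz \<Longrightarrow> S (\<lambda>x. f x - g x) = S f - S g"
  using tempered_add[of S f "\<lambda>x. (-1) * g x"] tempered_cmult[of S g "-1"] schwartz_cmult[of g "-1"] by simp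

lemma tempered_LIMSEQ:
  assumes "S \<in> tempered_distr" "\<And>k. f k \<in> schwartz" "g \<in> schwartz" "schwartz_null (\<lambda>k x. g x - f k x)"
  shows "(\<lambda>k. S (f k)) \<longlonglongrightarrow> S g"
proof -
  have "(\<lambda>k. S (\<lambda>x. g x - f k x)) \<longlonglongrightarrow> 0" by (rule tempered_null[OF assms(1,4)])
  then have "(\<lambda>k. S g - S (f k)) \<longlonglongrightarrow> 0" using assms by (simp add: tempered_diff)
  then have "(\<lambda>k. S g - (S g - S (f k))) \<longlonglongrightarrow> S g - 0" by (intro tendsto_intros)
  then show ?thesis by simp
qed

lemma schwartz_null_D: "schwartz_null f \<Longrightarrow> schwartz_null (\<lambda>k. D (f k))"
  unfolding schwartz_null_def by (metis schwartz_D funpow_Suc_right o_apply)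

lemma schwartz_null_D_pow: "schwartz_null f \<Longrightarrow> schwartz_null (\<lambda>k. (D ^^ n) (f k))"
  by (induction n) (auto intro: schwartz_null_D)

lemma schwartz_null_mult_id:
  assumes "schwartz_null f" shows "schwartz_null (\<lambda>k x. of_real x * f k x)"
  unfolding schwartz_null_def
proof (intro conjI allI)
  from assms obtain c where f: "\<And>k. f k \<in> schwartz" and
    c: "\<And>m n. c m n \<longlonglongrightarrow> 0" "\<And>m n k x. \<bar>x\<bar> ^ m * cmod ((D ^^ n) (f k) x) \<le> c m n k"
    unfolding schwartz_null_def by metis
  show "(\<lambda>x. of_real x * f k x) \<in> schwartz" for k by (intro schwartz_mult_id f)
  fix m n
  have "\<bar>x\<bar> ^ m * cmod ((D ^^ n) (\<lambda>x. of_real x * f k x) x) \<le> c (Suc m) n k + of_nat n * c m (n-1) k" for k x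
    by (rule order_trans[OF seminorm_mult_id[OF schwartz_smooth[OF f]]]) (intro add_mono mult_left_mono c, auto)
  moreover have "(\<lambda>k. c (Suc m) n k + of_nat n * c m (n-1) k) \<longlonglongrightarrow> 0 + of_nat n * 0"
    by (intro tendsto_intros c)
  ultimately show "\<exists>c. c \<longlonglongrightarrow> 0 \<and> (\<forall>k x. \<bar>x\<bar> ^ m * cmod ((D ^^ n) (\<lambda>x. of_real x * f k x) x) \<le> c k)"
    by (intro exI[of _ "\<lambda>k. c (Suc m) n k + of_nat n * c m (n-1) k"]) auto
qed

lemma schwartz_null_mult_id_pow:
  "schwartz_null f \<Longrightarrow> schwartz_null (\<lambda>k x. of_real x ^ n * f k x)"
  by (induction n) (auto dest: schwartz_null_mult_id simp: mult.assoc)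

lemma schwartz_null_cmult:
  assumes "schwartz_null f" shows "schwartz_null (\<lambda>k x. a * f k x)"
  unfolding schwartz_null_def
proof (intro conjI allI)
  from assms obtain c where f: "\<And>k. f k \<in> schwartz" and
    c: "\<And>m n. c m n \<longlonglongrightarrow> 0" "\<And>m n k x. \<bar>x\<bar> ^ m * cmod ((D ^^ n) (f k) x) \<le> c m n k"
    unfolding schwartz_null_def by metis
  show "(\<lambda>x. a * f k x) \<in> schwartz" for k by (intro schwartz_cmult f)
  fix m n
  have "(\<lambda>k. cmod a * c m n k) \<longlonglongrightarrow> cmod a * 0" by (intro tendsto_intros c)
  moreover have "\<bar>x\<bar> ^ m * cmod ((D ^^ n) (\<lambda>x. a * f k x) x) \<le> cmod a * c m n k" for k x
    using mult_left_mono[OF c(2), of "cmod a"]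
    unfolding D_pow_cmult[OF schwartz_smooth[OF f]] by (auto simp: norm_mult mult.left_commute)
  ultimately show "\<exists>c. c \<longlonglongrightarrow> 0 \<and> (\<forall>k x. \<bar>x\<bar> ^ m * cmod ((D ^^ n) (\<lambda>x. a * f k x) x) \<le> c k)"
    by (intro exI[of _ "\<lambda>k. cmod a * c m n k"]) auto
qed

section \<open>Fourier transform\<close>

lemma fourier_integrable: "integrable lborel f \<Longrightarrow> integrable lborel (\<lambda>x. exp (- (\<i> * of_real (p * x))) * f x)"
  by (rule Bochner_Integration.integrable_bound[of _ f]) (auto simp: norm_mult norm_exp_eq_Re)

lemma fourier_bound: "cmod (fourier f p) \<le> (LINT x|lborel. cmod (f x))"
  unfolding fourier_def
  by (rule order_trans[OF integral_norm_bound]) (simp add: norm_mult)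

text \<open>Taylor's formula for \<open>exp (- i h x)\<close> leaves the error \<open>h\<^sup>2 x\<^sup>2 \<bar>f(x)\<bar>\<close>, which is integrable.\<close>

lemma fourier_has_derivative:
  assumes f: "f \<in> schwartz"
  shows "(fourier f has_vector_derivative fourier (\<lambda>x. - \<i> * (of_real x * f x)) p) (at p)"
proof -
  let ?g = "\<lambda>x. - \<i> * (of_real x * f x)"
  let ?M = "LINT x|lborel. cmod (of_real x * (of_real x * f x))"
  have fi: "integrable lborel f" by (rule schwartz_integrable[OF f])
  have gi: "integrable lborel ?g"
    by (intro schwartz_integrable schwartz_cmult schwartz_mult_id f)
  have hi: "integrable lborel (\<lambda>x. cmod (of_real x * (of_real x * f x)))"
    by (intro integrable_norm schwartz_integrable schwartz_mult_id f)
  have est: "cmod (fourier f (p + h) - fourier f p - h *\<^sub>R fourier ?g p) \<le> ?M * h\<^sup>2" for h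
  proof -
    have "fourier f (p + h) - fourier f p - h *\<^sub>R fourier ?g p =
       (LINT x|lborel. exp (- (\<i> * of_real ((p+h) * x))) * f x - exp (- (\<i> * of_real (p * x))) * f x
          - h *\<^sub>R (exp (- (\<i> * of_real (p * x))) * ?g x))"
      unfolding fourier_def
      by (simp only: Bochner_Integration.integral_diff Bochner_Integration.integrable_diff
           fourier_integrable[OF fi] fourier_integrable[OF gi] integrable_scaleR_right integral_scaleR_right)
    also have "cmod \<dots> \<le> (LINT x|lborel. h\<^sup>2 * cmod (of_real x * (of_real x * f x)))"
    proof (rule Bochner_Integration.integral_norm_bound_integral)
      fix x :: real
      have "exp (- (\<i> * of_real ((p+h) * x))) * f x - exp (- (\<i> * of_real (p * x))) * f x
          - h *\<^sub>R (exp (- (\<i> * of_real (p * x))) * ?g x)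
          = exp (- (\<i> * of_real (p * x))) * f x * (iexp (- h * x) - (1 + \<i> * of_real (- h * x)))"
        by (simp add: algebra_simps exp_add exp_diff exp_minus scaleR_conv_of_real divide_inverse)
      also have "cmod \<dots> = cmod (f x) * cmod (iexp (- h * x) - (1 + \<i> * of_real (- h * x)))"
        by (simp only: norm_mult) (simp add: norm_exp_eq_Re)
      also have "\<dots> \<le> cmod (f x) * (\<bar>- h * x\<bar>\<^sup>2 / 2)"
        using iexp_approx1[of "- h * x" 1] by (intro mult_left_mono) (simp_all add: numeral_2_eq_2)
      also have "\<dots> \<le> h\<^sup>2 * cmod (of_real x * (of_real x * f x))"
      proof -
        have nn: "0 \<le> h\<^sup>2 * (x\<^sup>2 * cmod (f x))" by simp
        have e1: "cmod (f x) * (\<bar>- h * x\<bar>\<^sup>2 / 2) = h\<^sup>2 * (x\<^sup>2 * cmod (f x)) / 2"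
          by (simp add: power_mult_distrib abs_mult)
        have e2: "h\<^sup>2 * cmod (of_real x * (of_real x * f x)) = h\<^sup>2 * (x\<^sup>2 * cmod (f x))"
          by (simp add: norm_mult power2_eq_square)
        show ?thesis unfolding e1 e2 using nn by linarith
      qed
      finally show "cmod (exp (- (\<i> * of_real ((p+h) * x))) * f x - exp (- (\<i> * of_real (p * x))) * f x
          - h *\<^sub>R (exp (- (\<i> * of_real (p * x))) * ?g x)) \<le> h\<^sup>2 * cmod (of_real x * (of_real x * f x))" .
    qed (intro Bochner_Integration.integrable_diff fourier_integrable fi gi integrable_scaleR_right
        integrable_mult_right hi)+
    finally show ?thesis by (simp add: mult.commute)
  qed
  show ?thesis
    unfolding has_vector_derivative_def has_derivative_at
  proof
    have M: "?M \<ge> 0" by (intro Bochner_Integration.integral_nonneg) auto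
    have lim: "((\<lambda>h. ?M * norm h) \<longlongrightarrow> ?M * norm (0::real)) (at (0::real))"
      by (rule tendsto_mult[OF tendsto_const tendsto_norm[OF tendsto_ident_at]])
    show "(\<lambda>h. norm (fourier f (p + h) - fourier f p - h *\<^sub>R fourier ?g p) / norm h) \<midarrow>0\<rightarrow> 0"
    proof (rule Lim_null_comparison[where g="\<lambda>h. ?M * norm h"])
      show "\<forall>\<^sub>F h in at 0. norm (norm (fourier f (p + h) - fourier f p - h *\<^sub>R fourier ?g p) / norm h) \<le> ?M * norm h"
        unfolding eventually_at_filter
      proof (rule always_eventually, intro allI impI)
        fix h :: real assume "h \<noteq> 0"
        then show "norm (norm (fourier f (p + h) - fourier f p - h *\<^sub>R fourier ?g p) / norm h) \<le> ?M * norm h"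
          using est[of h] by (simp add: field_simps power2_eq_square abs_mult_self_eq)
      qed
    qed (use lim in simp)
  qed (intro bounded_linear_intros)
qed

lemma schwartz_const_mult_pow: "f \<in> schwartz \<Longrightarrow> (\<lambda>x. (a * of_real x) ^ n * f x) \<in> schwartz"
proof (induction n)
  case (Suc n)
  have "(\<lambda>x. a * (of_real x * ((a * of_real x) ^ n * f x))) \<in> schwartz"
    by (intro schwartz_cmult schwartz_mult_id Suc)
  then show ?case by (simp add: mult_ac)
qed auto

lemma smooth_fourier:
  assumes "f \<in> schwartz" shows "smooth (fourier f)"
proof (rule smooth_family[where F="fourier ` schwartz"])
  fix g assume "g \<in> fourier ` schwartz"
  then show "\<exists>g'\<in>fourier ` schwartz. \<forall>x. (g has_vector_derivative g' x) (at x)"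
    using fourier_has_derivative schwartz_cmult[OF schwartz_mult_id] by blast
qed (use assms in auto)

lemma D_fourier: "f \<in> schwartz \<Longrightarrow> D (fourier f) = fourier (\<lambda>x. - \<i> * (of_real x * f x))"
  by (rule ext, rule dir_deriv_eq_vector) (rule fourier_has_derivative)

lemma D_pow_fourier: "f \<in> schwartz \<Longrightarrow> (D ^^ n) (fourier f) = fourier (\<lambda>x. (- \<i> * of_real x) ^ n * f x)"
proof (induction n)
  case (Suc n)
  have *: "(\<lambda>x. (- \<i> * of_real x) ^ n * f x) \<in> schwartz"
    using schwartz_const_mult_pow[OF Suc.prems, of "-\<i>" n] .
  show ?case
    using Suc D_fourier[OF *] by (simp add: mult_ac)
qed auto

lemma schwartz_tendsto_0:
  assumes "f \<in> schwartz" "filterlim (\<lambda>x. \<bar>x\<bar>) at_top F" shows "(f \<longlongrightarrow> 0) F"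
proof -
  obtain C where C: "C > 0" "\<And>x. cmod (f x) \<le> C * inverse (1 + x\<^sup>2)" using schwartz_bound_quad[OF assms(1)] by metis
  have "((\<lambda>y::real. C * inverse (1 + y\<^sup>2)) \<longlongrightarrow> 0) at_top" by real_asymp
  then have "((\<lambda>x::real. C * inverse (1 + \<bar>x\<bar>\<^sup>2)) \<longlongrightarrow> 0) F"
    by (rule filterlim_compose) (rule assms)
  then show ?thesis by (rule Lim_null_comparison[rotated]) (use C in auto)
qed

lemma has_vector_derivative_iexp_scaled:
  "((\<lambda>x. exp (\<i> * of_real (p * x))) has_vector_derivative \<i> * of_real p * exp (\<i> * of_real (p * x))) (at x)"
proof -
  have "((\<lambda>z. exp (\<i> * of_real p * z)) has_field_derivative \<i> * of_real p * exp (\<i> * of_real p * of_real x)) (at (of_real x))"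
    by (auto intro!: derivative_eq_intros)
  from has_vector_derivative_real_field[OF this] show ?thesis by (simp add: mult_ac)
qed

lemma fourier_D:
  assumes f: "f \<in> schwartz" shows "fourier (D f) p = \<i> * of_real p * fourier f p"
proof -
  let ?e = "\<lambda>x. exp (- (\<i> * of_real (p * x)))"
  have fi: "integrable lborel f" "integrable lborel (D f)" by (auto intro!: schwartz_integrable schwartz_D f)
  have de: "(?e has_vector_derivative - (\<i> * of_real p) * ?e x) (at x)" for x
    using has_vector_derivative_iexp_scaled[of "-p"] by simp
  have d: "((\<lambda>x. ?e x * f x) has_vector_derivative (?e x * D f x + (- (\<i> * of_real p) * ?e x) * f x)) (at x)" for x
    by (intro has_vector_derivative_mult de smooth_has_vector_derivative schwartz_smooth f)
  have cont: "continuous_on UNIV (\<lambda>x. ?e x * D f x + (- (\<i> * of_real p) * ?e x) * f x)"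
    by (intro continuous_intros smooth_continuous_on schwartz_smooth f schwartz_D)
  have int: "integrable lborel (\<lambda>x. ?e x * D f x + - (\<i> * of_real p) * (?e x * f x))"
    by (intro Bochner_Integration.integrable_add integrable_mult_right fourier_integrable fi)
  have lim: "((\<lambda>x. ?e x * f x) \<longlongrightarrow> 0) F" if "filterlim (\<lambda>x. \<bar>x\<bar>) at_top F" for F
    using schwartz_tendsto_0[OF f that] by (rule Lim_null_comparison[OF _ tendsto_norm_zero, rotated])
      (auto simp: norm_mult)
  have "(LBINT x=-\<infinity>..\<infinity>. (?e x * D f x + (- (\<i> * of_real p) * ?e x) * f x)) = 0 - 0"
  proof (rule interval_integral_FTC_integrable)
    show "set_integrable lborel (einterval (- \<infinity>) \<infinity>) (\<lambda>x. ?e x * D f x + - (\<i> * of_real p) * ?e x * f x)"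
      using int by (simp add: set_integrable_def mult.assoc)
    show "isCont (\<lambda>x. ?e x * D f x + - (\<i> * of_real p) * ?e x * f x) x" for x
      using cont by (simp add: continuous_on_eq_continuous_at)
    show "(((\<lambda>x. ?e x * f x) \<circ> real_of_ereal) \<longlongrightarrow> 0) (at_right (- \<infinity>))"
      unfolding ereal_tendsto_simps by (rule lim) real_asymp
    show "(((\<lambda>x. ?e x * f x) \<circ> real_of_ereal) \<longlongrightarrow> 0) (at_left \<infinity>)"
      unfolding ereal_tendsto_simps by (rule lim) real_asymp
  qed (use d in auto)
  then have "(LINT x|lborel. ?e x * D f x + - (\<i> * of_real p) * (?e x * f x)) = 0"
    by (simp add: interval_integral_to_infinity_eq set_lebesgue_integral_def interval_lebesgue_integral_def mult.assoc)
  also have "(LINT x|lborel. ?e x * D f x + - (\<i> * of_real p) * (?e x * f x)) =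
      fourier (D f) p - \<i> * of_real p * fourier f p"
    unfolding fourier_def
    by (subst Bochner_Integration.integral_add, intro fourier_integrable fi,
        intro integrable_mult_right fourier_integrable fi, subst integral_mult_right_zero) simp
  finally show ?thesis by simp
qed

lemma fourier_D_pow: "f \<in> schwartz \<Longrightarrow> fourier ((D ^^ m) f) p = (\<i> * of_real p) ^ m * fourier f p"
  by (induction m) (auto simp: fourier_D schwartz_D_pow)

lemma L1_le_quad:
  assumes "f \<in> borel_measurable borel" "\<And>x. cmod (f x) \<le> a" "\<And>x. \<bar>x\<bar>^2 * cmod (f x) \<le> b"
  shows "(LINT x|lborel. cmod (f x)) \<le> (a + b) * (LINT x|lborel. inverse (1 + x\<^sup>2))"
proof -
  have le: "cmod (f x) \<le> (a + b) * inverse (1 + x\<^sup>2)" for x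
    using assms(2,3)[of x] by (simp add: field_simps add_pos_nonneg)
  have i: "integrable lborel (\<lambda>x::real. (a + b) * inverse (1 + x\<^sup>2))"
    by (intro integrable_mult_right integrable_inv_quad)
  have "(LINT x|lborel. cmod (f x)) \<le> (LINT x|lborel. (a + b) * inverse (1 + x\<^sup>2))"
    by (intro integral_mono Bochner_Integration.integrable_bound[OF i] i)
       (use assms(1) order_trans[OF le abs_ge_self] le in \<open>auto intro!: AE_I2\<close>)
  then show ?thesis by simp
qed

lemma schwartz_nullD:
  "schwartz_null f \<Longrightarrow> \<exists>c. c \<longlonglongrightarrow> 0 \<and> (\<forall>k x. \<bar>x\<bar> ^ m * cmod ((D ^^ n) (f k) x) \<le> c k)"
  unfolding schwartz_null_def by blast

text \<open>Each derivative of the transform puts a factor \<open>x\<close> on \<open>f\<close> and each weight \<open>p\<close> puts a derivative on it; the transform of the result is bounded by its \<open>L\<^sup>1\<close> norm.\<close>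

lemma fourier_seminorm:
  assumes "f \<in> schwartz"
  shows "\<bar>p\<bar> ^ m * cmod ((D ^^ n) (fourier f) p) \<le> (LINT x|lborel. cmod ((D ^^ m) (\<lambda>x. (- \<i> * of_real x) ^ n * f x) x))"
proof -
  have *: "(\<lambda>x. (- \<i> * of_real x) ^ n * f x) \<in> schwartz"
    using schwartz_const_mult_pow[OF assms, of "-\<i>" n] .
  have "\<bar>p\<bar> ^ m * cmod ((D ^^ n) (fourier f) p) = cmod (fourier ((D ^^ m) (\<lambda>x. (- \<i> * of_real x) ^ n * f x)) p)"
    unfolding fourier_D_pow[OF *] D_pow_fourier[OF assms] by (simp add: norm_mult norm_power)
  then show ?thesis by (simp only: fourier_bound)
qed

lemma schwartz_fourier:
  assumes "f \<in> schwartz" shows "fourier f \<in> schwartz"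
  unfolding schwartz_iff
  by (intro conjI allI exI smooth_fourier[OF assms]) (rule fourier_seminorm[OF assms])

lemma schwartz_null_fourier:
  assumes f: "schwartz_null f" shows "schwartz_null (\<lambda>k. fourier (f k))"
  unfolding schwartz_null_def
proof (intro conjI allI)
  have fs: "f k \<in> schwartz" for k using f by (simp add: schwartz_null_def)
  then show "fourier (f k) \<in> schwartz" for k by (rule schwartz_fourier)
  fix m n
  have pw: "(\<lambda>x. (- \<i> * of_real x) ^ n * f k x) = (\<lambda>x. (-\<i>)^n * (of_real x ^ n * f k x))" for k
    by (rule ext) (subst power_mult_distrib, rule mult.assoc)
  have g: "schwartz_null (\<lambda>k. (D ^^ m) (\<lambda>x. (- \<i> * of_real x) ^ n * f k x))"
    unfolding pw by (rule schwartz_null_D_pow[OF schwartz_null_cmult[OF schwartz_null_mult_id_pow[OF f]]])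
  let ?g = "\<lambda>k. (D ^^ m) (\<lambda>x. (- \<i> * of_real x) ^ n * f k x)"
  let ?I = "LINT x|lborel. inverse (1 + x\<^sup>2) :: real"
  obtain c0 where c0: "c0 \<longlonglongrightarrow> 0" "\<And>k x. \<bar>x\<bar> ^ 0 * cmod ((D ^^ 0) (?g k) x) \<le> c0 k"
    using schwartz_nullD[OF g] by blast
  obtain c2 where c2: "c2 \<longlonglongrightarrow> 0" "\<And>k x. \<bar>x\<bar> ^ 2 * cmod ((D ^^ 0) (?g k) x) \<le> c2 k"
    using schwartz_nullD[OF g] by blast
  have "\<bar>p\<bar> ^ m * cmod ((D ^^ n) (fourier (f k)) p) \<le> (c0 k + c2 k) * ?I" for k p
  proof -
    have "?g k \<in> borel_measurable borel"
      using g by (intro schwartz_measurable) (simp add: schwartz_null_def)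
    then have "(LINT x|lborel. cmod (?g k x)) \<le> (c0 k + c2 k) * ?I"
      using c0(2) c2(2) by (intro L1_le_quad) auto
    then show ?thesis using fourier_seminorm[OF fs] order_trans by blast
  qed
  moreover have "(\<lambda>k. (c0 k + c2 k) * ?I) \<longlonglongrightarrow> (0 + 0) * ?I" by (intro tendsto_intros c0 c2)
  ultimately show "\<exists>c. c \<longlonglongrightarrow> 0 \<and> (\<forall>k p. \<bar>p\<bar> ^ m * cmod ((D ^^ n) (fourier (f k)) p) \<le> c k)"
    by (intro exI[of _ "\<lambda>k. (c0 k + c2 k) * ?I"]) auto
qed

lemma fourier_diff: "f \<in> schwartz \<Longrightarrow> g \<in> schwartz \<Longrightarrow> fourier (\<lambda>x. f x - g x) = (\<lambda>p. fourier f p - fourier g p)"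
  unfolding fourier_def right_diff_distrib
  by (rule ext, rule Bochner_Integration.integral_diff[OF fourier_integrable[OF schwartz_integrable]
        fourier_integrable[OF schwartz_integrable]])

section \<open>Truncation of Schwartz functions\<close>

text \<open>The factor \<open>\<kappa>(x / k)\<close> is zero for \<open>\<bar>x\<bar> < k\<close>, so one additional weight \<open>\<bar>x\<bar>\<close> on \<open>f\<close> buys a factor \<open>1 / k\<close>.
  By the product rule a derivative falls on \<open>f\<close> or turns \<open>\<kappa>\<close> into \<open>\<kappa>'\<close>, which is zero near 0 as well;
  this is why the induction over the number of derivatives is for all \<open>\<kappa>\<close> and \<open>f\<close>.\<close>

lemma cutoff_aux:
  assumes "smooth \<kappa>" "\<And>n. bounded (range ((D ^^ n) \<kappa>))" "\<And>x. \<bar>x\<bar> < 1 \<Longrightarrow> \<kappa> x = 0" "f \<in> schwartz"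
  shows "\<exists>C. \<forall>k x. \<bar>x\<bar> ^ m * cmod ((D ^^ n) (\<lambda>x. \<kappa> (x / real (Suc k)) * f x) x) \<le> C / real (Suc k)"
  using assms
proof (induction n arbitrary: \<kappa> f)
  case 0
  obtain B where B: "\<And>x. cmod (\<kappa> x) \<le> B" using 0(2)[of 0] by (auto simp: bounded_iff)
  obtain C where C: "C > 0" "\<And>x. \<bar>x\<bar> ^ Suc m * cmod ((D ^^ 0) f x) \<le> C" using schwartz_bound[OF 0(4)] by metis
  have "\<bar>x\<bar> ^ m * cmod (\<kappa> (x / real (Suc k)) * f x) \<le> B * C / real (Suc k)" for k x
  proof (cases "\<bar>x\<bar> < real (Suc k)")
    case True
    then have "\<kappa> (x / real (Suc k)) = 0" by (intro 0(3)) (simp add: abs_divide)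
    moreover have "B \<ge> 0" using B order_trans norm_ge_zero by blast
    ultimately show ?thesis using C by simp
  next
    case False
    have "\<bar>x\<bar> ^ m * cmod (\<kappa> (x / real (Suc k)) * f x) * real (Suc k)
        \<le> \<bar>x\<bar> ^ m * cmod (\<kappa> (x / real (Suc k)) * f x) * \<bar>x\<bar>"
      using False by (intro mult_left_mono) auto
    also have "\<dots> = cmod (\<kappa> (x / real (Suc k))) * (\<bar>x\<bar> ^ Suc m * cmod (f x))" by (simp add: norm_mult)
    also have "\<dots> \<le> B * C" using C by (intro mult_mono B) (auto intro: order_trans[OF norm_ge_zero B])
    finally show ?thesis by (simp add: field_simps)
  qed
  then show ?case by (auto simp del: of_nat_Suc)
next
  case (Suc n)
  have "((D ^^ j) (D \<kappa>)) = (D ^^ Suc j) \<kappa>" for j by (simp add: funpow_swap1)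
  then have b': "\<And>j. bounded (range ((D ^^ j) (D \<kappa>)))" using Suc.prems(2) by metis
  have z': "D \<kappa> x = 0" if "\<bar>x\<bar> < 1" for x
    using D_pow_eq_0_outside[of "{x. \<bar>x\<bar> \<ge> 1}" \<kappa> x 1] Suc.prems(3) that
    by (auto simp: closed_Collect_le continuous_intros)
  obtain C1 where C1: "\<And>k x. \<bar>x\<bar> ^ m * cmod ((D ^^ n) (\<lambda>x. \<kappa> (x / real (Suc k)) * D f x) x) \<le> C1 / real (Suc k)"
    using Suc.IH[OF Suc.prems(1-3) schwartz_D[OF Suc.prems(4)]] by blast
  obtain C2 where C2: "\<And>k x. \<bar>x\<bar> ^ m * cmod ((D ^^ n) (\<lambda>x. D \<kappa> (x / real (Suc k)) * f x) x) \<le> C2 / real (Suc k)"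
    using Suc.IH[OF smooth_D[OF Suc.prems(1)] b' z' Suc.prems(4)] by blast
  have C2': "C2 \<ge> 0" using order_trans[OF _ C2[of 0 0]] by simp
  have "\<bar>x\<bar> ^ m * cmod ((D ^^ Suc n) (\<lambda>x. \<kappa> (x / real (Suc k)) * f x) x) \<le> (C1 + C2) / real (Suc k)" for k x
  proof -
    let ?r = "real (Suc k)"
    have sk: "smooth (\<lambda>x. g (x / ?r))" if "smooth g" for g :: "real \<Rightarrow> complex"
      using smooth_affine[OF that, of 0 "1 / ?r"] by simp
    have dk: "D (\<lambda>x. \<kappa> (x / ?r)) = (\<lambda>x. of_real (1 / ?r) * D \<kappa> (x / ?r))"
    proof (rule ext, rule dir_deriv_eq_vector)
      fix x
      have 1: "((\<lambda>x. x / ?r) has_vector_derivative 1 / ?r) (at x)"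
        unfolding has_real_derivative_iff_has_vector_derivative[symmetric]
        by (auto intro!: derivative_eq_intros)
      have "((\<kappa> \<circ> (\<lambda>x. x / ?r)) has_vector_derivative (1/?r) *\<^sub>R D \<kappa> (x / ?r)) (at x)"
        by (rule vector_diff_chain_at[OF 1 smooth_has_vector_derivative[OF Suc.prems(1)]])
      then show "((\<lambda>x. \<kappa> (x / ?r)) has_vector_derivative of_real (1 / ?r) * D \<kappa> (x / ?r)) (at x)"
        by (simp add: o_def scaleR_conv_of_real)
    qed
    note sf = schwartz_smooth[OF Suc.prems(4)]
    note sk1 = sk[OF Suc.prems(1)] and sk2 = sk[OF smooth_D[OF Suc.prems(1)]]
    have "D (\<lambda>x. \<kappa> (x / ?r) * f x) = (\<lambda>x. \<kappa> (x / ?r) * D f x + of_real (1 / ?r) * (D \<kappa> (x / ?r) * f x))"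
      using D_mult[OF sk1 sf] unfolding dk mult.assoc .
    then have "(D ^^ Suc n) (\<lambda>x. \<kappa> (x / ?r) * f x) =
       (D ^^ n) (\<lambda>x. \<kappa> (x / ?r) * D f x + of_real (1 / ?r) * (D \<kappa> (x / ?r) * f x))"
      by (simp add: funpow_swap1)
    also have "\<dots> = (\<lambda>x. (D ^^ n) (\<lambda>x. \<kappa> (x / ?r) * D f x) x +
        of_real (1 / ?r) * (D ^^ n) (\<lambda>x. D \<kappa> (x / ?r) * f x) x)"
      using D_pow_add[OF smooth_mult[OF sk1 smooth_D[OF sf]]
          smooth_mult[OF smooth_const smooth_mult[OF sk2 sf]], of n "of_real (1 / ?r)"]
        D_pow_cmult[OF smooth_mult[OF sk2 sf], of n "of_real (1 / ?r)"] by simp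
    finally have "\<bar>x\<bar> ^ m * cmod ((D ^^ Suc n) (\<lambda>x. \<kappa> (x / ?r) * f x) x) \<le>
       \<bar>x\<bar> ^ m * (cmod ((D ^^ n) (\<lambda>x. \<kappa> (x / ?r) * D f x) x) + cmod (of_real (1 / ?r) * (D ^^ n) (\<lambda>x. D \<kappa> (x / ?r) * f x) x))"
      by (auto intro!: mult_left_mono norm_triangle_ineq)
    also have "\<dots> = \<bar>x\<bar> ^ m * cmod ((D ^^ n) (\<lambda>x. \<kappa> (x / ?r) * D f x) x) +
        (1 / ?r) * (\<bar>x\<bar> ^ m * cmod ((D ^^ n) (\<lambda>x. D \<kappa> (x / ?r) * f x) x))"
      by (simp add: norm_mult norm_divide distrib_left mult_ac del: of_nat_Suc)
    also have "\<dots> \<le> C1 / ?r + 1 * (C2 / ?r)"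
      by (intro add_mono mult_mono C1 C2) (use C2' in auto)
    finally show ?thesis by (simp add: add_divide_distrib)
  qed
  then show ?case by blast
qed

definition cutoff :: "nat \<Rightarrow> real \<Rightarrow> complex" where
  "cutoff k x = of_real (plateau (-2) 2 1 (x / real (Suc k)))"

lemma smooth_cutoff: "smooth (cutoff k)"
  unfolding cutoff_def[abs_def]
  using smooth_of_real[OF smooth_affine[OF smooth_plateau, of "-2" 2 1 0 "1 / real (Suc k)"]] by simp

lemma cutoff_eq_0: "\<bar>x\<bar> \<ge> 2 * real (Suc k) \<Longrightarrow> cutoff k x = 0"
  unfolding cutoff_def by (subst plateau_eq_0) (auto simp: field_simps abs_le_iff)

lemma cutoff_bound: "cmod (cutoff k x) \<le> 1"
  unfolding cutoff_def using plateau_bounds by simp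

lemma cutoff_tendsto: "(\<lambda>k. cutoff k x) \<longlonglongrightarrow> 1"
proof (rule tendsto_eventually)
  show "\<forall>\<^sub>F k in sequentially. cutoff k x = 1"
    using eventually_ge_at_top[of "nat \<lceil>\<bar>x\<bar>\<rceil>"]
  proof eventually_elim
    case (elim k)
    then have "\<bar>x\<bar> \<le> real (Suc k)" by linarith
    then show ?case unfolding cutoff_def
      by (subst plateau_eq_1) (auto simp: field_simps abs_le_iff)
  qed
qed

lemma test_fun_cutoff_mult:
  assumes "smooth f" shows "test_fun UNIV (\<lambda>x. cutoff k x * f x)"
  unfolding test_fun_def
proof (intro conjI exI[of _ "{-2 * real (Suc k)..2 * real (Suc k)}"] allI impI)
  show "smooth (\<lambda>x. cutoff k x * f x)" by (intro smooth_mult smooth_cutoff assms)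
  fix x assume "x \<notin> {-2 * real (Suc k)..2 * real (Suc k)}"
  then have "\<bar>x\<bar> \<ge> 2 * real (Suc k)" by auto
  then show "cutoff k x * f x = 0" by (subst cutoff_eq_0) auto
qed auto

lemma cutoff_null:
  assumes f: "f \<in> schwartz"
  shows "schwartz_null (\<lambda>k x. f x - cutoff k x * f x)"
  unfolding schwartz_null_def
proof (intro conjI allI)
  show "(\<lambda>x. f x - cutoff k x * f x) \<in> schwartz" for k
    by (rule schwartz_diff[OF f test_fun_schwartz[OF test_fun_cutoff_mult[OF schwartz_smooth[OF f]]]])
  fix m n
  define \<kappa> :: "real \<Rightarrow> complex" where "\<kappa> = (\<lambda>x. 1 - of_real (plateau (-2) 2 1 x))"
  have sp: "smooth (\<lambda>x. complex_of_real (plateau (-2) 2 1 x))" by (intro smooth_of_real smooth_plateau)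
  have s: "smooth \<kappa>" unfolding \<kappa>_def by (intro smooth_diff smooth_const sp)
  have t: "test_fun UNIV (\<lambda>x. complex_of_real (plateau (-2) 2 1 x))"
    using sp plateau_eq_0[of 1 _ "-2" 2] unfolding test_fun_def
    by (auto intro!: exI[of _ "{-2..2}"])
  have "bounded (range ((D ^^ n) \<kappa>))" for n
  proof -
    obtain C where C: "\<And>x. \<bar>x\<bar> ^ 0 * cmod ((D ^^ n) (\<lambda>x. complex_of_real (plateau (-2) 2 1 x)) x) \<le> C"
      using schwartz_bound[OF test_fun_schwartz[OF t]] by metis
    have c: "(D ^^ n) (\<lambda>x. 1) = (\<lambda>x. if n = 0 then 1 else 0)" by (induction n) (auto simp: D_const)
    have "(D ^^ n) \<kappa> = (\<lambda>x. (D ^^ n) (\<lambda>x. 1) x + (- 1) * (D ^^ n) (\<lambda>x. complex_of_real (plateau (-2) 2 1 x)) x)"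
      using D_pow_add[OF smooth_const smooth_mult[OF smooth_const sp], of n 1 "- 1"] D_pow_cmult[OF sp, of n "- 1"]
      by (simp add: \<kappa>_def)
    then have "cmod ((D ^^ n) \<kappa> x) \<le> 1 + C" for x
      using C[of x] norm_triangle_ineq4[of "(D ^^ n) (\<lambda>x. 1) x"  "(D ^^ n) (\<lambda>x. complex_of_real (plateau (-2) 2 1 x)) x"]
      by (auto simp: c split: if_splits)
    then show ?thesis by (auto simp: bounded_iff)
  qed
  moreover have "\<kappa> x = 0" if "\<bar>x\<bar> < 1" for x
    unfolding \<kappa>_def using that by (subst plateau_eq_1) auto
  ultimately obtain C where C: "\<And>k x. \<bar>x\<bar> ^ m * cmod ((D ^^ n) (\<lambda>x. \<kappa> (x / real (Suc k)) * f x) x) \<le> C / real (Suc k)"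
    using cutoff_aux[OF s _ _ f] by blast
  have "(\<lambda>x. f x - cutoff k x * f x) = (\<lambda>x. \<kappa> (x / real (Suc k)) * f x)" for k
    by (auto simp: \<kappa>_def cutoff_def algebra_simps)
  moreover have "(\<lambda>k. C / real (Suc k)) \<longlonglongrightarrow> 0" by real_asymp
  ultimately show "\<exists>c. c \<longlonglongrightarrow> 0 \<and> (\<forall>k x. \<bar>x\<bar> ^ m * cmod ((D ^^ n) (\<lambda>x. f x - cutoff k x * f x) x) \<le> c k)"
    using C by (intro exI[of _ "\<lambda>k. C / real (Suc k)"]) simp
qed

lemma tempered_eqI:
  assumes "S \<in> tempered_distr" "S' \<in> tempered_distr" "\<And>\<phi>. test_fun UNIV \<phi> \<Longrightarrow> S \<phi> = S' \<phi>"
  shows "S = S'"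
proof
  fix \<phi>
  show "S \<phi> = S' \<phi>"
  proof (cases "\<phi> \<in> schwartz")
    case True
    have t: "test_fun UNIV (\<lambda>x. cutoff k x * \<phi> x)" for k by (intro test_fun_cutoff_mult schwartz_smooth True)
    have "(\<lambda>k. S (\<lambda>x. cutoff k x * \<phi> x)) \<longlonglongrightarrow> S \<phi>" "(\<lambda>k. S' (\<lambda>x. cutoff k x * \<phi> x)) \<longlonglongrightarrow> S' \<phi>"
      by (intro tempered_LIMSEQ assms True test_fun_schwartz[OF t] cutoff_null)+
    then show ?thesis using LIMSEQ_unique assms(3)[OF t] by simp
  qed (use assms in \<open>auto simp: tempered_distr_def\<close>)
qed

text \<open>Truncations converge in the Schwartz space, which the left-hand side respects together with the Fourier transform, and dominatedly against the bounded function \<open>g\<close>.\<close>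

lemma fourier_rep_extend:
  assumes S: "S \<in> tempered_distr" and g: "g \<in> borel_measurable lborel" "AE p in lborel. cmod (g p) \<le> B"
    and rep: "\<And>\<theta>. test_fun UNIV \<theta> \<Longrightarrow> S (fourier \<theta>) = (LINT p|lborel. g p * \<theta> p)"
    and \<theta>: "\<theta> \<in> schwartz"
  shows "S (fourier \<theta>) = (LINT p|lborel. g p * \<theta> p)"
proof (rule LIMSEQ_unique)
  have t: "test_fun UNIV (\<lambda>x. cutoff k x * \<theta> x)" for k by (intro test_fun_cutoff_mult schwartz_smooth \<theta>)
  note ts = test_fun_schwartz[OF t]
  show "(\<lambda>k. S (fourier (\<lambda>x. cutoff k x * \<theta> x))) \<longlonglongrightarrow> S (fourier \<theta>)"
    using schwartz_null_fourier[OF cutoff_null[OF \<theta>]]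
    by (intro tempered_LIMSEQ S schwartz_fourier \<theta> ts) (simp add: fourier_diff[OF \<theta> ts])
  show "(\<lambda>k. S (fourier (\<lambda>x. cutoff k x * \<theta> x))) \<longlonglongrightarrow> (LINT p|lborel. g p * \<theta> p)"
    unfolding rep[OF t]
  proof (rule integral_dominated_convergence[where w="\<lambda>p. B * cmod (\<theta> p)"])
    have m: "\<theta> \<in> borel_measurable lborel" "cutoff k \<in> borel_measurable lborel" for k
      using schwartz_measurable[OF \<theta>] borel_measurable_continuous_onI[OF smooth_continuous_on[OF smooth_cutoff]] by auto
    show "(\<lambda>p. g p * \<theta> p) \<in> borel_measurable lborel" "\<And>k. (\<lambda>p. g p * (cutoff k p * \<theta> p)) \<in> borel_measurable lborel"
      using m g by measurable
    show "integrable lborel (\<lambda>p. B * cmod (\<theta> p))"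
      by (intro integrable_mult_right integrable_norm schwartz_integrable \<theta>)
    show "AE p in lborel. (\<lambda>k. g p * (cutoff k p * \<theta> p)) \<longlonglongrightarrow> g p * \<theta> p"
    proof (rule AE_I2)
      fix p
      have "(\<lambda>k. g p * (cutoff k p * \<theta> p)) \<longlonglongrightarrow> g p * (1 * \<theta> p)"
        by (intro tendsto_intros cutoff_tendsto)
      then show "(\<lambda>k. g p * (cutoff k p * \<theta> p)) \<longlonglongrightarrow> g p * \<theta> p" by simp
    qed
    show "AE p in lborel. cmod (g p * (cutoff k p * \<theta> p)) \<le> B * cmod (\<theta> p)" for k
      using g(2)
    proof eventually_elim
      case (elim p)
      have "cmod (g p) * (cmod (cutoff k p) * cmod (\<theta> p)) \<le> B * (1 * cmod (\<theta> p))"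
        using elim by (intro mult_mono cutoff_bound) (auto intro: order_trans[OF norm_ge_zero])
      then show ?case by (simp add: norm_mult)
    qed
  qed
qed

section \<open>Fourier inversion\<close>

lemma schwartz_reflect:
  assumes "f \<in> schwartz" shows "(\<lambda>x. f (- x)) \<in> schwartz"
proof -
  have s: "smooth f" using assms by (rule schwartz_smooth)
  have sr: "smooth g \<Longrightarrow> smooth (\<lambda>x. g (- x))" for g :: "real \<Rightarrow> complex"
    using smooth_affine[of g 0 "-1"] by simp
  have d: "D (\<lambda>x. g (- x)) = (\<lambda>x. - D g (- x))" if "smooth g" for g
  proof (rule ext, rule dir_deriv_eq_vector)
    fix x
    have "((g \<circ> uminus) has_vector_derivative (-1) *\<^sub>R D g (- x)) (at x)"
      by (rule vector_diff_chain_at[OF _ smooth_has_vector_derivative[OF that]])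
         (auto intro!: derivative_eq_intros)
    then show "((\<lambda>x. g (- x)) has_vector_derivative - D g (- x)) (at x)" by (simp add: o_def)
  qed
  have "(D ^^ n) (\<lambda>x. f (- x)) = (\<lambda>x. (-1)^n * (D ^^ n) f (- x))" for n
  proof (induction n)
    case (Suc n)
    have "(D ^^ Suc n) (\<lambda>x. f (- x)) = D (\<lambda>x. (-1)^n * (D ^^ n) f (- x))" using Suc by simp
    also have "\<dots> = (\<lambda>x. (-1)^n * - D ((D ^^ n) f) (- x))"
      by (subst D_cmult[OF sr[OF smooth_D_pow[OF s]]]) (simp add: d smooth_D_pow s)
    finally show ?case by simp
  qed auto
  then have "\<bar>x\<bar> ^ m * cmod ((D ^^ n) (\<lambda>x. f (- x)) x) = \<bar>-x\<bar> ^ m * cmod ((D ^^ n) f (- x))" for m n x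
    by (simp add: norm_mult norm_power)
  then show ?thesis using assms sr[OF s] unfolding schwartz_iff by metis
qed

lemma fourier_gaussian:
  assumes "d > 0"
  shows "integrable lborel (\<lambda>p. of_real (std_normal_density (d * p)) * iexp (t * p))"
    "(LINT p|lborel. of_real (std_normal_density (d * p)) * iexp (t * p)) = of_real (exp (- ((t/d)\<^sup>2) / 2) / d)"
proof -
  have i: "integrable lborel (\<lambda>p. of_real (std_normal_density p) * iexp (t / d * p))"
  proof (rule Bochner_Integration.integrable_bound[of _ "\<lambda>p. std_normal_density p"])
    show "integrable lborel std_normal_density" by (rule integrable_normal_density) simp
  qed (auto simp: norm_mult)
  have "integrable lborel (\<lambda>p. (\<lambda>p. of_real (std_normal_density p) * iexp (t / d * p)) (0 + d * p))"
    by (rule lborel_integrable_real_affine[OF i]) (use assms in simp)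
  then show "integrable lborel (\<lambda>p. of_real (std_normal_density (d * p)) * iexp (t * p))"
    using assms by simp
  have "char std_normal_distribution (t/d) = (LINT p|lborel. std_normal_density p *\<^sub>R iexp (t / d * p))"
    unfolding char_def by (subst integral_density) (auto simp: normal_density_nonneg)
  also have "\<dots> = d *\<^sub>R (LINT p|lborel. std_normal_density (0 + d * p) *\<^sub>R iexp (t / d * (0 + d * p)))"
    using assms by (subst lborel_integral_real_affine[of d _ 0]) auto
  finally have "(LINT p|lborel. std_normal_density (d * p) *\<^sub>R iexp (t * p)) = char std_normal_distribution (t/d) /\<^sub>R d"
    using assms by (simp add: field_simps)
  then show "(LINT p|lborel. of_real (std_normal_density (d * p)) * iexp (t * p)) = of_real (exp (- ((t/d)\<^sup>2) / 2) / d)"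
    by (simp add: char_std_normal_distribution scaleR_conv_of_real field_simps)
qed

lemma std_normal_le: "std_normal_density x \<le> std_normal_density 0"
  by (simp add: std_normal_density_def divide_right_mono)

text \<open>A Gaussian factor \<open>exp (- (d p)\<^sup>2 / 2)\<close> in the inversion integral makes Fubini's theorem applicable and turns the
  integral into a Gaussian average of \<open>\<psi>\<close> around \<open>x\<close> on the scale \<open>d\<close>; then \<open>d\<close> tends to 0.\<close>

lemma fourier_inversion:
  assumes \<psi>: "\<psi> \<in> schwartz"
  shows "fourier (\<lambda>p. of_real (1 / (2 * pi)) * fourier \<psi> (- p)) x = \<psi> x"
proof -
  let ?n = std_normal_density
  define \<theta> where "\<theta> = (\<lambda>p. of_real (1 / (2 * pi)) * fourier \<psi> (- p))"
  have \<theta>s: "\<theta> \<in> schwartz"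
    unfolding \<theta>_def by (rule schwartz_cmult[OF schwartz_reflect[OF schwartz_fourier[OF \<psi>]]])
  define d :: "nat \<Rightarrow> real" where "d n = 1 / real (Suc n)" for n
  have d: "d n > 0" for n by (simp add: d_def)
  have dlim: "d \<longlonglongrightarrow> 0" unfolding d_def by real_asymp
  note \<theta>m = schwartz_measurable[OF \<theta>s] and \<psi>m = schwartz_measurable[OF \<psi>]
  define A where "A n = (LINT p|lborel. ?n (d n * p) *\<^sub>R (exp (- (\<i> * of_real (x * p))) * \<theta> p))" for n
  let ?c = "sqrt (2 * pi) / (2 * pi)"
  have isoc: "isCont ?n 0"
    unfolding std_normal_density_def by (intro continuous_intros) auto
  have "A \<longlonglongrightarrow> (LINT p|lborel. ?n 0 *\<^sub>R (exp (- (\<i> * of_real (x * p))) * \<theta> p))"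
    unfolding A_def
  proof (rule integral_dominated_convergence[where w="\<lambda>p. ?n 0 * cmod (\<theta> p)"])
    show "AE p in lborel. (\<lambda>n. ?n (d n * p) *\<^sub>R (exp (- (\<i> * of_real (x * p))) * \<theta> p))
        \<longlonglongrightarrow> ?n 0 *\<^sub>R (exp (- (\<i> * of_real (x * p))) * \<theta> p)"
    proof (rule AE_I2)
      fix p
      have "(\<lambda>n. d n * p) \<longlonglongrightarrow> 0 * p" by (intro tendsto_intros dlim)
      then have "(\<lambda>n. ?n (d n * p)) \<longlonglongrightarrow> ?n 0"
        using isCont_tendsto_compose[OF isoc] by simp
      then show "(\<lambda>n. ?n (d n * p) *\<^sub>R (exp (- (\<i> * of_real (x * p))) * \<theta> p))
          \<longlonglongrightarrow> ?n 0 *\<^sub>R (exp (- (\<i> * of_real (x * p))) * \<theta> p)"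
        by (intro tendsto_intros)
    qed
    show "AE p in lborel. norm (?n (d n * p) *\<^sub>R (exp (- (\<i> * of_real (x * p))) * \<theta> p))
        \<le> ?n 0 * cmod (\<theta> p)" for n
      by (intro AE_I2) (auto simp: norm_mult std_normal_le mult_right_mono)
  qed (use \<theta>m in \<open>auto intro!: integrable_mult_right integrable_norm schwartz_integrable \<theta>s\<close>)
  then have lim1: "A \<longlonglongrightarrow> (1 / sqrt (2 * pi)) *\<^sub>R fourier \<theta> x"
    by (simp add: fourier_def std_normal_density_def)
  have A2: "A n = (LINT z|lborel. ?n z *\<^sub>R (?c *\<^sub>R \<psi> (x + d n * z)))" for n
  proof -
    let ?k = "\<lambda>p y. of_real (1 / (2 * pi)) * (of_real (?n (d n * p)) * iexp ((y - x) * p) * \<psi> y)"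
    have e: "exp (- (\<i> * complex_of_real (x * p))) * exp (- (\<i> * of_real ((-p) * y))) = iexp ((y - x) * p)" for p y
      unfolding exp_add[symmetric] by (simp add: algebra_simps)
    have "integrable lborel (\<lambda>p. of_real (?n (d n * p)) * iexp (0 * p))"
      by (rule fourier_gaussian[OF d])
    then have gi: "integrable lborel (\<lambda>p. complex_of_real (?n (d n * p)))" by simp
    have gi': "integrable lborel (\<lambda>p. ?n (d n * p))"
      using integrable_norm[OF gi] by simp
    have i2: "integrable (lborel \<Otimes>\<^sub>M lborel) (\<lambda>(p, y). ?k p y)"
    proof (rule lborel_pair.Fubini_integrable)
      show "(\<lambda>(p, y). ?k p y) \<in> borel_measurable (lborel \<Otimes>\<^sub>M lborel)"
        using \<psi>m by (simp add: split_beta') measurable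
      have "integrable lborel (\<lambda>p. ?n (d n * p) * (1/(2 * pi) * (LINT y|lborel. cmod (\<psi> y))))"
        using gi' by simp
      then show "integrable lborel (\<lambda>p. LINT y|lborel. norm (case (p, y) of (p, y) \<Rightarrow> ?k p y))"
        by (simp add: norm_mult mult_ac norm_divide)
      show "AE p in lborel. integrable lborel (\<lambda>y. case (p, y) of (p, y) \<Rightarrow> ?k p y)"
      proof (rule AE_I2)
        fix p
        have "integrable lborel (\<lambda>y. of_real (1 / (2 * pi)) * of_real (?n (d n * p)) * exp (- (\<i> * of_real (x * p))) * (exp (- (\<i> * of_real ((-p) * y))) * \<psi> y))"
          by (intro integrable_mult_right fourier_integrable schwartz_integrable \<psi>)
        then show "integrable lborel (\<lambda>y. case (p, y) of (p, y) \<Rightarrow> ?k p y)"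
          unfolding e[symmetric] prod.case by (simp only: mult_ac)
      qed
    qed
    have "A n = (LINT p|lborel. LINT y|lborel. ?k p y)"
      unfolding A_def
    proof (rule Bochner_Integration.integral_cong[OF refl])
      fix p
      have "?n (d n * p) *\<^sub>R (exp (- (\<i> * of_real (x * p))) * \<theta> p) =
        (LINT y|lborel. ?n (d n * p) * exp (- (\<i> * of_real (x * p))) * of_real (1 / (2 * pi)) * (exp (- (\<i> * of_real ((-p) * y))) * \<psi> y))"
        unfolding \<theta>_def fourier_def by (simp add: scaleR_conv_of_real mult.assoc)
      also have "\<dots> = (LINT y|lborel. ?k p y)"
        by (rule Bochner_Integration.integral_cong[OF refl])
           (unfold e[symmetric], simp only: mult_ac scaleR_conv_of_real)
      finally show "?n (d n * p) *\<^sub>R (exp (- (\<i> * of_real (x * p))) * \<theta> p) = (LINT y|lborel. ?k p y)" .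
    qed
    also have "\<dots> = (LINT y|lborel. LINT p|lborel. ?k p y)"
      using lborel_pair.Fubini_integral[OF i2] by simp
    also have "\<dots> = (LINT y|lborel. of_real (1 / (2 * pi)) * (of_real (exp (- (((y - x)/d n)\<^sup>2) / 2) / d n) * \<psi> y))"
      by (simp only: integral_mult_right_zero integral_mult_left_zero fourier_gaussian(2)[OF d])
    also have "\<dots> = d n *\<^sub>R (LINT z|lborel. of_real (1 / (2 * pi)) * (of_real (exp (- (((x + d n * z - x)/d n)\<^sup>2) / 2) / d n) * \<psi> (x + d n * z)))"
      using d[of n] by (subst lborel_integral_real_affine[of "d n" _ x]) auto
    also have "\<dots> = (LINT z|lborel. d n *\<^sub>R (of_real (1 / (2 * pi)) * (of_real (exp (- (((x + d n * z - x)/d n)\<^sup>2) / 2) / d n) * \<psi> (x + d n * z))))"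
      by (rule integral_scaleR_right[symmetric])
    also have "\<dots> = (LINT z|lborel. ?n z *\<^sub>R (?c *\<^sub>R \<psi> (x + d n * z)))"
      using d[of n] by (intro Bochner_Integration.integral_cong refl)
        (simp add: scaleR_conv_of_real std_normal_density_def field_simps)
    finally show ?thesis .
  qed
  have ndi: "integrable lborel std_normal_density" by (rule integrable_normal_density) simp
  obtain B where B: "B > 0" "\<And>x. cmod (\<psi> x) \<le> B"
    using schwartz_bound[OF \<psi>, of 0 0] by (metis funpow_0 mult_1 power_0)
  have "A \<longlonglongrightarrow> (LINT z|lborel. ?n z *\<^sub>R (?c *\<^sub>R \<psi> x))"
    unfolding A2
  proof (rule integral_dominated_convergence[where w="\<lambda>z. ?n z * (?c * B)"])
    show "AE z in lborel. (\<lambda>n. ?n z *\<^sub>R (?c *\<^sub>R \<psi> (x + d n * z)))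
        \<longlonglongrightarrow> ?n z *\<^sub>R (?c *\<^sub>R \<psi> x)"
    proof (rule AE_I2)
      fix z
      have "isCont \<psi> x"
        using smooth_continuous_on[OF schwartz_smooth[OF \<psi>], of UNIV] by (simp add: continuous_on_eq_continuous_at)
      moreover have "(\<lambda>n. x + d n * z) \<longlonglongrightarrow> x + 0 * z" by (intro tendsto_intros dlim)
      ultimately have "(\<lambda>n. \<psi> (x + d n * z)) \<longlonglongrightarrow> \<psi> x" using isCont_tendsto_compose by fastforce
      then show "(\<lambda>n. ?n z *\<^sub>R (?c *\<^sub>R \<psi> (x + d n * z)))
        \<longlonglongrightarrow> ?n z *\<^sub>R (?c *\<^sub>R \<psi> x)" by (intro tendsto_intros)
    qed
    show "AE z in lborel. norm (?n z *\<^sub>R (?c *\<^sub>R \<psi> (x + d n * z))) \<le> ?n z * (?c * B)" for n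
    proof (rule AE_I2)
      fix z
      have "norm (?n z *\<^sub>R (?c *\<^sub>R \<psi> (x + d n * z))) = ?n z * (?c * cmod (\<psi> (x + d n * z)))"
        unfolding norm_scaleR by (simp add: abs_of_nonneg)
      also have "\<dots> \<le> ?n z * (?c * B)" by (intro mult_left_mono B) auto
      finally show "norm (?n z *\<^sub>R (?c *\<^sub>R \<psi> (x + d n * z))) \<le> ?n z * (?c * B)" .
    qed
  qed (use \<psi>m ndi in \<open>auto\<close>)
  also have "(LINT z|lborel. ?n z *\<^sub>R (?c *\<^sub>R \<psi> x)) = (LINT z|lborel. ?n z) *\<^sub>R (?c *\<^sub>R \<psi> x)"
    by (rule integral_scaleR_left) (use ndi in auto)
  also have "(LINT z|lborel. ?n z) = 1"
    using integral_normal_density[of 1 0] by simp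
  finally have "(1 / sqrt (2 * pi)) *\<^sub>R fourier \<theta> x = 1 *\<^sub>R (?c *\<^sub>R \<psi> x)"
    using LIMSEQ_unique[OF lim1] by blast
  then have "sqrt (2 * pi) *\<^sub>R ((1 / sqrt (2 * pi)) *\<^sub>R fourier \<theta> x) = sqrt (2 * pi) *\<^sub>R (?c *\<^sub>R \<psi> x)" by simp
  then show ?thesis by (simp add: \<theta>_def)
qed

section \<open>Fundamental lemma of the calculus of variations\<close>

lemma plateau_measurable [measurable]: "plateau a b d \<in> borel_measurable borel"
  by (intro borel_measurable_continuous_onI smooth_continuous_on smooth_plateau)

lemma plateau_integral_tendsto:
  fixes f :: "real \<Rightarrow> 'b::{banach, second_countable_topology}"
  assumes "set_integrable lborel {a..b} f"
  shows "(\<lambda>n. LINT x|lborel. plateau a b (1 / real (Suc n)) x *\<^sub>R f x) \<longlonglongrightarrow> (LINT x:{a..b}|lborel. f x)"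
proof -
  let ?g = "\<lambda>x. indicator {a..b} x *\<^sub>R f x"
  have gi: "integrable lborel ?g" using assms by (simp add: set_integrable_def)
  have gm: "?g \<in> borel_measurable lborel" using gi by auto
  have eq: "plateau a b (1 / real (Suc n)) x *\<^sub>R f x = plateau a b (1 / real (Suc n)) x *\<^sub>R ?g x" for n x
    using plateau_eq_0[of "1 / real (Suc n)" x a b] by (cases "x \<in> {a..b}") (auto simp del: of_nat_Suc)
  have "(\<lambda>n. LINT x|lborel. plateau a b (1 / real (Suc n)) x *\<^sub>R ?g x) \<longlonglongrightarrow> (LINT x|lborel. ?g x)"
  proof (rule integral_dominated_convergence[where w="\<lambda>x. norm (?g x)"])
    have "AE x in lborel. x \<noteq> a" "AE x in lborel. x \<noteq> b" by (rule AE_lborel_singleton)+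
    then show "AE x in lborel. (\<lambda>n. plateau a b (1 / real (Suc n)) x *\<^sub>R ?g x) \<longlonglongrightarrow> ?g x"
    proof eventually_elim
      case (elim x)
      show ?case
      proof (cases "x \<in> {a..b}")
        case True
        then have x: "a < x" "x < b" using elim by auto
        have "(\<lambda>n. 1 / real (Suc n)) \<longlonglongrightarrow> 0" by real_asymp
        then have "\<forall>\<^sub>F n in sequentially. 1 / real (Suc n) < min (x - a) (b - x)"
          using x by (intro order_tendstoD) auto
        then have "\<forall>\<^sub>F n in sequentially. plateau a b (1 / real (Suc n)) x *\<^sub>R ?g x = ?g x"
          by eventually_elim (subst plateau_eq_1, auto simp del: of_nat_Suc)
        then show ?thesis by (rule tendsto_eventually)
      qed auto
    qed
    show "AE x in lborel. norm (plateau a b (1 / real (Suc n)) x *\<^sub>R ?g x) \<le> norm (?g x)" for n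
    proof (rule AE_I2)
      fix x
      have "\<bar>plateau a b (1 / real (Suc n)) x\<bar> \<le> 1" using plateau_bounds abs_le_iff by (smt (verit))
      then have "\<bar>plateau a b (1 / real (Suc n)) x\<bar> * norm (?g x) \<le> 1 * norm (?g x)"
        by (rule mult_right_mono) simp
      then show "norm (plateau a b (1 / real (Suc n)) x *\<^sub>R ?g x) \<le> norm (?g x)"
        by (subst norm_scaleR) (simp only: mult_1)
    qed
    show "(\<lambda>x. plateau a b (1 / real (Suc n)) x *\<^sub>R ?g x) \<in> borel_measurable lborel" for n
      by (rule borel_measurable_scaleR[OF _ gm]) simp
  qed (rule gm integrable_norm[OF gi])+
  then show ?thesis unfolding eq by (simp add: set_lebesgue_integral_def)
qed

text \<open>The finite measures with the positive and the negative part of \<open>g\<close> as densities agree on half-lines, hence are equal.\<close>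

lemma integrable_AE_zero_real:
  fixes g :: "real \<Rightarrow> real"
  assumes g: "integrable lborel g" and z: "\<And>x. (LINT y:{x<..}|lborel. g y) = 0"
  shows "AE x in lborel. g x = 0"
proof -
  let ?p = "\<lambda>x. max 0 (g x)" and ?m = "\<lambda>x. max 0 (- g x)"
  have [measurable]: "g \<in> borel_measurable lborel" using g by auto
  have i: "integrable lborel (\<lambda>y. indicator {x<..} y * ?p y)" "integrable lborel (\<lambda>y. indicator {x<..} y * ?m y)" for x
    by (rule Bochner_Integration.integrable_bound[OF g]; auto simp: indicator_def)+
  have em: "emeasure (density lborel (\<lambda>x. ennreal (?p x))) {x<..} = ennreal (LINT y|lborel. indicator {x<..} y * ?p y)"
    "emeasure (density lborel (\<lambda>x. ennreal (?m x))) {x<..} = ennreal (LINT y|lborel. indicator {x<..} y * ?m y)" for x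
  proof -
    have *: "emeasure (density lborel (\<lambda>x. ennreal (h x))) {x<..} = ennreal (LINT y|lborel. indicator {x<..} y * h y)"
      if "integrable lborel (\<lambda>y. indicator {x<..} y * h y)" "h \<in> borel_measurable borel" "\<And>y. h y \<ge> 0" for h :: "real \<Rightarrow> real"
    proof -
      have "emeasure (density lborel (\<lambda>x. ennreal (h x))) {x<..} = (\<integral>\<^sup>+ y. ennreal (indicator {x<..} y * h y) \<partial>lborel)"
        using that by (subst emeasure_density) (auto intro!: nn_integral_cong simp: indicator_def)
      also have "\<dots> = ennreal (LINT y|lborel. indicator {x<..} y * h y)"
        by (rule nn_integral_eq_integral) (use that in auto)
      finally show ?thesis .
    qed
    show "emeasure (density lborel (\<lambda>x. ennreal (?p x))) {x<..} = ennreal (LINT y|lborel. indicator {x<..} y * ?p y)"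
      "emeasure (density lborel (\<lambda>x. ennreal (?m x))) {x<..} = ennreal (LINT y|lborel. indicator {x<..} y * ?m y)"
      by (rule *; use i in simp)+
  qed
  have eq: "(LINT y|lborel. indicator {x<..} y * ?p y) = (LINT y|lborel. indicator {x<..} y * ?m y)" for x
  proof -
    have "(LINT y|lborel. indicator {x<..} y * ?p y) - (LINT y|lborel. indicator {x<..} y * ?m y) =
      (LINT y|lborel. indicator {x<..} y * ?p y - indicator {x<..} y * ?m y)"
      by (rule Bochner_Integration.integral_diff[symmetric]) (rule i)+
    also have "\<dots> = (LINT y:{x<..}|lborel. g y)"
      unfolding set_lebesgue_integral_def
      by (rule Bochner_Integration.integral_cong) (auto simp: indicator_def max_def)
    finally show ?thesis using z by simp
  qed
  have "density lborel (\<lambda>x. ennreal (?p x)) = density lborel (\<lambda>x. ennreal (?m x))"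
  proof (rule measure_eqI_lessThan)
    show "emeasure (density lborel (\<lambda>x. ennreal (?p x))) {x<..} < \<infinity>" for x unfolding em by simp
    show "emeasure (density lborel (\<lambda>x. ennreal (?p x))) {x<..} = emeasure (density lborel (\<lambda>x. ennreal (?m x))) {x<..}" for x
      unfolding em eq ..
  qed auto
  then have "AE x in lborel. ennreal (?p x) = ennreal (?m x)"
    by (subst (asm) sigma_finite_measure.density_unique_iff[OF sigma_finite_lborel]) auto
  then show ?thesis
    by eventually_elim (auto simp: max_def split: if_splits)
qed

lemma locally_integrable_interval:
  "locally_integrable A f \<Longrightarrow> {a..b} \<subseteq> A \<Longrightarrow> set_integrable lborel {a..b} f"
  for f :: "real \<Rightarrow> 'b::{banach, second_countable_topology}"
  unfolding locally_integrable_def by auto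

text \<open>Plateaus converge to the indicator function of an interval, so the integral of \<open>f\<close> over each subinterval is zero.\<close>

lemma AE_zero_interval:
  fixes f :: "real \<Rightarrow> complex"
  assumes f: "locally_integrable A f" and A: "{a..b} \<subseteq> A"
    and z: "\<And>\<phi>::real\<Rightarrow>real. test_fun A \<phi> \<Longrightarrow> (LINT x|lborel. \<phi> x *\<^sub>R f x) = 0"
  shows "AE x in lborel. x \<in> {a..b} \<longrightarrow> f x = 0"
proof -
  have iz: "(LINT x:{c..b}|lborel. f x) = 0" if "a \<le> c" for c
  proof -
    have sub: "{c..b} \<subseteq> A" using that A by auto
    have "(\<lambda>n. LINT x|lborel. plateau c b (1 / real (Suc n)) x *\<^sub>R f x) \<longlonglongrightarrow> (LINT x:{c..b}|lborel. f x)"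
      by (rule plateau_integral_tendsto) (rule locally_integrable_interval[OF f sub])
    moreover have "(LINT x|lborel. plateau c b (1 / real (Suc n)) x *\<^sub>R f x) = 0" for n
      by (rule z) (rule test_fun_plateau[OF _ sub], simp)
    ultimately have "(\<lambda>n. 0) \<longlonglongrightarrow> (LINT x:{c..b}|lborel. f x)" by (simp only:)
    then show ?thesis by (simp add: LIMSEQ_const_iff)
  qed
  let ?g = "\<lambda>x. indicator {a..b} x *\<^sub>R f x"
  have gi: "integrable lborel ?g" using locally_integrable_interval[OF f A] by (simp add: set_integrable_def)
  have gz: "(LINT y:{x<..}|lborel. ?g y) = 0" for x
  proof -
    have "AE y in lborel. y \<noteq> max a x" by (rule AE_lborel_singleton)
    then have "(LINT y:{x<..}|lborel. ?g y) = (LINT y:{max a x..b}|lborel. f y)"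
      unfolding set_lebesgue_integral_def
    proof (intro integral_cong_AE)
      show "(\<lambda>y. indicator {x<..} y *\<^sub>R ?g y) \<in> borel_measurable lborel"
        by (rule borel_measurable_scaleR) (use gi in auto)
      have "{max a x..b} \<subseteq> A" using A by auto
      from locally_integrable_interval[OF f this]
      show "(\<lambda>y. indicator {max a x..b} y *\<^sub>R f y) \<in> borel_measurable lborel"
        by (auto simp: set_integrable_def)
    qed (auto simp: indicator_def elim!: eventually_mono)
    then show ?thesis using iz[of "max a x"] by simp
  qed
  have "AE x in lborel. Re (?g x) = 0" "AE x in lborel. Im (?g x) = 0"
  proof -
    have si: "integrable lborel (\<lambda>y. indicator {x<..} y *\<^sub>R ?g y)" for x
    proof (rule Bochner_Integration.integrable_bound[OF gi])
      show "(\<lambda>y. indicator {x<..} y *\<^sub>R ?g y) \<in> borel_measurable lborel"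
        by (rule borel_measurable_scaleR) (use gi in auto)
    qed (auto simp: indicator_def)
    have "(LINT y:{x<..}|lborel. Re (?g y)) = Re (LINT y:{x<..}|lborel. ?g y)" for x
      unfolding set_lebesgue_integral_def using si[of x] by (subst integral_Re[symmetric]) (auto simp: mult.assoc)
    then show "AE x in lborel. Re (?g x) = 0"
      using gi by (intro integrable_AE_zero_real integrable_Re) (auto simp: gz)
    have "(LINT y:{x<..}|lborel. Im (?g y)) = Im (LINT y:{x<..}|lborel. ?g y)" for x
      unfolding set_lebesgue_integral_def using si[of x] by (subst integral_Im[symmetric]) (auto simp: mult.assoc)
    then show "AE x in lborel. Im (?g x) = 0"
      using gi by (intro integrable_AE_zero_real integrable_Im) (auto simp: gz)
  qed
  then show ?thesis by eventually_elim (auto simp: complex_eq_iff)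
qed

text \<open>An open set is the union of the intervals with rational end points that it contains.\<close>

lemma AE_zero_open:
  fixes f :: "real \<Rightarrow> complex"
  assumes f: "locally_integrable A f" and A: "open A"
    and z: "\<And>\<phi>::real\<Rightarrow>real. test_fun A \<phi> \<Longrightarrow> (LINT x|lborel. \<phi> x *\<^sub>R f x) = 0"
  shows "AE x in lborel. x \<in> A \<longrightarrow> f x = 0"
proof -
  have "AE x in lborel. \<forall>r\<in>\<rat>. \<forall>s\<in>\<rat>. {r..s} \<subseteq> A \<longrightarrow> x \<in> {r..s} \<longrightarrow> f x = 0"
    unfolding AE_ball_countable[OF countable_rat]
  proof (intro ballI)
    fix r s :: real
    show "AE x in lborel. {r..s} \<subseteq> A \<longrightarrow> x \<in> {r..s} \<longrightarrow> f x = 0"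
    proof (cases "{r..s} \<subseteq> A")
      case True
      have "AE x in lborel. x \<in> {r..s} \<longrightarrow> f x = 0" by (rule AE_zero_interval[OF f True]) (rule z)
      then show ?thesis by eventually_elim simp
    qed simp
  qed
  then show ?thesis
  proof eventually_elim
    case (elim x)
    show ?case
    proof
      assume "x \<in> A"
      then obtain e where e: "e > 0" "ball x e \<subseteq> A" using A open_contains_ball by blast
      obtain r where r: "r \<in> \<rat>" "x - e < r" "r < x" using Rats_dense_in_real[of "x - e" x] e(1) by auto
      obtain s where s: "s \<in> \<rat>" "x < s" "s < x + e" using Rats_dense_in_real[of x "x + e"] e(1) by auto
      have "{r..s} \<subseteq> ball x e" using r s by (auto simp: dist_real_def)
      moreover have "x \<in> {r..s}" using r s by simp
      ultimately show "f x = 0" using elim r(1) s(1) e(2) by blast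
    qed
  qed
qed

lemma integrable_times_compact_support:
  fixes V C :: "'a::euclidean_space \<Rightarrow> 'b::{real_normed_field, banach, second_countable_topology}"
  assumes V: "set_integrable lborel K V" and K: "compact K" and C: "continuous_on UNIV C" "\<And>z. z \<notin> K \<Longrightarrow> C z = 0"
  shows "integrable lborel (\<lambda>z. V z * C z)"
proof -
  have i: "integrable lborel (\<lambda>z. indicator K z *\<^sub>R V z)" using V by (simp add: set_integrable_def)
  obtain D where D: "\<And>z. z \<in> K \<Longrightarrow> norm (C z) \<le> D"
    using compact_imp_bounded[OF compact_continuous_image[OF continuous_on_subset[OF C(1)] K]] unfolding bounded_iff by (meson imageI subset_UNIV)
  have eq: "V z * C z = (indicator K z *\<^sub>R V z) * C z" for z using C(2)[of z] by (cases "z \<in> K") auto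
  show ?thesis
  proof (rule Bochner_Integration.integrable_bound)
    show "integrable lborel (\<lambda>z. D *\<^sub>R (indicator K z *\<^sub>R V z))" by (rule integrable_scaleR_right) (rule i)
    have "C \<in> borel_measurable lborel" using borel_measurable_continuous_onI[OF C(1)] by simp
    then show "(\<lambda>z. V z * C z) \<in> borel_measurable lborel"
      unfolding eq by (intro borel_measurable_times borel_measurable_integrable[OF i])
    have "norm (V z * C z) \<le> norm (D *\<^sub>R (indicator K z *\<^sub>R V z))" for z
    proof (cases "z \<in> K")
      case True
      have "norm (V z) * norm (C z) \<le> norm (V z) * \<bar>D\<bar>" using D[OF True] by (intro mult_left_mono) auto
      then show ?thesis using True by (simp add: norm_mult mult.commute)
    qed (use C(2) in auto)
    then show "AE z in lborel. norm (V z * C z) \<le> norm (D *\<^sub>R (indicator K z *\<^sub>R V z))" by simp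
  qed
qed

lemma integrable_times_test_fun:
  fixes V C :: "'a::euclidean_space \<Rightarrow> 'b::{real_normed_field, banach, second_countable_topology}"
  assumes "locally_integrable A V" "test_fun A C" shows "integrable lborel (\<lambda>z. V z * C z)"
proof -
  obtain K where K: "smooth C" "compact K" "K \<subseteq> A" "\<And>z. z \<notin> K \<Longrightarrow> C z = 0" using assms(2) unfolding test_fun_def by blast
  then have "set_integrable lborel K V" using assms(1) by (auto simp: locally_integrable_def)
  then show ?thesis by (rule integrable_times_compact_support[OF _ K(2) smooth_continuous_on[OF K(1)] K(4)])
qed

lemma test_fun_of_real:
  "test_fun A \<phi> \<Longrightarrow> test_fun A (\<lambda>x. complex_of_real (\<phi> x))" for \<phi> :: "'a::euclidean_space \<Rightarrow> real"
  unfolding test_fun_def by (auto intro: smooth_of_real)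

lemma locally_integrable_eq_AE:
  fixes f g :: "real \<Rightarrow> complex"
  assumes A: "open A" and f: "locally_integrable A f" and g: "locally_integrable A g"
    and eq: "\<And>\<psi>::real\<Rightarrow>real. test_fun A \<psi> \<Longrightarrow> (LINT x|lborel. f x * of_real (\<psi> x)) = (LINT x|lborel. g x * of_real (\<psi> x))"
  shows "AE x in lborel. x \<in> A \<longrightarrow> f x = g x"
proof -
  have "AE x in lborel. x \<in> A \<longrightarrow> f x - g x = 0"
  proof (rule AE_zero_open[OF _ A])
    show "locally_integrable A (\<lambda>x. f x - g x)"
      using f g unfolding locally_integrable_def by (auto intro: set_integral_diff)
    fix \<phi> :: "real \<Rightarrow> real" assume \<phi>: "test_fun A \<phi>"
    have "(LINT x|lborel. \<phi> x *\<^sub>R (f x - g x)) = (LINT x|lborel. f x * of_real (\<phi> x) - g x * of_real (\<phi> x))"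
      by (rule Bochner_Integration.integral_cong) (auto simp: scaleR_conv_of_real algebra_simps)
    also have "\<dots> = (LINT x|lborel. f x * of_real (\<phi> x)) - (LINT x|lborel. g x * of_real (\<phi> x))"
      by (rule Bochner_Integration.integral_diff; rule integrable_times_test_fun[OF _ test_fun_of_real[OF \<phi>]]) (rule f g)+
    finally show "(LINT x|lborel. \<phi> x *\<^sub>R (f x - g x)) = 0" using eq[OF \<phi>] by simp
  qed
  then show ?thesis by eventually_elim simp
qed

lemma locally_integrable_measurable:
  fixes g :: "'a::euclidean_space \<Rightarrow> 'b::{banach, second_countable_topology}"
  assumes A: "open A" and g: "locally_integrable A g"
  shows "(\<lambda>x. indicator A x *\<^sub>R g x) \<in> borel_measurable borel"
proof -
  obtain C where C: "\<And>n::nat. compact (C n)" "\<And>n. C n \<subseteq> A" "\<And>K. compact K \<Longrightarrow> K \<subseteq> A \<Longrightarrow> \<exists>N. \<forall>n\<ge>N. K \<subseteq> C n"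
    using open_Union_compact_subsets[OF A] by metis
  show ?thesis
  proof (rule borel_measurable_LIMSEQ_metric)
    have "integrable lborel (\<lambda>x. indicator (C n) x *\<^sub>R g x)" for n
      using g C(1,2)[of n] unfolding locally_integrable_def set_integrable_def by blast
    from borel_measurable_integrable[OF this]
    show "(\<lambda>x. indicator (C n) x *\<^sub>R g x) \<in> borel_measurable borel" for n by simp
    fix x
    show "(\<lambda>n. indicator (C n) x *\<^sub>R g x) \<longlonglongrightarrow> indicator A x *\<^sub>R g x"
    proof (cases "x \<in> A")
      case True
      then obtain N where "\<forall>n\<ge>N. {x} \<subseteq> C n" using C(3)[of "{x}"] by auto
      then have "\<forall>\<^sub>F n in sequentially. indicator (C n) x *\<^sub>R g x = indicator A x *\<^sub>R g x"
        using True unfolding eventually_sequentially by (intro exI[of _ N]) auto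
      then show ?thesis by (rule tendsto_eventually)
    next
      case False
      then have "x \<notin> C n" for n using C(2) by blast
      then show ?thesis using False by simp
    qed
  qed
qed

lemma represents_measurable: "represents UNIV S g \<Longrightarrow> g \<in> borel_measurable borel"
  using locally_integrable_measurable[OF open_UNIV, of g] by (simp add: represents_def)

lemma represents_mono:
  assumes "represents A S g" "A' \<subseteq> A" shows "represents A' S g"
  using assms unfolding represents_def locally_integrable_def test_fun_def by (meson subset_trans)

lemma represents_unique_AE:
  assumes "open A" "represents A S f" "represents A S g" shows "AE x in lborel. x \<in> A \<longrightarrow> f x = g x"
proof (rule locally_integrable_eq_AE[OF assms(1)])
  fix \<psi> :: "real \<Rightarrow> real" assume "test_fun A \<psi>"
  from test_fun_of_real[OF this] show "(LINT x|lborel. f x * of_real (\<psi> x)) = (LINT x|lborel. g x * of_real (\<psi> x))"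
    using assms(2,3) by (metis (no_types) represents_def)
qed (use assms in \<open>auto simp: represents_def\<close>)

lemma bounded_locally_integrable:
  fixes g :: "real \<Rightarrow> complex"
  assumes [measurable]: "g \<in> borel_measurable borel" and B: "AE x in lborel. cmod (g x) \<le> B"
  shows "locally_integrable UNIV g"
  unfolding locally_integrable_def set_integrable_def
proof (intro allI impI)
  fix K :: "real set" assume K: "compact K \<and> K \<subseteq> UNIV"
  then have [measurable]: "K \<in> sets borel" by (auto intro: compact_imp_closed borel_closed)
  have "emeasure lborel K < \<infinity>" using K emeasure_compact_finite by auto
  then have i: "integrable lborel (\<lambda>x. B * indicator K x)" by (intro integrable_mult_right) (simp add: integrable_indicator_iff)
  show "integrable lborel (\<lambda>x. indicator K x *\<^sub>R g x)"
    by (rule Bochner_Integration.integrable_bound[OF i])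
       (measurable, use B in eventually_elim, auto simp: indicator_def)
qed

lemma continuous_locally_integrable:
  fixes K :: "real \<Rightarrow> 'a::{banach, second_countable_topology}"
  assumes "continuous_on UNIV K" shows "locally_integrable UNIV K"
  unfolding locally_integrable_def set_integrable_def
  by (auto intro!: borel_integrable_compact continuous_on_subset[OF assms])

lemma AE_bound_continuous_pos:
  fixes f :: "real \<Rightarrow> 'a::{real_normed_vector}"
  assumes "AE x in lborel. x > 0 \<longrightarrow> norm (f x) \<le> B" "continuous_on {0<..} f" "x > 0"
  shows "norm (f x) \<le> B"
proof (rule ccontr)
  assume *: "\<not> norm (f x) \<le> B"
  have "isCont f x" using assms(2,3) by (simp add: continuous_on_eq_continuous_at)
  then have "((\<lambda>y. norm (f y)) \<longlongrightarrow> norm (f x)) (at x)" by (intro tendsto_norm) (simp add: isCont_def)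
  then have "\<forall>\<^sub>F y in at x. B < norm (f y)" using * by (intro order_tendstoD) auto
  then obtain d where d: "d > 0" "\<And>y. y \<noteq> x \<Longrightarrow> dist y x < d \<Longrightarrow> B < norm (f y)"
    unfolding eventually_at by auto
  from assms(1) obtain N where N: "{y. \<not> (y > 0 \<longrightarrow> norm (f y) \<le> B)} \<subseteq> N" "emeasure lborel N = 0" "N \<in> sets lborel"
    unfolding eventually_ae_filter null_sets_def by auto
  have "{x<..<x+d} \<subseteq> N" using d(2) N(1) assms(3) by (force simp: dist_real_def)
  then have "emeasure lborel {x<..<x+d} \<le> 0" using emeasure_mono[of _ N lborel] N by auto
  then show False using d(1) by simp
qed

section \<open>Weak derivatives on the line\<close>

lemma bump_measurable [measurable]: "bump \<in> borel_measurable borel"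
  by (intro borel_measurable_continuous_onI smooth_continuous_on smooth_bump)

lemma integrable_bump: "integrable lborel bump"
  and LINT_bump: "(LINT z|lborel. bump z *\<^sub>R c) = c" for c :: "'a::{banach, second_countable_topology}"
proof -
  have ii: "set_integrable lborel {0..1} bump"
    by (rule borel_integrable_atLeastAtMost') (rule smooth_continuous_on[OF smooth_bump])
  have eq: "indicator {0..1} z *\<^sub>R bump z = bump z" for z
    using bump_eq_0[of z] by (cases "z \<in> {0..1}") auto
  have "(LINT z:{0..1}|lborel. bump z) = 1"
    using set_borel_integral_eq_integral(2)[OF ii] integral_bump by simp
  then have 1: "(LINT z|lborel. bump z) = 1" by (simp only: set_lebesgue_integral_def eq)
  show i: "integrable lborel bump" using ii by (simp only: set_integrable_def eq)
  show "(LINT z|lborel. bump z *\<^sub>R c) = c" using 1 i by (subst integral_scaleR_left) auto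
qed

text \<open>Since the bump lives on \<open>[0, 1]\<close>, only values of \<open>F\<close> between \<open>c\<close> and \<open>c + d n\<close> enter, on the side given by the sign of \<open>d n\<close>.\<close>

lemma bump_average_tendsto:
  fixes F :: "real \<Rightarrow> 'a::{banach, second_countable_topology}"
  assumes "continuous_on {l..r} F" "d \<longlonglongrightarrow> 0" "\<And>n z. 0 \<le> z \<Longrightarrow> z \<le> 1 \<Longrightarrow> c + d n * z \<in> {l..r}" "c \<in> {l..r}"
  shows "(\<lambda>n. LINT z|lborel. bump z *\<^sub>R F (c + d n * z)) \<longlonglongrightarrow> F c"
proof -
  obtain B where B: "\<And>x. x \<in> {l..r} \<Longrightarrow> norm (F x) \<le> B"
    using compact_imp_bounded[OF compact_continuous_image[OF assms(1) compact_Icc]]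
    unfolding bounded_iff by (meson imageI)
  have eq: "bump z *\<^sub>R F (c + d n * z) = bump z *\<^sub>R (indicator {0..1} z *\<^sub>R F (c + d n * z))" for z n
    using bump_eq_0[of z] by (cases "z \<in> {0..1}") auto
  have "(\<lambda>n. LINT z|lborel. bump z *\<^sub>R F (c + d n * z)) \<longlonglongrightarrow> (LINT z|lborel. bump z *\<^sub>R F c)"
  proof (rule integral_dominated_convergence[where w="\<lambda>z. bump z * B"])
    show "(\<lambda>z. bump z *\<^sub>R F (c + d n * z)) \<in> borel_measurable lborel" for n
      unfolding eq
    proof (rule borel_measurable_scaleR)
      have "continuous_on {0..1} (\<lambda>z. F (c + d n * z))"
        by (rule continuous_on_compose2[OF assms(1)]) (use assms(3) in \<open>auto intro!: continuous_intros\<close>)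
      then show "(\<lambda>z. indicator {0..1} z *\<^sub>R F (c + d n * z)) \<in> borel_measurable lborel"
        by (simp add: borel_measurable_continuous_on_indicator)
    qed auto
    show "integrable lborel (\<lambda>z. bump z * B)" using integrable_bump by simp
    show "AE z in lborel. (\<lambda>n. bump z *\<^sub>R F (c + d n * z)) \<longlonglongrightarrow> bump z *\<^sub>R F c"
    proof (rule AE_I2)
      fix z
      show "(\<lambda>n. bump z *\<^sub>R F (c + d n * z)) \<longlonglongrightarrow> bump z *\<^sub>R F c"
      proof (cases "0 \<le> z \<and> z \<le> 1")
        case True
        have "(\<lambda>n. c + d n * z) \<longlonglongrightarrow> c + 0 * z" by (intro tendsto_intros assms)
        then have "(\<lambda>n. F (c + d n * z)) \<longlonglongrightarrow> F c"
          using True assms by (intro continuous_on_tendsto_compose[OF assms(1)]) auto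
        then show ?thesis by (intro tendsto_intros)
      next
        case False
        then have "bump z = 0" by (intro bump_eq_0) auto
        then show ?thesis by simp
      qed
    qed
    show "AE z in lborel. norm (bump z *\<^sub>R F (c + d n * z)) \<le> bump z * B" for n
    proof (rule AE_I2)
      fix z
      show "norm (bump z *\<^sub>R F (c + d n * z)) \<le> bump z * B"
      proof (cases "0 \<le> z \<and> z \<le> 1")
        case True
        then show ?thesis using B[OF assms(3), of z n] by (auto simp: abs_of_nonneg bump_nonneg intro: mult_left_mono)
      next
        case False
        then have "bump z = 0" by (intro bump_eq_0) auto
        then show ?thesis by simp
      qed
    qed
  qed (auto intro: borel_measurable_scaleR)
  then show ?thesis by (simp only: LINT_bump)
qed

lemma plateau_deriv:
  assumes "0 < d" "2 * d \<le> b - a"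
  shows "dir_deriv 1 (plateau a b d) x = bump ((x - a) / d) / d - bump ((b - x) / d) / d"
proof (rule dir_deriv_eq_vector)
  have s: "((\<lambda>x. step (c + k * x)) has_real_derivative bump (c + k * x) * k) (at x)" for c k
    by (rule DERIV_chain2[where f=step])
       (use step_has_derivative in \<open>auto simp: has_real_derivative_iff_has_vector_derivative[symmetric] intro!: derivative_eq_intros\<close>)
  have 1: "((\<lambda>x. step ((x - a) / d)) has_real_derivative bump ((x - a) / d) / d) (at x)"
    using s[of "-a/d" "1/d"] by (simp add: diff_divide_distrib)
  have 2: "((\<lambda>x. step ((b - x) / d)) has_real_derivative - bump ((b - x) / d) / d) (at x)"
    using s[of "b/d" "-1/d"] by (simp add: diff_divide_distrib)
  have "(plateau a b d has_real_derivative
     (bump ((x - a) / d) / d) * step ((b - x) / d) + (- bump ((b - x) / d) / d) * step ((x - a) / d)) (at x)"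
    unfolding plateau_def[abs_def] by (rule DERIV_mult[OF 1 2])
  also have "(bump ((x - a) / d) / d) * step ((b - x) / d) = bump ((x - a) / d) / d"
  proof (cases "x < a + d")
    case True
    then have "step ((b - x) / d) = 1" using assms by (intro step_1) (auto simp: field_simps)
    then show ?thesis by simp
  next
    case False
    then have "bump ((x - a) / d) = 0" using assms by (intro bump_eq_0) (auto simp: field_simps)
    then show ?thesis by simp
  qed
  also have "(- bump ((b - x) / d) / d) * step ((x - a) / d) = - bump ((b - x) / d) / d"
  proof (cases "x > b - d")
    case True
    then have "step ((x - a) / d) = 1" using assms by (intro step_1) (auto simp: field_simps)
    then show ?thesis by simp
  next
    case False
    then have "bump ((b - x) / d) = 0" using assms by (intro bump_eq_0) (auto simp: field_simps)
    then show ?thesis by simp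
  qed
  finally show "(plateau a b d has_vector_derivative bump ((x - a) / d) / d - bump ((b - x) / d) / d) (at x)"
    by (simp add: has_real_derivative_iff_has_vector_derivative)
qed

lemma LINT_bump_scaled:
  fixes F :: "real \<Rightarrow> 'a::{banach, second_countable_topology}"
  assumes "d > 0"
  shows "(LINT x|lborel. (bump ((x - a) / d) / d) *\<^sub>R F x) = (LINT z|lborel. bump z *\<^sub>R F (a + d * z))"
    "(LINT x|lborel. (bump ((b - x) / d) / d) *\<^sub>R F x) = (LINT z|lborel. bump z *\<^sub>R F (b + (-d) * z))"
proof -
  show "(LINT x|lborel. (bump ((x - a) / d) / d) *\<^sub>R F x) = (LINT z|lborel. bump z *\<^sub>R F (a + d * z))"
    using assms by (subst lborel_integral_real_affine[of d _ a]) (simp_all flip: integral_scaleR_right)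
  show "(LINT x|lborel. (bump ((b - x) / d) / d) *\<^sub>R F x) = (LINT z|lborel. bump z *\<^sub>R F (b + (-d) * z))"
    using assms by (subst lborel_integral_real_affine[of "-d" _ b]) (simp_all flip: integral_scaleR_right)
qed

text \<open>The derivative of a plateau on \<open>[a, b]\<close> is a bump next to \<open>a\<close> minus a bump next to \<open>b\<close>, both on the inner side;
  as the slopes become steep the weak identity turns into the fundamental theorem of calculus.\<close>

lemma weak_derivative_FTC:
  fixes F h :: "real \<Rightarrow> 'a::{banach, second_countable_topology}"
  assumes A: "{a..b} \<subseteq> A" and ab: "a < b" and F: "continuous_on {a..b} F" and h: "set_integrable lborel {a..b} h"
    and wk: "\<And>\<phi>::real\<Rightarrow>real. test_fun A \<phi> \<Longrightarrow> (LINT x|lborel. \<phi> x *\<^sub>R h x) = - (LINT x|lborel. dir_deriv 1 \<phi> x *\<^sub>R F x)"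
  shows "F b - F a = (LINT x:{a..b}|lborel. h x)"
proof (rule LIMSEQ_unique)
  show "(\<lambda>n. LINT x|lborel. plateau a b (1 / real (Suc n)) x *\<^sub>R h x) \<longlonglongrightarrow> (LINT x:{a..b}|lborel. h x)"
    by (rule plateau_integral_tendsto[OF h])
  define d where "d n = 1 / real (Suc n)" for n
  have d: "d n > 0" for n by (simp add: d_def)
  have d0: "d \<longlonglongrightarrow> 0" unfolding d_def by real_asymp
  have ev: "\<forall>\<^sub>F n in sequentially. 2 * d n \<le> b - a"
  proof -
    have "(\<lambda>n. 2 * d n) \<longlonglongrightarrow> 2 * 0" by (intro tendsto_intros d0)
    then have "\<forall>\<^sub>F n in sequentially. 2 * d n < b - a" using ab by (intro order_tendstoD(2)[of _ "2 * 0"]) auto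
    then show ?thesis by eventually_elim simp
  qed
  \<comment> \<open>from here on the two slopes of the plateau are disjoint\<close>
  then obtain N where N: "\<And>n. n \<ge> N \<Longrightarrow> 2 * d n \<le> b - a" unfolding eventually_sequentially by blast
  let ?e = "\<lambda>n. d (n + N)"
  have e0: "?e \<longlonglongrightarrow> 0" using d0 by (rule LIMSEQ_ignore_initial_segment)
  have in1: "a + ?e n * z \<in> {a..b}" "b + (- ?e n) * z \<in> {a..b}" if "0 \<le> z" "z \<le> 1" for n z
  proof -
    have "0 \<le> ?e n * z" "?e n * z \<le> ?e n" "2 * ?e n \<le> b - a"
      using that d[of "n+N"] N[of "n+N"] by (auto simp: mult_left_le)
    then show "a + ?e n * z \<in> {a..b}" "b + (- ?e n) * z \<in> {a..b}"
      using N[of "n+N"] d[of "n+N"] unfolding atLeastAtMost_iff by argo+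
  qed
  have l1: "(\<lambda>n. LINT z|lborel. bump z *\<^sub>R F (a + ?e n * z)) \<longlonglongrightarrow> F a"
    by (rule bump_average_tendsto[OF F e0]) (use in1 ab in auto)
  have l2: "(\<lambda>n. LINT z|lborel. bump z *\<^sub>R F (b + (- ?e n) * z)) \<longlonglongrightarrow> F b"
    by (rule bump_average_tendsto[OF F]) (use in1 ab tendsto_minus[OF e0] in auto)
  have int: "integrable lborel (\<lambda>x. (bump ((x - a) / ?e n) / ?e n) *\<^sub>R F x)"
            "integrable lborel (\<lambda>x. (bump ((b - x) / ?e n) / ?e n) *\<^sub>R F x)" for n
  proof -
    have *: "integrable lborel (\<lambda>x. k x *\<^sub>R F x)" if "continuous_on UNIV k" "\<And>x. x \<notin> {a..b} \<Longrightarrow> k x = 0" for k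
    proof -
      have "set_integrable lborel {a..b} (\<lambda>x. k x *\<^sub>R F x)"
        by (rule borel_integrable_atLeastAtMost') (intro continuous_intros F continuous_on_subset[OF that(1)], simp)
      moreover have "indicator {a..b} x *\<^sub>R (k x *\<^sub>R F x) = k x *\<^sub>R F x" for x
        using that(2)[of x] by (auto simp: indicator_def)
      ultimately show ?thesis by (simp only: set_integrable_def)
    qed
    have c: "continuous_on UNIV (\<lambda>x. bump (g x) / ?e n)" if "continuous_on UNIV g" for g
      by (intro continuous_on_divide continuous_on_compose2[OF smooth_continuous_on[OF smooth_bump] that] continuous_on_const)
         (use d[of "n+N"] in auto)
    show "integrable lborel (\<lambda>x. (bump ((x - a) / ?e n) / ?e n) *\<^sub>R F x)"
    proof (rule *)
      show "continuous_on UNIV (\<lambda>x. bump ((x - a) / ?e n) / ?e n)"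
        by (rule c) (intro continuous_intros, use d[of "n+N"] in auto)
      show "bump ((x - a) / ?e n) / ?e n = 0" if "x \<notin> {a..b}" for x
        using that d[of "n+N"] N[of "n+N"] ab by (subst bump_eq_0) (auto simp: field_simps)
    qed
    show "integrable lborel (\<lambda>x. (bump ((b - x) / ?e n) / ?e n) *\<^sub>R F x)"
    proof (rule *)
      show "continuous_on UNIV (\<lambda>x. bump ((b - x) / ?e n) / ?e n)"
        by (rule c) (intro continuous_intros, use d[of "n+N"] in auto)
      show "bump ((b - x) / ?e n) / ?e n = 0" if "x \<notin> {a..b}" for x
        using that d[of "n+N"] N[of "n+N"] ab by (subst bump_eq_0) (auto simp: field_simps)
    qed
  qed
  have eq: "(LINT x|lborel. plateau a b (?e n) x *\<^sub>R h x) =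
      (LINT z|lborel. bump z *\<^sub>R F (b + (- ?e n) * z)) - (LINT z|lborel. bump z *\<^sub>R F (a + ?e n * z))" for n
  proof -
    have "(LINT x|lborel. plateau a b (?e n) x *\<^sub>R h x) = - (LINT x|lborel. dir_deriv 1 (plateau a b (?e n)) x *\<^sub>R F x)"
      by (rule wk) (rule test_fun_plateau[OF d A])
    also have "(LINT x|lborel. dir_deriv 1 (plateau a b (?e n)) x *\<^sub>R F x) =
       (LINT x|lborel. (bump ((x - a) / ?e n) / ?e n) *\<^sub>R F x - (bump ((b - x) / ?e n) / ?e n) *\<^sub>R F x)"
      by (simp only: plateau_deriv[OF d N] le_add2 scaleR_diff_left)
    also have "\<dots> = (LINT x|lborel. (bump ((x - a) / ?e n) / ?e n) *\<^sub>R F x) - (LINT x|lborel. (bump ((b - x) / ?e n) / ?e n) *\<^sub>R F x)"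
      by (rule Bochner_Integration.integral_diff[OF int])
    finally show ?thesis by (simp only: LINT_bump_scaled[OF d] minus_diff_eq)
  qed
  have "(\<lambda>n. LINT x|lborel. plateau a b (d (n + N)) x *\<^sub>R h x) \<longlonglongrightarrow> F b - F a"
    unfolding eq by (intro tendsto_diff l1 l2)
  then have "(\<lambda>n. LINT x|lborel. plateau a b (d n) x *\<^sub>R h x) \<longlonglongrightarrow> F b - F a"
    by (rule LIMSEQ_offset)
  then show "(\<lambda>n. LINT x|lborel. plateau a b (1 / real (Suc n)) x *\<^sub>R h x) \<longlonglongrightarrow> F b - F a"
    by (simp only: d_def)
qed

section \<open>Oscillatory integrals with absolutely continuous amplitude\<close>

text \<open>Only frequencies \<open>p \<ge> 0\<close> matter: for a real function those below 0 follow by symmetry, and \<open>G 0\<close> is the limit from the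
  right, whose non-zero imaginary part makes a jump of the full profile. The function \<open>h\<close> is the derivative of \<open>G\<close> in the integrated sense.\<close>

definition ac_profile :: "real \<Rightarrow> real \<Rightarrow> (real \<Rightarrow> complex) \<Rightarrow> (real \<Rightarrow> complex) \<Rightarrow> bool" where
  "ac_profile B M G h \<longleftrightarrow> B \<ge> 0 \<and> M \<ge> 0 \<and> h \<in> borel_measurable borel \<and> integrable lborel (\<lambda>p. (cmod (h p))\<^sup>2) \<and>
     (LINT p|lborel. (cmod (h p))\<^sup>2) \<le> M \<and> (\<forall>p\<ge>0. cmod (G p) \<le> B) \<and>
     (\<forall>a b. 0 \<le> a \<longrightarrow> a \<le> b \<longrightarrow> G b - G a = (LINT p:{a..b}|lborel. h p))"

lemma ac_profileD:
  assumes "ac_profile B M G h"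
  shows "B \<ge> 0" "M \<ge> 0" "h \<in> borel_measurable borel" "integrable lborel (\<lambda>p. (cmod (h p))\<^sup>2)"
    "(LINT p|lborel. (cmod (h p))\<^sup>2) \<le> M" "p \<ge> 0 \<Longrightarrow> cmod (G p) \<le> B"
    "0 \<le> a \<Longrightarrow> a \<le> b \<Longrightarrow> G b - G a = (LINT p:{a..b}|lborel. h p)"
  using assms unfolding ac_profile_def by blast+

lemma L2_set_integrable:
  fixes h :: "real \<Rightarrow> complex"
  assumes [measurable]: "h \<in> borel_measurable borel" and i: "integrable lborel (\<lambda>p. (cmod (h p))\<^sup>2)"
  shows "set_integrable lborel {a..b} h"
proof -
  have "integrable lborel (\<lambda>p. indicator {a..b} p * 1 + (cmod (h p))\<^sup>2)"
    by (intro Bochner_Integration.integrable_add i)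
       (simp add: integrable_indicator_iff emeasure_lborel_Icc_eq)
  then show ?thesis
    unfolding set_integrable_def
  proof (rule Bochner_Integration.integrable_bound)
    have "y \<le> 1 + y\<^sup>2" for y :: real
      using sum_squares_ge_zero[of "y - 1/2" 0] by (simp add: power2_eq_square algebra_simps)
    then show "AE p in lborel. norm (indicator {a..b} p *\<^sub>R h p) \<le> norm (indicator {a..b} p * 1 + (cmod (h p))\<^sup>2)"
      by (intro AE_I2) (auto simp: indicator_def)
  qed measurable
qed

lemma ac_profile_integrable:
  assumes "ac_profile B M G h" shows "set_integrable lborel {a..b} h"
  by (rule L2_set_integrable[OF ac_profileD(3,4)[OF assms]])

lemma ac_profile_continuous:
  assumes "ac_profile B M G h" shows "continuous_on {0..} G"
proof -
  have "continuous_on {0..b} G" if "b \<ge> 0" for b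
  proof -
    have i: "h integrable_on {0..b}" "\<And>p. integral {0..p} h = (LINT p:{0..p}|lborel. h p)"
      using set_borel_integral_eq_integral[OF ac_profile_integrable[OF assms]] by auto
    have "continuous_on {0..b} (\<lambda>p. G 0 + integral {0..p} h)"
      by (intro continuous_intros indefinite_integral_continuous_1 i)
    moreover have "G 0 + integral {0..p} h = G p" if "p \<in> {0..b}" for p
      using ac_profileD(7)[OF assms, of 0 p] that i by (auto simp: algebra_simps)
    ultimately show ?thesis by (rule continuous_on_eq)
  qed
  then have "continuous (at p within {0..}) G" if "p \<ge> 0" for p
  proof -
    have "continuous (at p within {0..p+1}) G"
      using \<open>\<And>b. 0 \<le> b \<Longrightarrow> continuous_on {0..b} G\<close>[of "p+1"] that by (auto simp: continuous_on_eq_continuous_within)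
    moreover have "at p within {0..p+1} = at p within {0..}"
      by (rule at_within_nhd[of _ "{..<p+1}"]) (use that in auto)
    ultimately show ?thesis by simp
  qed
  then show ?thesis by (auto simp: continuous_on_eq_continuous_within)
qed

lemma integrable_pair_mult:
  fixes f g :: "real \<Rightarrow> complex"
  assumes f: "integrable lborel f" and g: "integrable lborel g"
  shows "integrable (lborel \<Otimes>\<^sub>M lborel) (\<lambda>(x, y). f x * g y)"
proof (rule lborel_pair.Fubini_integrable)
  have [measurable]: "f \<in> borel_measurable lborel" "g \<in> borel_measurable lborel" using f g by auto
  show "(\<lambda>(x, y). f x * g y) \<in> borel_measurable (lborel \<Otimes>\<^sub>M lborel)" by measurable
  have "integrable lborel (\<lambda>x. cmod (f x) * (LINT y|lborel. cmod (g y)))"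
    using integrable_norm[OF f] by simp
  then show "integrable lborel (\<lambda>x. LINT y|lborel. norm (case (x, y) of (x, y) \<Rightarrow> f x * g y))"
    by (simp add: norm_mult)
qed (use g in auto)

text \<open>Write \<open>G(p) - G(l)\<close> as the integral of \<open>h\<close> and apply Fubini's theorem on the triangle \<open>s \<le> p\<close>.\<close>

lemma ac_integration_by_parts:
  assumes prof: "ac_profile B M G h" and ab: "0 \<le> l" "l \<le> r"
    and P: "\<And>p. p \<in> {l..r} \<Longrightarrow> (P has_vector_derivative P' p) (at p within {l..r})"
    and P': "continuous_on {l..r} P'"
  shows "integral {l..r} (\<lambda>p. P' p * G p) = P r * G r - P l * G l - (LINT p:{l..r}|lborel. P p * h p)"
proof -
  let ?I = "{l..r}"
  have cG: "continuous_on ?I G" using ac_profile_continuous[OF prof] by (rule continuous_on_subset) (use ab in auto)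
  have cP: "continuous_on ?I P" using P by (meson continuous_on_vector_derivative)
  have hi: "set_integrable lborel ?I h" by (rule ac_profile_integrable[OF prof])
  have P'i: "set_integrable lborel ?I P'" by (rule borel_integrable_atLeastAtMost'[OF P'])
  let ?h = "\<lambda>s. indicator ?I s *\<^sub>R h s" and ?p = "\<lambda>p. indicator ?I p *\<^sub>R P' p"
  have i0: "integrable (lborel \<Otimes>\<^sub>M lborel) (\<lambda>(s, p). ?h s * ?p p)"
    by (rule integrable_pair_mult) (use hi P'i in \<open>auto simp: set_integrable_def\<close>)
  let ?k = "\<lambda>s p. (if s \<le> p then ?h s * ?p p else 0)"
  have i1: "integrable (lborel \<Otimes>\<^sub>M lborel) (\<lambda>(s, p). ?k s p)"
  proof (rule Bochner_Integration.integrable_bound[OF i0])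
    have [measurable]: "?h \<in> borel_measurable lborel" "?p \<in> borel_measurable lborel"
      using hi P'i by (auto simp: set_integrable_def)
    show "(\<lambda>(s, p). ?k s p) \<in> borel_measurable (lborel \<Otimes>\<^sub>M lborel)" by measurable
  qed auto
  have PF: "integral {s..r} P' = P r - P s" if "s \<in> ?I" for s
    using that by (intro integral_unique fundamental_theorem_of_calculus)
       (auto intro!: has_vector_derivative_within_subset[OF P])
  have L1: "(LINT p|lborel. ?k s p) = ?h s * (P r - P s)" for s
  proof (cases "s \<in> ?I")
    case True
    have "(LINT p|lborel. ?k s p) = (LINT p|lborel. h s * (indicator {s..r} p *\<^sub>R P' p))"
      by (rule Bochner_Integration.integral_cong) (use True in \<open>auto simp: indicator_def\<close>)
    also have "\<dots> = h s * (LINT p:{s..r}|lborel. P' p)"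
      unfolding set_lebesgue_integral_def by (rule integral_mult_right_zero)
    also have "(LINT p:{s..r}|lborel. P' p) = integral {s..r} P'"
      by (rule set_borel_integral_eq_integral, rule set_integrable_subset[OF P'i]) (use True in auto)
    finally show ?thesis using PF True by simp
  next
    case False
    then have "indicator ?I s = (0::real)" by (simp only: indicator_simps not_False_eq_True)
    then show ?thesis by (simp cong: if_cong)
  qed
  have L2: "(LINT s|lborel. ?k s p) = ?p p * (G p - G l)" for p
  proof (cases "p \<in> ?I")
    case True
    have "(LINT s|lborel. ?k s p) = (LINT s|lborel. (indicator {l..p} s *\<^sub>R h s) * P' p)"
      by (rule Bochner_Integration.integral_cong) (use True in \<open>auto simp: indicator_def\<close>)
    also have "\<dots> = (LINT s:{l..p}|lborel. h s) * P' p"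
      unfolding set_lebesgue_integral_def by (rule integral_mult_left_zero)
    also have "(LINT s:{l..p}|lborel. h s) = G p - G l"
      by (rule ac_profileD(7)[OF prof, symmetric]) (use True ab in auto)
    finally show ?thesis using True by simp
  next
    case False
    then have "indicator ?I p = (0::real)" by (simp only: indicator_simps not_False_eq_True)
    then show ?thesis by (simp cong: if_cong)
  qed
  have Fub: "(LINT p|lborel. ?p p * (G p - G l)) = (LINT s|lborel. ?h s * (P r - P s))"
    using lborel_pair.Fubini_integral[OF i1] by (simp only: L1 L2)
  have "(LINT p|lborel. ?p p * (G p - G l)) = (LINT p:?I|lborel. P' p * (G p - G l))"
    by (simp add: set_lebesgue_integral_def mult.assoc)
  also have "\<dots> = integral ?I (\<lambda>p. P' p * (G p - G l))"
    by (rule set_borel_integral_eq_integral, rule borel_integrable_atLeastAtMost') (intro continuous_intros P' cG)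
  also have "\<dots> = integral ?I (\<lambda>p. P' p * G p) - integral ?I P' * G l"
    by (simp only: right_diff_distrib) (subst Henstock_Kurzweil_Integration.integral_diff;
        (intro integrable_continuous_interval continuous_intros P' cG | simp))
  also have "integral ?I P' = P r - P l" using PF[of l] ab by simp
  finally have lhs: "(LINT p|lborel. ?p p * (G p - G l)) = integral ?I (\<lambda>p. P' p * G p) - (P r - P l) * G l" .
  have hPi: "set_integrable lborel ?I (\<lambda>s. P s * h s)"
  proof -
    obtain C where C: "\<And>x. x \<in> ?I \<Longrightarrow> cmod (P x) \<le> C"
      using compact_imp_bounded[OF compact_continuous_image[OF cP compact_Icc]] unfolding bounded_iff by (meson imageI)
    have "integrable lborel (\<lambda>s. C *\<^sub>R ?h s)"
      by (rule integrable_scaleR_right) (use hi in \<open>auto simp: set_integrable_def\<close>)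
    then show ?thesis
      unfolding set_integrable_def
    proof (rule Bochner_Integration.integrable_bound)
      have "(\<lambda>s. (indicator ?I s *\<^sub>R P s) * ?h s) \<in> borel_measurable borel"
        by (rule borel_measurable_times[OF borel_measurable_continuous_on_indicator[OF _ cP]])
           (use hi in \<open>auto simp: set_integrable_def\<close>)
      moreover have "(indicator ?I s *\<^sub>R P s) * ?h s = indicator ?I s *\<^sub>R (P s * h s)" for s by (auto simp: indicator_def)
      ultimately show "(\<lambda>s. indicator ?I s *\<^sub>R (P s * h s)) \<in> borel_measurable lborel"
        by (simp only: measurable_lborel2)
      show "AE s in lborel. norm (indicator ?I s *\<^sub>R (P s * h s)) \<le> norm (C *\<^sub>R ?h s)"
        using C by (intro AE_I2) (auto simp: indicator_def norm_mult intro!: mult_right_mono intro: order_trans[OF _ abs_ge_self])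
    qed
  qed
  have "(LINT s|lborel. ?h s * (P r - P s)) = (LINT s|lborel. ?h s * P r - indicator ?I s *\<^sub>R (P s * h s))"
    by (rule Bochner_Integration.integral_cong) (auto simp: algebra_simps)
  also have "\<dots> = (LINT s|lborel. ?h s * P r) - (LINT s:?I|lborel. P s * h s)"
    unfolding set_lebesgue_integral_def
    by (rule Bochner_Integration.integral_diff[OF integrable_mult_left])
       (use hi hPi in \<open>auto simp: set_integrable_def\<close>)
  also have "(LINT s|lborel. ?h s * P r) = (LINT s:?I|lborel. h s) * P r"
    unfolding set_lebesgue_integral_def by (rule integral_mult_left_zero)
  also have "(LINT s:?I|lborel. h s) = G r - G l" by (rule ac_profileD(7)[OF prof ab, symmetric])
  finally have rhs: "(LINT s|lborel. ?h s * (P r - P s)) = (G r - G l) * P r - (LINT s:?I|lborel. P s * h s)" .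
  show ?thesis using Fub unfolding lhs rhs by (simp add: algebra_simps)
qed

definition phase :: "real \<Rightarrow> real \<Rightarrow> real \<Rightarrow> complex" where
  "phase t x p = exp (\<i> * of_real (x * p + t * p ^ 3))"

lemma norm_phase [simp]: "cmod (phase t x p) = 1"
  by (simp add: phase_def norm_exp_eq_Re)

lemma phase_has_derivative:
  "((phase t x) has_vector_derivative \<i> * of_real (x + 3 * t * p\<^sup>2) * phase t x p) (at p within A)"
proof -
  have "((\<lambda>z. exp (\<i> * (of_real x * z + of_real t * z ^ 3))) has_field_derivative
      \<i> * of_real (x + 3 * t * p\<^sup>2) * phase t x p) (at (of_real p))"
    by (auto intro!: derivative_eq_intros simp: phase_def)
  from has_vector_derivative_real_field[OF this]
  have "((\<lambda>p. exp (\<i> * (of_real x * of_real p + of_real t * of_real p ^ 3))) has_vector_derivative \<i> * of_real (x + 3 * t * p\<^sup>2) * phase t x p) (at p within A)" .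
  moreover have "(\<lambda>p. exp (\<i> * (of_real x * of_real p + of_real t * of_real p ^ 3))) = phase t x"
    by (auto simp: phase_def)
  ultimately show ?thesis by simp
qed

lemma continuous_on_phase [continuous_intros]:
  "continuous_on A f \<Longrightarrow> continuous_on A g \<Longrightarrow> continuous_on A k \<Longrightarrow> continuous_on A (\<lambda>z. phase (f z) (g z) (k z))"
  unfolding phase_def by (intro continuous_intros)

text \<open>Non-stationary phase: divide the amplitude \<open>a\<close> by the derivative of the phase and integrate by parts.
  Both the two boundary terms and the term with \<open>k'\<close>, which has a constant sign, cost \<open>2 B \<kappa>\<close>; the term with \<open>h\<close>
  is split by Young's inequality with a parameter \<open>\<mu>\<close>, to be chosen according to the size of \<open>Q\<close>.\<close>

lemma osc_far:
  assumes prof: "ac_profile B M G h" and ab: "0 \<le> l" "l \<le> r"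
    and k: "\<And>p. p \<in> {l..r} \<Longrightarrow> (k has_real_derivative k' p) (at p within {l..r})"
    and k': "continuous_on {l..r} k'"
    and sgn: "(\<forall>p\<in>{l..r}. k' p \<le> 0) \<or> (\<forall>p\<in>{l..r}. k' p \<ge> 0)"
    and kap: "\<And>p. p \<in> {l..r} \<Longrightarrow> \<bar>k p\<bar> \<le> \<kappa>"
    and Q: "integral {l..r} (\<lambda>p. (k p)\<^sup>2) \<le> Q" and lam: "\<mu> > 0"
    and a: "\<And>p. p \<in> {l..r} \<Longrightarrow> a p = (x + 3 * t * p\<^sup>2) * k p"
  shows "cmod (integral {l..r} (\<lambda>p. phase t x p * of_real (a p) * G p)) \<le> 4 * B * \<kappa> + (\<mu> * Q + M / \<mu>) / 2"
proof -
  let ?I = "{l..r}"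
  note B0 = ac_profileD(1)[OF prof]
  have cG: "continuous_on ?I G" using ac_profile_continuous[OF prof] by (rule continuous_on_subset) (use ab in auto)
  have ck: "continuous_on ?I k" using k DERIV_continuous_on by blast
  define P where "P p = - \<i> * phase t x p * of_real (k p)" for p
  define P' where "P' p = phase t x p * of_real (a p) - \<i> * phase t x p * of_real (k' p)" for p
  have P: "(P has_vector_derivative P' p) (at p within ?I)" if "p \<in> ?I" for p
  proof -
    have "((\<lambda>p. complex_of_real (k p)) has_vector_derivative of_real (k' p)) (at p within ?I)"
      using k[OF that] by (rule has_vector_derivative_of_real)
    then have "((\<lambda>p. (- \<i> * phase t x p) * of_real (k p)) has_vector_derivative
       (- \<i> * phase t x p) * of_real (k' p) + (- \<i> * (\<i> * of_real (x + 3 * t * p\<^sup>2) * phase t x p)) * of_real (k p)) (at p within ?I)"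
      by (intro has_vector_derivative_mult has_vector_derivative_mult_right phase_has_derivative)
    moreover have "(- \<i> * phase t x p) * of_real (k' p) + (- \<i> * (\<i> * of_real (x + 3 * t * p\<^sup>2) * phase t x p)) * of_real (k p) = P' p"
      using a[OF that] by (simp add: P'_def algebra_simps)
    ultimately show ?thesis unfolding P_def by simp
  qed
  have ca: "continuous_on ?I a"
    using a by (subst continuous_on_cong[OF refl, of _ _ "\<lambda>p. (x + 3 * t * p\<^sup>2) * k p"]) (auto intro!: continuous_intros ck)
  have cP': "continuous_on ?I P'" unfolding P'_def by (intro continuous_intros ca k')
  have ibp: "integral ?I (\<lambda>p. P' p * G p) = P r * G r - P l * G l - (LINT p:?I|lborel. P p * h p)"
    by (rule ac_integration_by_parts[OF prof ab _ cP']) (rule P)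
  have tri: "cmod (a - b - c + d) \<le> cmod a + cmod b + cmod c + cmod d" for a b c d
    using norm_triangle_ineq[of "a-b-c" d] norm_triangle_ineq4[of "a-b" c] norm_triangle_ineq4[of a b] by linarith
  have "integral ?I (\<lambda>p. phase t x p * of_real (a p) * G p) =
      integral ?I (\<lambda>p. P' p * G p) + integral ?I (\<lambda>p. \<i> * phase t x p * of_real (k' p) * G p)"
    by (subst Henstock_Kurzweil_Integration.integral_add[symmetric])
       (auto intro!: integrable_continuous_interval continuous_intros ca cG k' cP' simp: P'_def algebra_simps)
  then have 1: "cmod (integral ?I (\<lambda>p. phase t x p * of_real (a p) * G p)) \<le>
     cmod (P r * G r) + cmod (P l * G l) + cmod (LINT p:?I|lborel. P p * h p) + cmod (integral ?I (\<lambda>p. \<i> * phase t x p * of_real (k' p) * G p))"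
    unfolding ibp by (simp only:) (rule tri)
  have nP: "cmod (P p) = \<bar>k p\<bar>" for p by (simp add: P_def norm_mult)
  have "\<kappa> \<ge> 0" using kap[of l] ab by auto
  have bd: "cmod (P p * G p) \<le> \<kappa> * B" if "p \<in> ?I" for p
    unfolding norm_mult nP using that ab by (intro mult_mono kap ac_profileD(6)[OF prof] \<open>\<kappa> \<ge> 0\<close>) auto
  have "cmod (integral ?I (\<lambda>p. \<i> * phase t x p * of_real (k' p) * G p)) \<le> integral ?I (\<lambda>p. B * \<bar>k' p\<bar>)"
  proof (rule integral_norm_bound_integral)
    fix p assume "p \<in> ?I"
    then have "cmod (G p) * \<bar>k' p\<bar> \<le> B * \<bar>k' p\<bar>" using ab by (intro mult_right_mono ac_profileD(6)[OF prof]) auto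
    then show "cmod (\<i> * phase t x p * of_real (k' p) * G p) \<le> B * \<bar>k' p\<bar>" by (simp add: norm_mult mult.commute)
  qed (auto intro!: integrable_continuous_interval continuous_intros k' cG)
  also have "\<dots> = B * integral ?I (\<lambda>p. \<bar>k' p\<bar>)" by simp
  also have "\<dots> \<le> B * (2 * \<kappa>)"
  proof (rule mult_left_mono[OF _ B0])
    have F: "integral ?I k' = k r - k l"
      using ab k by (intro integral_unique fundamental_theorem_of_calculus) (auto simp: has_real_derivative_iff_has_vector_derivative)
    have kk: "\<bar>k r - k l\<bar> \<le> 2 * \<kappa>" using kap[of l] kap[of r] ab by auto
    from sgn show "integral ?I (\<lambda>p. \<bar>k' p\<bar>) \<le> 2 * \<kappa>"
    proof
      assume "\<forall>p\<in>?I. k' p \<le> 0"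
      then have "integral ?I (\<lambda>p. \<bar>k' p\<bar>) = integral ?I (\<lambda>p. - k' p)" by (intro integral_cong) auto
      then show ?thesis using F kk by simp
    next
      assume "\<forall>p\<in>?I. k' p \<ge> 0"
      then have "integral ?I (\<lambda>p. \<bar>k' p\<bar>) = integral ?I k'" by (intro integral_cong) auto
      then show ?thesis using F kk by simp
    qed
  qed
  finally have 2: "cmod (integral ?I (\<lambda>p. \<i> * phase t x p * of_real (k' p) * G p)) \<le> 2 * B * \<kappa>" by simp
  have 3: "cmod (LINT p:?I|lborel. P p * h p) \<le> (\<mu> * Q + M / \<mu>) / 2"
  proof -
    have k2: "set_integrable lborel ?I (\<lambda>p. (k p)\<^sup>2)" by (intro borel_integrable_atLeastAtMost' continuous_intros ck)
    have i: "integrable lborel (\<lambda>p. indicator ?I p * (k p)\<^sup>2)" "integrable lborel (\<lambda>p. (cmod (h p))\<^sup>2)"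
      using k2 ac_profileD(4)[OF prof] by (auto simp: set_integrable_def)
    have "cmod (LINT p:?I|lborel. P p * h p) \<le> (LINT p|lborel. \<mu> / 2 * (indicator ?I p * (k p)\<^sup>2) + 1 / (2 * \<mu>) * (cmod (h p))\<^sup>2)"
      unfolding set_lebesgue_integral_def
    proof (rule Bochner_Integration.integral_norm_bound_integral)
      have ineq: "a * b \<le> \<mu> / 2 * a\<^sup>2 + 1 / (2 * \<mu>) * b\<^sup>2" for a b :: real
      proof -
        have "0 \<le> (\<mu> * a - b)\<^sup>2 / (2 * \<mu>)" using lam by simp
        also have "(\<mu> * a - b)\<^sup>2 / (2 * \<mu>) = \<mu> / 2 * a\<^sup>2 + 1 / (2 * \<mu>) * b\<^sup>2 - a * b"
          using lam by (simp add: field_simps power2_eq_square)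
        finally show ?thesis by simp
      qed
      have cP: "continuous_on ?I P" unfolding P_def by (intro continuous_intros ck)
      note [measurable] = ac_profileD(3)[OF prof]
      have le: "norm (indicator ?I p *\<^sub>R (P p * h p)) \<le> \<mu> / 2 * (indicator ?I p * (k p)\<^sup>2) + 1 / (2 * \<mu>) * (cmod (h p))\<^sup>2" for p
        using ineq[of "\<bar>k p\<bar>" "cmod (h p)"] lam by (auto simp: indicator_def norm_mult nP)
      then show "norm (indicator ?I p *\<^sub>R (P p * h p)) \<le> \<mu> / 2 * (indicator ?I p * (k p)\<^sup>2) + 1 / (2 * \<mu>) * (cmod (h p))\<^sup>2" for p .
      show rhs: "integrable lborel (\<lambda>p. \<mu> / 2 * (indicator ?I p * (k p)\<^sup>2) + 1 / (2 * \<mu>) * (cmod (h p))\<^sup>2)"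
        by (intro Bochner_Integration.integrable_add integrable_mult_right i)
      have "(\<lambda>s. (indicator ?I s *\<^sub>R P s) * h s) \<in> borel_measurable borel"
        by (rule borel_measurable_times[OF borel_measurable_continuous_on_indicator[OF _ cP]]) auto
      then have m: "(\<lambda>p. indicator ?I p *\<^sub>R (P p * h p)) \<in> borel_measurable lborel" by simp
      show "integrable lborel (\<lambda>p. indicator ?I p *\<^sub>R (P p * h p))"
        by (rule Bochner_Integration.integrable_bound[OF rhs m]) (rule AE_I2, rule order_trans[OF le], simp)
    qed
    also have "\<dots> = \<mu> / 2 * (LINT p:?I|lborel. (k p)\<^sup>2) + 1 / (2 * \<mu>) * (LINT p|lborel. (cmod (h p))\<^sup>2)"
      unfolding set_lebesgue_integral_def
      by (subst Bochner_Integration.integral_add) (auto intro!: integrable_mult_right i simp: i)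
    also have "(LINT p:?I|lborel. (k p)\<^sup>2) = integral ?I (\<lambda>p. (k p)\<^sup>2)"
      by (rule set_borel_integral_eq_integral[OF k2])
    also have "\<mu> / 2 * integral ?I (\<lambda>p. (k p)\<^sup>2) + 1 / (2 * \<mu>) * (LINT p|lborel. (cmod (h p))\<^sup>2) \<le> \<mu> / 2 * Q + 1 / (2 * \<mu>) * M"
      by (intro add_mono mult_left_mono Q ac_profileD(5)[OF prof]) (use lam in auto)
    finally show ?thesis by (simp add: add_divide_distrib)
  qed
  have "cmod (P l * G l) \<le> \<kappa> * B" "cmod (P r * G r) \<le> \<kappa> * B" using bd ab by auto
  moreover have "4 * B * \<kappa> = \<kappa> * B + \<kappa> * B + 2 * B * \<kappa>" by simp
  ultimately show ?thesis using 1 2 3 by linarith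
qed

lemma integral_inv_sq:
  fixes q :: real
  assumes "l \<le> r" "q \<notin> {l..r}"
  shows "integral {l..r} (\<lambda>p. K\<^sup>2 / (p - q)\<^sup>2) = K\<^sup>2 / (l - q) - K\<^sup>2 / (r - q)"
proof -
  have "((\<lambda>p. K\<^sup>2 / (p - q)\<^sup>2) has_integral (- K\<^sup>2 / (r - q)) - (- K\<^sup>2 / (l - q))) {l..r}"
  proof (rule fundamental_theorem_of_calculus[OF assms(1)])
    fix p assume "p \<in> {l..r}"
    then have "p - q \<noteq> 0" using assms by auto
    then have "((\<lambda>p. - K\<^sup>2 / (p - q)) has_real_derivative K\<^sup>2 / (p - q)\<^sup>2) (at p within {l..r})"
      by (auto intro!: derivative_eq_intros simp: power2_eq_square field_simps)
    then show "((\<lambda>p. - K\<^sup>2 / (p - q)) has_vector_derivative K\<^sup>2 / (p - q)\<^sup>2) (at p within {l..r})"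
      by (simp add: has_real_derivative_iff_has_vector_derivative)
  qed
  then show ?thesis by (simp add: integral_unique)
qed

lemma integral_sq_le:
  fixes k :: "real \<Rightarrow> real"
  assumes "l \<le> r" "q \<notin> {l..r}" "continuous_on {l..r} k" "\<And>p. p \<in> {l..r} \<Longrightarrow> \<bar>k p\<bar> \<le> K / \<bar>p - q\<bar>"
    "d > 0" "\<And>p. p \<in> {l..r} \<Longrightarrow> d \<le> \<bar>p - q\<bar>"
  shows "integral {l..r} (\<lambda>p. (k p)\<^sup>2) \<le> K\<^sup>2 / d"
proof -
  have "integral {l..r} (\<lambda>p. (k p)\<^sup>2) \<le> integral {l..r} (\<lambda>p. K\<^sup>2 / (p - q)\<^sup>2)"
  proof (rule integral_le)
    show "(\<lambda>p. K\<^sup>2 / (p - q)\<^sup>2) integrable_on {l..r}"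
      by (intro integrable_continuous_interval continuous_intros) (use assms(2) in auto)
    fix p assume p: "p \<in> {l..r}"
    have "(k p)\<^sup>2 = \<bar>k p\<bar>\<^sup>2" by simp
    also have "\<dots> \<le> (K / \<bar>p - q\<bar>)\<^sup>2" by (rule power_mono[OF assms(4)[OF p]]) simp
    finally show "(k p)\<^sup>2 \<le> K\<^sup>2 / (p - q)\<^sup>2" by (simp add: power_divide)
  qed (intro integrable_continuous_interval continuous_intros assms)
  also have "\<dots> \<le> K\<^sup>2 / d"
  proof -
    have da: "d \<le> \<bar>l - q\<bar>" "d \<le> \<bar>r - q\<bar>" using assms(1,6) by auto
    consider "q < l" | "r < q" using assms(2) by auto
    then have "K\<^sup>2 / (l - q) - K\<^sup>2 / (r - q) \<le> K\<^sup>2 / d"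
    proof cases
      case 1
      have "K\<^sup>2 / (l - q) \<le> K\<^sup>2 / d" using 1 da assms(5) by (intro divide_left_mono) auto
      moreover have "K\<^sup>2 / (r - q) \<ge> 0" using 1 assms(1) by auto
      ultimately show ?thesis by linarith
    next
      case 2
      have "K\<^sup>2 / (q - r) \<le> K\<^sup>2 / d" using 2 da assms(5) by (intro divide_left_mono) auto
      moreover have "K\<^sup>2 / (q - l) \<ge> 0" using 2 assms(1) by auto
      moreover have "K\<^sup>2 / (r - q) = - (K\<^sup>2 / (q - r))" "K\<^sup>2 / (l - q) = - (K\<^sup>2 / (q - l))"
        by (metis minus_diff_eq minus_divide_right)+
      ultimately show ?thesis by linarith
    qed
    then show ?thesis by (simp add: integral_inv_sq[OF assms(1,2)])
  qed
  finally show ?thesis .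
qed

text \<open>The weights \<open>j = 0\<close> and \<open>j = 1\<close> belong to a function and its derivative in \<open>x\<close>; the truncation at frequency \<open>N\<close> makes the integral absolutely convergent.\<close>

definition osc :: "(real \<Rightarrow> complex) \<Rightarrow> real \<Rightarrow> real \<Rightarrow> nat \<Rightarrow> real \<Rightarrow> complex" where
  "osc G t x j N = integral {0..N} (\<lambda>p. phase t x p * of_real (p ^ j) * G p)"

lemma osc_quot_deriv:
  fixes t x :: real
  assumes "x + 3 * t * p\<^sup>2 \<noteq> 0" "j \<le> 1"
  shows "((\<lambda>p. p ^ j / (x + 3 * t * p\<^sup>2)) has_real_derivative
      (if j = 0 then - (6 * t * p) else x - 3 * t * p\<^sup>2) / (x + 3 * t * p\<^sup>2)\<^sup>2) (at p within A)"
proof -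
  have "j = 0 \<or> j = 1" using assms by auto
  then show ?thesis using assms(1)
    by (auto intro!: derivative_eq_intros simp: power2_eq_square field_simps)
qed

text \<open>The quotient \<open>p\<^sup>j / (x + 3 t p\<^sup>2)\<close> is at most \<open>K / \<bar>p - q\<bar>\<close> when the derivative of the phase is comparable to
  \<open>\<bar>p - q\<bar> (p + q)\<close>, as it is on both sides of the stationary point \<open>q\<close>.\<close>

lemma osc_piece:
  assumes prof: "ac_profile B M G h" and ab: "0 \<le> l" "l \<le> r" and t: "t > 0" and j: "j \<le> 1"
    and q: "q > 0" "d > 0" "\<mu> > 0" "\<And>p. p \<in> {l..r} \<Longrightarrow> d \<le> \<bar>p - q\<bar>"
    and low: "\<And>p. p \<in> {l..r} \<Longrightarrow> 3 * t * \<bar>p - q\<bar> * (p + q) \<le> \<bar>x + 3 * t * p\<^sup>2\<bar>"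
    and sg: "(\<forall>p\<in>{l..r}. x - 3 * t * p\<^sup>2 \<le> 0) \<or> (\<forall>p\<in>{l..r}. x - 3 * t * p\<^sup>2 \<ge> 0)"
    and K: "K = (if j = 0 then 1 / (3 * t * q) else 1 / (3 * t))"
  shows "cmod (integral {l..r} (\<lambda>p. phase t x p * of_real (p ^ j) * G p)) \<le> 4 * B * (K / d) + (\<mu> * (K\<^sup>2 / d) + M / \<mu>) / 2"
proof -
  let ?I = "{l..r}"
  let ?k = "\<lambda>p. p ^ j / (x + 3 * t * p\<^sup>2)"
  have K0: "K > 0" using t q K by auto
  have pos: "\<bar>x + 3 * t * p\<^sup>2\<bar> > 0" if "p \<in> ?I" for p
  proof -
    have "\<bar>p - q\<bar> > 0" using q(4)[OF that] q(2) by linarith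
    then have "0 < 3 * t * \<bar>p - q\<bar> * (p + q)" using t q ab that by (auto intro!: mult_pos_pos)
    then show ?thesis using low[OF that] by linarith
  qed
  then have nz: "x + 3 * t * p\<^sup>2 \<noteq> 0" if "p \<in> ?I" for p using that by fastforce
  have kb: "\<bar>?k p\<bar> \<le> K / \<bar>p - q\<bar>" if p: "p \<in> ?I" for p
  proof -
    have pq: "\<bar>p - q\<bar> > 0" using q(4)[OF p] q(2) by linarith
    have p0: "p \<ge> 0" using p ab by auto
    have "\<bar>?k p\<bar> = p ^ j / \<bar>x + 3 * t * p\<^sup>2\<bar>" using p0 by (simp add: abs_divide)
    also have "\<dots> \<le> p ^ j / (3 * t * \<bar>p - q\<bar> * (p + q))"
      using pq t q p0 pos[OF p] by (intro divide_left_mono low p) (auto intro!: mult_pos_pos)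
    also have "\<dots> \<le> K / \<bar>p - q\<bar>"
    proof (cases "j = 0")
      case True
      have "1 / (3 * t * \<bar>p - q\<bar> * (p + q)) \<le> 1 / (3 * t * \<bar>p - q\<bar> * q)"
        using pq t q p0 by (intro divide_left_mono mult_left_mono) (auto intro!: mult_pos_pos)
      then show ?thesis using True K by (simp add: field_simps)
    next
      case False
      then have "j = 1" using j by auto
      moreover have "p / (3 * t * \<bar>p - q\<bar> * (p + q)) = (p / (p + q)) * (1 / (3 * t * \<bar>p - q\<bar>))" by simp
      moreover have "p / (p + q) \<le> 1" using q p0 by simp
      then have "(p / (p + q)) * (1 / (3 * t * \<bar>p - q\<bar>)) \<le> 1 * (1 / (3 * t * \<bar>p - q\<bar>))"
        by (rule mult_right_mono) (use t in auto)
      ultimately show ?thesis using K by (simp add: field_simps)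
    qed
    finally show ?thesis .
  qed
  let ?k' = "\<lambda>p. (if j = 0 then - (6 * t * p) else x - 3 * t * p\<^sup>2) / (x + 3 * t * p\<^sup>2)\<^sup>2"
  have ck: "continuous_on ?I ?k" by (intro continuous_intros) (use nz in auto)
  show ?thesis
  proof (rule osc_far[OF prof ab, where k="?k" and k'="?k'"])
    show "(?k has_real_derivative ?k' p) (at p within ?I)" if "p \<in> ?I" for p
      by (rule osc_quot_deriv[OF nz[OF that] j])
    show "continuous_on ?I ?k'" by (cases "j = 0") (auto intro!: continuous_intros simp: nz)
    show "(\<forall>p\<in>?I. ?k' p \<le> 0) \<or> (\<forall>p\<in>?I. ?k' p \<ge> 0)"
    proof (cases "j = 0")
      case True
      have "?k' p \<le> 0" if "p \<in> ?I" for p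
        using True t ab that by (auto intro!: divide_nonpos_nonneg mult_nonneg_nonneg)
      then show ?thesis by blast
    next
      case False
      from sg show ?thesis
      proof
        assume "\<forall>p\<in>?I. x - 3 * t * p\<^sup>2 \<le> 0"
        then have "?k' p \<le> 0" if "p \<in> ?I" for p
          using False that by (auto intro!: divide_nonpos_nonneg)
        then show ?thesis by blast
      next
        assume "\<forall>p\<in>?I. x - 3 * t * p\<^sup>2 \<ge> 0"
        then have "?k' p \<ge> 0" if "p \<in> ?I" for p
          using False that by auto
        then show ?thesis by blast
      qed
    qed
    show "\<bar>?k p\<bar> \<le> K / d" if "p \<in> ?I" for p
      by (rule order_trans[OF kb[OF that]]) (use K0 q(2,4) that in \<open>auto intro!: divide_left_mono mult_pos_pos intro: less_le_trans\<close>)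
    show "integral ?I (\<lambda>p. (?k p)\<^sup>2) \<le> K\<^sup>2 / d"
      by (rule integral_sq_le[OF ab(2) _ ck kb q(2)]) (use q in force)+
    show "p ^ j = (x + 3 * t * p\<^sup>2) * ?k p" if "p \<in> ?I" for p using nz[OF that] by simp
  qed (rule q)
qed

text \<open>For \<open>x < 0\<close> this is the stationary point of the phase, kept away from 0; it also serves for \<open>x > 0\<close>, where the phase is not stationary,
  as a measure of \<open>\<surd>\<bar>x\<bar>\<close>.\<close>

definition qq :: "real \<Rightarrow> real \<Rightarrow> real" where
  "qq t x = max 1 (sqrt (\<bar>x\<bar> / (3 * t)))"

definition Cosc :: "real \<Rightarrow> real" where
  "Cosc t = 4 + 8 / (3 * t) + 1 / (9 * t\<^sup>2)"

lemma qq_ge_1: "qq t x \<ge> 1" by (simp add: qq_def)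

lemma qq_sq: assumes "t > 0" shows "\<bar>x\<bar> \<le> 3 * t * (qq t x)\<^sup>2" "qq t x > 1 \<Longrightarrow> \<bar>x\<bar> = 3 * t * (qq t x)\<^sup>2"
proof -
  have s: "(sqrt (\<bar>x\<bar> / (3 * t)))\<^sup>2 = \<bar>x\<bar> / (3 * t)" using assms by simp
  have "(sqrt (\<bar>x\<bar> / (3 * t)))\<^sup>2 \<le> (qq t x)\<^sup>2"
    unfolding qq_def using assms by (intro power_mono) auto
  then have "\<bar>x\<bar> / (3 * t) \<le> (qq t x)\<^sup>2" unfolding s .
  then show "\<bar>x\<bar> \<le> 3 * t * (qq t x)\<^sup>2" using assms by (simp add: field_simps)
  assume "qq t x > 1"
  then have "qq t x = sqrt (\<bar>x\<bar> / (3 * t))" unfolding qq_def by auto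
  then show "\<bar>x\<bar> = 3 * t * (qq t x)\<^sup>2" using s assms by simp
qed

lemma osc_right:
  assumes prof: "ac_profile B M G h" and t: "t > 0" and j: "j \<le> 1" and \<mu>: "\<mu> > 0" and d: "d > 0"
    and ab: "qq t x + d \<le> l" "l \<le> r"
    and K: "K = (if j = 0 then 1 / (3 * t * qq t x) else 1 / (3 * t))"
  shows "cmod (integral {l..r} (\<lambda>p. phase t x p * of_real (p ^ j) * G p)) \<le> 4 * B * (K / d) + (\<mu> * (K\<^sup>2 / d) + M / \<mu>) / 2"
proof (rule osc_piece[OF prof _ ab(2) t j _ d \<mu> _ _ _ K])
  let ?q = "qq t x"
  note q1 = qq_ge_1[of t x] and qs = qq_sq(1)[OF t, of x]
  show "0 \<le> l" "?q > 0" using ab d q1 by auto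
  fix p assume p: "p \<in> {l..r}"
  then show "d \<le> \<bar>p - ?q\<bar>" using ab by auto
  have pq: "p > ?q" using p ab d by auto
  have "3 * t * \<bar>p - ?q\<bar> * (p + ?q) = 3 * t * p\<^sup>2 - 3 * t * ?q\<^sup>2"
    using pq by (simp add: power2_eq_square algebra_simps)
  then show "3 * t * \<bar>p - ?q\<bar> * (p + ?q) \<le> \<bar>x + 3 * t * p\<^sup>2\<bar>" using qs by linarith
next
  have "x - 3 * t * p\<^sup>2 \<le> 0" if "p \<in> {l..r}" for p
  proof -
    have "(qq t x)\<^sup>2 \<le> p\<^sup>2" using that ab d qq_ge_1[of t x] by (intro power_mono) auto
    then have "3 * t * (qq t x)\<^sup>2 \<le> 3 * t * p\<^sup>2" using t by simp
    then show ?thesis using qq_sq(1)[OF t, of x] by linarith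
  qed
  then show "(\<forall>p\<in>{l..r}. x - 3 * t * p\<^sup>2 \<le> 0) \<or> (\<forall>p\<in>{l..r}. x - 3 * t * p\<^sup>2 \<ge> 0)" by blast
qed

lemma osc_left:
  assumes prof: "ac_profile B M G h" and t: "t > 0" and j: "j \<le> 1" and \<mu>: "\<mu> > 0" and d: "d > 0"
    and ab: "0 \<le> l" "l \<le> r" "r \<le> qq t x - d" and q1: "qq t x > 1"
    and K: "K = (if j = 0 then 1 / (3 * t * qq t x) else 1 / (3 * t))"
  shows "cmod (integral {l..r} (\<lambda>p. phase t x p * of_real (p ^ j) * G p)) \<le> 4 * B * (K / d) + (\<mu> * (K\<^sup>2 / d) + M / \<mu>) / 2"
proof (rule osc_piece[OF prof ab(1,2) t j _ d \<mu> _ _ _ K])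
  let ?q = "qq t x"
  note qs = qq_sq(2)[OF t q1]
  show "?q > 0" using q1 by auto
  have pp: "3 * t * p\<^sup>2 \<le> 3 * t * ?q\<^sup>2" "0 \<le> 3 * t * p\<^sup>2" if "p \<in> {l..r}" for p
  proof -
    have "p\<^sup>2 \<le> ?q\<^sup>2" using that ab d by (intro power_mono) auto
    then show "3 * t * p\<^sup>2 \<le> 3 * t * ?q\<^sup>2" "0 \<le> 3 * t * p\<^sup>2" using t by auto
  qed
  {
    fix p assume p: "p \<in> {l..r}"
    then show "d \<le> \<bar>p - ?q\<bar>" using ab by auto
    have pq: "p < ?q" using p ab d by auto
    have "3 * t * \<bar>p - ?q\<bar> * (p + ?q) = 3 * t * ?q\<^sup>2 - 3 * t * p\<^sup>2"
      using pq by (simp add: power2_eq_square algebra_simps)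
    then show "3 * t * \<bar>p - ?q\<bar> * (p + ?q) \<le> \<bar>x + 3 * t * p\<^sup>2\<bar>" using qs pp[OF p] by linarith
  }
  show "(\<forall>p\<in>{l..r}. x - 3 * t * p\<^sup>2 \<le> 0) \<or> (\<forall>p\<in>{l..r}. x - 3 * t * p\<^sup>2 \<ge> 0)"
  proof (cases "x \<ge> 0")
    case True
    then have "\<forall>p\<in>{l..r}. x - 3 * t * p\<^sup>2 \<ge> 0" using pp qs by force
    then show ?thesis by blast
  next
    case False
    then have "\<forall>p\<in>{l..r}. x - 3 * t * p\<^sup>2 \<le> 0" using pp by force
    then show ?thesis by blast
  qed
qed

lemma osc_integrand_continuous:
  assumes "ac_profile B M G h" "0 \<le> l"
  shows "continuous_on {l..r} (\<lambda>p. phase t x p * of_real (p ^ j) * G p)"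
proof -
  have "continuous_on {l..r} G"
    using ac_profile_continuous[OF assms(1)] by (rule continuous_on_subset) (use assms(2) in auto)
  then show ?thesis by (intro continuous_intros)
qed

lemma osc_integrable:
  assumes "ac_profile B M G h" "0 \<le> l"
  shows "(\<lambda>p. phase t x p * of_real (p ^ j) * G p) integrable_on {l..r}"
  by (rule integrable_continuous_interval[OF osc_integrand_continuous[OF assms]])

lemma Cosc_ge: "t > 0 \<Longrightarrow> 4 \<le> Cosc t"
  by (simp add: Cosc_def)

lemma Cosc_mono: assumes "0 < a" "a \<le> t" shows "Cosc t \<le> Cosc a"
proof -
  have "8 / (3 * t) \<le> 8 / (3 * a)" using assms by (intro divide_left_mono) auto
  moreover have "1 / (9 * t\<^sup>2) \<le> 1 / (9 * a\<^sup>2)"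
    using assms by (intro divide_left_mono mult_left_mono power_mono) auto
  ultimately show ?thesis by (simp add: Cosc_def)
qed

text \<open>The region within \<open>d = q\<^sup>-\<^sup>1\<^sup>/\<^sup>2\<close> of the stationary point contributes at most its length times the size of the amplitude;
  outside it the integral is non-stationary. Both parts have the same size for this \<open>d\<close>.\<close>

lemma osc_bound:
  assumes prof: "ac_profile B M G h" and t: "t > 0" and j: "j \<le> 1" and N: "N \<ge> 2 * qq t x"
  shows "cmod (osc G t x j N) \<le> Cosc t * (B + M + 1) * (if j = 0 then 1 / sqrt (qq t x) else sqrt (qq t x))"
proof -
  define q where "q = qq t x"
  define s where "s = sqrt q"
  have q1: "q \<ge> 1" unfolding q_def by (rule qq_ge_1)
  have s1: "s \<ge> 1" unfolding s_def using q1 by simp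
  have qs: "q = s\<^sup>2" unfolding s_def using q1 by simp
  define d where "d = 1 / s"
  have d: "d > 0" "d \<le> 1" unfolding d_def using s1 by auto
  note B0 = ac_profileD(1)[OF prof] and M0 = ac_profileD(2)[OF prof]
  define K where "K = (if j = 0 then 1 / (3 * t * q) else 1 / (3 * t))"
  \<comment> \<open>the parameter of Young's inequality: \<open>M / m\<close> must not exceed the claimed size\<close>
  define m where "m = (if j = 0 then s else 1)"
  have m: "m > 0" unfolding m_def using s1 by auto
  define E where "E = 4 * B * (K / d) + (m * (K\<^sup>2 / d) + M / m) / 2"
  have K0: "K \<ge> 0" unfolding K_def using t q1 by auto
  have E0: "E \<ge> 0" unfolding E_def using B0 M0 K0 d m by (intro add_nonneg_nonneg mult_nonneg_nonneg divide_nonneg_nonneg) auto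
  let ?f = "\<lambda>p. phase t x p * of_real (p ^ j) * G p"
  have I: "?f integrable_on {l..r}" if "0 \<le> l" for l r by (rule osc_integrable[OF prof that])
  have Nq: "q + d \<le> N" using N d q1 unfolding q_def by linarith
  have split: "osc G t x j N = integral {0..q-d} ?f + (integral {q-d..q+d} ?f + integral {q+d..N} ?f)"
  proof -
    have "integral {q-d..q+d} ?f + integral {q+d..N} ?f = integral {q-d..N} ?f"
      by (rule Henstock_Kurzweil_Integration.integral_combine) (use d q1 Nq I in auto)
    moreover have "integral {0..q-d} ?f + integral {q-d..N} ?f = integral {0..N} ?f"
      by (rule Henstock_Kurzweil_Integration.integral_combine) (use d q1 Nq I in auto)
    ultimately show ?thesis unfolding osc_def by simp
  qed
  have right: "cmod (integral {q+d..N} ?f) \<le> E"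
    unfolding E_def by (rule osc_right[OF prof t j m d(1) _ Nq]) (auto simp: q_def K_def)
  have left: "cmod (integral {0..q-d} ?f) \<le> E"
  proof (cases "q > 1")
    case True
    show ?thesis unfolding E_def
      by (rule osc_left[OF prof t j m d(1)]) (use True d q1 in \<open>auto simp: q_def K_def\<close>)
  next
    case False
    then have "q = 1" using q1 by simp
    moreover have "s = 1" unfolding s_def using \<open>q = 1\<close> by simp
    ultimately have "q - d = 0" by (simp add: d_def)
    then show ?thesis using E0 by simp
  qed
  define A where "A = (if j = 0 then 1 else 2 * q)"
  have near: "cmod (integral {q-d..q+d} ?f) \<le> (A * B) * (2 * d)"
  proof -
    have "norm (integral (cbox (q-d) (q+d)) ?f) \<le> (A * B) * measure lborel (cbox (q-d) (q+d))"
    proof (rule Henstock_Kurzweil_Integration.integrable_bound)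
      show "0 \<le> A * B" unfolding A_def using B0 q1 by auto
      show "?f integrable_on cbox (q-d) (q+d)" using I[of "q-d" "q+d"] d q1 by simp
      fix p assume "p \<in> cbox (q-d) (q+d)"
      then have p: "0 \<le> p" "p \<le> 2 * q" using d q1 by auto
      have "p ^ j \<le> A" using j p unfolding A_def by (cases j) auto
      then have "p ^ j * cmod (G p) \<le> A * B"
        using p B0 q1 by (intro mult_mono ac_profileD(6)[OF prof]) (auto simp: A_def)
      then show "norm (?f p) \<le> A * B" using p by (simp add: norm_mult norm_power)
    qed
    then show ?thesis using d by simp
  qed
  have tot: "cmod (osc G t x j N) \<le> 2 * E + (A * B) * (2 * d)"
    unfolding split using left near right
      norm_triangle_ineq[of "integral {0..q-d} ?f" "integral {q-d..q+d} ?f + integral {q+d..N} ?f"]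
      norm_triangle_ineq[of "integral {q-d..q+d} ?f" "integral {q+d..N} ?f"] by linarith
  define Z where "Z = Cosc t * (B + M + 1)"
  have Zge: "4 * B + B * (8 / (3 * t)) + M + 1 / (9 * t\<^sup>2) \<le> Z"
  proof -
    have e: "Z = 4 * B + B * (8 / (3 * t)) + M + 1 / (9 * t\<^sup>2) + (3 * M + 4 + (8 / (3 * t)) * (M + 1) + 1 / (9 * t\<^sup>2) * (B + M))"
    proof -
      have "(4 + c1 + c2) * (B + M + 1) = 4 * B + B * c1 + M + c2 + (3 * M + 4 + c1 * (M + 1) + c2 * (B + M))" for c1 c2
        by (simp add: algebra_simps)
      then show ?thesis unfolding Z_def Cosc_def .
    qed
    have "0 \<le> 3 * M + 4 + (8 / (3 * t)) * (M + 1) + 1 / (9 * t\<^sup>2) * (B + M)"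
      using t B0 M0 by (intro add_nonneg_nonneg mult_nonneg_nonneg) auto
    then show ?thesis using e by linarith
  qed
  show ?thesis
  proof (cases "j = 0")
    case True
    have "2 * E + (A * B) * (2 * d) = (2 * B + B * (8 / (3 * t)) + M + 1 / (9 * t\<^sup>2) * (1 / s)) * (1 / s)"
      using True s1 t unfolding E_def K_def A_def m_def d_def qs by (simp add: field_simps power2_eq_square power4_eq_xxxx)
    also have "\<dots> \<le> Z * (1 / s)"
    proof (rule mult_right_mono)
      have "1 / (9 * t\<^sup>2) * (1 / s) \<le> 1 / (9 * t\<^sup>2) * 1" using s1 by (intro mult_left_mono) auto
      then show "2 * B + B * (8 / (3 * t)) + M + 1 / (9 * t\<^sup>2) * (1 / s) \<le> Z" using Zge B0 by linarith
    qed (use s1 in auto)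
    finally show ?thesis using tot True by (simp add: Z_def s_def q_def)
  next
    case False
    then have "2 * E + (A * B) * (2 * d) = 4 * B * s + B * (8 / (3 * t)) * s + M + 1 / (9 * t\<^sup>2) * s"
      using s1 t unfolding E_def K_def A_def m_def d_def qs by (simp add: field_simps power2_eq_square)
    also have "\<dots> \<le> 4 * B * s + B * (8 / (3 * t)) * s + M * s + 1 / (9 * t\<^sup>2) * s"
      using mult_left_mono[OF s1 M0] by simp
    also have "\<dots> = (4 * B + B * (8 / (3 * t)) + M + 1 / (9 * t\<^sup>2)) * s" by (simp add: algebra_simps)
    also have "\<dots> \<le> Z * s" using Zge s1 by (intro mult_right_mono) auto
    finally show ?thesis using tot False by (simp add: Z_def s_def q_def)
  qed
qed

text \<open>Beyond \<open>N \<ge> 2 q\<close> the distance to the stationary point is at least \<open>N / 2\<close>, so that \<open>osc_right\<close> applies with \<open>\<mu> = \<surd>N\<close>.\<close>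

lemma osc_tail:
  assumes prof: "ac_profile B M G h" and t: "t > 0" and j: "j \<le> 1" and N: "N \<ge> 2 * qq t x" "N \<le> N'"
  shows "cmod (osc G t x j N' - osc G t x j N) \<le> Cosc t * (B + M + 1) / sqrt N"
proof -
  define q where "q = qq t x"
  have q1: "q \<ge> 1" unfolding q_def by (rule qq_ge_1)
  define s where "s = sqrt N"
  have N2: "N \<ge> 2" using N q1 by (simp add: q_def)
  have s1: "s \<ge> 1" and Ns: "N = s\<^sup>2" unfolding s_def using N2 by auto
  note B0 = ac_profileD(1)[OF prof] and M0 = ac_profileD(2)[OF prof]
  define K where "K = (if j = 0 then 1 / (3 * t * q) else 1 / (3 * t))"
  have K: "0 \<le> K" "K \<le> 1 / (3 * t)" unfolding K_def using q1 t by (auto intro!: divide_left_mono mult_pos_pos)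
  let ?f = "\<lambda>p. phase t x p * of_real (p ^ j) * G p"
  let ?d = "N / 2"
  have "integral {0..N} ?f + integral {N..N'} ?f = integral {0..N'} ?f"
    by (rule Henstock_Kurzweil_Integration.integral_combine) (use N N2 osc_integrable[OF prof] in auto)
  then have "osc G t x j N' = osc G t x j N + integral {N..N'} ?f" unfolding osc_def by (rule sym)
  then have "cmod (osc G t x j N' - osc G t x j N) = cmod (integral {N..N'} ?f)"
    by (simp only: add_diff_cancel_left')
  also have "\<dots> \<le> 4 * B * (K / ?d) + (s * (K\<^sup>2 / ?d) + M / s) / 2"
    by (rule osc_right[OF prof t j _ _ _ N(2)]) (use N N2 s1 q1 in \<open>auto simp: q_def K_def\<close>)
  also have "\<dots> \<le> 4 * B * ((1 / (3 * t)) / ?d) + (s * ((1 / (3 * t))\<^sup>2 / ?d) + M / s) / 2"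
    using K B0 N2 s1 by (intro add_mono mult_left_mono divide_right_mono power_mono) auto
  also have "\<dots> = (B * (8 / (3 * t)) * (1 / s) + 1 / (9 * t\<^sup>2) + M / 2) * (1 / s)"
    unfolding Ns using s1 t by (simp add: field_simps power2_eq_square)
  also have "\<dots> \<le> (Cosc t * (B + M + 1)) * (1 / s)"
  proof (rule mult_right_mono)
    have "B * (8 / (3 * t)) * (1 / s) \<le> B * (8 / (3 * t)) * 1" using s1 B0 t by (intro mult_left_mono) auto
    moreover have "Cosc t * (B + M + 1) = B * (8 / (3 * t)) + 1 / (9 * t\<^sup>2) + M / 2 +
      (4 * B + 7 / 2 * M + 4 + (8 / (3 * t)) * (M + 1) + 1 / (9 * t\<^sup>2) * (B + M))"
    proof -
      have "(4 + c1 + c2) * (B + M + 1) = B * c1 + c2 + M / 2 + (4 * B + 7 / 2 * M + 4 + c1 * (M + 1) + c2 * (B + M))" for c1 c2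
        by (simp add: algebra_simps)
      then show ?thesis unfolding Cosc_def .
    qed
    moreover have "0 \<le> 4 * B + 7 / 2 * M + 4 + (8 / (3 * t)) * (M + 1) + 1 / (9 * t\<^sup>2) * (B + M)"
      using t B0 M0 by (intro add_nonneg_nonneg mult_nonneg_nonneg) auto
    ultimately show "B * (8 / (3 * t)) * (1 / s) + 1 / (9 * t\<^sup>2) + M / 2 \<le> Cosc t * (B + M + 1)" by linarith
  qed (use s1 in auto)
  finally show ?thesis by (simp add: s_def)
qed

text \<open>The integral over the whole half-line is a limit of truncations, since it does not converge absolutely.\<close>

definition oscl :: "(real \<Rightarrow> complex) \<Rightarrow> real \<Rightarrow> real \<Rightarrow> nat \<Rightarrow> complex" where
  "oscl G t x j = lim (\<lambda>n. osc G t x j (real n))"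

lemma eventually_tail:
  fixes W Q e :: real assumes "e > 0"
  shows "\<forall>\<^sub>F n in sequentially. W / sqrt (real n) < e \<and> real n \<ge> Q"
proof -
  have "(\<lambda>n. W / sqrt (real n)) \<longlonglongrightarrow> 0" by real_asymp
  then have "\<forall>\<^sub>F n in sequentially. W / sqrt (real n) < e" using assms by (intro order_tendstoD) auto
  moreover have "\<forall>\<^sub>F n in sequentially. real n \<ge> Q"
    using filterlim_real_sequentially unfolding filterlim_at_top by blast
  ultimately show ?thesis by eventually_elim simp
qed

lemma osc_LIMSEQ:
  assumes prof: "ac_profile B M G h" and t: "t > 0" and j: "j \<le> 1"
  shows "(\<lambda>n. osc G t x j (real n)) \<longlonglongrightarrow> oscl G t x j"
proof -
  define W where "W = Cosc t * (B + M + 1)"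
  have W: "W \<ge> 0" unfolding W_def using Cosc_ge[OF t] ac_profileD(1,2)[OF prof] by auto
  have "Cauchy (\<lambda>n. osc G t x j (real n))"
  proof (rule metric_CauchyI)
    fix e :: real assume e: "e > 0"
    have "\<forall>\<^sub>F n in sequentially. W / sqrt (real n) < e / 2 \<and> real n \<ge> 2 * qq t x"
      by (rule eventually_tail) (use e in simp)
    then obtain n0 where n0: "W / sqrt (real n0) < e / 2" "real n0 \<ge> 2 * qq t x" by (auto simp: eventually_sequentially)
    have near: "dist (osc G t x j (real n)) (osc G t x j (real n0)) < e / 2" if "n \<ge> n0" for n
      using osc_tail[OF prof t j n0(2), of "real n"] that n0(1) unfolding dist_norm W_def of_nat_le_iff by linarith
    show "\<exists>M. \<forall>m\<ge>M. \<forall>n\<ge>M. dist (osc G t x j (real m)) (osc G t x j (real n)) < e"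
    proof (intro exI[of _ n0] allI impI)
      fix m n assume "m \<ge> n0" "n \<ge> n0"
      then show "dist (osc G t x j (real m)) (osc G t x j (real n)) < e"
        using dist_triangle_half_r[of "osc G t x j (real n0)"] near by (metis dist_commute)
    qed
  qed
  then show ?thesis unfolding oscl_def by (simp add: Cauchy_convergent_iff convergent_LIMSEQ_iff)
qed

lemma oscl_tail:
  assumes prof: "ac_profile B M G h" and t: "t > 0" and j: "j \<le> 1" and N: "N \<ge> 2 * qq t x"
  shows "cmod (oscl G t x j - osc G t x j N) \<le> Cosc t * (B + M + 1) / sqrt N"
proof (rule LIMSEQ_le_const2)
  show "(\<lambda>n. cmod (osc G t x j (real n) - osc G t x j N)) \<longlonglongrightarrow> cmod (oscl G t x j - osc G t x j N)"
    by (intro tendsto_intros osc_LIMSEQ[OF prof t j])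
  obtain n0 :: nat where n0: "N \<le> real n0" using real_arch_simple by blast
  show "\<exists>n0. \<forall>n\<ge>n0. cmod (osc G t x j (real n) - osc G t x j N) \<le> Cosc t * (B + M + 1) / sqrt N"
    by (intro exI[of _ n0] allI impI osc_tail[OF prof t j N]) (use n0 in auto)
qed

lemma oscl_bound:
  assumes prof: "ac_profile B M G h" and t: "t > 0" and j: "j \<le> 1"
  shows "cmod (oscl G t x j) \<le> Cosc t * (B + M + 1) * (if j = 0 then 1 / sqrt (qq t x) else sqrt (qq t x))"
proof (rule LIMSEQ_le_const2)
  show "(\<lambda>n. cmod (osc G t x j (real n))) \<longlonglongrightarrow> cmod (oscl G t x j)"
    by (intro tendsto_intros osc_LIMSEQ[OF prof t j])
  obtain n0 :: nat where n0: "2 * qq t x \<le> real n0" using real_arch_simple by blast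
  show "\<exists>n0. \<forall>n\<ge>n0. cmod (osc G t x j (real n)) \<le> Cosc t * (B + M + 1) * (if j = 0 then 1 / sqrt (qq t x) else sqrt (qq t x))"
    by (intro exI[of _ n0] allI impI osc_bound[OF prof t j]) (use n0 in linarith)
qed

lemma osc_diff:
  assumes "ac_profile B M G h" "ac_profile B' M' G' h'"
  shows "osc (\<lambda>p. G p - G' p) t x j N = osc G t x j N - osc G' t x j N"
  unfolding osc_def right_diff_distrib
  by (rule Henstock_Kurzweil_Integration.integral_diff) (intro osc_integrable[OF assms(1)] osc_integrable[OF assms(2)], simp)+

lemma ac_profile_diff:
  assumes p1: "ac_profile B M G h" and p2: "ac_profile B' M' G' h'"
  shows "ac_profile (B + B') (2 * M + 2 * M') (\<lambda>p. G p - G' p) (\<lambda>p. h p - h' p)"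
proof -
  note [measurable] = ac_profileD(3)[OF p1] ac_profileD(3)[OF p2]
  let ?d = "\<lambda>p. 2 * (cmod (h p))\<^sup>2 + 2 * (cmod (h' p))\<^sup>2"
  have i: "integrable lborel ?d"
    by (intro Bochner_Integration.integrable_add integrable_mult_right ac_profileD(4)[OF p1] ac_profileD(4)[OF p2])
  have le: "(cmod (h p - h' p))\<^sup>2 \<le> ?d p" for p
  proof -
    have "(cmod (h p - h' p))\<^sup>2 \<le> (cmod (h p) + cmod (h' p))\<^sup>2" by (intro power_mono norm_triangle_ineq4) auto
    also have "\<dots> \<le> ?d p" using sum_squares_ge_zero[of "cmod (h p) - cmod (h' p)" 0] by (simp add: power2_eq_square algebra_simps)
    finally show ?thesis .
  qed
  have i2: "integrable lborel (\<lambda>p. (cmod (h p - h' p))\<^sup>2)"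
    by (rule Bochner_Integration.integrable_bound[OF i]) (use le in \<open>auto intro!: AE_I2\<close>)
  have "(LINT p|lborel. (cmod (h p - h' p))\<^sup>2) \<le> (LINT p|lborel. ?d p)"
    by (rule integral_mono[OF i2 i le])
  also have "\<dots> = 2 * (LINT p|lborel. (cmod (h p))\<^sup>2) + 2 * (LINT p|lborel. (cmod (h' p))\<^sup>2)"
    using ac_profileD(4)[OF p1] ac_profileD(4)[OF p2] by simp
  also have "\<dots> \<le> 2 * M + 2 * M'" using ac_profileD(5)[OF p1] ac_profileD(5)[OF p2] by linarith
  finally have "(LINT p|lborel. (cmod (h p - h' p))\<^sup>2) \<le> 2 * M + 2 * M'" .
  moreover have "cmod (G p - G' p) \<le> B + B'" if "p \<ge> 0" for p
    using norm_triangle_ineq4[of "G p" "G' p"] ac_profileD(6)[OF p1 that] ac_profileD(6)[OF p2 that] by linarith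
  moreover have "(G b - G' b) - (G a - G' a) = (LINT p:{a..b}|lborel. h p - h' p)" if "0 \<le> a" "a \<le> b" for a b
    using ac_profileD(7)[OF p1 that] ac_profileD(7)[OF p2 that]
    by (subst set_integral_diff(2)) (auto simp: ac_profile_integrable[OF p1] ac_profile_integrable[OF p2] algebra_simps)
  ultimately show ?thesis
    using ac_profileD(1,2)[OF p1] ac_profileD(1,2)[OF p2] i2 unfolding ac_profile_def by simp
qed

lemma oscl_diff:
  assumes "ac_profile B M G h" "ac_profile B' M' G' h'" "t > 0" "j \<le> 1"
  shows "oscl (\<lambda>p. G p - G' p) t x j = oscl G t x j - oscl G' t x j"
proof (rule LIMSEQ_unique)
  show "(\<lambda>n. osc (\<lambda>p. G p - G' p) t x j (real n)) \<longlonglongrightarrow> oscl (\<lambda>p. G p - G' p) t x j"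
    by (rule osc_LIMSEQ[OF ac_profile_diff[OF assms(1,2)] assms(3,4)])
  show "(\<lambda>n. osc (\<lambda>p. G p - G' p) t x j (real n)) \<longlonglongrightarrow> oscl G t x j - oscl G' t x j"
    unfolding osc_diff[OF assms(1,2)]
    by (intro tendsto_diff osc_LIMSEQ[OF assms(1,3,4)] osc_LIMSEQ[OF assms(2,3,4)])
qed

lemma osc_has_derivative:
  assumes prof: "ac_profile B M G h"
  shows "((\<lambda>x. osc G t x j N) has_vector_derivative \<i> * osc G t x (Suc j) N) (at x within A)"
proof -
  have cG: "continuous_on {0..N} G" using ac_profile_continuous[OF prof] by (rule continuous_on_subset) auto
  have "((\<lambda>x. integral (cbox 0 N) (\<lambda>p. phase t x p * of_real (p ^ j) * G p)) has_vector_derivative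
      integral (cbox 0 N) (\<lambda>p. \<i> * of_real p * phase t x p * of_real (p ^ j) * G p)) (at x within UNIV)"
  proof (rule leibniz_rule_vector_derivative)
    fix x p
    have "((\<lambda>z. exp (\<i> * (z * of_real p + of_real (t * p ^ 3)))) has_field_derivative
       \<i> * of_real p * phase t x p) (at (of_real x))"
      by (auto intro!: derivative_eq_intros simp: phase_def)
    from has_vector_derivative_real_field[OF this]
    have "((\<lambda>x. phase t x p) has_vector_derivative \<i> * of_real p * phase t x p) (at x)"
      by (simp add: phase_def)
    then show "((\<lambda>x. phase t x p * of_real (p ^ j) * G p) has_vector_derivative
         \<i> * of_real p * phase t x p * of_real (p ^ j) * G p) (at x within UNIV)"
      by (intro has_vector_derivative_mult_left)
  next
    fix x show "(\<lambda>p. phase t x p * of_real (p ^ j) * G p) integrable_on cbox 0 N"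
      using osc_integrable[OF prof] by simp
    have "continuous_on (UNIV \<times> cbox 0 N) (\<lambda>z::real \<times> real. G (snd z))"
      by (rule continuous_on_compose2[OF cG]) (auto intro!: continuous_intros)
    then show "continuous_on (UNIV \<times> cbox 0 N) (\<lambda>(x, p). \<i> * of_real p * phase t x p * of_real (p ^ j) * G p)"
      unfolding split_beta by (intro continuous_intros)
  qed auto
  moreover have "integral (cbox 0 N) (\<lambda>p. \<i> * of_real p * phase t x p * of_real (p ^ j) * G p) = \<i> * osc G t x (Suc j) N"
    unfolding osc_def Henstock_Kurzweil_Integration.integral_mult_right[symmetric] cbox_interval
    by (rule integral_cong) (simp add: mult_ac)
  ultimately show ?thesis unfolding osc_def by (auto intro: has_vector_derivative_at_within)
qed

lemma qq_le: assumes "0 < a" "a \<le> t" "\<bar>x\<bar> \<le> L" shows "qq t x \<le> qq a L"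
proof -
  have "\<bar>x\<bar> / (3 * t) \<le> \<bar>L\<bar> / (3 * a)" using assms by (intro frac_le) auto
  then show ?thesis unfolding qq_def using real_sqrt_le_mono by (intro max.mono) auto
qed

lemma osc_unif_tail:
  assumes prof: "ac_profile B M G h" and t: "0 < a" "a \<le> t" and j: "j \<le> 1" and x: "\<bar>x\<bar> \<le> L" and N: "N \<ge> 2 * qq a L"
  shows "cmod (oscl G t x j - osc G t x j N) \<le> Cosc a * (B + M + 1) / sqrt N"
proof -
  have N': "N \<ge> 2 * qq t x" using qq_le[OF t x] N by linarith
  have "cmod (oscl G t x j - osc G t x j N) \<le> Cosc t * (B + M + 1) / sqrt N"
    by (rule oscl_tail[OF prof _ j N']) (use t in auto)
  also have "\<dots> \<le> Cosc a * (B + M + 1) / sqrt N"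
    using ac_profileD(1,2)[OF prof] Cosc_mono[OF t] N qq_ge_1[of a L]
    by (intro divide_right_mono mult_right_mono) auto
  finally show ?thesis .
qed

text \<open>By \<open>osc_unif_tail\<close> with \<open>j = 1\<close> the derivatives of the truncated integrals converge locally uniformly.\<close>

lemma oscl_has_derivative:
  assumes prof: "ac_profile B M G h" and t: "t > 0"
  shows "((\<lambda>x. oscl G t x 0) has_vector_derivative \<i> * oscl G t x 1) (at x)"
proof -
  let ?S = "{x-1<..<x+1}"
  have "\<exists>g. \<forall>y\<in>?S. (\<lambda>n. osc G t y 0 (real n)) \<longlonglongrightarrow> g y \<and> (g has_derivative (\<lambda>h. h *\<^sub>R (\<i> * oscl G t y 1))) (at y within ?S)"
  proof (rule has_derivative_sequence)
    fix n y show "((\<lambda>y. osc G t y 0 (real n)) has_derivative (\<lambda>h. h *\<^sub>R (\<i> * osc G t y 1 (real n)))) (at y within ?S)"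
      using osc_has_derivative[OF prof, of t 0 "real n" y ?S] by (simp add: has_vector_derivative_def)
  next
    fix e :: real assume e: "e > 0"
    let ?L = "\<bar>x\<bar> + 1"
    show "\<forall>\<^sub>F n in sequentially. \<forall>y\<in>?S. \<forall>h. norm (h *\<^sub>R (\<i> * osc G t y 1 (real n)) - h *\<^sub>R (\<i> * oscl G t y 1)) \<le> e * norm h"
      using eventually_tail[OF e, of "Cosc t * (B + M + 1)" "2 * qq t ?L"]
    proof eventually_elim
      case (elim n)
      show ?case
      proof (intro ballI allI)
        fix y h :: real assume "y \<in> ?S"
        then have "\<bar>y\<bar> \<le> ?L" by auto
        then have "cmod (oscl G t y 1 - osc G t y 1 (real n)) \<le> e"
          using osc_unif_tail[OF prof t order_refl, of 1 y ?L "real n"] elim by linarith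
        then have "norm h * cmod (oscl G t y 1 - osc G t y 1 (real n)) \<le> norm h * e" by (rule mult_left_mono) simp
        moreover have "h *\<^sub>R (\<i> * osc G t y 1 (real n)) - h *\<^sub>R (\<i> * oscl G t y 1) = - (h *\<^sub>R (\<i> * (oscl G t y 1 - osc G t y 1 (real n))))"
          by (simp add: algebra_simps)
        ultimately show "norm (h *\<^sub>R (\<i> * osc G t y 1 (real n)) - h *\<^sub>R (\<i> * oscl G t y 1)) \<le> e * norm h"
          by (simp add: norm_mult mult.commute)
      qed
    qed
  next
    show "(\<lambda>n. osc G t x 0 (real n)) \<longlonglongrightarrow> oscl G t x 0" by (rule osc_LIMSEQ[OF prof t]) simp
  qed auto
  then obtain g where g: "\<And>y. y \<in> ?S \<Longrightarrow> (\<lambda>n. osc G t y 0 (real n)) \<longlonglongrightarrow> g y"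
    "\<And>y. y \<in> ?S \<Longrightarrow> (g has_derivative (\<lambda>h. h *\<^sub>R (\<i> * oscl G t y 1))) (at y within ?S)" by blast
  have geq: "g y = oscl G t y 0" if "y \<in> ?S" for y
    using LIMSEQ_unique[OF g(1)[OF that] osc_LIMSEQ[OF prof t]] by simp
  have gd: "(g has_derivative (\<lambda>h. h *\<^sub>R (\<i> * oscl G t x 1))) (at x)"
    using g(2)[of x] at_within_open[of x ?S] by simp
  have "((\<lambda>y. oscl G t y 0) has_derivative (\<lambda>h. h *\<^sub>R (\<i> * oscl G t x 1))) (at x)"
    by (rule has_derivative_transform_within_open[OF gd open_greaterThanLessThan _ geq]) auto
  then show ?thesis by (simp add: has_vector_derivative_def)
qed

text \<open>The uniform convergence in time is on the open half-line; it extends to \<open>p = 0\<close> since every profile is continuous there.\<close>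

lemma profile_joint_continuous:
  fixes I :: "real set"
  assumes prof: "\<And>t. t \<in> I \<Longrightarrow> ac_profile B M (G t) (h t)"
    and ul: "\<And>s. s \<in> I \<Longrightarrow> uniform_limit {0<..} G (G s) (at s within I)"
  shows "continuous_on (I \<times> {0..}) (\<lambda>(t, p). G t p)"
  unfolding continuous_on_iff
proof (intro ballI allI impI)
  fix z :: "real \<times> real" and e :: real assume z: "z \<in> I \<times> {0..}" and e: "e > 0"
  obtain s q where zq: "z = (s, q)" "s \<in> I" "q \<ge> 0" using z by auto
  have "\<forall>\<^sub>F t in at s within I. \<forall>p\<in>{0<..}. dist (G t p) (G s p) < e / 3"
    using ul[OF zq(2), unfolded uniform_limit_iff, rule_format, of "e / 3"] e by simp
  then obtain d1 where d1: "d1 > 0" "\<And>t p. t \<in> I \<Longrightarrow> t \<noteq> s \<Longrightarrow> dist t s < d1 \<Longrightarrow> p > 0 \<Longrightarrow> dist (G t p) (G s p) < e / 3"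
    unfolding eventually_at by (metis greaterThan_iff)
  have d1': "dist (G t p) (G s p) \<le> e / 3" if "t \<in> I" "dist t s < d1" "p \<ge> 0" for t p
  proof (cases "t = s \<or> p > 0")
    case True then show ?thesis using d1(2)[of t p] that e by (cases "t = s") auto
  next
    case False
    then have p0: "p = 0" and ts: "t \<noteq> s" using that by auto
    have c: "continuous (at 0 within {0..}) (G r)" if "r \<in> I" for r
      using ac_profile_continuous[OF prof[OF that]] by (auto simp: continuous_on_eq_continuous_within)
    have lim: "(G r \<longlongrightarrow> G r 0) (at_right 0)" if "r \<in> I" for r
      using c[OF that] unfolding continuous_within by (rule tendsto_mono[rotated]) (auto intro: at_le)
    have "((\<lambda>p. dist (G t p) (G s p)) \<longlongrightarrow> dist (G t 0) (G s 0)) (at_right 0)"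
      by (intro tendsto_dist lim that zq)
    then show ?thesis unfolding p0
    proof (rule tendsto_upperbound)
      show "\<forall>\<^sub>F p in at_right 0. dist (G t p) (G s p) \<le> e / 3"
        unfolding eventually_at_filter
        by (rule always_eventually) (use d1(2)[OF that(1) ts that(2)] in \<open>auto intro: less_imp_le\<close>)
    qed simp
  qed
  have "continuous (at q within {0..}) (G s)"
    using ac_profile_continuous[OF prof[OF zq(2)]] zq by (auto simp: continuous_on_eq_continuous_within)
  then obtain d2 where d2: "d2 > 0" "\<And>p. p \<ge> 0 \<Longrightarrow> dist p q < d2 \<Longrightarrow> dist (G s p) (G s q) < e / 3"
    unfolding continuous_within_eps_delta using e by (metis atLeast_iff divide_pos_pos zero_less_numeral)
  show "\<exists>d>0. \<forall>z'\<in>I \<times> {0..}. dist z' z < d \<longrightarrow> dist (case z' of (t, p) \<Rightarrow> G t p) (case z of (t, p) \<Rightarrow> G t p) < e"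
  proof (intro exI[of _ "min d1 d2"] conjI ballI impI)
    fix z' assume z': "z' \<in> I \<times> {0..}" "dist z' z < min d1 d2"
    obtain t p where tp: "z' = (t, p)" "t \<in> I" "p \<ge> 0" using z' by auto
    have dd: "dist t s < d1" "dist p q < d2"
      using z'(2) dist_fst_le[of z' z] dist_snd_le[of z' z] by (auto simp: tp zq)
    have "dist (G t p) (G s q) \<le> dist (G t p) (G s p) + dist (G s p) (G s q)" by (rule dist_triangle)
    also have "\<dots> < e" using d1'[OF tp(2) dd(1) tp(3)] d2(2)[OF tp(3) dd(2)] e by linarith
    finally show "dist (case z' of (t, p) \<Rightarrow> G t p) (case z of (t, p) \<Rightarrow> G t p) < e" by (simp add: tp zq)
  qed (use d1 d2 in auto)
qed

lemma oscl_joint_continuous: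
  fixes I :: "real set"
  assumes prof: "\<And>t. t \<in> I \<Longrightarrow> ac_profile B M (G t) (h t)"
    and ul: "\<And>s. s \<in> I \<Longrightarrow> uniform_limit {0<..} G (G s) (at s within I)"
    and a: "a > 0" "\<And>t. t \<in> I \<Longrightarrow> a \<le> t" and j: "j \<le> 1"
  shows "continuous_on (I \<times> UNIV) (\<lambda>(t, x). oscl (G t) t x j)"
proof -
  have cosc: "continuous_on (I \<times> UNIV) (\<lambda>z. osc (G (fst z)) (fst z) (snd z) j N)" for N
  proof -
    have "continuous_on ((I \<times> UNIV) \<times> cbox 0 N) (\<lambda>w. (\<lambda>(t, p). G t p) (fst (fst w), snd w))"
      by (rule continuous_on_compose2[OF profile_joint_continuous[OF prof ul]]) (auto intro!: continuous_intros)
    then have "continuous_on ((I \<times> UNIV) \<times> cbox 0 N) (\<lambda>(z, p). phase (fst z) (snd z) p * of_real (p ^ j) * G (fst z) p)"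
      unfolding split_beta by (intro continuous_intros) auto
    from integral_continuous_on_param[OF this] show ?thesis unfolding osc_def by simp
  qed
  have c: "continuous_on (I \<times> {-L..L}) (\<lambda>z. oscl (G (fst z)) (fst z) (snd z) j)" for L
  proof (rule uniform_limit_theorem)
    show "\<forall>\<^sub>F n in sequentially. continuous_on (I \<times> {-L..L}) (\<lambda>z. osc (G (fst z)) (fst z) (snd z) j (real n))"
      by (intro always_eventually allI continuous_on_subset[OF cosc]) auto
    show "uniform_limit (I \<times> {-L..L}) (\<lambda>n z. osc (G (fst z)) (fst z) (snd z) j (real n)) (\<lambda>z. oscl (G (fst z)) (fst z) (snd z) j) sequentially"
      unfolding uniform_limit_iff
    proof (intro allI impI)
      fix e :: real assume "e > 0"
      from eventually_tail[OF this, of "Cosc a * (B + M + 1)" "2 * qq a L"]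
      show "\<forall>\<^sub>F n in sequentially. \<forall>z\<in>I \<times> {-L..L}. dist (osc (G (fst z)) (fst z) (snd z) j (real n)) (oscl (G (fst z)) (fst z) (snd z) j) < e"
      proof eventually_elim
        case (elim n)
        show ?case
        proof
          fix z assume "z \<in> I \<times> {-L..L}"
          then have z: "fst z \<in> I" "\<bar>snd z\<bar> \<le> L" by auto
          from osc_unif_tail[OF prof[OF z(1)] a(1) a(2)[OF z(1)] j z(2), of "real n"] elim
          show "dist (osc (G (fst z)) (fst z) (snd z) j (real n)) (oscl (G (fst z)) (fst z) (snd z) j) < e"
            by (simp add: dist_norm norm_minus_commute)
        qed
      qed
    qed
  qed simp
  show ?thesis
    unfolding continuous_on_eq_continuous_within
  proof
    fix z assume z: "z \<in> I \<times> (UNIV::real set)"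
    define L where "L = \<bar>snd z\<bar> + 1"
    have "z \<in> I \<times> {-L..L}" using z by (auto simp: L_def)
    then have "continuous (at z within I \<times> {-L..L}) (\<lambda>(t, x). oscl (G t) t x j)"
      using c[of L] unfolding continuous_on_eq_continuous_within split_beta by blast
    moreover have "at z within I \<times> {-L..L} = at z within I \<times> UNIV"
      by (rule at_within_nhd[of _ "UNIV \<times> {-L<..<L}"]) (auto simp: L_def open_Times mem_Times_iff)
    ultimately show "continuous (at z within I \<times> UNIV) (\<lambda>(t, x). oscl (G t) t x j)" by simp
  qed
qed

section \<open>A local L2 bound for Fourier integrals\<close>

lemma ennreal_norm_integral_le: "ennreal (norm (integral\<^sup>L M f)) \<le> (\<integral>\<^sup>+x. ennreal (norm (f x)) \<partial>M)"
  for f :: "'a \<Rightarrow> 'b::{banach, second_countable_topology}"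
proof (cases "integrable M f")
  case True
  have "ennreal (norm (integral\<^sup>L M f)) \<le> ennreal (LINT x|M. norm (f x))" by (intro ennreal_leI integral_norm_bound)
  also have "\<dots> = (\<integral>\<^sup>+x. ennreal (norm (f x)) \<partial>M)"
    by (rule nn_integral_eq_integral[symmetric]) (use True in auto)
  finally show ?thesis .
qed (simp add: not_integrable_integral_eq)

lemma LINT_cnj: "(LINT x|M. cnj (f x)) = cnj (integral\<^sup>L M f)"
  by (rule integral_bounded_linear'[OF bounded_linear_cnj bounded_linear_cnj]) simp

text \<open>The Schur test, by \<open>f(p) f(q) \<le> (f(p)\<^sup>2 + f(q)\<^sup>2) / 2\<close>.\<close>

lemma schur_bound:
  fixes f :: "real \<Rightarrow> real" and g :: "real \<Rightarrow> real"
  assumes [measurable]: "f \<in> borel_measurable borel" "g \<in> borel_measurable borel"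
    and nn: "\<And>x. f x \<ge> 0" "\<And>x. g x \<ge> 0"
    and \<Gamma>: "\<And>c. (\<integral>\<^sup>+q. ennreal (g (c - q)) \<partial>lborel) = ennreal \<Gamma>" "\<And>c. (\<integral>\<^sup>+p. ennreal (g (p - c)) \<partial>lborel) = ennreal \<Gamma>"
  shows "(\<integral>\<^sup>+p. (\<integral>\<^sup>+q. ennreal (f p * f q * g (p - q)) \<partial>lborel) \<partial>lborel) \<le> ennreal \<Gamma> * (\<integral>\<^sup>+p. ennreal ((f p)\<^sup>2) \<partial>lborel)"
proof -
  let ?N = "\<integral>\<^sup>+p. ennreal ((f p)\<^sup>2) \<partial>lborel"
  let ?h = "\<lambda>p. ennreal ((f p)\<^sup>2 / 2)"
  have "(\<integral>\<^sup>+p. (\<integral>\<^sup>+q. ennreal (f p * f q * g (p - q)) \<partial>lborel) \<partial>lborel) \<le>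
     (\<integral>\<^sup>+p. (\<integral>\<^sup>+q. ?h p * ennreal (g (p - q)) + ?h q * ennreal (g (p - q)) \<partial>lborel) \<partial>lborel)"
  proof (intro nn_integral_mono)
    fix p q
    have "f p * f q \<le> (f p)\<^sup>2 / 2 + (f q)\<^sup>2 / 2"
      using sum_squares_ge_zero[of "f p - f q" 0] by (simp add: power2_eq_square algebra_simps)
    then have "f p * f q * g (p - q) \<le> ((f p)\<^sup>2 / 2 + (f q)\<^sup>2 / 2) * g (p - q)" by (rule mult_right_mono) (rule nn)
    then have "ennreal (f p * f q * g (p - q)) \<le> ennreal ((f p)\<^sup>2 / 2 * g (p - q) + (f q)\<^sup>2 / 2 * g (p - q))"
      by (intro ennreal_leI) (simp add: algebra_simps)
    also have "\<dots> = ?h p * ennreal (g (p - q)) + ?h q * ennreal (g (p - q))"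
    proof -
      have "ennreal (A * G + B * G) = ennreal A * ennreal G + ennreal B * ennreal G" if "A \<ge> 0" "B \<ge> 0" "G \<ge> 0" for A B G
        using that by (simp add: ennreal_plus ennreal_mult)
      then show ?thesis by this (use nn in auto)
    qed
    finally show "ennreal (f p * f q * g (p - q)) \<le> ?h p * ennreal (g (p - q)) + ?h q * ennreal (g (p - q))" .
  qed
  also have "\<dots> = (\<integral>\<^sup>+p. (\<integral>\<^sup>+q. ?h p * ennreal (g (p - q)) \<partial>lborel) \<partial>lborel) + (\<integral>\<^sup>+p. (\<integral>\<^sup>+q. ?h q * ennreal (g (p - q)) \<partial>lborel) \<partial>lborel)"
    by (subst nn_integral_add[symmetric]) (auto intro!: nn_integral_cong nn_integral_add)
  also have "(\<integral>\<^sup>+p. (\<integral>\<^sup>+q. ?h p * ennreal (g (p - q)) \<partial>lborel) \<partial>lborel) = (\<integral>\<^sup>+p. ?h p * ennreal \<Gamma> \<partial>lborel)"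
    by (intro nn_integral_cong) (simp add: nn_integral_cmult \<Gamma>)
  also have "(\<integral>\<^sup>+p. (\<integral>\<^sup>+q. ?h q * ennreal (g (p - q)) \<partial>lborel) \<partial>lborel) = (\<integral>\<^sup>+q. (\<integral>\<^sup>+p. ?h q * ennreal (g (p - q)) \<partial>lborel) \<partial>lborel)"
    by (rule lborel_pair.Fubini') measurable
  also have "\<dots> = (\<integral>\<^sup>+q. ?h q * ennreal \<Gamma> \<partial>lborel)"
    by (intro nn_integral_cong) (simp add: nn_integral_cmult \<Gamma>)
  also have "(\<integral>\<^sup>+p. ?h p * ennreal \<Gamma> \<partial>lborel) + (\<integral>\<^sup>+q. ?h q * ennreal \<Gamma> \<partial>lborel) = ennreal \<Gamma> * ?N"
  proof -
    have "ennreal \<Gamma> * ?N = (\<integral>\<^sup>+p. ennreal \<Gamma> * (?h p + ?h p) \<partial>lborel)"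
      by (subst nn_integral_cmult[symmetric]) (auto simp: ennreal_plus[symmetric] simp del: ennreal_plus intro!: nn_integral_cong)
    also have "\<dots> = (\<integral>\<^sup>+p. ?h p * ennreal \<Gamma> + ?h p * ennreal \<Gamma> \<partial>lborel)"
      by (intro nn_integral_cong) (simp only: distrib_left mult.commute)
    also have "\<dots> = (\<integral>\<^sup>+p. ?h p * ennreal \<Gamma> \<partial>lborel) + (\<integral>\<^sup>+q. ?h q * ennreal \<Gamma> \<partial>lborel)"
      by (rule nn_integral_add) auto
    finally show ?thesis by simp
  qed
  finally show ?thesis .
qed

text \<open>The upper bound of Plancherel's theorem, up to a factor 2: a Gaussian of width \<open>L\<close> dominates the window,
  and with it the left-hand side becomes a double integral of \<open>f(p) cnj (f(q))\<close> against a Gaussian in \<open>p - q\<close>, to which the Schur test applies.\<close>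

lemma fourier_window_L2:
  fixes f :: "real \<Rightarrow> complex"
  assumes f: "integrable lborel f" and f2: "integrable lborel (\<lambda>p. (cmod (f p))\<^sup>2)" and L: "L > 0"
  defines "F \<equiv> \<lambda>x. LINT p|lborel. iexp (x * p) * f p"
  shows "set_integrable lborel {-L..L} (\<lambda>x. (cmod (F x))\<^sup>2)"
    "(LINT x:{-L..L}|lborel. (cmod (F x))\<^sup>2) \<le> 4 * pi * (LINT p|lborel. (cmod (f p))\<^sup>2)"
proof -
  have fm [measurable]: "f \<in> borel_measurable borel" using f by auto
  have [measurable]: "cnj \<in> borel_measurable borel"
    by (intro borel_measurable_continuous_onI continuous_on_cnj continuous_on_id)
  have Fm [measurable]: "F \<in> borel_measurable borel" unfolding F_def by measurable
  define N1 where "N1 = (LINT p|lborel. cmod (f p))"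
  have Fb: "cmod (F x) \<le> N1" for x
    unfolding F_def N1_def by (rule order_trans[OF integral_norm_bound]) (simp add: norm_mult)
  have N10: "N1 \<ge> 0" using Fb[of 0] norm_ge_zero order_trans by blast
  \<comment> \<open>the Gaussian weight of this width is at least \<open>exp (-1/2) / \<surd>(2 \<pi>)\<close> on the window\<close>
  define d where "d = 1 / L"
  have d: "d > 0" using L by (simp add: d_def)
  define w where "w x = std_normal_density (d * x)" for x
  have w0: "w x \<ge> 0" for x by (simp add: w_def)
  have [measurable]: "w \<in> borel_measurable borel" unfolding w_def by measurable
  have wci: "integrable lborel (\<lambda>x. complex_of_real (w x))"
    using fourier_gaussian(1)[OF d, of 0] by (simp add: w_def)
  then have wi: "integrable lborel w" using integrable_norm[OF wci] w0 by simp
  define g where "g r = exp (- ((r/d)\<^sup>2) / 2) / d" for r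
  have g0: "g r \<ge> 0" for r using d by (simp add: g_def)
  have [measurable]: "g \<in> borel_measurable borel" unfolding g_def by measurable
  have gw: "(LINT x|lborel. of_real (w x) * iexp (r * x)) = of_real (g r)" for r
    unfolding w_def g_def by (rule fourier_gaussian(2)[OF d])
  have gG: "(\<integral>\<^sup>+r. ennreal (g r) \<partial>lborel) = ennreal (sqrt (2 * pi))"
  proof -
    have "(\<integral>\<^sup>+r. ennreal (g r) \<partial>lborel) = ennreal \<bar>d\<bar> * (\<integral>\<^sup>+r. ennreal (g (0 + d * r)) \<partial>lborel)"
      using d by (intro nn_integral_real_affine) auto
    also have "\<dots> = (\<integral>\<^sup>+r. ennreal d * ennreal (g (0 + d * r)) \<partial>lborel)"
      using d by (subst nn_integral_cmult) auto
    also have "\<dots> = (\<integral>\<^sup>+r. ennreal (sqrt (2 * pi)) * ennreal (std_normal_density r) \<partial>lborel)"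
      using d by (intro nn_integral_cong) (simp add: ennreal_mult''[symmetric] g_def std_normal_density_def)
    also have "\<dots> = ennreal (sqrt (2 * pi)) * (\<integral>\<^sup>+r. ennreal (std_normal_density r) \<partial>lborel)"
      by (rule nn_integral_cmult) auto
    also have "(\<integral>\<^sup>+r. ennreal (std_normal_density r) \<partial>lborel) = 1"
      by (subst nn_integral_eq_integral) (auto intro!: integrable_normal_density simp: integral_normal_density)
    finally show ?thesis by simp
  qed
  have G1: "(\<integral>\<^sup>+q. ennreal (g (c - q)) \<partial>lborel) = ennreal (sqrt (2 * pi))" for c
    using nn_integral_real_affine[of "\<lambda>r. ennreal (g r)" "-1" c] by (simp add: gG)
  have G2: "(\<integral>\<^sup>+p. ennreal (g (p - c)) \<partial>lborel) = ennreal (sqrt (2 * pi))" for c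
    using nn_integral_real_affine[of "\<lambda>r. ennreal (g r)" 1 "-c"] by (simp add: gG)
  define X where "X p = (LINT x|lborel. of_real (w x) * iexp (x * p) * cnj (F x))" for p
  have X: "X p = (LINT q|lborel. cnj (f q) * of_real (g (p - q)))" for p
  proof -
    let ?k = "\<lambda>x q. of_real (w x) * iexp (x * p) * (iexp (- (x * q)) * cnj (f q))"
    have i: "integrable (lborel \<Otimes>\<^sub>M lborel) (\<lambda>(x, q). ?k x q)"
    proof (rule Bochner_Integration.integrable_bound[OF integrable_pair_mult[OF wci f]])
      show "(\<lambda>(x, q). ?k x q) \<in> borel_measurable (lborel \<Otimes>\<^sub>M lborel)" by measurable
    qed (auto simp: norm_mult split_beta)
    have "X p = (LINT x|lborel. LINT q|lborel. ?k x q)"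
      unfolding X_def
    proof (rule Bochner_Integration.integral_cong[OF refl])
      fix x
      have "cnj (F x) = (LINT q|lborel. iexp (- (x * q)) * cnj (f q))"
        unfolding F_def LINT_cnj[symmetric] by (simp add: exp_cnj)
      then show "of_real (w x) * iexp (x * p) * cnj (F x) = (LINT q|lborel. ?k x q)" by simp
    qed
    also have "\<dots> = (LINT q|lborel. LINT x|lborel. ?k x q)"
      using lborel_pair.Fubini_integral[OF i] by simp
    also have "\<dots> = (LINT q|lborel. (LINT x|lborel. (of_real (w x) * iexp ((p - q) * x)) * cnj (f q)))"
      by (intro Bochner_Integration.integral_cong refl)
         (simp add: algebra_simps flip: exp_add)
    also have "\<dots> = (LINT q|lborel. cnj (f q) * of_real (g (p - q)))"
      unfolding integral_mult_left_zero gw by (simp only: mult.commute)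
    finally show ?thesis .
  qed
  define S where "S = (LINT x|lborel. w x * (cmod (F x))\<^sup>2)"
  have Si: "integrable lborel (\<lambda>x. w x * (cmod (F x))\<^sup>2)"
  proof (rule Bochner_Integration.integrable_bound)
    show "integrable lborel (\<lambda>x. w x * N1\<^sup>2)" using wi by simp
    show "AE x in lborel. norm (w x * (cmod (F x))\<^sup>2) \<le> norm (w x * N1\<^sup>2)"
      using w0 Fb by (intro AE_I2) (auto simp: abs_mult intro!: mult_left_mono power_mono)
  qed measurable
  have S: "of_real S = (LINT p|lborel. f p * X p)"
  proof -
    let ?k = "\<lambda>x p. f p * (of_real (w x) * iexp (x * p) * cnj (F x))"
    have i0: "integrable lborel (\<lambda>x. of_real N1 * complex_of_real (w x))" using wci by simp
    have i: "integrable (lborel \<Otimes>\<^sub>M lborel) (\<lambda>(x, p). ?k x p)"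
    proof (rule Bochner_Integration.integrable_bound[OF integrable_pair_mult[OF i0 f]])
      show "AE z in lborel \<Otimes>\<^sub>M lborel. norm (case z of (x, p) \<Rightarrow> ?k x p) \<le> norm (case z of (x, p) \<Rightarrow> of_real N1 * complex_of_real (w x) * f p)"
      proof (rule AE_I2, clarify)
        fix x p
        have "cmod (f p) * (w x * cmod (F x)) \<le> cmod (f p) * (w x * N1)"
          by (intro mult_left_mono Fb w0) auto
        then show "norm (?k x p) \<le> norm (of_real N1 * complex_of_real (w x) * f p)"
          using w0[of x] N10 by (simp add: norm_mult mult_ac)
      qed
    qed measurable
    have "of_real S = (LINT x|lborel. complex_of_real (w x * (cmod (F x))\<^sup>2))"
      unfolding S_def by (rule integral_complex_of_real[symmetric])
    also have "\<dots> = (LINT x|lborel. LINT p|lborel. ?k x p)"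
    proof (rule Bochner_Integration.integral_cong[OF refl])
      fix x
      have "(LINT p|lborel. ?k x p) = (LINT p|lborel. (iexp (x * p) * f p) * (of_real (w x) * cnj (F x)))"
        by (intro Bochner_Integration.integral_cong refl) (simp add: mult_ac)
      also have "\<dots> = F x * (of_real (w x) * cnj (F x))" unfolding F_def by (rule integral_mult_left_zero)
      finally show "complex_of_real (w x * (cmod (F x))\<^sup>2) = (LINT p|lborel. ?k x p)"
        using complex_norm_square[of "F x"] by (simp add: mult_ac)
    qed
    also have "\<dots> = (LINT p|lborel. LINT x|lborel. ?k x p)"
      using lborel_pair.Fubini_integral[OF i] by simp
    finally show ?thesis unfolding X_def integral_mult_right_zero .
  qed
  have S0: "S \<ge> 0" unfolding S_def using w0 by (intro Bochner_Integration.integral_nonneg) auto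
  have "ennreal S = ennreal (norm (complex_of_real S))" using S0 by simp
  also have "\<dots> \<le> (\<integral>\<^sup>+p. ennreal (norm (f p * X p)) \<partial>lborel)" unfolding S by (rule ennreal_norm_integral_le)
  also have "\<dots> \<le> (\<integral>\<^sup>+p. (\<integral>\<^sup>+q. ennreal (cmod (f p) * cmod (f q) * g (p - q)) \<partial>lborel) \<partial>lborel)"
  proof (rule nn_integral_mono)
    fix p
    have "ennreal (cmod (X p)) \<le> (\<integral>\<^sup>+q. ennreal (norm (cnj (f q) * of_real (g (p - q)))) \<partial>lborel)"
      unfolding X by (rule ennreal_norm_integral_le)
    then have "ennreal (cmod (f p)) * ennreal (cmod (X p)) \<le> ennreal (cmod (f p)) * (\<integral>\<^sup>+q. ennreal (cmod (f q) * g (p - q)) \<partial>lborel)"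
      using g0 by (intro mult_left_mono) (simp_all add: norm_mult)
    also have "\<dots> = (\<integral>\<^sup>+q. ennreal (cmod (f p) * cmod (f q) * g (p - q)) \<partial>lborel)"
      using g0 by (subst nn_integral_cmult[symmetric]) (auto simp: ennreal_mult''[symmetric] mult.assoc)
    finally show "ennreal (norm (f p * X p)) \<le> (\<integral>\<^sup>+q. ennreal (cmod (f p) * cmod (f q) * g (p - q)) \<partial>lborel)"
      by (simp add: norm_mult ennreal_mult'')
  qed
  also have "\<dots> \<le> ennreal (sqrt (2 * pi)) * (\<integral>\<^sup>+p. ennreal ((cmod (f p))\<^sup>2) \<partial>lborel)"
    by (rule schur_bound) (use g0 G1 G2 in auto)
  also have "(\<integral>\<^sup>+p. ennreal ((cmod (f p))\<^sup>2) \<partial>lborel) = ennreal (LINT p|lborel. (cmod (f p))\<^sup>2)"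
    by (rule nn_integral_eq_integral[OF f2]) auto
  finally have "ennreal S \<le> ennreal (sqrt (2 * pi) * (LINT p|lborel. (cmod (f p))\<^sup>2))"
    by (simp add: ennreal_mult'')
  then have Sle: "S \<le> sqrt (2 * pi) * (LINT p|lborel. (cmod (f p))\<^sup>2)"
    by (subst (asm) ennreal_le_iff) (auto intro!: mult_nonneg_nonneg Bochner_Integration.integral_nonneg)
  have e2: "exp (1/2 :: real) \<le> 2"
  proof -
    have "(exp (1/2 :: real))\<^sup>2 = exp 1" by (simp add: power2_eq_square flip: exp_add)
    also have "\<dots> \<le> 2\<^sup>2" using exp_le by simp
    finally show ?thesis by (rule power2_le_imp_le) simp
  qed
  have lowr: "indicator {-L..L} x * (cmod (F x))\<^sup>2 \<le> (2 * sqrt (2 * pi)) * (w x * (cmod (F x))\<^sup>2)" for x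
  proof (cases "x \<in> {-L..L}")
    case True
    have "(d * x)\<^sup>2 \<le> 1\<^sup>2" using True L d by (intro abs_le_square_iff[THEN iffD1]) (auto simp: d_def abs_mult field_simps)
    then have "exp (- (1/2)) \<le> exp (- ((d * x)\<^sup>2) / 2)" by simp
    moreover have "1 / 2 \<le> exp (- (1/2) :: real)" using e2 by (simp add: exp_minus field_simps)
    ultimately have "1 \<le> 2 * exp (- ((d * x)\<^sup>2) / 2)" by linarith
    also have "\<dots> = (2 * sqrt (2 * pi)) * w x" by (simp add: w_def std_normal_density_def)
    finally have "1 * (cmod (F x))\<^sup>2 \<le> (2 * sqrt (2 * pi)) * w x * (cmod (F x))\<^sup>2" by (rule mult_right_mono) simp
    then show ?thesis using True by (simp add: mult_ac)
  qed (use w0 in auto)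
  have Si': "integrable lborel (\<lambda>x. (2 * sqrt (2 * pi)) * (w x * (cmod (F x))\<^sup>2))" using Si by simp
  have int: "integrable lborel (\<lambda>x. indicator {-L..L} x * (cmod (F x))\<^sup>2)"
  proof (rule Bochner_Integration.integrable_bound[OF Si'])
    show "AE x in lborel. norm (indicator {-L..L} x * (cmod (F x))\<^sup>2) \<le> norm ((2 * sqrt (2 * pi)) * (w x * (cmod (F x))\<^sup>2))"
      using order_trans[OF lowr abs_ge_self] by (intro AE_I2) auto
  qed measurable
  then show "set_integrable lborel {-L..L} (\<lambda>x. (cmod (F x))\<^sup>2)" by (simp add: set_integrable_def)
  have "(LINT x:{-L..L}|lborel. (cmod (F x))\<^sup>2) \<le> (LINT x|lborel. (2 * sqrt (2 * pi)) * (w x * (cmod (F x))\<^sup>2))"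
    unfolding set_lebesgue_integral_def using integral_mono[OF int Si' lowr] by simp
  also have "\<dots> = (2 * sqrt (2 * pi)) * S" unfolding S_def by simp
  also have "\<dots> \<le> (2 * sqrt (2 * pi)) * (sqrt (2 * pi) * (LINT p|lborel. (cmod (f p))\<^sup>2))"
    by (rule mult_left_mono[OF Sle]) simp
  also have "\<dots> = 4 * pi * (LINT p|lborel. (cmod (f p))\<^sup>2)" by simp
  finally show "(LINT x:{-L..L}|lborel. (cmod (F x))\<^sup>2) \<le> 4 * pi * (LINT p|lborel. (cmod (f p))\<^sup>2)" .
qed

section \<open>The virial estimate at a fixed time\<close>

text \<open>The real function of \<open>x\<close> at time \<open>t\<close> with profile \<open>G\<close>: taking twice the real part accounts for the negative frequencies, \<open>1 / (2 \<pi>)\<close> is the factor of Fourier inversion.\<close>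

definition kdv :: "(real \<Rightarrow> complex) \<Rightarrow> real \<Rightarrow> real \<Rightarrow> real" where
  "kdv G t x = Re (oscl G t x 0) / pi"

definition kdvx :: "(real \<Rightarrow> complex) \<Rightarrow> real \<Rightarrow> real \<Rightarrow> real" where
  "kdvx G t x = Re (\<i> * oscl G t x 1) / pi"

text \<open>The \<open>k\<close>-th derivative of the solution with frequencies truncated at \<open>N\<close>. The truncation gives sense to
  the second derivative, which has no limit as \<open>N\<close> grows.\<close>

definition tkdv :: "(real \<Rightarrow> complex) \<Rightarrow> real \<Rightarrow> real \<Rightarrow> nat \<Rightarrow> real \<Rightarrow> real" where
  "tkdv G t N k x = Re (\<i> ^ k * osc G t x k N) / pi"

lemma tkdv_has_derivative:
  assumes "ac_profile B M G h"
  shows "((tkdv G t N k) has_real_derivative tkdv G t N (Suc k) x) (at x within A)"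
proof -
  have "bounded_linear (\<lambda>z::complex. Re (\<i> ^ k * z) / pi)"
    by (intro bounded_linear_compose[OF bounded_linear_divide] bounded_linear_compose[OF bounded_linear_Re] bounded_linear_mult_right)
  from bounded_linear.has_vector_derivative[OF this osc_has_derivative[OF assms, of t k N x A]]
  have "((\<lambda>x. Re (\<i> ^ k * osc G t x k N) / pi) has_vector_derivative Re (\<i> ^ k * (\<i> * osc G t x (Suc k) N)) / pi) (at x within A)" .
  moreover have "(\<lambda>x. Re (\<i> ^ k * osc G t x k N) / pi) = tkdv G t N k" by (auto simp: tkdv_def)
  moreover have "Re (\<i> ^ k * (\<i> * osc G t x (Suc k) N)) / pi = tkdv G t N (Suc k) x"
    unfolding tkdv_def power_Suc by (simp only: mult_ac)
  ultimately show ?thesis by (simp add: has_real_derivative_iff_has_vector_derivative)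
qed

lemma kdv_has_derivative:
  assumes "ac_profile B M G h" "t > 0"
  shows "((\<lambda>x. kdv G t x) has_real_derivative kdvx G t x) (at x within A)"
proof -
  have "bounded_linear (\<lambda>z::complex. Re z / pi)"
    by (intro bounded_linear_compose[OF bounded_linear_divide] bounded_linear_Re)
  from bounded_linear.has_vector_derivative[OF this oscl_has_derivative[OF assms]]
  have "((\<lambda>x. kdv G t x) has_real_derivative kdvx G t x) (at x)"
    by (simp add: has_real_derivative_iff_has_vector_derivative kdv_def kdvx_def)
  then show ?thesis by (rule has_field_derivative_at_within)
qed

lemma Re_pi_le: "cmod z \<le> c \<Longrightarrow> \<bar>Re z / pi\<bar> \<le> c"
proof -
  assume a: "cmod z \<le> c"
  have "\<bar>Re z / pi\<bar> = \<bar>Re z\<bar> / pi" by (simp add: abs_divide)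
  also have "\<dots> \<le> \<bar>Re z\<bar> / 1" using pi_ge_two by (intro divide_left_mono) auto
  finally show "\<bar>Re z / pi\<bar> \<le> c" using a abs_Re_le_cmod[of z] by linarith
qed

lemma kdv_bound:
  assumes "ac_profile B M G h" "t > 0"
  shows "\<bar>kdv G t x\<bar> \<le> Cosc t * (B + M + 1) / sqrt (qq t x)" "\<bar>kdvx G t x\<bar> \<le> Cosc t * (B + M + 1) * sqrt (qq t x)"
  using Re_pi_le[OF oscl_bound[OF assms, of 0 x]] Re_pi_le[of "\<i> * oscl G t x 1"] oscl_bound[OF assms, of 1 x]
  by (auto simp: kdv_def kdvx_def norm_mult)

lemma kdv_joint_continuous:
  fixes I :: "real set"
  assumes prof: "\<And>t. t \<in> I \<Longrightarrow> ac_profile B M (G t) (h t)"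
    and ul: "\<And>s. s \<in> I \<Longrightarrow> uniform_limit {0<..} G (G s) (at s within I)"
    and a: "a > 0" "\<And>t. t \<in> I \<Longrightarrow> a \<le> t"
  shows "continuous_on (I \<times> UNIV) (\<lambda>(t, x). kdv (G t) t x)" "continuous_on (I \<times> UNIV) (\<lambda>(t, x). kdvx (G t) t x)"
proof -
  have c: "continuous_on (I \<times> UNIV) (\<lambda>z. oscl (G (fst z)) (fst z) (snd z) j)" if "j \<le> 1" for j
    using oscl_joint_continuous[OF prof ul a that] by (simp add: split_beta)
  show "continuous_on (I \<times> UNIV) (\<lambda>(t, x). kdv (G t) t x)"
    unfolding kdv_def split_beta by (intro continuous_intros c) auto
  show "continuous_on (I \<times> UNIV) (\<lambda>(t, x). kdvx (G t) t x)"
    unfolding kdvx_def split_beta by (intro continuous_intros c) auto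
qed

lemma tkdv_bound:
  assumes "ac_profile B M G h" "t > 0" "N \<ge> 2 * qq t x"
  shows "\<bar>tkdv G t N 0 x\<bar> \<le> Cosc t * (B + M + 1) / sqrt (qq t x)" "\<bar>tkdv G t N 1 x\<bar> \<le> Cosc t * (B + M + 1) * sqrt (qq t x)"
  using Re_pi_le[OF osc_bound[OF assms(1,2) _ assms(3), of 0]] Re_pi_le[of "\<i> * osc G t x 1 N"] osc_bound[OF assms(1,2) _ assms(3), of 1]
  by (auto simp: tkdv_def norm_mult)

lemma tkdv_LIMSEQ:
  assumes "ac_profile B M G h" "t > 0"
  shows "(\<lambda>n. tkdv G t (real n) 0 x) \<longlonglongrightarrow> kdv G t x" "(\<lambda>n. tkdv G t (real n) 1 x) \<longlonglongrightarrow> kdvx G t x"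
  unfolding tkdv_def kdv_def kdvx_def power_0 power_one_right mult_1
  by (intro tendsto_intros osc_LIMSEQ[OF assms]; simp)+

text \<open>The factor \<open>x + 3 t p\<^sup>2\<close> that the operator puts under the integral is the derivative of the phase, so an integration by parts in \<open>p\<close> moves it to the profile.\<close>

lemma tkdv_vector_field:
  assumes prof: "ac_profile B M G h" and N: "N \<ge> 0"
  shows "x * tkdv G t N 0 x - 3 * t * tkdv G t N 2 x =
    Re (- \<i> * phase t x N * G N + \<i> * G 0 + \<i> * (LINT p:{0..N}|lborel. phase t x p * h p)) / pi"
proof -
  have cG: "continuous_on {0..N} G" using ac_profile_continuous[OF prof] by (rule continuous_on_subset) auto
  define P where "P p = - \<i> * phase t x p" for p
  have "integral {0..N} (\<lambda>p. of_real (x + 3 * t * p\<^sup>2) * phase t x p * G p) = P N * G N - P 0 * G 0 - (LINT p:{0..N}|lborel. P p * h p)"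
  proof (rule ac_integration_by_parts[OF prof])
    fix p
    have "(P has_vector_derivative - \<i> * (\<i> * of_real (x + 3 * t * p\<^sup>2) * phase t x p)) (at p within {0..N})"
      unfolding P_def by (intro has_vector_derivative_mult_right phase_has_derivative)
    then show "(P has_vector_derivative of_real (x + 3 * t * p\<^sup>2) * phase t x p) (at p within {0..N})"
      by (simp add: mult.assoc[symmetric])
  qed (auto intro!: continuous_intros N)
  also have "(LINT p:{0..N}|lborel. P p * h p) = - \<i> * (LINT p:{0..N}|lborel. phase t x p * h p)"
    unfolding P_def mult.assoc by (rule set_integral_mult_right)
  also have "integral {0..N} (\<lambda>p. of_real (x + 3 * t * p\<^sup>2) * phase t x p * G p) = of_real x * osc G t x 0 N + of_real (3 * t) * osc G t x 2 N"
    unfolding osc_def Henstock_Kurzweil_Integration.integral_mult_right[symmetric]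
    by (subst Henstock_Kurzweil_Integration.integral_add[symmetric])
       (auto intro!: integrable_continuous_interval continuous_intros cG integral_cong simp: algebra_simps)
  finally have *: "of_real x * osc G t x 0 N + of_real (3 * t) * osc G t x 2 N =
     - \<i> * phase t x N * G N + \<i> * G 0 + \<i> * (LINT p:{0..N}|lborel. phase t x p * h p)"
    by (simp add: P_def phase_def)
  have "x * tkdv G t N 0 x - 3 * t * tkdv G t N 2 x = Re (of_real x * osc G t x 0 N + of_real (3 * t) * osc G t x 2 N) / pi"
    by (simp add: tkdv_def field_simps)
  then show ?thesis unfolding * .
qed

lemma profile_window_L2:
  assumes prof: "ac_profile B M G h" and L: "L > 0"
  shows "set_integrable lborel {-L..L} (\<lambda>x. (cmod (LINT p:{0..N}|lborel. phase t x p * h p))\<^sup>2)"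
    "(LINT x:{-L..L}|lborel. (cmod (LINT p:{0..N}|lborel. phase t x p * h p))\<^sup>2) \<le> 4 * pi * M"
proof -
  note [measurable] = ac_profileD(3)[OF prof]
  let ?f = "\<lambda>p. indicator {0..N} p *\<^sub>R (iexp (t * p ^ 3) * h p)"
  have hi: "integrable lborel (\<lambda>p. indicator {0..N} p *\<^sub>R h p)" using ac_profile_integrable[OF prof] by (simp add: set_integrable_def)
  have f1: "integrable lborel ?f"
    by (rule Bochner_Integration.integrable_bound[OF hi]) (auto simp: norm_mult)
  have le: "(cmod (?f p))\<^sup>2 \<le> (cmod (h p))\<^sup>2" for p by (auto simp: indicator_def norm_mult)
  have f2: "integrable lborel (\<lambda>p. (cmod (?f p))\<^sup>2)"
  proof (rule Bochner_Integration.integrable_bound[OF ac_profileD(4)[OF prof]])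
    show "AE p in lborel. norm ((cmod (?f p))\<^sup>2) \<le> norm ((cmod (h p))\<^sup>2)" using le by (intro AE_I2) auto
  qed measurable
  have eq: "(LINT p|lborel. iexp (x * p) * ?f p) = (LINT p:{0..N}|lborel. phase t x p * h p)" for x
    unfolding set_lebesgue_integral_def
    by (rule Bochner_Integration.integral_cong) (auto simp: phase_def exp_add distrib_left indicator_def)
  show "set_integrable lborel {-L..L} (\<lambda>x. (cmod (LINT p:{0..N}|lborel. phase t x p * h p))\<^sup>2)"
    using fourier_window_L2(1)[OF f1 f2 L] unfolding eq .
  have "(LINT x:{-L..L}|lborel. (cmod (LINT p:{0..N}|lborel. phase t x p * h p))\<^sup>2) \<le> 4 * pi * (LINT p|lborel. (cmod (?f p))\<^sup>2)"
    using fourier_window_L2(2)[OF f1 f2 L] unfolding eq .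
  also have "\<dots> \<le> 4 * pi * M"
    using integral_mono[OF f2 ac_profileD(4)[OF prof] le] ac_profileD(5)[OF prof] by (intro mult_left_mono) auto
  finally show "(LINT x:{-L..L}|lborel. (cmod (LINT p:{0..N}|lborel. phase t x p * h p))\<^sup>2) \<le> 4 * pi * M" .
qed

text \<open>Integrating by parts once in \<open>x\<close> and using \<open>3 t w\<^sub>x\<^sub>x = x w - J w\<close>, the left-hand side is \<open>\<integral> w (J w) \<zeta>\<close> up to sign and a term
  \<open>\<integral> w\<^sup>2 \<zeta>''\<close>. In \<open>J w\<close> the boundary term at frequency \<open>N\<close> oscillates, has an antiderivative in \<open>x\<close> of size \<open>1 / N\<close> and is integrated by parts;
  the boundary term at frequency 0 is bounded by \<open>B\<close>, and \<open>h\<close> gives a function that is square integrable on the window.\<close>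

lemma virial_truncated:
  assumes prof: "ac_profile B M G h" and t: "t > 0" and L: "L > 0" and N: "N \<ge> 2 * qq t L"
    and z: "\<And>x. (\<zeta> has_real_derivative \<zeta>1 x) (at x)" "\<And>x. (\<zeta>1 has_real_derivative \<zeta>2 x) (at x)" "continuous_on UNIV \<zeta>2"
    and bd: "\<zeta> L = 0" "\<zeta> (-L) = 0" "\<zeta>1 L = 0" "\<zeta>1 (-L) = 0"
    and Z: "\<And>x. \<bar>\<zeta> x\<bar> \<le> Z" "\<And>x. \<bar>\<zeta>1 x\<bar> \<le> Z1" "\<And>x. \<bar>\<zeta>2 x\<bar> \<le> Z2"
    and m: "m \<ge> 0" "\<And>x. x \<in> {-L..L} \<Longrightarrow> \<zeta> x \<noteq> 0 \<or> \<zeta>2 x \<noteq> 0 \<Longrightarrow> Cosc t * (B + M + 1) / sqrt (qq t x) \<le> m"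
  defines "W \<equiv> Cosc t * (B + M + 1)"
  shows "\<bar>integral {-L..L} (\<lambda>x. (- 3 * t * (tkdv G t N 1 x)\<^sup>2 - x * (tkdv G t N 0 x)\<^sup>2) * \<zeta> x)\<bar>
     \<le> m * Z * (2 * L * B + L + 2 * pi * M) + 3 * t * m\<^sup>2 * Z2 * L + 2 * L * (W * sqrt (qq t L) * Z + W * Z1) * B / N"
proof -
  let ?I = "{-L..L}"
  define w where "w = tkdv G t N 0"
  define w1 where "w1 = tkdv G t N 1"
  define w2 where "w2 = tkdv G t N 2"
  have dw: "(w has_real_derivative w1 x) (at x)" "(w1 has_real_derivative w2 x) (at x)" for x
    unfolding w_def w1_def w2_def using tkdv_has_derivative[OF prof, of t N] by (metis One_nat_def Suc_1)+
  have w2d: "(w2 has_real_derivative tkdv G t N 3 x) (at x)" for x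
    unfolding w2_def using tkdv_has_derivative[OF prof, of t N 2] by (simp add: numeral_3_eq_3 numeral_2_eq_2)
  have cont: "continuous_on A f" if "\<And>x. (f has_real_derivative f' x) (at x)" for f f' :: "real \<Rightarrow> real" and A
    using that by (meson DERIV_continuous_on has_field_derivative_at_within)
  have cw: "continuous_on A w" "continuous_on A w1" "continuous_on A w2" "continuous_on A \<zeta>" "continuous_on A \<zeta>1" for A
    using cont[OF dw(1)] cont[OF dw(2)] cont[OF w2d] cont[OF z(1)] cont[OF z(2)] by auto
  have cz2: "continuous_on A \<zeta>2" for A using z(3) by (rule continuous_on_subset) simp
  note ci = cw cz2
  have ii: "f integrable_on ?I" if "continuous_on ?I f" for f :: "real \<Rightarrow> real" by (rule integrable_continuous_interval[OF that])
  have qx: "qq t x \<le> qq t L" if "x \<in> ?I" for x using qq_le[OF t order_refl, of x L] that by auto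
  have W0: "W \<ge> 0" unfolding W_def using Cosc_ge[OF t] ac_profileD(1,2)[OF prof] by auto
  note B0 = ac_profileD(1)[OF prof] and M0 = ac_profileD(2)[OF prof]
  have Z0: "Z \<ge> 0" "Z1 \<ge> 0" "Z2 \<ge> 0" using Z[of 0] by (auto intro: order_trans[OF abs_ge_zero])
  have wb: "\<bar>w x\<bar> \<le> W / sqrt (qq t x)" "\<bar>w1 x\<bar> \<le> W * sqrt (qq t L)" if "x \<in> ?I" for x
  proof -
    have N': "N \<ge> 2 * qq t x" using qx[OF that] N by linarith
    show "\<bar>w x\<bar> \<le> W / sqrt (qq t x)" unfolding w_def W_def by (rule tkdv_bound[OF prof t N'])
    have "\<bar>w1 x\<bar> \<le> W * sqrt (qq t x)" unfolding w1_def W_def by (rule tkdv_bound[OF prof t N'])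
    also have "\<dots> \<le> W * sqrt (qq t L)" using qx[OF that] W0 by (intro mult_left_mono) auto
    finally show "\<bar>w1 x\<bar> \<le> W * sqrt (qq t L)" .
  qed
  have wbW: "\<bar>w x\<bar> \<le> W" if "x \<in> ?I" for x
  proof -
    have "W / sqrt (qq t x) \<le> W / 1" using qq_ge_1[of t x] W0 by (intro divide_left_mono) auto
    then show ?thesis using wb(1)[OF that] by simp
  qed
  have wm: "\<bar>w x\<bar> \<le> m" if "x \<in> ?I" "\<zeta> x \<noteq> 0 \<or> \<zeta>2 x \<noteq> 0" for x
    using wb(1)[OF that(1)] m(2)[OF that] unfolding W_def by linarith
  define kk where "kk x = (LINT p:{0..N}|lborel. phase t x p * h p)" for x
  define b where "b x = Re (- \<i> * phase t x N * G N) / pi" for x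
  define r where "r x = Re (\<i> * G 0 + \<i> * kk x) / pi" for x
  have N0: "N > 0" using N qq_ge_1[of t L] by linarith
  have vf: "x * w x - 3 * t * w2 x = b x + r x" for x
    unfolding w_def w2_def b_def r_def kk_def tkdv_vector_field[OF prof less_imp_le[OF N0]]
    by (simp only: add.assoc plus_complex.sel add_divide_distrib)
  have bder: "((\<lambda>x. Re (- phase t x N * G N / of_real N) / pi) has_real_derivative b x) (at x)" for x
  proof -
    have "((\<lambda>z. exp (\<i> * (z * of_real N + of_real (t * N ^ 3)))) has_field_derivative \<i> * of_real N * phase t x N) (at (of_real x))"
      by (auto intro!: derivative_eq_intros simp: phase_def)
    from has_vector_derivative_real_field[OF this]
    have 1: "((\<lambda>x. phase t x N) has_vector_derivative \<i> * of_real N * phase t x N) (at x)" by (simp add: phase_def)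
    have "bounded_linear (\<lambda>z::complex. Re (- z * G N / of_real N) / pi)"
      by (intro bounded_linear_compose[OF bounded_linear_divide] bounded_linear_compose[OF bounded_linear_Re]
        bounded_linear_compose[OF bounded_linear_mult_left] bounded_linear_minus bounded_linear_ident)
    from bounded_linear.has_vector_derivative[OF this 1]
    have "((\<lambda>x. Re (- phase t x N * G N / of_real N) / pi) has_vector_derivative Re (- (\<i> * of_real N * phase t x N) * G N / of_real N) / pi) (at x)" .
    moreover have "Re (- (\<i> * of_real N * phase t x N) * G N / of_real N) / pi = b x"
      unfolding b_def using N0 by simp
    ultimately show ?thesis by (simp add: has_real_derivative_iff_has_vector_derivative)
  qed
  define \<beta> where "\<beta> x = Re (- phase t x N * G N / of_real N) / pi" for x
  have bder': "(\<beta> has_real_derivative b x) (at x)" for x using bder unfolding \<beta>_def .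
  have \<beta>b: "\<bar>\<beta> x\<bar> \<le> B / N" for x
    unfolding \<beta>_def by (rule Re_pi_le) (use N0 ac_profileD(6)[OF prof, of N] in \<open>auto simp: norm_mult norm_divide divide_right_mono\<close>)
  have cb: "continuous_on A b" for A unfolding b_def by (intro continuous_intros) auto
  have cr: "continuous_on A r" for A
  proof -
    have "r = (\<lambda>x. x * w x - 3 * t * w2 x - b x)" using vf by (auto simp: fun_eq_iff algebra_simps)
    then show ?thesis by (simp only:) (intro continuous_intros ci cb)
  qed
  note ci' = ci cb cr
  \<comment> \<open>integration by parts\<close>
  have I1: "integral ?I (\<lambda>x. - 3 * t * (w1 x)\<^sup>2 * \<zeta> x - 3 * t * w x * w2 x * \<zeta> x + 3 * t / 2 * (w x)\<^sup>2 * \<zeta>2 x) = 0"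
  proof -
    define f where "f x = - 3 * t * w x * w1 x * \<zeta> x + 3 * t / 2 * (w x)\<^sup>2 * \<zeta>1 x" for x
    have "((\<lambda>x. - 3 * t * (w1 x)\<^sup>2 * \<zeta> x - 3 * t * w x * w2 x * \<zeta> x + 3 * t / 2 * (w x)\<^sup>2 * \<zeta>2 x) has_integral f L - f (- L)) ?I"
    proof (rule fundamental_theorem_of_calculus)
      fix x
      have "(f has_real_derivative - 3 * t * (w1 x)\<^sup>2 * \<zeta> x - 3 * t * w x * w2 x * \<zeta> x + 3 * t / 2 * (w x)\<^sup>2 * \<zeta>2 x) (at x)"
        unfolding f_def
        by (rule DERIV_cong, (rule derivative_intros dw z)+) (simp add: power2_eq_square algebra_simps)
      then show "(f has_vector_derivative - 3 * t * (w1 x)\<^sup>2 * \<zeta> x - 3 * t * w x * w2 x * \<zeta> x + 3 * t / 2 * (w x)\<^sup>2 * \<zeta>2 x) (at x within ?I)"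
        by (simp add: has_real_derivative_iff_has_vector_derivative has_vector_derivative_at_within)
    qed (use L in auto)
    then show ?thesis by (simp add: integral_unique f_def bd)
  qed
  have split: "integral ?I (\<lambda>x. (- 3 * t * (w1 x)\<^sup>2 - x * (w x)\<^sup>2) * \<zeta> x) =
     - integral ?I (\<lambda>x. w x * \<zeta> x * b x) - integral ?I (\<lambda>x. w x * \<zeta> x * r x) - integral ?I (\<lambda>x. 3 * t / 2 * (w x)\<^sup>2 * \<zeta>2 x)"
  proof -
    have "integral ?I (\<lambda>x. (- 3 * t * (w1 x)\<^sup>2 - x * (w x)\<^sup>2) * \<zeta> x) =
      integral ?I (\<lambda>x. (- 3 * t * (w1 x)\<^sup>2 * \<zeta> x - 3 * t * w x * w2 x * \<zeta> x + 3 * t / 2 * (w x)\<^sup>2 * \<zeta>2 x)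
         - w x * \<zeta> x * b x - w x * \<zeta> x * r x - 3 * t / 2 * (w x)\<^sup>2 * \<zeta>2 x)"
    proof (rule integral_cong)
      fix x
      have "w x * \<zeta> x * b x + w x * \<zeta> x * r x = w x * \<zeta> x * (x * w x - 3 * t * w2 x)" unfolding vf by (simp add: algebra_simps)
      then show "(- 3 * t * (w1 x)\<^sup>2 - x * (w x)\<^sup>2) * \<zeta> x = (- 3 * t * (w1 x)\<^sup>2 * \<zeta> x - 3 * t * w x * w2 x * \<zeta> x + 3 * t / 2 * (w x)\<^sup>2 * \<zeta>2 x)
         - w x * \<zeta> x * b x - w x * \<zeta> x * r x - 3 * t / 2 * (w x)\<^sup>2 * \<zeta>2 x"
        by (simp add: power2_eq_square algebra_simps)
    qed
    also have "\<dots> = integral ?I (\<lambda>x. - 3 * t * (w1 x)\<^sup>2 * \<zeta> x - 3 * t * w x * w2 x * \<zeta> x + 3 * t / 2 * (w x)\<^sup>2 * \<zeta>2 x)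
        - integral ?I (\<lambda>x. w x * \<zeta> x * b x) - integral ?I (\<lambda>x. w x * \<zeta> x * r x) - integral ?I (\<lambda>x. 3 * t / 2 * (w x)\<^sup>2 * \<zeta>2 x)"
      by (subst Henstock_Kurzweil_Integration.integral_diff, (rule ii, intro continuous_intros ci')+)+ (rule refl)
    finally show ?thesis unfolding I1 by simp
  qed
  have T1: "\<bar>integral ?I (\<lambda>x. w x * \<zeta> x * b x)\<bar> \<le> 2 * L * (W * sqrt (qq t L) * Z + W * Z1) * B / N"
  proof -
    have "((\<lambda>x. w x * \<zeta> x * b x + (w1 x * \<zeta> x + w x * \<zeta>1 x) * \<beta> x) has_integral (w L * \<zeta> L * \<beta> L) - (w (-L) * \<zeta> (-L) * \<beta> (-L))) ?I"
    proof (rule fundamental_theorem_of_calculus)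
      fix x
      have "((\<lambda>x. w x * \<zeta> x * \<beta> x) has_real_derivative w x * \<zeta> x * b x + (w1 x * \<zeta> x + w x * \<zeta>1 x) * \<beta> x) (at x)"
        by (rule DERIV_cong, (rule derivative_intros dw z bder')+) (simp add: algebra_simps)
      then show "((\<lambda>x. w x * \<zeta> x * \<beta> x) has_vector_derivative w x * \<zeta> x * b x + (w1 x * \<zeta> x + w x * \<zeta>1 x) * \<beta> x) (at x within ?I)"
        by (simp add: has_real_derivative_iff_has_vector_derivative has_vector_derivative_at_within)
    qed (use L in auto)
    then have "integral ?I (\<lambda>x. w x * \<zeta> x * b x + (w1 x * \<zeta> x + w x * \<zeta>1 x) * \<beta> x) = 0" by (simp add: integral_unique bd)
    moreover have "integral ?I (\<lambda>x. w x * \<zeta> x * b x + (w1 x * \<zeta> x + w x * \<zeta>1 x) * \<beta> x)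
        = integral ?I (\<lambda>x. w x * \<zeta> x * b x) + integral ?I (\<lambda>x. (w1 x * \<zeta> x + w x * \<zeta>1 x) * \<beta> x)"
      by (rule Henstock_Kurzweil_Integration.integral_add) (rule ii, intro continuous_intros ci' cont[OF bder'])+
    ultimately have "\<bar>integral ?I (\<lambda>x. w x * \<zeta> x * b x)\<bar> = \<bar>integral ?I (\<lambda>x. (w1 x * \<zeta> x + w x * \<zeta>1 x) * \<beta> x)\<bar>" by linarith
    also have "\<dots> \<le> integral ?I (\<lambda>x. (W * sqrt (qq t L) * Z + W * Z1) * (B / N))"
    proof (rule integral_norm_bound_integral[where 'a=real, unfolded real_norm_def])
      fix x assume x: "x \<in> ?I"
      have "\<bar>w1 x * \<zeta> x + w x * \<zeta>1 x\<bar> \<le> \<bar>w1 x\<bar> * \<bar>\<zeta> x\<bar> + \<bar>w x\<bar> * \<bar>\<zeta>1 x\<bar>" using abs_triangle_ineq[of "w1 x * \<zeta> x" "w x * \<zeta>1 x"] by (simp add: abs_mult)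
      also have "\<dots> \<le> W * sqrt (qq t L) * Z + W * Z1"
        using x W0 Z0 qq_ge_1[of t L] by (intro add_mono mult_mono wb wbW Z) auto
      finally show "\<bar>(w1 x * \<zeta> x + w x * \<zeta>1 x) * \<beta> x\<bar> \<le> (W * sqrt (qq t L) * Z + W * Z1) * (B / N)"
        unfolding abs_mult using \<beta>b by (intro mult_mono) auto
    qed (rule ii, intro continuous_intros ci' cont[OF bder'])+
    also have "\<dots> = 2 * L * (W * sqrt (qq t L) * Z + W * Z1) * B / N" using L by simp
    finally show ?thesis .
  qed
  have T2: "\<bar>integral ?I (\<lambda>x. w x * \<zeta> x * r x)\<bar> \<le> m * Z * (2 * L * B + L + 2 * pi * M)"
  proof -
    have rb: "\<bar>r x\<bar> \<le> B + (1 + (cmod (kk x))\<^sup>2) / 2" for x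
      unfolding r_def
    proof (rule Re_pi_le)
      have "cmod (\<i> * G 0 + \<i> * kk x) \<le> cmod (G 0) + cmod (kk x)" using norm_triangle_ineq[of "\<i> * G 0" "\<i> * kk x"] by (simp add: norm_mult)
      moreover have "cmod (kk x) \<le> (1 + (cmod (kk x))\<^sup>2) / 2"
        using sum_squares_ge_zero[of "cmod (kk x) - 1" 0] by (simp add: power2_eq_square algebra_simps)
      ultimately show "cmod (\<i> * G 0 + \<i> * kk x) \<le> B + (1 + (cmod (kk x))\<^sup>2) / 2"
        using ac_profileD(6)[OF prof order_refl] by linarith
    qed
    have kki: "(\<lambda>x. (cmod (kk x))\<^sup>2) integrable_on ?I" "integral ?I (\<lambda>x. (cmod (kk x))\<^sup>2) \<le> 4 * pi * M"
      using set_borel_integral_eq_integral[OF profile_window_L2(1)[OF prof L, of N t]] profile_window_L2(2)[OF prof L, of N t]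
      unfolding kk_def by auto
    have rhsi: "((\<lambda>x. m * Z * (B + 1 / 2) + m * Z / 2 * (cmod (kk x))\<^sup>2) has_integral
       (m * Z * (B + 1 / 2) * (2 * L) + m * Z / 2 * integral ?I (\<lambda>x. (cmod (kk x))\<^sup>2))) ?I"
      using has_integral_add[OF has_integral_const_real[of "m * Z * (B + 1 / 2)" "-L" L] has_integral_mult_right[OF integrable_integral[OF kki(1)], of "m * Z / 2"]] L
      by (simp add: mult.commute)
    have "\<bar>integral ?I (\<lambda>x. w x * \<zeta> x * r x)\<bar> \<le> integral ?I (\<lambda>x. m * Z * (B + 1 / 2) + m * Z / 2 * (cmod (kk x))\<^sup>2)"
    proof (rule integral_norm_bound_integral[where 'a=real, unfolded real_norm_def])
      fix x assume x: "x \<in> ?I"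
      have "\<bar>w x * \<zeta> x\<bar> \<le> m * Z"
      proof (cases "\<zeta> x = 0")
        case False
        then show ?thesis unfolding abs_mult by (intro mult_mono wm x Z m) auto
      qed (use m Z0 in auto)
      then have "\<bar>w x * \<zeta> x\<bar> * \<bar>r x\<bar> \<le> m * Z * (B + (1 + (cmod (kk x))\<^sup>2) / 2)"
        using m Z0 by (intro mult_mono rb) auto
      then show "\<bar>w x * \<zeta> x * r x\<bar> \<le> m * Z * (B + 1 / 2) + m * Z / 2 * (cmod (kk x))\<^sup>2"
        by (simp add: abs_mult algebra_simps add_divide_distrib)
    next
      show "(\<lambda>x. w x * \<zeta> x * r x) integrable_on ?I" by (rule ii, intro continuous_intros ci')
      show "(\<lambda>x. m * Z * (B + 1 / 2) + m * Z / 2 * (cmod (kk x))\<^sup>2) integrable_on ?I" using rhsi by (rule has_integral_integrable)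
    qed
    also have "\<dots> = m * Z * (B + 1 / 2) * (2 * L) + m * Z / 2 * integral ?I (\<lambda>x. (cmod (kk x))\<^sup>2)"
      using rhsi by (rule integral_unique)
    also have "\<dots> \<le> m * Z * (B + 1 / 2) * (2 * L) + m * Z / 2 * (4 * pi * M)"
      using m Z0 by (intro add_left_mono mult_left_mono kki) auto
    finally show ?thesis by (simp add: algebra_simps)
  qed
  have T3: "\<bar>integral ?I (\<lambda>x. 3 * t / 2 * (w x)\<^sup>2 * \<zeta>2 x)\<bar> \<le> 3 * t * m\<^sup>2 * Z2 * L"
  proof -
    have "\<bar>integral ?I (\<lambda>x. 3 * t / 2 * (w x)\<^sup>2 * \<zeta>2 x)\<bar> \<le> integral ?I (\<lambda>x. 3 * t / 2 * m\<^sup>2 * Z2)"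
    proof (rule integral_norm_bound_integral[where 'a=real, unfolded real_norm_def])
      fix x assume x: "x \<in> ?I"
      have "(w x)\<^sup>2 * \<bar>\<zeta>2 x\<bar> \<le> m\<^sup>2 * Z2"
      proof (cases "\<zeta>2 x = 0")
        case False
        then have "(w x)\<^sup>2 \<le> m\<^sup>2" using wm[OF x] m by (intro abs_le_square_iff[THEN iffD1]) auto
        then show ?thesis by (intro mult_mono Z) auto
      qed (use m Z0 in auto)
      then have "3 * t / 2 * ((w x)\<^sup>2 * \<bar>\<zeta>2 x\<bar>) \<le> 3 * t / 2 * (m\<^sup>2 * Z2)" by (rule mult_left_mono) (use t in auto)
      then show "\<bar>3 * t / 2 * (w x)\<^sup>2 * \<zeta>2 x\<bar> \<le> 3 * t / 2 * m\<^sup>2 * Z2" using t by (simp add: abs_mult mult.assoc)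
    qed (rule ii, intro continuous_intros ci')+
    also have "\<dots> = 3 * t * m\<^sup>2 * Z2 * L" using L by simp
    finally show ?thesis .
  qed
  have "\<bar>integral ?I (\<lambda>x. (- 3 * t * (w1 x)\<^sup>2 - x * (w x)\<^sup>2) * \<zeta> x)\<bar>
     \<le> m * Z * (2 * L * B + L + 2 * pi * M) + 3 * t * m\<^sup>2 * Z2 * L + 2 * L * (W * sqrt (qq t L) * Z + W * Z1) * B / N"
    unfolding split using T1 T2 T3 by linarith
  then show ?thesis unfolding w_def w1_def .
qed

text \<open>Only the first bound on the right, linear in the size \<open>m\<close> of \<open>w\<close> on the support of \<open>\<zeta>\<close> and in the length of the window, carries the jump and
  the derivative of the profile. The two summands on the left, taken separately, would cost a factor quadratic in \<open>L\<close>.\<close>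

lemma virial:
  assumes prof: "ac_profile B M G h" and t: "t > 0" and L: "L > 0"
    and z: "\<And>x. (\<zeta> has_real_derivative \<zeta>1 x) (at x)" "\<And>x. (\<zeta>1 has_real_derivative \<zeta>2 x) (at x)" "continuous_on UNIV \<zeta>2"
    and bd: "\<zeta> L = 0" "\<zeta> (-L) = 0" "\<zeta>1 L = 0" "\<zeta>1 (-L) = 0"
    and Z: "\<And>x. \<bar>\<zeta> x\<bar> \<le> Z" "\<And>x. \<bar>\<zeta>1 x\<bar> \<le> Z1" "\<And>x. \<bar>\<zeta>2 x\<bar> \<le> Z2"
    and m: "m \<ge> 0" "\<And>x. x \<in> {-L..L} \<Longrightarrow> \<zeta> x \<noteq> 0 \<or> \<zeta>2 x \<noteq> 0 \<Longrightarrow> Cosc t * (B + M + 1) / sqrt (qq t x) \<le> m"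
  shows "\<bar>integral {-L..L} (\<lambda>x. (- 3 * t * (kdvx G t x)\<^sup>2 - x * (kdv G t x)\<^sup>2) * \<zeta> x)\<bar>
     \<le> m * Z * (2 * L * B + L + 2 * pi * M) + 3 * t * m\<^sup>2 * Z2 * L"
proof -
  let ?I = "{-L..L}"
  define W where "W = Cosc t * (B + M + 1)"
  have W0: "W \<ge> 0" unfolding W_def using Cosc_ge[OF t] ac_profileD(1,2)[OF prof] by auto
  obtain n0 :: nat where n0: "2 * qq t L \<le> real n0" using real_arch_simple by blast
  let ?f = "\<lambda>n x. (- 3 * t * (tkdv G t (real (n + n0)) 1 x)\<^sup>2 - x * (tkdv G t (real (n + n0)) 0 x)\<^sup>2) * \<zeta> x"
  let ?R = "\<lambda>n. m * Z * (2 * L * B + L + 2 * pi * M) + 3 * t * m\<^sup>2 * Z2 * L + 2 * L * (W * sqrt (qq t L) * Z + W * Z1) * B / real (n + n0)"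
  have cz: "continuous_on ?I \<zeta>" using z(1) by (meson DERIV_continuous_on has_field_derivative_at_within)
  have ct: "continuous_on ?I (tkdv G t N k)" for N k using tkdv_has_derivative[OF prof] by (meson DERIV_continuous_on)
  have "(\<lambda>n. integral ?I (?f n)) \<longlonglongrightarrow> integral ?I (\<lambda>x. (- 3 * t * (kdvx G t x)\<^sup>2 - x * (kdv G t x)\<^sup>2) * \<zeta> x)"
  proof (rule dominated_convergence(2))
    show "?f n integrable_on ?I" for n by (intro integrable_continuous_interval continuous_intros ct cz)
    show "(\<lambda>x::real. (3 * t * (W * sqrt (qq t L))\<^sup>2 + L * W\<^sup>2) * Z) integrable_on ?I"
      by (intro integrable_continuous_interval continuous_intros)
    fix n x assume x: "x \<in> ?I"
    have qx: "qq t x \<le> qq t L" using qq_le[OF t order_refl, of x L] x by auto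
    then have N: "2 * qq t x \<le> real (n + n0)" using n0 by simp
    have "\<bar>tkdv G t (real (n + n0)) 0 x\<bar> \<le> W / sqrt (qq t x)" using tkdv_bound(1)[OF prof t N] by (simp add: W_def)
    also have "\<dots> \<le> W / 1" using qq_ge_1[of t x] W0 by (intro divide_left_mono) auto
    finally have b0: "(tkdv G t (real (n + n0)) 0 x)\<^sup>2 \<le> W\<^sup>2" using W0 by (intro abs_le_square_iff[THEN iffD1]) auto
    have "\<bar>tkdv G t (real (n + n0)) 1 x\<bar> \<le> W * sqrt (qq t x)" using tkdv_bound(2)[OF prof t N] by (simp add: W_def)
    also have "\<dots> \<le> W * sqrt (qq t L)" using qx W0 by (intro mult_left_mono) auto
    finally have b1: "(tkdv G t (real (n + n0)) 1 x)\<^sup>2 \<le> (W * sqrt (qq t L))\<^sup>2" by (metis abs_ge_self abs_le_square_iff order_trans)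
    have "\<bar>- 3 * t * (tkdv G t (real (n + n0)) 1 x)\<^sup>2 - x * (tkdv G t (real (n + n0)) 0 x)\<^sup>2\<bar> \<le>
      3 * t * (tkdv G t (real (n + n0)) 1 x)\<^sup>2 + \<bar>x\<bar> * (tkdv G t (real (n + n0)) 0 x)\<^sup>2"
      using t abs_triangle_ineq4[of "- 3 * t * (tkdv G t (real (n + n0)) 1 x)\<^sup>2" "x * (tkdv G t (real (n + n0)) 0 x)\<^sup>2"] by (simp add: abs_mult)
    also have "\<dots> \<le> 3 * t * (W * sqrt (qq t L))\<^sup>2 + L * W\<^sup>2"
      using t x b0 b1 by (intro add_mono mult_mono mult_left_mono) auto
    finally show "norm (?f n x) \<le> (3 * t * (W * sqrt (qq t L))\<^sup>2 + L * W\<^sup>2) * Z"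
      unfolding real_norm_def abs_mult by (intro mult_mono Z) auto
  next
    fix x assume "x \<in> ?I"
    show "(\<lambda>n. ?f n x) \<longlonglongrightarrow> (- 3 * t * (kdvx G t x)\<^sup>2 - x * (kdv G t x)\<^sup>2) * \<zeta> x"
      by (intro tendsto_intros LIMSEQ_ignore_initial_segment[OF tkdv_LIMSEQ(1)[OF prof t]] LIMSEQ_ignore_initial_segment[OF tkdv_LIMSEQ(2)[OF prof t]])
  qed
  then have l1: "(\<lambda>n. \<bar>integral ?I (?f n)\<bar>) \<longlonglongrightarrow> \<bar>integral ?I (\<lambda>x. (- 3 * t * (kdvx G t x)\<^sup>2 - x * (kdv G t x)\<^sup>2) * \<zeta> x)\<bar>"
    by (rule tendsto_rabs)
  have "(\<lambda>n. 2 * L * (W * sqrt (qq t L) * Z + W * Z1) * B / real (n + n0)) \<longlonglongrightarrow> 0"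
    by (rule LIMSEQ_ignore_initial_segment) real_asymp
  then have "?R \<longlonglongrightarrow> m * Z * (2 * L * B + L + 2 * pi * M) + 3 * t * m\<^sup>2 * Z2 * L + 0"
    by (intro tendsto_add tendsto_const)
  then have l2: "?R \<longlonglongrightarrow> m * Z * (2 * L * B + L + 2 * pi * M) + 3 * t * m\<^sup>2 * Z2 * L" by simp
  have "\<bar>integral ?I (?f n)\<bar> \<le> ?R n" for n
    using n0 virial_truncated[OF prof t L _ z bd Z m, of "real (n + n0)"] unfolding W_def by simp
  then show ?thesis by (intro LIMSEQ_le[OF l1 l2]) blast
qed

section \<open>Mollification and cutoffs\<close>

lemma iter_deriv_has_derivative:
  fixes f :: "real \<Rightarrow> real"
  assumes "smooth f"
  shows "((dir_deriv 1 ^^ k) f has_real_derivative (dir_deriv 1 ^^ Suc k) f x) (at x)"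
proof -
  have "smooth ((dir_deriv 1 ^^ k) f)" by (induction k) (auto intro: assms smooth_dir_deriv)
  from smooth_has_vector_derivative[OF this] show ?thesis
    by (simp add: has_real_derivative_iff_has_vector_derivative)
qed

lemma iter_deriv_continuous:
  fixes f :: "real \<Rightarrow> real"
  assumes "smooth f" shows "continuous_on A ((dir_deriv 1 ^^ k) f)"
  using iter_deriv_has_derivative[OF assms] by (meson DERIV_continuous_on has_field_derivative_at_within)

lemma iter_deriv_eq_0:
  fixes f :: "real \<Rightarrow> real"
  assumes "open U" "\<And>x. x \<in> U \<Longrightarrow> f x = c" "x \<in> U"
  shows "(dir_deriv 1 ^^ Suc k) f x = 0"
  using assms(3)
proof (induction k arbitrary: x)
  case 0
  have "((\<lambda>x. c) has_vector_derivative 0) (at x)" by simp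
  then have "(f has_vector_derivative 0) (at x)"
    by (rule has_vector_derivative_transform_within_open[OF _ assms(1) 0]) (use assms(2) in auto)
  then show ?case by (auto dest: dir_deriv_eq_vector)
next
  case (Suc k)
  have "((\<lambda>x. 0) has_vector_derivative 0) (at x)" by simp
  then have "((dir_deriv 1 ^^ Suc k) f has_vector_derivative 0) (at x)"
    by (rule has_vector_derivative_transform_within_open[OF _ assms(1) Suc.prems]) (use Suc.IH in auto)
  then show ?case by (auto dest: dir_deriv_eq_vector)
qed

lemma iter_deriv_bounded:
  fixes f :: "real \<Rightarrow> real"
  assumes "smooth f" "\<And>x. x \<notin> {l..r} \<Longrightarrow> f x = 0"
  obtains C where "C \<ge> 0" "\<And>x. \<bar>(dir_deriv 1 ^^ k) f x\<bar> \<le> C"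
proof -
  from compact_imp_bounded[OF compact_continuous_image[OF iter_deriv_continuous[OF assms(1), of "{l..r}" k] compact_Icc]]
  obtain C where C: "\<And>x. x \<in> {l..r} \<Longrightarrow> \<bar>(dir_deriv 1 ^^ k) f x\<bar> \<le> C"
    unfolding bounded_iff real_norm_def by (meson imageI)
  have z: "(dir_deriv 1 ^^ k) f x = 0" if "x \<notin> {l..r}" for x
  proof (cases k)
    case 0 then show ?thesis using assms(2)[OF that] by simp
  next
    case (Suc j)
    have "open (- {l..r})" by (intro open_Compl closed_atLeastAtMost)
    then show ?thesis unfolding Suc by (rule iter_deriv_eq_0[of _ _ 0]) (use assms(2) that in auto)
  qed
  have "\<bar>(dir_deriv 1 ^^ k) f x\<bar> \<le> max C 0" for x
    using C[of x] z[of x] by (cases "x \<in> {l..r}") auto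
  then show ?thesis using that[of "max C 0"] by auto
qed

text \<open>The \<open>k\<close>-th derivative of the mollifier \<open>bump (y / d) / d\<close>.\<close>

definition moll :: "nat \<Rightarrow> real \<Rightarrow> real \<Rightarrow> real" where
  "moll k d y = (dir_deriv 1 ^^ k) bump (y / d) / d ^ Suc k"

lemma moll_has_derivative:
  assumes "d > 0" shows "(moll k d has_real_derivative moll (Suc k) d y) (at y)"
proof -
  have "((\<lambda>y. (dir_deriv 1 ^^ k) bump (y / d)) has_real_derivative (dir_deriv 1 ^^ Suc k) bump (y / d) * (1 / d)) (at y)"
    by (rule DERIV_chain2[OF iter_deriv_has_derivative[OF smooth_bump]])
       (use assms in \<open>auto intro!: derivative_eq_intros\<close>)
  from DERIV_cdivide[OF this, of "d ^ Suc k"] show ?thesis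
    unfolding moll_def by (simp add: mult.commute)
qed

lemma moll_eq_0:
  assumes "d > 0" "y < 0 \<or> y > d" shows "moll k d y = 0"
proof -
  have o: "open (- {0..1::real})" by (intro open_Compl closed_atLeastAtMost)
  have m: "y / d \<in> - {0..1}" using assms by (auto simp: field_simps)
  have "(dir_deriv 1 ^^ k) bump (y / d) = 0"
  proof (cases k)
    case 0 then show ?thesis using m bump_eq_0[of "y / d"] by auto
  next
    case (Suc j)
    show ?thesis unfolding Suc
      by (rule iter_deriv_eq_0[OF o _ m, of _ 0]) (use bump_eq_0 in auto)
  qed
  then show ?thesis by (simp add: moll_def)
qed

lemma moll_continuous: "continuous_on A (moll k d)" if "d > 0"
  using moll_has_derivative[OF that] by (meson DERIV_continuous_on has_field_derivative_at_within)

lemma moll_continuous_compose [continuous_intros]: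
  "d > 0 \<Longrightarrow> continuous_on A f \<Longrightarrow> continuous_on A (\<lambda>x. moll k d (f x))"
  by (rule continuous_on_compose2[OF moll_continuous[of d UNIV k]]) auto

text \<open>For \<open>\<bar>x\<bar> \<le> L - 2\<close> and \<open>d \<le> 1\<close> the window contains the support of the mollifier, so this is the \<open>k\<close>-th derivative of a convolution on the line.\<close>

definition mollify :: "nat \<Rightarrow> real \<Rightarrow> real \<Rightarrow> (real \<Rightarrow> real) \<Rightarrow> real \<Rightarrow> real" where
  "mollify k d L g x = integral {-L..L} (\<lambda>y. g y * moll k d (x - y))"

lemma mollify_has_derivative:
  assumes "d > 0" "continuous_on UNIV g"
  shows "(mollify k d L g has_real_derivative mollify (Suc k) d L g x) (at x)"
proof -
  have cg: "continuous_on A g" for A using assms(2) by (rule continuous_on_subset) simp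
  have "((\<lambda>x. integral (cbox (-L) L) (\<lambda>y. g y * moll k d (x - y))) has_field_derivative
      integral (cbox (-L) L) (\<lambda>y. g y * moll (Suc k) d (x - y))) (at x within UNIV)"
  proof (rule leibniz_rule_field_derivative)
    fix x y
    have "((\<lambda>x. moll k d (x - y)) has_real_derivative moll (Suc k) d (x - y) * 1) (at x)"
      by (rule DERIV_chain2[OF moll_has_derivative[OF assms(1)]]) (auto intro!: derivative_eq_intros)
    then show "((\<lambda>x. g y * moll k d (x - y)) has_field_derivative g y * moll (Suc k) d (x - y)) (at x within UNIV)"
      by (auto intro: DERIV_cmult)
  next
    fix x show "(\<lambda>y. g y * moll k d (x - y)) integrable_on cbox (-L) L"
      by (intro integrable_continuous continuous_intros cg assms)
    show "continuous_on (UNIV \<times> cbox (-L) L) (\<lambda>(x, y). g y * moll (Suc k) d (x - y))"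
      unfolding split_beta by (intro continuous_intros assms continuous_on_compose2[OF assms(2)]) auto
  qed auto
  then show ?thesis unfolding mollify_def[abs_def] by simp
qed

lemma mollify_joint_continuous:
  assumes "d > 0" "continuous_on (I \<times> UNIV) (\<lambda>(t, x). g t x)"
  shows "continuous_on (I \<times> UNIV) (\<lambda>(t::real, x). mollify k d L (g t) x)"
proof -
  have "continuous_on ((I \<times> (UNIV::real set)) \<times> cbox (-L) L) (\<lambda>w. (\<lambda>(t, x). g t x) (fst (fst w), snd w))"
    by (rule continuous_on_compose2[OF assms(2)]) (auto intro!: continuous_intros)
  then have "continuous_on ((I \<times> UNIV) \<times> cbox (-L) L) (\<lambda>(z, y). g (fst z) y * moll k d (snd z - y))"
    unfolding split_beta by (intro continuous_intros assms) auto
  from integral_continuous_on_param[OF this] show ?thesis unfolding mollify_def split_beta by simp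
qed

lemma mollify_integral_eq:
  assumes "0 < d" "d \<le> 1" "continuous_on UNIV g" "\<bar>x\<bar> \<le> L - 2"
  shows "mollify 0 d L g x = (LINT z|lborel. bump z *\<^sub>R g (x + (- d) * z))"
proof -
  have c: "continuous_on A (\<lambda>y. g y * moll 0 d (x - y))" for A
    by (intro continuous_intros assms continuous_on_subset[OF assms(3)]) auto
  have "mollify 0 d L g x = (LINT y:{-L..L}|lborel. g y * moll 0 d (x - y))"
    unfolding mollify_def by (rule set_borel_integral_eq_integral(2)[symmetric]) (rule borel_integrable_atLeastAtMost'[OF c])
  also have "\<dots> = (LINT y|lborel. (bump ((x - y) / d) / d) *\<^sub>R g y)"
    unfolding set_lebesgue_integral_def
  proof (rule Bochner_Integration.integral_cong[OF refl])
    fix y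
    show "indicator {-L..L} y *\<^sub>R (g y * moll 0 d (x - y)) = (bump ((x - y) / d) / d) *\<^sub>R g y"
    proof (cases "y \<in> {-L..L}")
      case False
      then have "x - y < 0 \<or> x - y > d" using assms by auto
      then have "moll 0 d (x - y) = 0" by (rule moll_eq_0[OF assms(1)])
      then show ?thesis using False by (auto simp: moll_def)
    qed (simp add: moll_def)
  qed
  also have "\<dots> = (LINT z|lborel. bump z *\<^sub>R g (x + (- d) * z))" by (rule LINT_bump_scaled(2)[OF assms(1)])
  finally show ?thesis .
qed

lemma mollify_bound:
  assumes "0 < d" "d \<le> 1" "continuous_on UNIV g" "\<bar>x\<bar> \<le> L - 2" "\<And>y. \<bar>y\<bar> \<le> L \<Longrightarrow> \<bar>g y\<bar> \<le> C"
  shows "\<bar>mollify 0 d L g x\<bar> \<le> C"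
proof -
  have "norm (LINT z|lborel. bump z *\<^sub>R g (x + (- d) * z)) \<le> (LINT z|lborel. bump z *\<^sub>R C)"
  proof (rule Bochner_Integration.integral_norm_bound_integral)
    have le: "\<bar>bump z *\<^sub>R g (x + (- d) * z)\<bar> \<le> bump z *\<^sub>R C" for z
    proof (cases "z \<in> {0..1}")
      case True
      then have "d * z \<le> 1" "0 \<le> d * z" using assms(1,2) by (auto simp: mult_le_one)
      then have "\<bar>g (x + (- d) * z)\<bar> \<le> C" using assms(4) by (intro assms(5)) auto
      then show ?thesis using bump_nonneg[of z] by (simp add: abs_mult mult_left_mono)
    next
      case False
      then have "bump z = 0" by (intro bump_eq_0) auto
      then show ?thesis by simp
    qed
    then show "norm (bump z *\<^sub>R g (x + (- d) * z)) \<le> bump z *\<^sub>R C" for z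
      unfolding real_norm_def .
    show i: "integrable lborel (\<lambda>z. bump z *\<^sub>R C)" using integrable_bump by simp
    have "continuous_on UNIV (\<lambda>z. g (x + (- d) * z))"
      by (rule continuous_on_compose2[OF assms(3)]) (auto intro!: continuous_intros)
    then have "(\<lambda>z. bump z *\<^sub>R g (x + (- d) * z)) \<in> borel_measurable borel"
      by (intro borel_measurable_scaleR borel_measurable_continuous_onI) (auto intro: smooth_continuous_on[OF smooth_bump])
    then show "integrable lborel (\<lambda>z. bump z *\<^sub>R g (x + (- d) * z))"
      by (intro Bochner_Integration.integrable_bound[OF i]) (use order_trans[OF le abs_ge_self] in auto)
  qed
  then show ?thesis unfolding mollify_integral_eq[OF assms(1-4)] LINT_bump real_norm_def .
qed

lemma mollify_tendsto:
  assumes "continuous_on UNIV g" "\<bar>x\<bar> \<le> L - 2"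
  shows "(\<lambda>n. mollify 0 (1 / real (Suc n)) L g x) \<longlonglongrightarrow> g x"
proof -
  have "(\<lambda>n. LINT z|lborel. bump z *\<^sub>R g (x + (- (1 / real (Suc n))) * z)) \<longlonglongrightarrow> g x"
  proof (rule bump_average_tendsto[where l="x-1" and r="x+1"])
    show "continuous_on {x-1..x+1} g" using assms(1) by (rule continuous_on_subset) simp
    show "(\<lambda>n. - (1 / real (Suc n))) \<longlonglongrightarrow> 0" by real_asymp
    fix n and z :: real assume z: "0 \<le> z" "z \<le> 1"
    have "1 / real (Suc n) * z \<le> 1" "0 \<le> 1 / real (Suc n) * z" using z by (auto intro!: mult_le_one)
    then show "x + (- (1 / real (Suc n))) * z \<in> {x-1..x+1}" by auto
  qed auto
  then show ?thesis using mollify_integral_eq[OF _ _ assms, of "1 / real (Suc n)" for n] by simp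
qed

lemma mollify_by_parts:
  assumes "0 < d" "d \<le> 1" "\<And>y. (g has_real_derivative g' y) (at y)" "continuous_on UNIV g'" "\<bar>x\<bar> \<le> L - 2"
  shows "mollify 1 d L g x = mollify 0 d L g' x"
proof -
  have L: "L \<ge> 2" using assms(5) by linarith
  have cg: "continuous_on A g" for A using assms(3) by (meson DERIV_continuous_on has_field_derivative_at_within)
  have cg': "continuous_on A g'" for A using assms(4) by (rule continuous_on_subset) simp
  have "((\<lambda>y. g' y * moll 0 d (x - y) - g y * moll 1 d (x - y)) has_integral g L * moll 0 d (x - L) - g (-L) * moll 0 d (x - (-L))) {-L..L}"
  proof (rule fundamental_theorem_of_calculus)
    fix y
    have "((\<lambda>y. moll 0 d (x - y)) has_real_derivative moll (Suc 0) d (x - y) * (-1)) (at y)"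
      by (rule DERIV_chain2[OF moll_has_derivative[OF assms(1)]]) (auto intro!: derivative_eq_intros)
    from DERIV_mult[OF assms(3) this]
    have "((\<lambda>y. g y * moll 0 d (x - y)) has_real_derivative g' y * moll 0 d (x - y) - g y * moll 1 d (x - y)) (at y)"
      by (simp add: algebra_simps)
    then show "((\<lambda>y. g y * moll 0 d (x - y)) has_vector_derivative g' y * moll 0 d (x - y) - g y * moll 1 d (x - y)) (at y within {-L..L})"
      by (simp add: has_real_derivative_iff_has_vector_derivative has_vector_derivative_at_within)
  qed (use L in auto)
  moreover have "moll 0 d (x - L) = 0" "moll 0 d (x - (-L)) = 0" using assms by (auto intro!: moll_eq_0)
  ultimately have "integral {-L..L} (\<lambda>y. g' y * moll 0 d (x - y) - g y * moll 1 d (x - y)) = 0"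
    by (simp add: integral_unique)
  moreover have "integral {-L..L} (\<lambda>y. g' y * moll 0 d (x - y) - g y * moll 1 d (x - y)) = mollify 0 d L g' x - mollify 1 d L g x"
    unfolding mollify_def
    by (rule Henstock_Kurzweil_Integration.integral_diff) (intro integrable_continuous_interval continuous_intros cg cg' assms)+
  ultimately show ?thesis by simp
qed

text \<open>The \<open>k\<close>-th derivative in \<open>x\<close> of a cutoff to \<open>\<bar>x\<bar> \<le> 2 R t\<close>. As its edges move along rays, its derivative in time is
  \<open>- x / t\<close> times the one in \<open>x\<close>: the term that completes the virial.\<close>

definition chi :: "real \<Rightarrow> nat \<Rightarrow> real \<Rightarrow> real \<Rightarrow> real" where
  "chi R k t x = (dir_deriv 1 ^^ k) (plateau (-2) 2 1) (x / (R * t)) / (R * t) ^ k"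

lemma chi_has_derivative:
  assumes "R > 0" "t > 0" shows "(chi R k t has_real_derivative chi R (Suc k) t x) (at x)"
proof -
  have "((\<lambda>x. (dir_deriv 1 ^^ k) (plateau (-2) 2 1) (x / (R * t))) has_real_derivative (dir_deriv 1 ^^ Suc k) (plateau (-2) 2 1) (x / (R * t)) * (1 / (R * t))) (at x)"
    by (rule DERIV_chain2[OF iter_deriv_has_derivative[OF smooth_plateau]])
       (use assms in \<open>auto intro!: derivative_eq_intros\<close>)
  from DERIV_cdivide[OF this, of "(R * t) ^ k"] show ?thesis
    unfolding chi_def by (simp add: mult.commute)
qed

lemma chi_has_time_derivative:
  assumes "R > 0" "t > 0" shows "((\<lambda>t. chi R 0 t x) has_real_derivative - (x / t) * chi R 1 t x) (at t within A)"
proof -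
  have "((\<lambda>t. x / (R * t)) has_real_derivative - x / (R * t^2)) (at t)"
    using assms by (auto intro!: derivative_eq_intros simp: field_simps power2_eq_square)
  from DERIV_chain2[OF iter_deriv_has_derivative[OF smooth_plateau, of 0] this]
  have "((\<lambda>t. plateau (-2) 2 1 (x / (R * t))) has_real_derivative dir_deriv 1 (plateau (-2) 2 1) (x / (R * t)) * (- x / (R * t^2))) (at t)"
    by simp
  moreover have "dir_deriv 1 (plateau (-2) 2 1) (x / (R * t)) * (- x / (R * t^2)) = - (x / t) * chi R 1 t x"
    using assms by (simp add: chi_def field_simps power2_eq_square)
  ultimately show ?thesis by (simp add: chi_def has_field_derivative_at_within)
qed

lemma chi_eq_0:
  assumes "R > 0" "t > 0" "\<bar>x\<bar> > 2 * R * t" shows "chi R k t x = 0"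
proof -
  have m: "x / (R * t) \<in> - {-2..2}" using assms by (auto simp: field_simps abs_if split: if_splits)
  have "(dir_deriv 1 ^^ k) (plateau (-2) 2 1) (x / (R * t)) = 0"
  proof (cases k)
    case 0 then show ?thesis using m plateau_eq_0[of 1 "x / (R * t)" "-2" 2] by auto
  next
    case (Suc j)
    have "open (- {-2..2::real})" by (intro open_Compl closed_atLeastAtMost)
    then show ?thesis unfolding Suc
      by (rule iter_deriv_eq_0[OF _ _ m, of _ 0]) (auto intro!: plateau_eq_0)
  qed
  then show ?thesis by (simp add: chi_def)
qed

lemma chi_eq_0_inside:
  assumes "R > 0" "t > 0" "\<bar>x\<bar> < R * t" shows "chi R (Suc k) t x = 0"
proof -
  have m: "x / (R * t) \<in> {-1<..<1}" using assms by (auto simp: field_simps abs_if split: if_splits)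
  have "(dir_deriv 1 ^^ Suc k) (plateau (-2) 2 1) (x / (R * t)) = 0"
    by (rule iter_deriv_eq_0[OF open_greaterThanLessThan _ m, of _ 1]) (auto intro!: plateau_eq_1)
  then show ?thesis by (simp add: chi_def)
qed

lemma chi_0_bounds: "0 \<le> chi R 0 t x" "chi R 0 t x \<le> 1"
  using plateau_bounds by (auto simp: chi_def)

lemma chi_0_eq_1: "R > 0 \<Longrightarrow> t > 0 \<Longrightarrow> \<bar>x\<bar> \<le> R * t \<Longrightarrow> chi R 0 t x = 1"
  unfolding chi_def by (simp, rule plateau_eq_1) (auto simp: field_simps abs_if split: if_splits)

lemma chi_bound:
  obtains C where "C \<ge> 0" "\<And>R t x. R > 0 \<Longrightarrow> t > 0 \<Longrightarrow> \<bar>chi R k t x\<bar> \<le> C / (R * t) ^ k"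
proof -
  obtain C where C: "C \<ge> 0" "\<And>x. \<bar>(dir_deriv 1 ^^ k) (plateau (-2) 2 1) x\<bar> \<le> C"
    using iter_deriv_bounded[OF smooth_plateau, of "-2" 2 "-2" 2 1 k] plateau_eq_0[of 1 _ "-2" 2] by (metis atLeastAtMost_iff linear zero_less_one)
  then have "\<bar>chi R k t x\<bar> \<le> C / (R * t) ^ k" if "R > 0" "t > 0" for R t x
    using that by (simp add: chi_def abs_divide divide_right_mono)
  then show ?thesis using that C by blast
qed

lemma chi_joint_continuous:
  assumes "R > 0" "\<And>t. t \<in> I \<Longrightarrow> t > 0"
  shows "continuous_on (I \<times> A) (\<lambda>(t, x). chi R k t x)"
proof -
  have "continuous_on (I \<times> A) (\<lambda>z. (dir_deriv 1 ^^ k) (plateau (-2) 2 1) (snd z / (R * fst z)))"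
    by (rule continuous_on_compose2[OF iter_deriv_continuous[OF smooth_plateau, of UNIV]])
       (use assms in \<open>force intro!: continuous_intros\<close>)+
  then show ?thesis unfolding chi_def split_beta
    by (intro continuous_on_divide continuous_intros) (use assms in force)+
qed

section \<open>The localized energy identity for smooth approximations\<close>

lemma energy_space_identity:
  assumes w: "\<And>x. (w0 has_real_derivative w1 x) (at x)" "\<And>x. (w1 has_real_derivative w2 x) (at x)"
     "\<And>x. (w2 has_real_derivative w3 x) (at x)" "continuous_on UNIV w3"
    and R: "R > 0" "t > 0" and L: "L > 2 * R * t"
  shows "integral {-L..L} (\<lambda>x. - 2 * w0 x * w3 x * chi R 0 t x) =
     integral {-L..L} (\<lambda>x. - 3 * (w1 x)\<^sup>2 * chi R 1 t x + (w0 x)\<^sup>2 * chi R 3 t x)"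
proof -
  let ?c = "\<lambda>k. chi R k t"
  have L0: "L > 0" using L R by (smt (verit) mult_pos_pos)
  have dc: "(?c 0 has_real_derivative ?c 1 x) (at x)" "(?c 1 has_real_derivative ?c 2 x) (at x)" "(?c 2 has_real_derivative ?c 3 x) (at x)" for x
    using chi_has_derivative[OF R] by (metis One_nat_def Suc_1 numeral_3_eq_3 numeral_2_eq_2)+
  have cont: "continuous_on A f" if "\<And>x. (f has_real_derivative f' x) (at x)" for f f' :: "real \<Rightarrow> real" and A
    using that by (meson DERIV_continuous_on has_field_derivative_at_within)
  note ci = cont[OF w(1)] cont[OF w(2)] cont[OF w(3)] cont[OF chi_has_derivative[OF R]] continuous_on_subset[OF w(4) subset_UNIV]
  have z: "?c k L = 0" "?c k (-L) = 0" for k using L R L0 by (auto intro!: chi_eq_0)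
  let ?f = "\<lambda>x. - 2 * w0 x * w2 x * ?c 0 x + (w1 x)\<^sup>2 * ?c 0 x + 2 * w0 x * w1 x * ?c 1 x - (w0 x)\<^sup>2 * ?c 2 x"
  have "((\<lambda>x. - 2 * w0 x * w3 x * ?c 0 x - (- 3 * (w1 x)\<^sup>2 * ?c 1 x + (w0 x)\<^sup>2 * ?c 3 x)) has_integral ?f L - ?f (-L)) {-L..L}"
  proof (rule fundamental_theorem_of_calculus)
    fix x
    have "(?f has_real_derivative (- 2 * w0 x * w3 x * ?c 0 x - (- 3 * (w1 x)\<^sup>2 * ?c 1 x + (w0 x)\<^sup>2 * ?c 3 x))) (at x)"
      by (rule DERIV_cong, (rule derivative_intros w dc)+) (simp add: power2_eq_square algebra_simps)
    then show "(?f has_vector_derivative (- 2 * w0 x * w3 x * ?c 0 x - (- 3 * (w1 x)\<^sup>2 * ?c 1 x + (w0 x)\<^sup>2 * ?c 3 x))) (at x within {-L..L})"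
      by (simp add: has_real_derivative_iff_has_vector_derivative has_vector_derivative_at_within)
  qed (use L0 in auto)
  then have "integral {-L..L} (\<lambda>x. - 2 * w0 x * w3 x * ?c 0 x - (- 3 * (w1 x)\<^sup>2 * ?c 1 x + (w0 x)\<^sup>2 * ?c 3 x)) = 0"
    by (simp add: integral_unique z)
  moreover have "integral {-L..L} (\<lambda>x. - 2 * w0 x * w3 x * ?c 0 x - (- 3 * (w1 x)\<^sup>2 * ?c 1 x + (w0 x)\<^sup>2 * ?c 3 x)) =
    integral {-L..L} (\<lambda>x. - 2 * w0 x * w3 x * ?c 0 x) - integral {-L..L} (\<lambda>x. - 3 * (w1 x)\<^sup>2 * ?c 1 x + (w0 x)\<^sup>2 * ?c 3 x)"
    by (rule Henstock_Kurzweil_Integration.integral_diff) (intro integrable_continuous_interval continuous_intros ci)+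
  ultimately show ?thesis by simp
qed

text \<open>The motion of the cutoff contributes the term with \<open>x / r\<close>; the third derivative in \<open>x\<close> is distributed by \<open>energy_space_identity\<close>.\<close>

lemma energy_smooth:
  fixes W :: "nat \<Rightarrow> real \<Rightarrow> real \<Rightarrow> real"
  assumes ab: "0 < a" and R: "R > 0" and L: "L > 2 * R * b"
    and Wc: "\<And>k. continuous_on ({a..b} \<times> UNIV) (\<lambda>(t, x). W k t x)"
    and Fc: "continuous_on ({a..b} \<times> UNIV) (\<lambda>(t, x). F t x)"
    and Wx: "\<And>k t x. t \<in> {a..b} \<Longrightarrow> (W k t has_real_derivative W (Suc k) t x) (at x)"
    and Wt: "\<And>t x. t \<in> {a..b} \<Longrightarrow> x \<in> {-L..L} \<Longrightarrow> ((\<lambda>t. W 0 t x) has_real_derivative - W 3 t x - F t x) (at t within {a..b})"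
    and st: "a \<le> s" "s \<le> t" "t \<le> b"
  shows "integral {-L..L} (\<lambda>x. (W 0 t x)\<^sup>2 * chi R 0 t x) - integral {-L..L} (\<lambda>x. (W 0 s x)\<^sup>2 * chi R 0 s x) =
    integral {s..t} (\<lambda>r. integral {-L..L} (\<lambda>x. - 3 * (W 1 r x)\<^sup>2 * chi R 1 r x - (x / r) * (W 0 r x)\<^sup>2 * chi R 1 r x
       + (W 0 r x)\<^sup>2 * chi R 3 r x - 2 * W 0 r x * chi R 0 r x * F r x))"
proof -
  let ?I = "{a..b}"
  define Y where "Y t = integral {-L..L} (\<lambda>x. (W 0 t x)\<^sup>2 * chi R 0 t x)" for t
  define Q where "Q r = integral {-L..L} (\<lambda>x. - 3 * (W 1 r x)\<^sup>2 * chi R 1 r x - (x / r) * (W 0 r x)\<^sup>2 * chi R 1 r x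
       + (W 0 r x)\<^sup>2 * chi R 3 r x - 2 * W 0 r x * chi R 0 r x * F r x)" for r
  have pos: "r > 0" if "r \<in> ?I" for r using that ab by auto
  have Wc2: "continuous_on (?I \<times> cbox (-L) L) (\<lambda>z. W k (fst z) (snd z))" for k
    using continuous_on_subset[OF Wc[of k], of "?I \<times> cbox (-L) L"] by (auto simp: split_beta)
  have Fc2: "continuous_on (?I \<times> cbox (-L) L) (\<lambda>z. F (fst z) (snd z))"
    using continuous_on_subset[OF Fc, of "?I \<times> cbox (-L) L"] by (auto simp: split_beta)
  have Cc2: "continuous_on (?I \<times> cbox (-L) L) (\<lambda>z. chi R k (fst z) (snd z))" for k
    using chi_joint_continuous[OF R, of ?I] pos by (auto simp: split_beta)
  note jc = Wc2 Fc2 Cc2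
  have sl: "continuous_on {-L..L} (f r)" if "continuous_on (?I \<times> cbox (-L) L) (\<lambda>z. f (fst z) (snd z))" "r \<in> ?I" for f :: "real \<Rightarrow> real \<Rightarrow> real" and r
    using continuous_on_compose2[OF that(1) continuous_on_Pair[OF continuous_on_const continuous_on_id], of r "{-L..L}"] that(2)
    by (auto simp: image_subset_iff)
  have Yd: "(Y has_real_derivative Q r) (at r within ?I)" if r: "r \<in> ?I" for r
  proof -
    let ?g = "\<lambda>r x. 2 * W 0 r x * (- W 3 r x - F r x) * chi R 0 r x - (W 0 r x)\<^sup>2 * ((x / r) * chi R 1 r x)"
    have "((\<lambda>r. integral (cbox (-L) L) (\<lambda>x. (W 0 r x)\<^sup>2 * chi R 0 r x)) has_field_derivative integral (cbox (-L) L) (?g r)) (at r within ?I)"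
    proof (rule leibniz_rule_field_derivative)
      fix r x assume r: "r \<in> ?I" and x: "x \<in> cbox (-L) L"
      have x': "x \<in> {-L..L}" using x by simp
      show "((\<lambda>r. (W 0 r x)\<^sup>2 * chi R 0 r x) has_field_derivative ?g r x) (at r within ?I)"
        by (rule DERIV_cong, (rule derivative_intros Wt[OF r x'] chi_has_time_derivative[OF R pos[OF r]])+)
           (simp add: power2_eq_square algebra_simps)
    next
      fix r assume "r \<in> ?I"
      then show "(\<lambda>x. (W 0 r x)\<^sup>2 * chi R 0 r x) integrable_on cbox (-L) L"
        unfolding cbox_interval by (intro integrable_continuous_interval continuous_intros sl jc)
    next
      show "continuous_on (?I \<times> cbox (-L) L) (\<lambda>(r, x). ?g r x)"
        unfolding split_beta by (intro continuous_intros jc) (use ab in auto)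
    qed (use r in auto)
    moreover have "integral {-L..L} (?g r) = Q r"
    proof -
      have L': "L > 2 * R * r" using L r R by (smt (verit) atLeastAtMost_iff mult_left_mono)
      have cx: "continuous_on UNIV (W k r)" for k using Wx[OF r] by (meson DERIV_continuous_on has_field_derivative_at_within)
      have id: "integral {-L..L} (\<lambda>x. - 2 * W 0 r x * W 3 r x * chi R 0 r x) = integral {-L..L} (\<lambda>x. - 3 * (W 1 r x)\<^sup>2 * chi R 1 r x + (W 0 r x)\<^sup>2 * chi R 3 r x)"
      proof -
        have d: "(W 0 r has_real_derivative W 1 r x) (at x)" "(W 1 r has_real_derivative W 2 r x) (at x)"
          "(W 2 r has_real_derivative W 3 r x) (at x)" for x
          using Wx[OF r, of 0] Wx[OF r, of 1] Wx[OF r, of 2] by (auto simp: numeral_3_eq_3 numeral_2_eq_2)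
        show ?thesis by (rule energy_space_identity[OF d cx R pos[OF r] L'])
      qed
      let ?r = "\<lambda>x. - (2 * W 0 r x * F r x * chi R 0 r x) - (W 0 r x)\<^sup>2 * ((x / r) * chi R 1 r x)"
      have "integral {-L..L} (?g r) = integral {-L..L} (\<lambda>x. - 2 * W 0 r x * W 3 r x * chi R 0 r x + ?r x)"
        by (rule integral_cong) (simp add: algebra_simps)
      also have "\<dots> = integral {-L..L} (\<lambda>x. - 2 * W 0 r x * W 3 r x * chi R 0 r x) + integral {-L..L} ?r"
        by (rule Henstock_Kurzweil_Integration.integral_add) (intro integrable_continuous_interval continuous_intros sl jc r; use pos[OF r] in auto)+
      also have "\<dots> = integral {-L..L} (\<lambda>x. (- 3 * (W 1 r x)\<^sup>2 * chi R 1 r x + (W 0 r x)\<^sup>2 * chi R 3 r x) + ?r x)"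
        unfolding id
        by (rule Henstock_Kurzweil_Integration.integral_add[symmetric]) (intro integrable_continuous_interval continuous_intros sl jc r; use pos[OF r] in auto)+
      also have "\<dots> = Q r" unfolding Q_def by (rule integral_cong) (simp add: algebra_simps)
      finally show ?thesis .
    qed
    ultimately show ?thesis unfolding Y_def[abs_def] cbox_interval by simp
  qed
  have "(Q has_integral Y t - Y s) {s..t}"
  proof (rule fundamental_theorem_of_calculus[OF st(2)])
    fix r assume "r \<in> {s..t}"
    then have "(Y has_real_derivative Q r) (at r within {s..t})"
      using st by (intro DERIV_subset[OF Yd]) auto
    then show "(Y has_vector_derivative Q r) (at r within {s..t})" by (simp add: has_real_derivative_iff_has_vector_derivative)
  qed
  then show ?thesis unfolding Y_def Q_def by (simp add: integral_unique)
qed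

section \<open>Weak solutions built from profiles\<close>

text \<open>The equation integrated in time against a test function of \<open>x\<close>, which makes sense for a continuous \<open>u\<close>. The window \<open>[-L, L]\<close> contains the support of \<open>\<psi>\<close>.\<close>

definition weak_kdv :: "real \<Rightarrow> real \<Rightarrow> real \<Rightarrow> (real \<Rightarrow> real \<Rightarrow> real) \<Rightarrow> bool" where
  "weak_kdv \<epsilon> a b u \<longleftrightarrow> (\<forall>\<psi> L s t. smooth \<psi> \<longrightarrow> L > 0 \<longrightarrow> (\<forall>x. \<bar>x\<bar> \<ge> L \<longrightarrow> \<psi> x = 0) \<longrightarrow> a \<le> s \<longrightarrow> s \<le> t \<longrightarrow> t \<le> b \<longrightarrow>
     integral {-L..L} (\<lambda>y. u t y * \<psi> y) - integral {-L..L} (\<lambda>y. u s y * \<psi> y) =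
     integral {s..t} (\<lambda>r. integral {-L..L} (\<lambda>y. u r y * (dir_deriv 1 ^^ 3) \<psi> y + \<epsilon> * u r y ^ 3 * dir_deriv 1 \<psi> y)))"

lemma mollifier_smooth: "smooth (\<lambda>y. moll 0 d (x - y))"
proof -
  have "smooth (\<lambda>y. bump (x / d + (- 1 / d) * y) * (1 / d))"
    by (intro smooth_mult smooth_const smooth_affine smooth_bump)
  then show ?thesis by (simp add: moll_def diff_divide_distrib)
qed

lemma mollifier_iter_deriv:
  assumes "d > 0"
  shows "(dir_deriv 1 ^^ k) (\<lambda>y. moll 0 d (x - y)) = (\<lambda>y. (- 1) ^ k * moll k d (x - y))"
proof (induction k)
  case (Suc k)
  have "dir_deriv 1 (\<lambda>y. (- 1) ^ k * moll k d (x - y)) = (\<lambda>y. (- 1) ^ Suc k * moll (Suc k) d (x - y))"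
  proof (rule ext, rule dir_deriv_eq_vector)
    fix y
    have "((\<lambda>y. moll k d (x - y)) has_real_derivative moll (Suc k) d (x - y) * (-1)) (at y)"
      by (rule DERIV_chain2[OF moll_has_derivative[OF assms]]) (auto intro!: derivative_eq_intros)
    from DERIV_cmult[OF this, of "(-1) ^ k"]
    show "((\<lambda>y. (- 1) ^ k * moll k d (x - y)) has_vector_derivative (- 1) ^ Suc k * moll (Suc k) d (x - y)) (at y)"
      by (simp add: has_real_derivative_iff_has_vector_derivative)
  qed
  then show ?case using Suc by simp
qed auto

lemma weak_kdv_mollified:
  assumes weak: "weak_kdv \<epsilon> a b u" and c: "continuous_on ({a..b} \<times> UNIV) (\<lambda>(t, x). u t x)"
    and d: "0 < d" "d \<le> 1" and x: "\<bar>x\<bar> \<le> L - 2" and t: "t \<in> {a..b}"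
  shows "((\<lambda>t. mollify 0 d L (u t) x) has_real_derivative
     - mollify 3 d L (u t) x - \<epsilon> * mollify 1 d L (\<lambda>y. u t y ^ 3) x) (at t within {a..b})"
proof -
  let ?g = "\<lambda>r. - mollify 3 d L (u r) x - \<epsilon> * mollify 1 d L (\<lambda>y. u r y ^ 3) x"
  let ?\<psi> = "\<lambda>y. moll 0 d (x - y)"
  have L: "L > 0" using x by linarith
  have c3: "continuous_on ({a..b} \<times> UNIV) (\<lambda>(t, x). u t x ^ 3)"
    using c by (simp add: split_beta) (intro continuous_intros)
  have jc: "continuous_on {a..b} (\<lambda>r. mollify k d L (g r) x)" if "continuous_on ({a..b} \<times> UNIV) (\<lambda>(t, x). g t x)" for g k
    using continuous_on_compose2[OF mollify_joint_continuous[OF d(1) that] continuous_on_Pair[OF continuous_on_id continuous_on_const], of x "{a..b}"]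
    by (auto simp: image_subset_iff)
  have cg: "continuous_on {a..b} ?g" by (intro continuous_intros jc c c3)
  have ucx: "continuous_on A (u r)" if "r \<in> {a..b}" for r A
    using continuous_on_compose2[OF c continuous_on_Pair[OF continuous_on_const continuous_on_id], of r A] that
    by (auto simp: image_subset_iff)
  have supp: "?\<psi> y = 0" if "\<bar>y\<bar> \<ge> L" for y
    by (rule moll_eq_0[OF d(1)]) (use x d that in auto)
  have eq: "mollify 0 d L (u t) x - mollify 0 d L (u a) x = integral {a..t} ?g" if "t \<in> {a..b}" for t
  proof -
    have at: "a \<le> a" "a \<le> t" "t \<le> b" using that by auto
    have "mollify 0 d L (u t) x - mollify 0 d L (u a) x =
       integral {a..t} (\<lambda>r. integral {-L..L} (\<lambda>y. u r y * (dir_deriv 1 ^^ 3) ?\<psi> y + \<epsilon> * u r y ^ 3 * (dir_deriv 1 ^^ 1) ?\<psi> y))"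
      using weak[unfolded weak_kdv_def, rule_format, OF mollifier_smooth L supp at] by (simp add: mollify_def)
    also have "\<dots> = integral {a..t} ?g"
    proof (rule integral_cong)
      fix r assume "r \<in> {a..t}"
      then have r: "r \<in> {a..b}" using that by auto
      have "integral {-L..L} (\<lambda>y. u r y * (dir_deriv 1 ^^ 3) ?\<psi> y + \<epsilon> * u r y ^ 3 * (dir_deriv 1 ^^ 1) ?\<psi> y) =
         integral {-L..L} (\<lambda>y. - (u r y * moll 3 d (x - y)) - \<epsilon> * (u r y ^ 3 * moll 1 d (x - y)))"
        unfolding mollifier_iter_deriv[OF d(1)] by (rule integral_cong) (simp add: algebra_simps)
      also have "\<dots> = integral {-L..L} (\<lambda>y. - (u r y * moll 3 d (x - y))) - integral {-L..L} (\<lambda>y. \<epsilon> * (u r y ^ 3 * moll 1 d (x - y)))"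
        by (rule Henstock_Kurzweil_Integration.integral_diff) (intro integrable_continuous_interval continuous_intros ucx r d)+
      also have "\<dots> = ?g r" unfolding mollify_def by simp
      finally show "integral {-L..L} (\<lambda>y. u r y * (dir_deriv 1 ^^ 3) ?\<psi> y + \<epsilon> * u r y ^ 3 * (dir_deriv 1 ^^ 1) ?\<psi> y) = ?g r" .
    qed
    finally show ?thesis .
  qed
  have "((\<lambda>t. mollify 0 d L (u a) x + integral {a..t} ?g) has_vector_derivative 0 + ?g t) (at t within {a..b})"
    by (intro has_vector_derivative_add has_vector_derivative_const integral_has_vector_derivative[OF cg t])
  then have "((\<lambda>t. mollify 0 d L (u t) x) has_vector_derivative ?g t) (at t within {a..b})"
    unfolding add_0 by (rule has_vector_derivative_transform[OF t, rotated]) (subst eq[symmetric], assumption, simp)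
  then show ?thesis by (simp add: has_real_derivative_iff_has_vector_derivative)
qed

lemma mollify_diff:
  assumes "d > 0" "continuous_on UNIV g" "continuous_on UNIV g'"
  shows "mollify k d L (\<lambda>y. g y - g' y) x = mollify k d L g x - mollify k d L g' x"
  unfolding mollify_def left_diff_distrib
  by (rule Henstock_Kurzweil_Integration.integral_diff;
      intro integrable_continuous_interval continuous_intros assms continuous_on_subset[OF assms(2)] continuous_on_subset[OF assms(3)]; simp)

lemma cts_bounded_on_strip:
  fixes g :: "real \<Rightarrow> real \<Rightarrow> real"
  assumes "continuous_on ({a..b} \<times> UNIV) (\<lambda>(t, x). g t x)"
  obtains C where "C \<ge> 0" "\<And>t x. t \<in> {a..b} \<Longrightarrow> x \<in> {-L..L} \<Longrightarrow> \<bar>g t x\<bar> \<le> C"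
proof -
  have "continuous_on ({a..b} \<times> {-L..L}) (\<lambda>(t, x). g t x)" using assms by (rule continuous_on_subset) auto
  from compact_imp_bounded[OF compact_continuous_image[OF this compact_Times[OF compact_Icc compact_Icc]]]
  obtain C where C: "\<forall>y\<in>(\<lambda>(t, x). g t x) ` ({a..b} \<times> {-L..L}). norm y \<le> C" unfolding bounded_iff by blast
  have "\<bar>g t x\<bar> \<le> max C 0" if "t \<in> {a..b}" "x \<in> {-L..L}" for t x
    using C that by (force simp: le_max_iff_disj)
  then show ?thesis using that[of "max C 0"] by auto
qed

text \<open>Two solutions whose profiles have a common bound. The case of one solution is that in which the second is zero.\<close>

locale two_kdv =
  fixes \<epsilon> a b B M :: real and G1 h1 G2 h2 :: "real \<Rightarrow> real \<Rightarrow> complex"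
  assumes a: "0 < a" and ab: "a \<le> b" and eps: "\<bar>\<epsilon>\<bar> \<le> 1"
    and prof1: "\<And>t. t \<in> {a..b} \<Longrightarrow> ac_profile B M (G1 t) (h1 t)"
    and prof2: "\<And>t. t \<in> {a..b} \<Longrightarrow> ac_profile B M (G2 t) (h2 t)"
    and ul1: "\<And>s. s \<in> {a..b} \<Longrightarrow> uniform_limit {0<..} G1 (G1 s) (at s within {a..b})"
    and ul2: "\<And>s. s \<in> {a..b} \<Longrightarrow> uniform_limit {0<..} G2 (G2 s) (at s within {a..b})"
    and weak1: "weak_kdv \<epsilon> a b (\<lambda>t. kdv (G1 t) t)"
    and weak2: "weak_kdv \<epsilon> a b (\<lambda>t. kdv (G2 t) t)"
begin

definition "u1 t x = kdv (G1 t) t x"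
definition "u2 t x = kdv (G2 t) t x"
definition "u1x t x = kdvx (G1 t) t x"
definition "u2x t x = kdvx (G2 t) t x"
definition "w t x = u1 t x - u2 t x"
definition "wx t x = u1x t x - u2x t x"
definition "f t x = u1 t x ^ 3 - u2 t x ^ 3"
definition "fx t x = 3 * (u1 t x)\<^sup>2 * u1x t x - 3 * (u2 t x)\<^sup>2 * u2x t x"
definition "P = Cosc a * (B + M + 1)"

lemma pos: "t \<in> {a..b} \<Longrightarrow> t > 0" using a by auto

lemma kdv_jc:
  assumes "\<And>t. t \<in> {a..b} \<Longrightarrow> ac_profile B M (G t) (h t)"
    "\<And>s. s \<in> {a..b} \<Longrightarrow> uniform_limit {0<..} G (G s) (at s within {a..b})"
  shows "continuous_on ({a..b} \<times> UNIV) (\<lambda>(t, x). kdv (G t) t x)" "continuous_on ({a..b} \<times> UNIV) (\<lambda>(t, x). kdvx (G t) t x)"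
  by (rule kdv_joint_continuous[OF assms a]; simp)+

lemma jc0: "continuous_on ({a..b} \<times> UNIV) (\<lambda>z. u1 (fst z) (snd z))" "continuous_on ({a..b} \<times> UNIV) (\<lambda>z. u2 (fst z) (snd z))"
  "continuous_on ({a..b} \<times> UNIV) (\<lambda>z. u1x (fst z) (snd z))" "continuous_on ({a..b} \<times> UNIV) (\<lambda>z. u2x (fst z) (snd z))"
  using kdv_jc[OF prof1 ul1] kdv_jc[OF prof2 ul2] by (auto simp: u1_def u2_def u1x_def u2x_def split_beta)

lemma jc: "continuous_on ({a..b} \<times> UNIV) (\<lambda>(t, x). u1 t x)" "continuous_on ({a..b} \<times> UNIV) (\<lambda>(t, x). u2 t x)"
  "continuous_on ({a..b} \<times> UNIV) (\<lambda>(t, x). w t x)" "continuous_on ({a..b} \<times> UNIV) (\<lambda>(t, x). wx t x)"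
  "continuous_on ({a..b} \<times> UNIV) (\<lambda>(t, x). f t x)" "continuous_on ({a..b} \<times> UNIV) (\<lambda>(t, x). fx t x)"
  unfolding split_beta w_def wx_def f_def fx_def by (intro continuous_intros jc0)+

lemma slice: "continuous_on A (g t)" if "continuous_on ({a..b} \<times> UNIV) (\<lambda>(t, x). g t x)" "t \<in> {a..b}" for g :: "real \<Rightarrow> real \<Rightarrow> real"
  using continuous_on_compose2[OF that(1) continuous_on_Pair[OF continuous_on_const continuous_on_id], of t A] that(2)
  by (auto simp: image_subset_iff)

lemma du: "t \<in> {a..b} \<Longrightarrow> (u1 t has_real_derivative u1x t x) (at x)" "t \<in> {a..b} \<Longrightarrow> (u2 t has_real_derivative u2x t x) (at x)"
  unfolding u1_def[abs_def] u2_def[abs_def] u1x_def u2x_def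
  using kdv_has_derivative[OF prof1 pos] kdv_has_derivative[OF prof2 pos] by auto

lemma dw: "t \<in> {a..b} \<Longrightarrow> (w t has_real_derivative wx t x) (at x)"
  unfolding w_def[abs_def] wx_def by (intro DERIV_diff du)

lemma df: "t \<in> {a..b} \<Longrightarrow> (f t has_real_derivative fx t x) (at x)"
  unfolding f_def[abs_def] fx_def by (auto intro!: derivative_eq_intros du)

lemma BM: "B \<ge> 0" "M \<ge> 0" using prof1[of a] ab ac_profileD(1,2) by auto

lemma P0: "P \<ge> 0" unfolding P_def using Cosc_ge[OF a] BM by auto

lemma bounds:
  assumes t: "t \<in> {a..b}"
  shows "\<bar>u1 t x\<bar> \<le> P / sqrt (qq t x)" "\<bar>u2 t x\<bar> \<le> P / sqrt (qq t x)" "\<bar>u1x t x\<bar> \<le> P * sqrt (qq t x)" "\<bar>u2x t x\<bar> \<le> P * sqrt (qq t x)"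
    "\<bar>u1 t x\<bar> \<le> P" "\<bar>u2 t x\<bar> \<le> P"
proof -
  have q1: "1 \<le> sqrt (qq t x)" using qq_ge_1 by simp
  have C: "Cosc t * (B + M + 1) \<le> P" unfolding P_def using Cosc_mono[OF a, of t] t BM by (intro mult_right_mono) auto
  have 1: "Cosc t * (B + M + 1) / sqrt (qq t x) \<le> P / sqrt (qq t x)" "Cosc t * (B + M + 1) * sqrt (qq t x) \<le> P * sqrt (qq t x)"
    using C q1 by (auto intro!: divide_right_mono mult_right_mono)
  show b: "\<bar>u1 t x\<bar> \<le> P / sqrt (qq t x)" "\<bar>u2 t x\<bar> \<le> P / sqrt (qq t x)" "\<bar>u1x t x\<bar> \<le> P * sqrt (qq t x)" "\<bar>u2x t x\<bar> \<le> P * sqrt (qq t x)"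
    unfolding u1_def u2_def u1x_def u2x_def
    using kdv_bound[OF prof1[OF t] pos[OF t], of x] kdv_bound[OF prof2[OF t] pos[OF t], of x] 1 by linarith+
  have "P / sqrt (qq t x) \<le> P / 1" using q1 P0 by (intro divide_left_mono) auto
  then show "\<bar>u1 t x\<bar> \<le> P" "\<bar>u2 t x\<bar> \<le> P" using b(1,2) by auto
qed

definition "Y R t = integral {-(2*R*b+1)..2*R*b+1} (\<lambda>x. (w t x)\<^sup>2 * chi R 0 t x)"
definition "Q R r = integral {-(2*R*b+1)..2*R*b+1} (\<lambda>x. - 3 * (wx r x)\<^sup>2 * chi R 1 r x - (x / r) * (w r x)\<^sup>2 * chi R 1 r x
       + (w r x)\<^sup>2 * chi R 3 r x - 2 * w r x * chi R 0 r x * (\<epsilon> * fx r x))"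

text \<open>The mollified equation holds pointwise, so \<open>energy_smooth\<close> applies to the mollified difference. Its right-hand side involves
  only \<open>w\<close>, \<open>w\<^sub>x\<close> and \<open>(u\<^sup>3 - v\<^sup>3)\<^sub>x\<close>, which are continuous, so the mollification can be removed.\<close>

lemma energy_identity:
  assumes R: "R \<ge> 1" and st: "a \<le> s" "s \<le> t" "t \<le> b"
  shows "Q R integrable_on {s..t}" "Y R t - Y R s = integral {s..t} (Q R)"
proof -
  define L where "L = 2*R*b+1"
  \<comment> \<open>room for the support of the mollifier on both sides\<close>
  define L2 where "L2 = L + 2"
  have b0: "b > 0" using a ab by linarith
  have R0: "R > 0" using R by linarith
  have L0: "L > 0" "L > 2 * R * b" using R0 b0 by (auto simp: L_def intro!: add_pos_pos mult_pos_pos)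
  define d where "d n = 1 / real (Suc n)" for n
  have d: "d n > 0" "d n \<le> 1" for n by (auto simp: d_def)
  define W where "W n k r x = mollify k (d n) L2 (w r) x" for n k r x
  define F where "F n r x = \<epsilon> * mollify 1 (d n) L2 (f r) x" for n r x
  define Yn where "Yn n t = integral {-L..L} (\<lambda>x. (W n 0 t x)\<^sup>2 * chi R 0 t x)" for n t
  define q where "q n r x = - 3 * (W n 1 r x)\<^sup>2 * chi R 1 r x - (x / r) * (W n 0 r x)\<^sup>2 * chi R 1 r x
       + (W n 0 r x)\<^sup>2 * chi R 3 r x - 2 * W n 0 r x * chi R 0 r x * F n r x" for n r x
  define ql where "ql r x = - 3 * (wx r x)\<^sup>2 * chi R 1 r x - (x / r) * (w r x)\<^sup>2 * chi R 1 r x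
       + (w r x)\<^sup>2 * chi R 3 r x - 2 * w r x * chi R 0 r x * (\<epsilon> * fx r x)" for r x
  have st_sub: "r \<in> {a..b}" if "r \<in> {s..t}" for r using that st by auto
  have Wc: "continuous_on ({a..b} \<times> UNIV) (\<lambda>(t, x). W n k t x)" for n k
    unfolding W_def by (rule mollify_joint_continuous[OF d(1) jc(3)])
  have Fc: "continuous_on ({a..b} \<times> UNIV) (\<lambda>(t, x). F n t x)" for n
  proof -
    have "continuous_on ({a..b} \<times> UNIV) (\<lambda>z. mollify 1 (d n) L2 (f (fst z)) (snd z))"
      using mollify_joint_continuous[OF d(1) jc(5)] by (simp add: split_beta)
    then show ?thesis unfolding F_def split_beta by (intro continuous_intros)
  qed
  have en: "Yn n t - Yn n s = integral {s..t} (\<lambda>r. integral {-L..L} (q n r))" for n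
    unfolding Yn_def q_def
  proof (rule energy_smooth[OF a R0 L0(2) Wc Fc _ _ st])
    fix k r x assume r: "r \<in> {a..b}"
    show "(W n k r has_real_derivative W n (Suc k) r x) (at x)"
      unfolding W_def[abs_def] by (rule mollify_has_derivative[OF d(1) slice[OF jc(3) r]])
  next
    fix r x assume r: "r \<in> {a..b}" and x: "x \<in> {-L..L}"
    have x': "\<bar>x\<bar> \<le> L2 - 2" using x by (auto simp: L2_def)
    have m1: "((\<lambda>t. mollify 0 (d n) L2 (u1 t) x) has_real_derivative - mollify 3 (d n) L2 (u1 r) x - \<epsilon> * mollify 1 (d n) L2 (\<lambda>y. u1 r y ^ 3) x) (at r within {a..b})"
      by (rule weak_kdv_mollified[OF _ jc(1) d x' r]) (use weak1 in \<open>simp add: u1_def[abs_def]\<close>)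
    have m2: "((\<lambda>t. mollify 0 (d n) L2 (u2 t) x) has_real_derivative - mollify 3 (d n) L2 (u2 r) x - \<epsilon> * mollify 1 (d n) L2 (\<lambda>y. u2 r y ^ 3) x) (at r within {a..b})"
      by (rule weak_kdv_mollified[OF _ jc(2) d x' r]) (use weak2 in \<open>simp add: u2_def[abs_def]\<close>)
    have cu: "continuous_on UNIV (u1 t)" "continuous_on UNIV (u2 t)" if "t \<in> {a..b}" for t
      using slice[OF jc(1) that] slice[OF jc(2) that] by auto
    have mw: "W n k t x = mollify k (d n) L2 (u1 t) x - mollify k (d n) L2 (u2 t) x" if "t \<in> {a..b}" for t k
      unfolding W_def w_def[abs_def] by (rule mollify_diff[OF d(1) cu[OF that]])
    have mf: "F n r x = \<epsilon> * (mollify 1 (d n) L2 (\<lambda>y. u1 r y ^ 3) x - mollify 1 (d n) L2 (\<lambda>y. u2 r y ^ 3) x)"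
      unfolding F_def f_def[abs_def] by (subst mollify_diff[OF d(1)]) (intro continuous_intros cu r refl)+
    from DERIV_diff[OF m1 m2]
    have "((\<lambda>t. mollify 0 (d n) L2 (u1 t) x - mollify 0 (d n) L2 (u2 t) x) has_real_derivative - W n 3 r x - F n r x) (at r within {a..b})"
      unfolding mw[OF r] mf by (simp add: algebra_simps)
    then show "((\<lambda>t. W n 0 t x) has_real_derivative - W n 3 r x - F n r x) (at r within {a..b})"
      by (rule has_field_derivative_transform_within[OF _ zero_less_one r]) (simp add: mw)
  qed
  obtain Cw where Cw: "Cw \<ge> 0" "\<And>t x. t \<in> {a..b} \<Longrightarrow> x \<in> {-L2..L2} \<Longrightarrow> \<bar>w t x\<bar> \<le> Cw" using cts_bounded_on_strip[OF jc(3)] by metis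
  obtain Cx where Cx: "Cx \<ge> 0" "\<And>t x. t \<in> {a..b} \<Longrightarrow> x \<in> {-L2..L2} \<Longrightarrow> \<bar>wx t x\<bar> \<le> Cx" using cts_bounded_on_strip[OF jc(4)] by metis
  obtain Cf where Cf: "Cf \<ge> 0" "\<And>t x. t \<in> {a..b} \<Longrightarrow> x \<in> {-L2..L2} \<Longrightarrow> \<bar>fx t x\<bar> \<le> Cf" using cts_bounded_on_strip[OF jc(6)] by metis
  have chj: "continuous_on ({a..b} \<times> UNIV) (\<lambda>(t, x). chi R k t x)" for k
    by (rule chi_joint_continuous[OF R0]) (rule pos)
  obtain C1 where C1: "C1 \<ge> 0" "\<And>t x. t \<in> {a..b} \<Longrightarrow> x \<in> {-L2..L2} \<Longrightarrow> \<bar>chi R 1 t x\<bar> \<le> C1" using cts_bounded_on_strip[OF chj] by metis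
  obtain C3 where C3: "C3 \<ge> 0" "\<And>t x. t \<in> {a..b} \<Longrightarrow> x \<in> {-L2..L2} \<Longrightarrow> \<bar>chi R 3 t x\<bar> \<le> C3" using cts_bounded_on_strip[OF chj] by metis
  define K where "K = 3 * Cx\<^sup>2 * C1 + (L / a) * Cw\<^sup>2 * C1 + Cw\<^sup>2 * C3 + 2 * Cw * 1 * Cf"
  have W1: "W n 1 r x = mollify 0 (d n) L2 (wx r) x" "F n r x = \<epsilon> * mollify 0 (d n) L2 (fx r) x" if "r \<in> {a..b}" "x \<in> {-L..L}" for n r x
    unfolding W_def F_def
    by (subst mollify_by_parts[OF d dw[OF that(1)] slice[OF jc(4) that(1)]] mollify_by_parts[OF d df[OF that(1)] slice[OF jc(6) that(1)]];
        use that in \<open>auto simp: L2_def\<close>)+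
  have Wb: "\<bar>W n 0 r x\<bar> \<le> Cw" "\<bar>W n 1 r x\<bar> \<le> Cx" "\<bar>F n r x\<bar> \<le> Cf" if r: "r \<in> {a..b}" and x: "x \<in> {-L..L}" for n r x
  proof -
    have x': "\<bar>x\<bar> \<le> L2 - 2" using x by (auto simp: L2_def)
    show "\<bar>W n 0 r x\<bar> \<le> Cw"
      unfolding W_def by (rule mollify_bound[OF d slice[OF jc(3) r] x']) (rule Cw(2)[OF r], auto)
    show "\<bar>W n 1 r x\<bar> \<le> Cx"
      unfolding W1[OF r x] by (rule mollify_bound[OF d slice[OF jc(4) r] x']) (rule Cx(2)[OF r], auto)
    have "\<bar>mollify 0 (d n) L2 (fx r) x\<bar> \<le> Cf"
      by (rule mollify_bound[OF d slice[OF jc(6) r] x']) (rule Cf(2)[OF r], auto)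
    then have "\<bar>\<epsilon>\<bar> * \<bar>mollify 0 (d n) L2 (fx r) x\<bar> \<le> 1 * Cf" using eps by (intro mult_mono) auto
    then show "\<bar>F n r x\<bar> \<le> Cf" unfolding W1[OF r x] by (simp add: abs_mult)
  qed
  have qb: "\<bar>q n r x\<bar> \<le> K" if r: "r \<in> {a..b}" and x: "x \<in> {-L..L}" for n r x
  proof -
    have x2: "x \<in> {-L2..L2}" using x by (auto simp: L2_def)
    note wb = Wb[OF r x, of n]
    have s0: "(W n 0 r x)\<^sup>2 \<le> Cw\<^sup>2" "(W n 1 r x)\<^sup>2 \<le> Cx\<^sup>2"
      using wb Cw(1) Cx(1) by (auto intro!: abs_le_square_iff[THEN iffD1])
    have t1: "\<bar>3 * (W n 1 r x)\<^sup>2 * chi R 1 r x\<bar> \<le> 3 * Cx\<^sup>2 * C1"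
      unfolding abs_mult using s0 C1(2)[OF r x2] by (intro mult_mono) auto
    have "\<bar>x / r\<bar> \<le> L / a" unfolding abs_divide using x r a by (intro frac_le) auto
    then have t2: "\<bar>(x / r) * (W n 0 r x)\<^sup>2 * chi R 1 r x\<bar> \<le> (L / a) * Cw\<^sup>2 * C1"
      unfolding abs_mult[of _ "chi R 1 r x"] abs_mult[of "x / r"] using s0 C1 C1(2)[OF r x2] L0 a by (intro mult_mono) auto
    have t3: "\<bar>(W n 0 r x)\<^sup>2 * chi R 3 r x\<bar> \<le> Cw\<^sup>2 * C3"
      unfolding abs_mult using s0 C3(2)[OF r x2] by (intro mult_mono) auto
    have t4: "\<bar>2 * W n 0 r x * chi R 0 r x * F n r x\<bar> \<le> 2 * Cw * 1 * Cf"
      unfolding abs_mult using wb Cw Cf chi_0_bounds[of R r x] by (intro mult_mono) auto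
    have "\<bar>- 3 * (W n 1 r x)\<^sup>2 * chi R 1 r x\<bar> \<le> 3 * Cx\<^sup>2 * C1" using t1 by simp
    then show ?thesis unfolding q_def K_def using t2 t3 t4 by linarith
  qed
  have lim: "(\<lambda>n. W n 0 r x) \<longlonglongrightarrow> w r x" "(\<lambda>n. q n r x) \<longlonglongrightarrow> ql r x" if r: "r \<in> {a..b}" and x: "x \<in> {-L..L}" for r x
  proof -
    have x': "\<bar>x\<bar> \<le> L2 - 2" using x by (auto simp: L2_def)
    show l0: "(\<lambda>n. W n 0 r x) \<longlonglongrightarrow> w r x"
      unfolding W_def d_def by (rule mollify_tendsto[OF slice[OF jc(3) r] x'])
    have l1: "(\<lambda>n. W n 1 r x) \<longlonglongrightarrow> wx r x"
      unfolding W1[OF r x] unfolding d_def by (rule mollify_tendsto[OF slice[OF jc(4) r] x'])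
    have l2: "(\<lambda>n. F n r x) \<longlonglongrightarrow> \<epsilon> * fx r x"
      unfolding W1[OF r x] unfolding d_def by (intro tendsto_intros mollify_tendsto[OF slice[OF jc(6) r] x'])
    show "(\<lambda>n. q n r x) \<longlonglongrightarrow> ql r x"
      unfolding q_def ql_def by (intro tendsto_intros l0 l1 l2)
  qed
  have csl: "continuous_on {-L..L} (W n k r)" "continuous_on {-L..L} (F n r)" "continuous_on {-L..L} (chi R k r)" if r: "r \<in> {a..b}" for n k r
    using slice[OF Wc r] slice[OF Fc r] slice[OF chj r] by auto
  have qi: "q n r integrable_on {-L..L}" if r: "r \<in> {a..b}" for n r
    unfolding q_def by (intro integrable_continuous_interval continuous_intros csl r) (use pos[OF r] in auto)
  have Ki: "(\<lambda>x::real. c::real) integrable_on {l..r}" for c l r by (intro integrable_continuous_interval continuous_intros)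
  have inner: "(\<lambda>n. integral {-L..L} (q n r)) \<longlonglongrightarrow> Q R r" if r: "r \<in> {a..b}" for r
  proof -
    have "(\<lambda>n. integral {-L..L} (q n r)) \<longlonglongrightarrow> integral {-L..L} (ql r)"
      by (rule dominated_convergence(2)[OF qi[OF r] Ki[of K]]) (use qb[OF r] lim(2)[OF r] in auto)
    then show ?thesis unfolding Q_def ql_def L_def[symmetric] .
  qed
  have outer: "Q R integrable_on {s..t}" "(\<lambda>n. integral {s..t} (\<lambda>r. integral {-L..L} (q n r))) \<longlonglongrightarrow> integral {s..t} (Q R)"
  proof -
    have i: "(\<lambda>r. integral {-L..L} (q n r)) integrable_on {s..t}" for n
    proof (rule integrable_continuous_interval)
      have jW: "continuous_on ({s..t} \<times> cbox (-L) L) (\<lambda>z. g (fst z) (snd z))" if "continuous_on ({a..b} \<times> UNIV) (\<lambda>(t, x). g t x)" for g :: "real \<Rightarrow> real \<Rightarrow> real"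
        using that unfolding split_beta by (rule continuous_on_subset) (use st in auto)
      have "continuous_on ({s..t} \<times> cbox (-L) L) (\<lambda>(r, x). q n r x)"
        unfolding q_def split_beta
        by (intro continuous_intros jW Wc Fc chj) (use st a in auto)
      from integral_continuous_on_param[OF this]
      show "continuous_on {s..t} (\<lambda>r. integral {-L..L} (q n r))" by simp
    qed
    have bd: "norm (integral {-L..L} (q n r)) \<le> K * (2 * L)" if r: "r \<in> {s..t}" for n r
    proof -
      have "norm (integral {-L..L} (q n r)) \<le> integral {-L..L} (\<lambda>x. K)"
        by (rule integral_norm_bound_integral[OF qi[OF st_sub[OF r]] Ki]) (use qb[OF st_sub[OF r]] in auto)
      also have "\<dots> = K * (2 * L)" using L0 by simp
      finally show ?thesis .
    qed
    show "Q R integrable_on {s..t}" "(\<lambda>n. integral {s..t} (\<lambda>r. integral {-L..L} (q n r))) \<longlonglongrightarrow> integral {s..t} (Q R)"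
      by (rule dominated_convergence(1)[OF i Ki[of "K * (2 * L)"] bd inner[OF st_sub]]; assumption)
         (rule dominated_convergence(2)[OF i Ki[of "K * (2 * L)"] bd inner[OF st_sub]]; assumption)
  qed
  have Ylim: "(\<lambda>n. Yn n r) \<longlonglongrightarrow> Y R r" if r: "r \<in> {a..b}" for r
  proof -
    have "(\<lambda>n. Yn n r) \<longlonglongrightarrow> integral {-L..L} (\<lambda>x. (w r x)\<^sup>2 * chi R 0 r x)"
      unfolding Yn_def
    proof (rule dominated_convergence(2)[OF _ Ki[of "Cw\<^sup>2"]])
      show "(\<lambda>x. (W n 0 r x)\<^sup>2 * chi R 0 r x) integrable_on {-L..L}" for n
        by (intro integrable_continuous_interval continuous_intros csl r)
      fix n x assume x: "x \<in> {-L..L}"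
      have "(W n 0 r x)\<^sup>2 * chi R 0 r x \<le> Cw\<^sup>2 * 1"
        using Wb(1)[OF r x, of n] Cw(1) chi_0_bounds[of R r x] by (intro mult_mono abs_le_square_iff[THEN iffD1]) auto
      then show "norm ((W n 0 r x)\<^sup>2 * chi R 0 r x) \<le> Cw\<^sup>2" using chi_0_bounds[of R r x] by (simp add: abs_mult)
    next
      fix x assume x: "x \<in> {-L..L}"
      show "(\<lambda>n. (W n 0 r x)\<^sup>2 * chi R 0 r x) \<longlonglongrightarrow> (w r x)\<^sup>2 * chi R 0 r x"
        by (intro tendsto_intros lim[OF r x])
    qed
    then show ?thesis unfolding Y_def L_def .
  qed
  show "Q R integrable_on {s..t}" by (rule outer)
  have "(\<lambda>n. Yn n t - Yn n s) \<longlonglongrightarrow> Y R t - Y R s" using st by (intro tendsto_diff Ylim) auto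
  then show "Y R t - Y R s = integral {s..t} (Q R)"
    unfolding en using outer(2) LIMSEQ_unique by blast
qed

end

section \<open>Growth of the square norm of a difference\<close>

lemma gronwall_forward:
  fixes g :: "real \<Rightarrow> real"
  assumes st: "s \<le> t" and c: "continuous_on {s..t} g" and C: "C \<ge> 0"
    and le: "\<And>r. r \<in> {s..t} \<Longrightarrow> g r \<le> g s + C * integral {s..r} g"
  shows "g t \<le> exp (C * (t - s)) * g s"
proof (cases "s = t")
  case False
  then have st': "s < t" using st by simp
  define H where "H r = integral {s..r} g" for r
  define \<phi> where "\<phi> r = exp (- C * (r - s)) * (g s + C * H r)" for r
  have Hd: "(H has_real_derivative g r) (at r within {s..t})" if "r \<in> {s..t}" for r
    using integral_has_real_derivative[OF c that] unfolding H_def .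
  have "\<phi> t \<le> \<phi> s"
  proof (rule DERIV_nonpos_imp_decreasing_open[OF st])
    fix r assume r: "s < r" "r < t"
    have "(H has_real_derivative g r) (at r)"
      using Hd[of r] r at_within_Icc_at[of s r t] by simp
    then have "(\<phi> has_real_derivative exp (- C * (r - s)) * (C * (g r - (g s + C * H r)))) (at r)"
      unfolding \<phi>_def by (auto intro!: derivative_eq_intros simp: algebra_simps)
    moreover have "exp (- C * (r - s)) * (C * (g r - (g s + C * H r))) \<le> 0"
      using le[of r] r C unfolding H_def by (intro mult_nonneg_nonpos mult_nonneg_nonpos2) (auto intro: mult_nonneg_nonpos)
    ultimately show "\<exists>y. DERIV \<phi> r :> y \<and> y \<le> 0" by blast
  next
    have "continuous_on {s..t} H" using Hd DERIV_continuous_on by blast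
    then show "continuous_on {s..t} \<phi>" unfolding \<phi>_def by (intro continuous_intros)
  qed
  then have "exp (- (C * (t - s))) * (g s + C * H t) \<le> g s" unfolding \<phi>_def H_def by simp
  then have "exp (C * (t - s)) * (exp (- (C * (t - s))) * (g s + C * H t)) \<le> exp (C * (t - s)) * g s"
    by (rule mult_left_mono) simp
  then have "g s + C * H t \<le> exp (C * (t - s)) * g s" by (simp add: mult.assoc[symmetric] flip: exp_add)
  then show ?thesis using le[of t] st unfolding H_def by simp
qed simp

text \<open>The inequality holds in both directions of time, so that reflection reduces the past to the future; the constant \<open>E\<close> is absorbed into \<open>Y + E / C\<close>.\<close>

lemma gronwall:
  fixes Y :: "real \<Rightarrow> real"
  assumes c: "continuous_on {a..b} Y" and C: "C > 0" and nn: "\<And>t. t \<in> {a..b} \<Longrightarrow> Y t \<ge> 0" and E: "E \<ge> 0"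
    and le: "\<And>s t. a \<le> s \<Longrightarrow> s \<le> t \<Longrightarrow> t \<le> b \<Longrightarrow> \<bar>Y t - Y s\<bar> \<le> integral {s..t} (\<lambda>r. C * Y r + E)"
    and s: "s \<in> {a..b}" and t: "t \<in> {a..b}"
  shows "Y t \<le> exp (C * \<bar>t - s\<bar>) * (Y s + E / C)"
proof -
  define g where "g r = Y r + E / C" for r
  have EC: "E / C \<ge> 0" using C E by simp
  have cg: "continuous_on {a..b} g" unfolding g_def by (intro continuous_intros c)
  have le': "\<bar>g t - g s\<bar> \<le> C * integral {s..t} g" if "a \<le> s" "s \<le> t" "t \<le> b" for s t
  proof -
    have "integral {s..t} (\<lambda>r. C * Y r + E) = integral {s..t} (\<lambda>r. C * g r)"
      using C by (intro integral_cong) (simp add: g_def distrib_left)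
    also have "\<dots> = C * integral {s..t} g" by (rule Henstock_Kurzweil_Integration.integral_mult_right)
    finally have e: "integral {s..t} (\<lambda>r. C * Y r + E) = C * integral {s..t} g" .
    have d: "g t - g s = Y t - Y s" by (simp add: g_def)
    show ?thesis using le[OF that] unfolding d e .
  qed
  have "g t \<le> exp (C * \<bar>t - s\<bar>) * g s"
  proof (cases "s \<le> t")
    case True
    have "g t \<le> exp (C * (t - s)) * g s"
    proof (rule gronwall_forward[OF True])
      show "continuous_on {s..t} g" using cg by (rule continuous_on_subset) (use s t in auto)
      fix r assume "r \<in> {s..t}"
      then show "g r \<le> g s + C * integral {s..r} g" using le'[of s r] s t by auto
    qed (use C in simp)
    then show ?thesis using True by simp
  next
    case False
    then have ts: "- s \<le> - t" "t \<le> s" by auto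
    define k where "k r = g (- r)" for r
    have "k (-t) \<le> exp (C * (- t - - s)) * k (- s)"
    proof (rule gronwall_forward[OF ts(1)])
      show "continuous_on {- s..- t} k" unfolding k_def
        by (rule continuous_on_compose2[OF cg]) (use s t in \<open>auto intro!: continuous_intros\<close>)
      fix r assume r: "r \<in> {- s..- t}"
      have "integral {- s..r} k = integral {- r..s} g"
        unfolding k_def using Henstock_Kurzweil_Integration.integral_reflect_real[of s "-r" g] by simp
      then show "k r \<le> k (- s) + C * integral {- s..r} k"
        using le'[of "-r" s] r s t unfolding k_def by auto
    qed (use C in simp)
    then show ?thesis using ts by (simp add: k_def)
  qed
  then show ?thesis using EC unfolding g_def by simp
qed

context two_kdv begin

text \<open>A bound for \<open>w\<close> outside the rays \<open>\<bar>x\<bar> = R t\<close>, decaying like \<open>R\<^sup>-\<^sup>1\<^sup>/\<^sup>4\<close>. The constants are those of the difference of two profiles.\<close>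

definition "mR R = Cosc a * (B + B + (2 * M + 2 * M) + 1) / sqrt (sqrt (R / 3))"

lemma mR_nonneg: "R > 0 \<Longrightarrow> mR R \<ge> 0"
  unfolding mR_def using Cosc_ge[OF a] BM by auto

lemma mR_tendsto: "((\<lambda>R. mR R) \<longlongrightarrow> 0) at_top"
proof -
  have "((\<lambda>R::real. 1 / sqrt (sqrt (R / 3))) \<longlongrightarrow> 0) at_top" by real_asymp
  from tendsto_mult_right_zero[OF this, of "Cosc a * (B + B + (2 * M + 2 * M) + 1)"]
  show ?thesis by (simp add: mR_def[abs_def])
qed

lemma prof_diff: "t \<in> {a..b} \<Longrightarrow> ac_profile (B + B) (2 * M + 2 * M) (\<lambda>p. G1 t p - G2 t p) (\<lambda>p. h1 t p - h2 t p)"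
  by (rule ac_profile_diff[OF prof1 prof2])

lemma kdv_diff: "t \<in> {a..b} \<Longrightarrow> kdv (\<lambda>p. G1 t p - G2 t p) t x = w t x"
  "t \<in> {a..b} \<Longrightarrow> kdvx (\<lambda>p. G1 t p - G2 t p) t x = wx t x"
  unfolding kdv_def kdvx_def w_def wx_def u1_def u2_def u1x_def u2x_def
  by (subst oscl_diff[OF prof1 prof2 pos]; simp add: diff_divide_distrib)+

lemma m_bound:
  assumes t: "t \<in> {a..b}" and R: "R > 0" and x: "\<bar>x\<bar> \<ge> R * t"
  shows "Cosc t * (B + B + (2 * M + 2 * M) + 1) / sqrt (qq t x) \<le> mR R" "\<bar>w t x\<bar> \<le> mR R"
proof -
  have "R / 3 \<le> \<bar>x\<bar> / (3 * t)" using x pos[OF t] by (simp add: field_simps)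
  then have "sqrt (R / 3) \<le> qq t x" unfolding qq_def using real_sqrt_le_mono by (simp add: le_max_iff_disj)
  then have s: "sqrt (sqrt (R / 3)) \<le> sqrt (qq t x)" by (rule real_sqrt_le_mono)
  have s0: "0 < sqrt (sqrt (R / 3))" using R by simp
  have "Cosc t * (B + B + (2 * M + 2 * M) + 1) / sqrt (qq t x) \<le> Cosc a * (B + B + (2 * M + 2 * M) + 1) / sqrt (sqrt (R / 3))"
    using s s0 Cosc_mono[OF a, of t] t BM Cosc_ge[OF a] by (intro frac_le mult_right_mono mult_nonneg_nonneg) auto
  then show 1: "Cosc t * (B + B + (2 * M + 2 * M) + 1) / sqrt (qq t x) \<le> mR R" by (simp add: mR_def)
  show "\<bar>w t x\<bar> \<le> mR R"
    using kdv_bound(1)[OF prof_diff[OF t] pos[OF t], of x] 1 by (simp add: kdv_diff[OF t])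
qed

definition "C0 = 6 * P\<^sup>2 + 1"

text \<open>The three parts of the energy identity: the virial term, of size \<open>m\<close>, the term with \<open>\<chi>\<^sub>x\<^sub>x\<^sub>x\<close>, of size \<open>m\<^sup>2\<close>, and the nonlinear term,
  in which an integration by parts leaves \<open>\<integral> w\<^sup>2 \<chi> V\<^sub>x\<close> and a term of size \<open>m\<^sup>2\<close>.\<close>

lemma Q_bound:
  obtains k1 k2 where "k1 \<ge> 0" "k2 \<ge> 0"
    "\<And>R t. R \<ge> 1 \<Longrightarrow> t \<in> {a..b} \<Longrightarrow> \<bar>Q R t\<bar> \<le> C0 * Y R t + (mR R * k1 + (mR R)\<^sup>2 * k2)"
proof -
  obtain c1 where c1: "c1 \<ge> 0" "\<And>R t x. R > 0 \<Longrightarrow> t > 0 \<Longrightarrow> \<bar>chi R 1 t x\<bar> \<le> c1 / (R * t) ^ 1" using chi_bound[of 1] by metis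
  obtain c2 where c2: "c2 \<ge> 0" "\<And>R t x. R > 0 \<Longrightarrow> t > 0 \<Longrightarrow> \<bar>chi R 2 t x\<bar> \<le> c2 / (R * t) ^ 2" using chi_bound[of 2] by metis
  obtain c3 where c3: "c3 \<ge> 0" "\<And>R t x. R > 0 \<Longrightarrow> t > 0 \<Longrightarrow> \<bar>chi R 3 t x\<bar> \<le> c3 / (R * t) ^ 3" using chi_bound[of 3] by metis
  have b0: "b > 0" using a ab by linarith
  define k where "k = c1 * (2 * b + 1) / a"
  define k' where "k' = c3 * (2 * b + 1) / a ^ 3"
  define k1 where "k1 = (k * (4 * B + 1) + 8 * pi * M * (c1 / a)) / a"
  define k2 where "k2 = 3 * b * k' / a + 2 * k' + 6 * P\<^sup>2 * k"
  have kn: "k \<ge> 0" "k' \<ge> 0" using c1 c3 a b0 by (auto simp: k_def k'_def)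
  have k12: "k1 \<ge> 0" "k2 \<ge> 0" unfolding k1_def k2_def using kn BM c1 a b0
    by (auto intro!: add_nonneg_nonneg mult_nonneg_nonneg divide_nonneg_nonneg)
  have "\<bar>Q R t\<bar> \<le> C0 * Y R t + (mR R * k1 + (mR R)\<^sup>2 * k2)" if R: "R \<ge> 1" and t: "t \<in> {a..b}" for R t
  proof -
    define L where "L = 2*R*b+1"
    define m where "m = mR R"
    define Z where "Z = c1 / (R * a)"
    define Z2 where "Z2 = c3 / (R * a) ^ 3"
    have R0: "R > 0" using R by simp
    note t0 = pos[OF t]
    have tab: "a \<le> t" "t \<le> b" using t by auto
    have L0: "L > 0" "L > 2 * R * b" unfolding L_def using R0 b0 by (auto intro!: add_pos_pos)
    have Lt: "L > 2 * R * t" using L0(2) tab R0 by (smt (verit) mult_left_mono)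
    have m0: "m \<ge> 0" unfolding m_def by (rule mR_nonneg[OF R0])
    have Ra: "R * a \<le> R * t" "R * a > 0" using R0 a tab by auto
    have Zb: "\<bar>chi R 1 t x\<bar> \<le> Z" "\<bar>chi R 3 t x\<bar> \<le> Z2" for x
    proof -
      have "c1 / (R * t) ^ 1 \<le> Z" unfolding Z_def using Ra c1 by (auto intro!: divide_left_mono)
      then show "\<bar>chi R 1 t x\<bar> \<le> Z" using c1(2)[OF R0 t0, of x] by linarith
      have "c3 / (R * t) ^ 3 \<le> Z2" unfolding Z2_def using Ra c3 R0 t0 by (intro divide_left_mono power_mono) auto
      then show "\<bar>chi R 3 t x\<bar> \<le> Z2" using c3(2)[OF R0 t0, of x] by linarith
    qed
    have Z0: "Z \<ge> 0" "Z2 \<ge> 0" unfolding Z_def Z2_def using c1 c3 Ra by auto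
    have outside: "\<bar>x\<bar> \<ge> R * t" if "chi R 1 t x \<noteq> 0 \<or> chi R 3 t x \<noteq> 0" for x
      using chi_eq_0_inside[OF R0 t0, of x 0] chi_eq_0_inside[OF R0 t0, of x 2] that
      by (force simp: numeral_3_eq_3 numeral_2_eq_2 not_less[symmetric])
    have wm: "\<bar>w t x\<bar> \<le> m" if "chi R 1 t x \<noteq> 0 \<or> chi R 3 t x \<noteq> 0" for x
      unfolding m_def by (rule m_bound[OF t R0 outside[OF that]])
    have w2m: "(w t x)\<^sup>2 * \<bar>chi R 1 t x\<bar> \<le> m\<^sup>2 * Z" "(w t x)\<^sup>2 * \<bar>chi R 3 t x\<bar> \<le> m\<^sup>2 * Z2" for x
    proof -
      have sq: "(w t x)\<^sup>2 \<le> m\<^sup>2" if "chi R 1 t x \<noteq> 0 \<or> chi R 3 t x \<noteq> 0"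
        using wm[OF that] m0 by (intro abs_le_square_iff[THEN iffD1]) auto
      show "(w t x)\<^sup>2 * \<bar>chi R 1 t x\<bar> \<le> m\<^sup>2 * Z"
        by (cases "chi R 1 t x = 0") (use sq Zb Z0 in \<open>auto intro!: mult_mono\<close>)
      show "(w t x)\<^sup>2 * \<bar>chi R 3 t x\<bar> \<le> m\<^sup>2 * Z2"
        by (cases "chi R 3 t x = 0") (use sq Zb Z0 in \<open>auto intro!: mult_mono\<close>)
    qed
    have chj: "continuous_on A (chi R k t)" for A k
      using chi_has_derivative[OF R0 t0] by (meson DERIV_continuous_on has_field_derivative_at_within)
    note sl = slice[OF jc(1) t] slice[OF jc(2) t] slice[OF jc(3) t] slice[OF jc(4) t] slice[OF jc(5) t] slice[OF jc(6) t] chj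
    have u1x_c: "continuous_on A (u1x t)" for A
      using slice[of u1x t] jc0(3) t by (auto simp: split_beta)
    have u2x_c: "continuous_on A (u2x t)" for A
      using slice[of u2x t] jc0(4) t by (auto simp: split_beta)
    have dc: "(chi R 0 t has_real_derivative chi R 1 t x) (at x)" "(chi R 1 t has_real_derivative chi R 2 t x) (at x)"
      "(chi R 2 t has_real_derivative chi R 3 t x) (at x)" for x
      using chi_has_derivative[OF R0 t0, of 0] chi_has_derivative[OF R0 t0, of 1] chi_has_derivative[OF R0 t0, of 2]
      by (auto simp: numeral_3_eq_3 numeral_2_eq_2)
    have bz: "chi R k t L = 0" "chi R k t (-L) = 0" for k using L0 Lt by (auto intro!: chi_eq_0 R0 t0)
    let ?q = "\<lambda>x. (- 3 * t * (wx t x)\<^sup>2 - x * (w t x)\<^sup>2) * chi R 1 t x"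
    define A1 where "A1 = integral {-L..L} (\<lambda>x. ?q x)"
    define A2 where "A2 = integral {-L..L} (\<lambda>x. (w t x)\<^sup>2 * chi R 3 t x)"
    define A3 where "A3 = integral {-L..L} (\<lambda>x. 2 * w t x * chi R 0 t x * fx t x)"
    have A1: "\<bar>A1\<bar> \<le> m * Z * (2 * L * (B + B) + L + 2 * pi * (2 * M + 2 * M)) + 3 * t * m\<^sup>2 * Z2 * L"
      unfolding A1_def kdv_diff[OF t, symmetric]
      by (rule virial[OF prof_diff[OF t] t0 L0(1) dc(2,3) chj bz bz Zb(1) c2(2)[OF R0 t0] Zb(2) m0])
         (unfold m_def, rule m_bound(1)[OF t R0 outside])
    have A2: "\<bar>A2\<bar> \<le> m\<^sup>2 * Z2 * (2 * L)"
    proof -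
      have "norm A2 \<le> integral {-L..L} (\<lambda>x. m\<^sup>2 * Z2)"
        unfolding A2_def
        by (rule integral_norm_bound_integral) (use w2m(2) in \<open>auto simp: abs_mult intro!: integrable_continuous_interval continuous_intros sl\<close>)
      then show ?thesis using L0 by (simp add: mult_ac)
    qed
    \<comment> \<open>\<open>u\<^sub>1\<^sup>3 - u\<^sub>2\<^sup>3 = w V\<close>, hence \<open>fx = (w V)\<^sub>x\<close>\<close>
    define V where "V x = (u1 t x)\<^sup>2 + u1 t x * u2 t x + (u2 t x)\<^sup>2" for x
    define Vx where "Vx x = 2 * (u1 t x * u1x t x) + u2 t x * u1x t x + u1 t x * u2x t x + 2 * (u2 t x * u2x t x)" for x
    have Vb: "\<bar>V x\<bar> \<le> 3 * P\<^sup>2" for x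
    proof -
      have "\<bar>u1 t x * u1 t x\<bar> \<le> P * P" "\<bar>u1 t x * u2 t x\<bar> \<le> P * P" "\<bar>u2 t x * u2 t x\<bar> \<le> P * P"
        unfolding abs_mult by (intro mult_mono bounds(5,6)[OF t] P0 abs_ge_zero)+
      then show ?thesis unfolding V_def power2_eq_square by linarith
    qed
    have Vxb: "\<bar>Vx x\<bar> \<le> 6 * P\<^sup>2" for x
    proof -
      have q0: "sqrt (qq t x) > 0" using qq_ge_1[of t x] by simp
      have pr: "\<bar>y * z\<bar> \<le> P * P" if "\<bar>y\<bar> \<le> P / sqrt (qq t x)" "\<bar>z\<bar> \<le> P * sqrt (qq t x)" for y z
      proof -
        have "\<bar>y * z\<bar> \<le> (P / sqrt (qq t x)) * (P * sqrt (qq t x))"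
          unfolding abs_mult using that P0 q0 by (intro mult_mono) auto
        then show ?thesis using q0 by simp
      qed
      note bb = bounds(1-4)[OF t, of x]
      show ?thesis unfolding Vx_def power2_eq_square
        using pr[OF bb(1) bb(3)] pr[OF bb(2) bb(3)] pr[OF bb(1) bb(4)] pr[OF bb(2) bb(4)] by linarith
    qed
    have cV: "continuous_on A V" "continuous_on A Vx" for A
      unfolding V_def Vx_def by (intro continuous_intros sl u1x_c u2x_c)+
    have A3: "\<bar>A3\<bar> \<le> 6 * P\<^sup>2 * Y R t + 3 * P\<^sup>2 * (m\<^sup>2 * Z) * (2 * L)"
    proof -
      let ?D = "\<lambda>x. 2 * w t x * chi R 0 t x * fx t x - ((w t x)\<^sup>2 * chi R 0 t x * Vx x - (w t x)\<^sup>2 * chi R 1 t x * V x)"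
      have "((\<lambda>x. ?D x) has_integral
          ((w t L)\<^sup>2 * chi R 0 t L * V L) - ((w t (-L))\<^sup>2 * chi R 0 t (-L) * V (-L))) {-L..L}"
      proof (rule fundamental_theorem_of_calculus)
        fix x
        have dV: "(V has_real_derivative Vx x) (at x)"
          unfolding V_def Vx_def by (rule DERIV_cong, (rule derivative_intros du t)+) (simp add: algebra_simps)
        have e: "?D x =
           (2 * w t x * wx t x * chi R 0 t x + (w t x)\<^sup>2 * chi R 1 t x) * V x + (w t x)\<^sup>2 * chi R 0 t x * Vx x"
        proof -
          have "fx t x = wx t x * V x + w t x * Vx x"
            unfolding fx_def w_def wx_def V_def Vx_def by (simp add: power2_eq_square algebra_simps)
          then show ?thesis by (simp add: power2_eq_square algebra_simps)
        qed
        have "((\<lambda>x. (w t x)\<^sup>2 * chi R 0 t x * V x) has_real_derivative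
           ?D x) (at x)"
          unfolding e by (rule DERIV_cong, (rule derivative_intros dw[OF t] dc dV)+) (simp add: power2_eq_square algebra_simps)
        then show "((\<lambda>x. (w t x)\<^sup>2 * chi R 0 t x * V x) has_vector_derivative
           ?D x) (at x within {-L..L})"
          by (simp add: has_real_derivative_iff_has_vector_derivative has_vector_derivative_at_within)
      qed (use L0 in auto)
      then have "integral {-L..L} (\<lambda>x. ?D x) = 0"
        by (simp add: integral_unique bz)
      moreover have "integral {-L..L} (\<lambda>x. ?D x)
        = A3 - integral {-L..L} (\<lambda>x. (w t x)\<^sup>2 * chi R 0 t x * Vx x - (w t x)\<^sup>2 * chi R 1 t x * V x)"
        unfolding A3_def by (rule Henstock_Kurzweil_Integration.integral_diff) (intro integrable_continuous_interval continuous_intros sl cV)+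
      ultimately have A3e: "A3 = integral {-L..L} (\<lambda>x. (w t x)\<^sup>2 * chi R 0 t x * Vx x - (w t x)\<^sup>2 * chi R 1 t x * V x)" by simp
      have "norm A3 \<le> integral {-L..L} (\<lambda>x. 6 * P\<^sup>2 * ((w t x)\<^sup>2 * chi R 0 t x) + 3 * P\<^sup>2 * (m\<^sup>2 * Z))"
        unfolding A3e
      proof (rule integral_norm_bound_integral)
        fix x
        have "\<bar>(w t x)\<^sup>2 * chi R 0 t x * Vx x\<bar> \<le> (w t x)\<^sup>2 * chi R 0 t x * (6 * P\<^sup>2)"
          unfolding abs_mult using Vxb chi_0_bounds[of R t x] by (intro mult_mono) auto
        moreover have "\<bar>(w t x)\<^sup>2 * chi R 1 t x * V x\<bar> \<le> (m\<^sup>2 * Z) * (3 * P\<^sup>2)"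
        proof -
          have "\<bar>(w t x)\<^sup>2 * chi R 1 t x * V x\<bar> = ((w t x)\<^sup>2 * \<bar>chi R 1 t x\<bar>) * \<bar>V x\<bar>" by (simp add: abs_mult)
          also have "\<dots> \<le> (m\<^sup>2 * Z) * (3 * P\<^sup>2)"
            by (rule mult_mono[OF w2m(1) Vb]) (use Z0 in auto)
          finally show ?thesis .
        qed
        ultimately show "norm ((w t x)\<^sup>2 * chi R 0 t x * Vx x - (w t x)\<^sup>2 * chi R 1 t x * V x) \<le> 6 * P\<^sup>2 * ((w t x)\<^sup>2 * chi R 0 t x) + 3 * P\<^sup>2 * (m\<^sup>2 * Z)"
          using abs_triangle_ineq4[of "(w t x)\<^sup>2 * chi R 0 t x * Vx x" "(w t x)\<^sup>2 * chi R 1 t x * V x"] unfolding real_norm_def by (simp add: mult_ac)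
      qed (intro integrable_continuous_interval continuous_intros sl cV)+
      also have "\<dots> = integral {-L..L} (\<lambda>x. 6 * P\<^sup>2 * ((w t x)\<^sup>2 * chi R 0 t x)) + integral {-L..L} (\<lambda>x. 3 * P\<^sup>2 * (m\<^sup>2 * Z))"
        by (rule Henstock_Kurzweil_Integration.integral_add) (intro integrable_continuous_interval continuous_intros sl)+
      also have "integral {-L..L} (\<lambda>x. 6 * P\<^sup>2 * ((w t x)\<^sup>2 * chi R 0 t x)) = 6 * P\<^sup>2 * Y R t"
        unfolding Y_def L_def[symmetric] by (rule Henstock_Kurzweil_Integration.integral_mult_right)
      also have "integral {-L..L} (\<lambda>x. 3 * P\<^sup>2 * (m\<^sup>2 * Z)) = 3 * P\<^sup>2 * (m\<^sup>2 * Z) * (2 * L)" using L0 by simp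
      finally show ?thesis by simp
    qed
    have Qe: "Q R t = A1 / t + A2 - \<epsilon> * A3"
    proof -
      have "Q R t = integral {-L..L} (\<lambda>x. ((?q x) / t + (w t x)\<^sup>2 * chi R 3 t x) - \<epsilon> * (2 * w t x * chi R 0 t x * fx t x))"
        unfolding Q_def L_def[symmetric] using t0 by (intro integral_cong) (simp add: field_simps)
      also have "\<dots> = integral {-L..L} (\<lambda>x. (?q x) / t + (w t x)\<^sup>2 * chi R 3 t x) - integral {-L..L} (\<lambda>x. \<epsilon> * (2 * w t x * chi R 0 t x * fx t x))"
        by (rule Henstock_Kurzweil_Integration.integral_diff) (intro integrable_continuous_interval continuous_intros sl; use t0 in simp)+
      also have "integral {-L..L} (\<lambda>x. (?q x) / t + (w t x)\<^sup>2 * chi R 3 t x) = integral {-L..L} (\<lambda>x. (?q x) / t) + A2"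
        unfolding A2_def by (rule Henstock_Kurzweil_Integration.integral_add) (intro integrable_continuous_interval continuous_intros sl; use t0 in simp)+
      also have "integral {-L..L} (\<lambda>x. (?q x) / t) = A1 / t"
        unfolding A1_def by (rule integral_divide)
      also have "integral {-L..L} (\<lambda>x. \<epsilon> * (2 * w t x * chi R 0 t x * fx t x)) = \<epsilon> * A3"
        unfolding A3_def by (rule Henstock_Kurzweil_Integration.integral_mult_right)
      finally show ?thesis .
    qed
    have Lle: "L \<le> (2 * b + 1) * R" unfolding L_def using R by (simp add: algebra_simps)
    have ZL: "Z * L \<le> k"
    proof -
      have "Z * L \<le> Z * ((2 * b + 1) * R)" by (rule mult_left_mono[OF Lle Z0(1)])
      also have "\<dots> = k" unfolding Z_def k_def using R0 by simp
      finally show ?thesis .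
    qed
    have Zle: "Z \<le> c1 / a" unfolding Z_def using R a c1 by (intro divide_left_mono) auto
    have Z2L: "Z2 * L \<le> k'"
    proof -
      have "Z2 * L \<le> Z2 * ((2 * b + 1) * R)" by (rule mult_left_mono[OF Lle Z0(2)])
      also have "\<dots> = k' * (1 / R\<^sup>2)" unfolding Z2_def k'_def using R0 a by (simp add: field_simps power2_eq_square power3_eq_cube)
      also have "\<dots> \<le> k' * 1" using R kn by (intro mult_left_mono) auto
      finally show ?thesis by simp
    qed
    have "\<bar>A1 / t\<bar> \<le> m * k1 + m\<^sup>2 * (3 * b * k' / a)"
    proof -
      have "m * Z * (2 * L * (B + B) + L + 2 * pi * (2 * M + 2 * M)) = m * ((Z * L) * (4 * B + 1) + 8 * pi * M * Z)" by (simp add: algebra_simps)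
      also have "\<dots> \<le> m * (k * (4 * B + 1) + 8 * pi * M * (c1 / a))"
        using BM m0 by (intro mult_left_mono add_mono mult_right_mono ZL Zle) auto
      also have "\<dots> = m * (k1 * a)" unfolding k1_def using a by simp
      finally have 1: "m * Z * (2 * L * (B + B) + L + 2 * pi * (2 * M + 2 * M)) \<le> m * (k1 * a)" .
      have "3 * t * m\<^sup>2 * Z2 * L = 3 * t * m\<^sup>2 * (Z2 * L)" by simp
      also have "\<dots> \<le> 3 * b * m\<^sup>2 * k'"
        using t0 tab L0 Z0 kn by (intro mult_mono mult_right_mono mult_left_mono Z2L) auto
      finally have 2: "\<bar>A1\<bar> \<le> m * (k1 * a) + 3 * b * m\<^sup>2 * k'" using A1 1 by linarith
      have "\<bar>A1 / t\<bar> = \<bar>A1\<bar> / t" using t0 by (simp add: abs_divide)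
      also have "\<dots> \<le> (m * (k1 * a) + 3 * b * m\<^sup>2 * k') / a"
        using 2 tab a by (intro frac_le) (auto intro: order_trans[OF abs_ge_zero])
      also have "\<dots> = m * k1 + m\<^sup>2 * (3 * b * k' / a)" using a by (simp add: field_simps)
      finally show ?thesis .
    qed
    moreover have "\<bar>A2\<bar> \<le> m\<^sup>2 * (2 * k')"
    proof -
      have "m\<^sup>2 * Z2 * (2 * L) = m\<^sup>2 * (2 * (Z2 * L))" by simp
      also have "\<dots> \<le> m\<^sup>2 * (2 * k')" by (intro mult_left_mono Z2L) auto
      finally show ?thesis using A2 by linarith
    qed
    moreover have "\<bar>\<epsilon> * A3\<bar> \<le> 6 * P\<^sup>2 * Y R t + m\<^sup>2 * (6 * P\<^sup>2 * k)"
    proof -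
      have "3 * P\<^sup>2 * (m\<^sup>2 * Z) * (2 * L) = m\<^sup>2 * (6 * P\<^sup>2 * (Z * L))" by simp
      also have "\<dots> \<le> m\<^sup>2 * (6 * P\<^sup>2 * k)" by (intro mult_left_mono ZL) auto
      finally have "\<bar>A3\<bar> \<le> 6 * P\<^sup>2 * Y R t + m\<^sup>2 * (6 * P\<^sup>2 * k)" using A3 by linarith
      moreover have "\<bar>\<epsilon> * A3\<bar> \<le> 1 * \<bar>A3\<bar>" unfolding abs_mult by (rule mult_right_mono[OF eps]) simp
      ultimately show ?thesis by linarith
    qed
    moreover have "Y R t \<ge> 0" unfolding Y_def
      using chi_0_bounds by (intro Henstock_Kurzweil_Integration.integral_nonneg integrable_continuous_interval continuous_intros sl) auto
    moreover have "m\<^sup>2 * (3 * b * k' / a) + m\<^sup>2 * (2 * k') + m\<^sup>2 * (6 * P\<^sup>2 * k) = m\<^sup>2 * k2"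
      unfolding k2_def by (simp add: algebra_simps)
    moreover have "C0 * Y R t = 6 * P\<^sup>2 * Y R t + Y R t" unfolding C0_def by (simp add: algebra_simps)
    ultimately show ?thesis unfolding Qe m_def[symmetric] by linarith
  qed
  then show ?thesis using that[OF k12] by blast
qed

lemma Y_props:
  assumes R: "R \<ge> 1"
  shows "continuous_on {a..b} (Y R)" "t \<in> {a..b} \<Longrightarrow> Y R t \<ge> 0"
    "t \<in> {a..b} \<Longrightarrow> ennreal (Y R t) \<le> (\<integral>\<^sup>+x. ennreal ((w t x)\<^sup>2) \<partial>lborel)"
    "t \<in> {a..b} \<Longrightarrow> (\<integral>\<^sup>+x. ennreal ((w t x)\<^sup>2) * indicator {-(R * a)..R * a} x \<partial>lborel) \<le> ennreal (Y R t)"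
proof -
  have R0: "R > 0" using R by simp
  let ?L = "2*R*b+1"
  have chj: "continuous_on ({a..b} \<times> UNIV) (\<lambda>(t, x). chi R 0 t x)"
    by (rule chi_joint_continuous[OF R0]) (rule pos)
  have "continuous_on ({a..b} \<times> cbox (-?L) ?L) (\<lambda>(t, x). (w t x)\<^sup>2 * chi R 0 t x)"
    using continuous_on_subset[OF jc(3), of "{a..b} \<times> cbox (-?L) ?L"] continuous_on_subset[OF chj, of "{a..b} \<times> cbox (-?L) ?L"]
    unfolding split_beta by (intro continuous_intros) auto
  from integral_continuous_on_param[OF this]
  show "continuous_on {a..b} (Y R)" unfolding Y_def by simp
  {
    assume t: "t \<in> {a..b}"
    note sl = slice[OF jc(3) t] slice[OF chj t]
    let ?g = "\<lambda>x. (w t x)\<^sup>2 * chi R 0 t x"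
    have g0: "?g x \<ge> 0" for x using chi_0_bounds by simp
    show "Y R t \<ge> 0" unfolding Y_def
      by (intro Henstock_Kurzweil_Integration.integral_nonneg integrable_continuous_interval continuous_intros sl g0)
    have si: "set_integrable lborel {-?L..?L} ?g"
      by (intro borel_integrable_atLeastAtMost' continuous_intros sl)
    have "Y R t = (LINT x|lborel. indicator {-?L..?L} x * ?g x)"
      unfolding Y_def using set_borel_integral_eq_integral(2)[OF si] by (simp add: set_lebesgue_integral_def)
    then have e: "ennreal (Y R t) = (\<integral>\<^sup>+x. ennreal (indicator {-?L..?L} x * ?g x) \<partial>lborel)"
      using si g0 by (subst nn_integral_eq_integral) (auto simp: set_integrable_def)
    show "ennreal (Y R t) \<le> (\<integral>\<^sup>+x. ennreal ((w t x)\<^sup>2) \<partial>lborel)"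
      unfolding e
    proof (intro nn_integral_mono ennreal_leI)
      fix x
      have "?g x \<le> (w t x)\<^sup>2 * 1" using chi_0_bounds by (intro mult_left_mono) auto
      then show "indicator {-?L..?L} x * ?g x \<le> (w t x)\<^sup>2" by (auto simp: indicator_def)
    qed
    show "(\<integral>\<^sup>+x. ennreal ((w t x)\<^sup>2) * indicator {-(R * a)..R * a} x \<partial>lborel) \<le> ennreal (Y R t)"
      unfolding e
    proof (intro nn_integral_mono)
      fix x
      show "ennreal ((w t x)\<^sup>2) * indicator {-(R * a)..R * a} x \<le> ennreal (indicator {-?L..?L} x * ?g x)"
      proof (cases "x \<in> {-(R * a)..R * a}")
        case True
        have "R * a \<le> R * t" "R * t \<le> R * b" "0 \<le> R * t" using R0 t a by auto
        then have "\<bar>x\<bar> \<le> R * t" "x \<in> {-?L..?L}" using True by auto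
        then show ?thesis using chi_0_eq_1[OF R0 pos[OF t], of x] True by simp
      qed auto
    qed
  }
qed

text \<open>Gronwall's lemma for each \<open>R\<close>, then \<open>R \<rightarrow> \<infinity>\<close> by monotone convergence on the left, where the cutoff is replaced by an interval on which it is 1.\<close>

lemma L2_growth:
  assumes s: "s \<in> {a..b}" and t: "t \<in> {a..b}"
  shows "(\<integral>\<^sup>+x. ennreal ((w t x)\<^sup>2) \<partial>lborel) \<le> ennreal (exp (C0 * \<bar>t - s\<bar>)) * (\<integral>\<^sup>+x. ennreal ((w s x)\<^sup>2) \<partial>lborel)"
proof -
  obtain k1 k2 where k: "k1 \<ge> 0" "k2 \<ge> 0"
    "\<And>R r. R \<ge> 1 \<Longrightarrow> r \<in> {a..b} \<Longrightarrow> \<bar>Q R r\<bar> \<le> C0 * Y R r + (mR R * k1 + (mR R)\<^sup>2 * k2)" using Q_bound by metis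
  define E where "E R = mR R * k1 + (mR R)\<^sup>2 * k2" for R
  have C0: "C0 > 0" unfolding C0_def by (simp add: add_nonneg_pos)
  let ?e = "exp (C0 * \<bar>t - s\<bar>)"
  define S where "S = (\<integral>\<^sup>+x. ennreal ((w s x)\<^sup>2) \<partial>lborel)"
  have step: "Y R t \<le> ?e * (Y R s + E R / C0)" and E0: "E R \<ge> 0" if R: "R \<ge> 1" for R
  proof -
    have "mR R \<ge> 0" using mR_nonneg R by simp
    then show E0: "E R \<ge> 0" unfolding E_def using k by auto
    show "Y R t \<le> ?e * (Y R s + E R / C0)"
    proof (rule gronwall[OF Y_props(1)[OF R] C0 Y_props(2)[OF R] E0 _ s t])
      fix s' t' assume st: "a \<le> s'" "s' \<le> t'" "t' \<le> b"
      have "norm (integral {s'..t'} (Q R)) \<le> integral {s'..t'} (\<lambda>r. C0 * Y R r + E R)"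
      proof (rule integral_norm_bound_integral[OF energy_identity(1)[OF R st]])
        have "continuous_on {s'..t'} (Y R)" using Y_props(1)[OF R] by (rule continuous_on_subset) (use st in auto)
        then show "(\<lambda>r. C0 * Y R r + E R) integrable_on {s'..t'}" by (intro integrable_continuous_interval continuous_intros)
        fix r assume "r \<in> {s'..t'}"
        then show "norm (Q R r) \<le> C0 * Y R r + E R" using k(3)[OF R, of r] st by (simp add: E_def)
      qed
      then show "\<bar>Y R t' - Y R s'\<bar> \<le> integral {s'..t'} (\<lambda>r. C0 * Y R r + E R)"
        unfolding energy_identity(2)[OF R st] by simp
    qed
  qed
  have Elim: "(\<lambda>n. E (real (Suc n))) \<longlonglongrightarrow> 0"
  proof -
    have "filterlim (\<lambda>n. real (Suc n)) at_top sequentially" by real_asymp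
    then have "(\<lambda>n. mR (real (Suc n))) \<longlonglongrightarrow> 0" by (rule filterlim_compose[OF mR_tendsto])
    then have "(\<lambda>n. E (real (Suc n))) \<longlonglongrightarrow> 0 * k1 + 0\<^sup>2 * k2" unfolding E_def by (intro tendsto_intros)
    then show ?thesis by simp
  qed
  have lim: "(\<lambda>n. ennreal ?e * (S + ennreal (E (real (Suc n)) / C0))) \<longlonglongrightarrow> ennreal ?e * (S + ennreal (0 / C0))"
    by (intro ennreal_tendsto_cmult tendsto_add tendsto_const tendsto_ennrealI tendsto_divide Elim) (use C0 in auto)
  let ?J = "\<lambda>n. {-(real (Suc n) * a)..real (Suc n) * a}"
  let ?T = "\<lambda>n. (\<integral>\<^sup>+x. ennreal ((w t x)\<^sup>2) * indicator (?J n) x \<partial>lborel)"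
  have mono: "?T n \<le> ?T n'" if "n \<le> n'" for n n'
  proof (intro nn_integral_mono mult_left_mono)
    fix x
    have "real (Suc n) * a \<le> real (Suc n') * a" using that a by (intro mult_right_mono) auto
    then show "indicator (?J n) x \<le> (indicator (?J n') x :: ennreal)"
      by (auto simp: indicator_def)
  qed auto
  have bd: "?T n \<le> ennreal ?e * (S + ennreal (E (real (Suc n)) / C0))" for n
  proof -
    have R: "real (Suc n) \<ge> 1" by simp
    have "?T n \<le> ennreal (Y (real (Suc n)) t)" by (rule Y_props(4)[OF R t])
    also have "\<dots> \<le> ennreal (?e * (Y (real (Suc n)) s + E (real (Suc n)) / C0))" by (rule ennreal_leI[OF step[OF R]])
    also have "\<dots> = ennreal ?e * (ennreal (Y (real (Suc n)) s) + ennreal (E (real (Suc n)) / C0))"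
      using Y_props(2)[OF R s] E0[OF R] C0 by (simp add: ennreal_mult ennreal_plus)
    also have "\<dots> \<le> ennreal ?e * (S + ennreal (E (real (Suc n)) / C0))"
      unfolding S_def by (intro mult_left_mono add_right_mono Y_props(3)[OF R s]) auto
    finally show ?thesis .
  qed
  have fix_n: "?T n \<le> ennreal ?e * S" for n
  proof -
    have "?T n \<le> ennreal ?e * (S + ennreal (0 / C0))"
      by (rule LIMSEQ_le_const[OF lim]) (use order_trans[OF mono bd] in blast)
    then show ?thesis by simp
  qed
  have cw: "continuous_on UNIV (w t)" by (rule slice[OF jc(3) t])
  have "(\<integral>\<^sup>+x. ennreal ((w t x)\<^sup>2) \<partial>lborel) = (\<integral>\<^sup>+x. (SUP n. ennreal ((w t x)\<^sup>2) * indicator (?J n) x) \<partial>lborel)"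
  proof (rule nn_integral_cong)
    fix x
    obtain n :: nat where n: "\<bar>x\<bar> / a \<le> real n" using real_arch_simple by blast
    then have "\<bar>x\<bar> \<le> real (Suc n) * a" using a by (simp add: field_simps)
    then have "x \<in> (?J n)" by auto
    then have "ennreal ((w t x)\<^sup>2) = ennreal ((w t x)\<^sup>2) * indicator (?J n) x" by simp
    also have "\<dots> \<le> (SUP n. ennreal ((w t x)\<^sup>2) * indicator (?J n) x)" by (rule SUP_upper) simp
    finally have "ennreal ((w t x)\<^sup>2) \<le> (SUP n. ennreal ((w t x)\<^sup>2) * indicator (?J n) x)" .
    moreover have "(SUP n. ennreal ((w t x)\<^sup>2) * indicator (?J n) x) \<le> ennreal ((w t x)\<^sup>2)"
      by (rule SUP_least) (auto simp: indicator_def)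
    ultimately show "ennreal ((w t x)\<^sup>2) = (SUP n. ennreal ((w t x)\<^sup>2) * indicator (?J n) x)" by (rule antisym)
  qed
  also have "\<dots> = (SUP n. ?T n)"
  proof (rule nn_integral_monotone_convergence_SUP)
    show "incseq (\<lambda>n x. ennreal ((w t x)\<^sup>2) * indicator (?J n) x)"
    proof (intro incseq_SucI le_funI mult_left_mono)
      fix n x
      have "real (Suc n) * a \<le> real (Suc (Suc n)) * a" using a by (intro mult_right_mono) auto
      then show "indicator (?J n) x \<le> (indicator (?J (Suc n)) x :: ennreal)"
        by (auto simp: indicator_def)
    qed auto
    have "(\<lambda>x. (w t x)\<^sup>2) \<in> borel_measurable borel" by (intro borel_measurable_continuous_onI continuous_intros cw)
    then show "(\<lambda>x. ennreal ((w t x)\<^sup>2) * indicator (?J n) x) \<in> borel_measurable lborel" for n by measurable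
  qed
  also have "\<dots> \<le> ennreal ?e * S" by (rule SUP_least) (rule fix_n)
  finally show ?thesis unfolding S_def .
qed

end

section \<open>From the space E to profiles\<close>

lemma D_of_real_compose:
  fixes \<phi> :: "real \<Rightarrow> real"
  assumes "smooth \<phi>" shows "D (\<lambda>x. complex_of_real (\<phi> x)) = (\<lambda>x. complex_of_real (dir_deriv 1 \<phi> x))"
  by (rule ext, rule dir_deriv_eq_vector) (intro has_vector_derivative_of_real smooth_has_vector_derivative assms
      | simp add: has_real_derivative_iff_has_vector_derivative smooth_has_vector_derivative assms)+

lemma test_fun_D:
  fixes \<phi> :: "real \<Rightarrow> complex"
  assumes "test_fun A \<phi>" shows "test_fun A (D \<phi>)"
proof -
  from assms obtain K where K: "smooth \<phi>" "compact K" "K \<subseteq> A" "\<And>x. x \<notin> K \<Longrightarrow> \<phi> x = 0" unfolding test_fun_def by blast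
  have "D \<phi> x = 0" if "x \<notin> K" for x
    using D_pow_eq_0_outside[OF compact_imp_closed[OF K(2)] K(4) that, where n=1] by simp
  then show ?thesis using K smooth_D unfolding test_fun_def by blast
qed

text \<open>The square integrable function \<open>h\<close> is integrable up to \<open>p = 0\<close>, so its primitive extends \<open>F\<close> continuously to the closed half-line.\<close>

lemma ac_profile_of_weak:
  assumes F: "continuous_on {0<..} F" "\<And>p. p > 0 \<Longrightarrow> cmod (F p) \<le> B"
    and h: "locally_integrable {0<..} h" "(\<integral>\<^sup>+p\<in>{0<..}. ennreal ((cmod (h p))\<^sup>2) \<partial>lborel) \<le> ennreal M" "M \<ge> 0"
    and wk: "\<And>\<phi>::real\<Rightarrow>real. test_fun {0<..} \<phi> \<Longrightarrow> (LINT x|lborel. \<phi> x *\<^sub>R h x) = - (LINT x|lborel. dir_deriv 1 \<phi> x *\<^sub>R F x)"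
  obtains G h' where "ac_profile B M G h'" "\<And>p. p > 0 \<Longrightarrow> G p = F p"
proof -
  define h' where "h' = (\<lambda>p. indicator {0<..} p *\<^sub>R h p)"
  have m [measurable]: "h' \<in> borel_measurable borel" unfolding h'_def by (rule locally_integrable_measurable[OF open_greaterThan h(1)])
  have nn: "(\<integral>\<^sup>+p. ennreal ((cmod (h' p))\<^sup>2) \<partial>lborel) \<le> ennreal M"
  proof -
    have "(\<integral>\<^sup>+p. ennreal ((cmod (h' p))\<^sup>2) \<partial>lborel) = (\<integral>\<^sup>+p\<in>{0<..}. ennreal ((cmod (h p))\<^sup>2) \<partial>lborel)"
      by (rule nn_integral_cong) (auto simp: h'_def indicator_def)
    then show ?thesis using h(2) by simp
  qed
  have i2: "integrable lborel (\<lambda>p. (cmod (h' p))\<^sup>2)"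
    by (rule integrableI_bounded) (use nn in \<open>auto intro: le_less_trans\<close>)
  have le: "(LINT p|lborel. (cmod (h' p))\<^sup>2) \<le> M"
    using nn h(3) by (subst (asm) nn_integral_eq_integral[OF i2]) auto
  have si: "set_integrable lborel {a..b} h'" for a b by (rule L2_set_integrable[OF m i2])
  define J where "J p = integral {0..p} h'" for p
  have hi: "h' integrable_on {a..b}" "(LINT p:{a..b}|lborel. h' p) = integral {a..b} h'" for a b
    using set_borel_integral_eq_integral[OF si] by auto
  have Jd: "J b - J a = (LINT p:{a..b}|lborel. h' p)" if "0 \<le> a" "a \<le> b" for a b
    using Henstock_Kurzweil_Integration.integral_combine[OF that hi(1)] unfolding J_def hi(2) by (simp add: algebra_simps)
  have Fd: "F b - F a = J b - J a" if "0 < a" "a < b" for a b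
  proof -
    have sub: "{a..b} \<subseteq> {0<..}" using that by auto
    have "F b - F a = (LINT x:{a..b}|lborel. h x)"
      by (rule weak_derivative_FTC[OF sub that(2) continuous_on_subset[OF F(1) sub] locally_integrable_interval[OF h(1) sub] wk])
    also have "\<dots> = (LINT x:{a..b}|lborel. h' x)"
      unfolding set_lebesgue_integral_def
      by (rule Bochner_Integration.integral_cong) (use that in \<open>auto simp: h'_def indicator_def\<close>)
    finally show ?thesis using Jd[of a b] that by simp
  qed
  define G where "G p = F 1 - J 1 + J p" for p
  have GF: "G p = F p" if "p > 0" for p
  proof -
    consider "p < 1" | "p = 1" | "p > 1" by linarith
    then show ?thesis using Fd[of p 1] Fd[of 1 p] that unfolding G_def by cases (auto simp: algebra_simps)
  qed
  have cJ: "continuous_on {0..1} J" unfolding J_def by (rule indefinite_integral_continuous_1[OF hi(1)])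
  have G0: "cmod (G 0) \<le> B"
  proof -
    have "continuous (at 0 within {0..1}) J" using cJ by (auto simp: continuous_on_eq_continuous_within)
    then have "(J \<longlongrightarrow> J 0) (at 0 within {0..1})" by (simp add: continuous_within)
    then have "(J \<longlongrightarrow> J 0) (at_right 0)" by (simp add: at_within_Icc_at_right)
    then have "((\<lambda>p. cmod (G p)) \<longlongrightarrow> cmod (G 0)) (at_right 0)" unfolding G_def by (intro tendsto_intros)
    then show ?thesis
    proof (rule tendsto_upperbound)
      show "\<forall>\<^sub>F p in at_right 0. cmod (G p) \<le> B"
        unfolding eventually_at_filter by (rule always_eventually) (use GF F(2) in auto)
    qed simp
  qed
  have "ac_profile B M G h'"
    unfolding ac_profile_def
  proof (intro conjI allI impI)
    show "B \<ge> 0" using G0 norm_ge_zero order_trans by blast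
    show "cmod (G p) \<le> B" if "0 \<le> p" for p using G0 GF[of p] F(2)[of p] that by (cases "p = 0") auto
    show "G b - G a = (LINT p:{a..b}|lborel. h' p)" if "0 \<le> a" "a \<le> b" for a b
      using Jd[OF that] by (simp add: G_def)
  qed (use h i2 le in auto)
  then show ?thesis using that GF by blast
qed

text \<open>The infima in the norms need not be attained, hence the summands 1. The factor \<open>t\<^sup>-\<^sup>1\<^sup>/\<^sup>6\<close> in front of the \<open>L\<^sup>2\<close> norm is bounded below on
  bounded time intervals.\<close>

lemma E_norm_profile:
  assumes E: "E_norm t v \<le> ennreal K" and t: "0 < t" "t \<le> T" and K: "K \<ge> 0"
    and F: "represents {0<..} (profile t v) F" "continuous_on {0<..} F"
  obtains G h g where "ac_profile (K + 1) ((K * T powr (1/6) + 1)\<^sup>2) G h" "\<And>p. p > 0 \<Longrightarrow> G p = F p"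
    "represents UNIV (profile t v) g" "AE p in lborel. cmod (g p) \<le> K + 1" "AE p in lborel. p > 0 \<longrightarrow> g p = G p"
proof -
  have "Linf_norm (profile t v) \<le> ennreal K" using E unfolding E_norm_def by (rule order_trans[OF add_increasing2[OF zero_le order_refl]])
  also have "ennreal K < ennreal (K + 1)" using K by (intro ennreal_lessI) auto
  finally obtain g where g: "represents UNIV (profile t v) g" "esssup lborel (\<lambda>p. ennreal (cmod (g p))) < ennreal (K + 1)"
    unfolding Linf_norm_def INF_less_iff by blast
  have "AE p in lborel. ennreal (cmod (g p)) \<le> esssup lborel (\<lambda>p. ennreal (cmod (g p)))" by (rule esssup_AE)
  then have gb: "AE p in lborel. cmod (g p) \<le> K + 1"
  proof eventually_elim
    case (elim p)
    then have "ennreal (cmod (g p)) \<le> ennreal (K + 1)" using g(2) by (meson le_less_trans less_imp_le)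
    then show ?case using K by (subst (asm) ennreal_le_iff) auto
  qed
  define \<theta> where "\<theta> = T powr (- 1 / 6)"
  define R where "R = K * T powr (1/6) + 1"
  have T0: "T > 0" using t by linarith
  have \<theta>: "\<theta> > 0" unfolding \<theta>_def using T0 by simp
  have R0: "R > 0" unfolding R_def using K by (simp add: add_nonneg_pos)
  have "ennreal (t powr (- 1 / 6)) * L2_norm {0<..} (deriv_distr (profile t v)) \<le> ennreal K"
    using E unfolding E_norm_def by (rule order_trans[OF add_increasing[OF zero_le order_refl]])
  moreover have "\<theta> \<le> t powr (- 1 / 6)" unfolding \<theta>_def using t by (intro powr_mono2') auto
  ultimately have L2: "ennreal \<theta> * L2_norm {0<..} (deriv_distr (profile t v)) \<le> ennreal K"
    by (meson ennreal_leI mult_right_mono order_trans zero_le)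
  have "L2_norm {0<..} (deriv_distr (profile t v)) < ennreal R"
  proof (rule ccontr)
    assume "\<not> L2_norm {0<..} (deriv_distr (profile t v)) < ennreal R"
    then have "ennreal \<theta> * ennreal R \<le> ennreal K"
      using L2 by (meson mult_left_mono not_less order_trans zero_le)
    then have "\<theta> * R \<le> K" using \<theta> R0 K by (simp add: ennreal_mult''[symmetric])
    moreover have "\<theta> * R = K * (T powr (- 1 / 6) * T powr (1/6)) + \<theta>" unfolding R_def \<theta>_def by (simp add: algebra_simps)
    moreover have "T powr (- 1 / 6) * T powr (1/6) = 1" using T0 by (simp flip: powr_add)
    ultimately show False using \<theta> by simp
  qed
  then obtain c h where c: "c < ennreal R" "represents {0<..} (deriv_distr (profile t v)) h"
    "(\<integral>\<^sup>+p\<in>{0<..}. ennreal ((cmod (h p))\<^sup>2) \<partial>lborel) \<le> c\<^sup>2"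
    unfolding L2_norm_def Inf_less_iff by blast
  have "c\<^sup>2 \<le> (ennreal R)\<^sup>2" using c(1) by (intro power_mono) auto
  also have "(ennreal R)\<^sup>2 = ennreal (R\<^sup>2)" using R0 by (simp add: ennreal_power)
  finally have hM: "(\<integral>\<^sup>+p\<in>{0<..}. ennreal ((cmod (h p))\<^sup>2) \<partial>lborel) \<le> ennreal (R\<^sup>2)" using c(3) by (rule order_trans[rotated])
  have gF: "AE p in lborel. p \<in> {0<..} \<longrightarrow> g p = F p"
    by (rule represents_unique_AE[OF open_greaterThan represents_mono[OF g(1) subset_UNIV] F(1)])
  have Fb: "cmod (F p) \<le> K + 1" if "p > 0" for p
  proof (rule AE_bound_continuous_pos[OF _ F(2) that])
    show "AE x in lborel. x > 0 \<longrightarrow> norm (F x) \<le> K + 1" using gF gb by eventually_elim auto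
  qed
  have wk: "(LINT x|lborel. \<phi> x *\<^sub>R h x) = - (LINT x|lborel. dir_deriv 1 \<phi> x *\<^sub>R F x)" if \<phi>: "test_fun {0<..} \<phi>" for \<phi> :: "real \<Rightarrow> real"
  proof -
    note \<phi>c = test_fun_of_real[OF \<phi>]
    have sm: "smooth \<phi>" using \<phi> by (simp add: test_fun_def)
    have "(LINT x|lborel. h x * complex_of_real (\<phi> x)) = deriv_distr (profile t v) (\<lambda>x. complex_of_real (\<phi> x))"
      using c(2) \<phi>c by (simp add: represents_def)
    also have "\<dots> = - profile t v (D (\<lambda>x. complex_of_real (\<phi> x)))" by (simp add: deriv_distr_def)
    also have "profile t v (D (\<lambda>x. complex_of_real (\<phi> x))) = (LINT x|lborel. F x * D (\<lambda>x. complex_of_real (\<phi> x)) x)"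
      using F(1) test_fun_D[OF \<phi>c] by (simp add: represents_def)
    finally show ?thesis unfolding D_of_real_compose[OF sm] by (simp add: scaleR_conv_of_real mult.commute)
  qed
  have hl: "locally_integrable {0<..} h" using c(2) by (simp add: represents_def)
  obtain G h' where G: "ac_profile (K + 1) (R\<^sup>2) G h'" "\<And>p. p > 0 \<Longrightarrow> G p = F p"
    using ac_profile_of_weak[OF F(2) Fb hl hM _ wk] by (metis zero_le_power2)
  have "AE p in lborel. p > 0 \<longrightarrow> g p = G p" using gF by eventually_elim (use G(2) in auto)
  then show ?thesis using that[OF G(1)[unfolded R_def] G(2) g(1) gb] by blast
qed

section \<open>The function represented by the distribution\<close>

lemma fourier_conj:
  "fourier (\<lambda>x. cnj (\<theta> (- x))) p = cnj (fourier \<theta> p)"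
proof -
  have "fourier (\<lambda>x. cnj (\<theta> (- x))) p = (LINT x|lborel. exp (- (\<i> * of_real (p * (0 + (-1) * x)))) * cnj (\<theta> (- (0 + (-1) * x))))"
    unfolding fourier_def by (subst lborel_integral_real_affine[of "-1" _ 0]) auto
  also have "\<dots> = (LINT x|lborel. cnj (exp (- (\<i> * of_real (p * x))) * \<theta> x))"
    by (rule Bochner_Integration.integral_cong) (auto simp: exp_cnj)
  also have "\<dots> = cnj (fourier \<theta> p)" unfolding fourier_def by (rule LINT_cnj)
  finally show ?thesis .
qed

lemma test_fun_conj_reflect:
  fixes \<theta> :: "real \<Rightarrow> complex"
  assumes "test_fun UNIV \<theta>" shows "test_fun UNIV (\<lambda>x. cnj (\<theta> (- x)))"
proof -
  from assms obtain K where K: "smooth \<theta>" "compact K" "\<And>x. x \<notin> K \<Longrightarrow> \<theta> x = 0" unfolding test_fun_def by blast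
  have "smooth (\<lambda>x. \<theta> (- x))" using smooth_affine[OF K(1), of 0 "-1"] by simp
  then have "smooth (\<lambda>x. cnj (\<theta> (- x)))" by (rule smooth_bounded_linear[OF bounded_linear_cnj])
  moreover have "compact (uminus ` K)" by (rule compact_negations[OF K(2)])
  moreover have "cnj (\<theta> (- x)) = 0" if "x \<notin> uminus ` K" for x
    using K(3)[of "-x"] that by force
  ultimately show ?thesis unfolding test_fun_def by blast
qed

lemma test_fun_mult_smooth:
  fixes \<theta> e :: "real \<Rightarrow> complex"
  assumes "test_fun A \<theta>" "smooth e" shows "test_fun A (\<lambda>x. e x * \<theta> x)"
proof -
  from assms obtain K where K: "smooth \<theta>" "compact K" "K \<subseteq> A" "\<And>x. x \<notin> K \<Longrightarrow> \<theta> x = 0" unfolding test_fun_def by blast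
  then have "smooth (\<lambda>x. e x * \<theta> x)" "\<And>x. x \<notin> K \<Longrightarrow> e x * \<theta> x = 0" using assms by (auto intro: smooth_mult)
  then show ?thesis using K unfolding test_fun_def by blast
qed

lemma fourier_distr_of_profile:
  assumes rep: "represents UNIV (profile t S) g" and \<theta>: "test_fun UNIV \<theta>"
  shows "S (fourier \<theta>) = (LINT p|lborel. (iexp (t * p ^ 3) * g p) * \<theta> p)"
proof -
  have s: "smooth (\<lambda>p. iexp (t * p ^ 3))" by (intro smooth_iexp smooth_mult smooth_const smooth_power smooth_id)
  have "profile t S (\<lambda>p. iexp (t * p ^ 3) * \<theta> p) = fourier_distr S (\<lambda>p. exp (- (\<i> * of_real (t * p ^ 3))) * (iexp (t * p ^ 3) * \<theta> p))"
    by (simp add: profile_def mult_distr_def)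
  also have "(\<lambda>p. exp (- (\<i> * of_real (t * p ^ 3))) * (iexp (t * p ^ 3) * \<theta> p)) = \<theta>"
    by (auto simp: mult.assoc[symmetric] exp_add[symmetric])
  also have "fourier_distr S \<theta> = S (fourier \<theta>)" using test_fun_schwartz[OF \<theta>] by (simp add: fourier_distr_def)
  finally show ?thesis
    using rep test_fun_mult_smooth[OF \<theta> s] unfolding represents_def by (simp add: mult_ac)
qed

text \<open>Conjugation in \<open>x\<close> is conjugation and reflection in \<open>p\<close>.\<close>

lemma real_distr_symmetry:
  assumes S: "real_distr S" and g: "g \<in> borel_measurable borel" "AE p in lborel. cmod (g p) \<le> B"
    and rep: "\<And>\<theta>. test_fun UNIV \<theta> \<Longrightarrow> S (fourier \<theta>) = (LINT p|lborel. g p * \<theta> p)"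
  shows "AE p in lborel. g (- p) = cnj (g p)"
proof -
  note [measurable] = g(1)
  have cm [measurable]: "cnj \<in> borel_measurable borel" by (intro borel_measurable_continuous_onI continuous_on_cnj continuous_on_id)
  have AEm: "AE p in lborel. cmod (g (- p)) \<le> B"
    using AE_borel_affine[of "-1" "\<lambda>p. cmod (g p) \<le> B" 0] g(2) by simp
  have "AE p in lborel. p \<in> UNIV \<longrightarrow> cnj (g (- p)) = g p"
  proof (rule locally_integrable_eq_AE[OF open_UNIV])
    show "locally_integrable UNIV g" by (rule bounded_locally_integrable[OF g])
    show "locally_integrable UNIV (\<lambda>p. cnj (g (- p)))"
      by (rule bounded_locally_integrable[where B=B]) (measurable, use AEm in simp)
    fix \<phi> :: "real \<Rightarrow> real" assume \<phi>: "test_fun UNIV \<phi>"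
    let ?\<theta> = "\<lambda>x. complex_of_real (\<phi> x)"
    note t = test_fun_of_real[OF \<phi>]
    note t' = test_fun_conj_reflect[OF t]
    have \<theta>s: "?\<theta> \<in> schwartz" by (rule test_fun_schwartz[OF t])
    have "S (fourier (\<lambda>x. cnj (?\<theta> (- x)))) = cnj (S (fourier ?\<theta>))"
    proof -
      have fe: "fourier (\<lambda>x. cnj (?\<theta> (- x))) = (\<lambda>p. cnj (fourier ?\<theta> p))" by (rule ext) (rule fourier_conj)
      show ?thesis unfolding fe using S schwartz_fourier[OF \<theta>s] unfolding real_distr_def by blast
    qed
    then have "(LINT p|lborel. g p * cnj (?\<theta> (- p))) = cnj (LINT p|lborel. g p * ?\<theta> p)"
      using rep[OF t] rep[OF t'] by simp
    moreover have "(LINT p|lborel. g p * cnj (?\<theta> (- p))) = (LINT p|lborel. g (- p) * ?\<theta> p)"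
      by (subst lborel_integral_real_affine[of "-1" _ 0]) auto
    moreover have "cnj (LINT p|lborel. g (- p) * ?\<theta> p) = (LINT p|lborel. cnj (g (- p)) * ?\<theta> p)"
      unfolding LINT_cnj[symmetric] by simp
    ultimately show "(LINT p|lborel. cnj (g (- p)) * ?\<theta> p) = (LINT p|lborel. g p * ?\<theta> p)" by (metis complex_cnj_cnj)
  qed
  then show ?thesis by eventually_elim (metis UNIV_I complex_cnj_cnj)
qed

text \<open>Reality makes the transform Hermitian, so the pairing is twice the real part of its half over \<open>p > 0\<close>, where \<open>g = G\<close>. Truncation at a
  frequency \<open>n\<close> allows Fubini's theorem, and both sides converge as \<open>n\<close> tends to infinity.\<close>

lemma kdv_represents_weakly:
  assumes S: "S \<in> tempered_distr" "real_distr S" and t: "t > 0"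
    and prof: "ac_profile B M G h" and rep: "represents UNIV (profile t S) g"
    and gb: "AE p in lborel. cmod (g p) \<le> B'" and gG: "AE p in lborel. p > 0 \<longrightarrow> g p = G p"
    and \<psi>: "test_fun UNIV (\<psi> :: real \<Rightarrow> real)"
  shows "S (\<lambda>x. complex_of_real (\<psi> x)) = complex_of_real (LINT x|lborel. kdv G t x * \<psi> x)"
proof -
  let ?\<Psi> = "\<lambda>x. complex_of_real (\<psi> x)"
  note \<Psi>t = test_fun_of_real[OF \<psi>]
  note \<Psi>s = test_fun_schwartz[OF \<Psi>t]
  from \<psi> obtain K where K: "smooth \<psi>" "compact K" "\<And>x. x \<notin> K \<Longrightarrow> \<psi> x = 0" unfolding test_fun_def by blast
  obtain L0 where "\<And>x. x \<in> K \<Longrightarrow> norm x \<le> L0" using compact_imp_bounded[OF K(2)] unfolding bounded_iff by blast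
  then have L0: "\<psi> x = 0" if "\<bar>x\<bar> > L0" for x using that K(3) by force
  define L where "L = max L0 1"
  have L: "L > 0" and Lz: "\<psi> x = 0" if "\<bar>x\<bar> > L" for x using L0[of x] that by (auto simp: L_def)
  define \<theta> where "\<theta> = (\<lambda>p. of_real (1 / (2 * pi)) * fourier ?\<Psi> (- p))"
  have \<theta>s: "\<theta> \<in> schwartz" unfolding \<theta>_def by (rule schwartz_cmult[OF schwartz_reflect[OF schwartz_fourier[OF \<Psi>s]]])
  have F\<theta>: "fourier \<theta> = ?\<Psi>" unfolding \<theta>_def by (rule ext) (rule fourier_inversion[OF \<Psi>s])
  define g1 where "g1 p = iexp (t * p ^ 3) * g p" for p
  have gm [measurable]: "g \<in> borel_measurable borel" by (rule represents_measurable[OF rep])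
  have g1m [measurable]: "g1 \<in> borel_measurable borel" unfolding g1_def by measurable
  have g1b: "AE p in lborel. cmod (g1 p) \<le> B'" using gb by eventually_elim (simp add: g1_def norm_mult)
  have g1rep: "\<And>\<theta>. test_fun UNIV \<theta> \<Longrightarrow> S (fourier \<theta>) = (LINT p|lborel. g1 p * \<theta> p)"
    unfolding g1_def by (rule fourier_distr_of_profile[OF rep])
  have sym: "AE p in lborel. g1 (- p) = cnj (g1 p)"
    by (rule real_distr_symmetry[OF S(2) g1m g1b g1rep])
  have g1m': "g1 \<in> borel_measurable lborel" using g1m by simp
  have 1: "S ?\<Psi> = (LINT p|lborel. g1 p * \<theta> p)"
    using fourier_rep_extend[OF S(1) g1m' g1b g1rep \<theta>s] unfolding F\<theta> .
  have \<theta>sym: "\<theta> (- p) = cnj (\<theta> p)" for p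
  proof -
    have "fourier ?\<Psi> p = cnj (fourier ?\<Psi> (- p))"
    proof -
      have "cnj (fourier ?\<Psi> (- p)) = (LINT x|lborel. cnj (exp (- (\<i> * of_real ((- p) * x))) * ?\<Psi> x))"
        unfolding fourier_def by (rule LINT_cnj[symmetric])
      also have "\<dots> = fourier ?\<Psi> p" unfolding fourier_def
        by (rule Bochner_Integration.integral_cong) (auto simp: exp_cnj)
      finally show ?thesis by simp
    qed
    then show ?thesis by (simp add: \<theta>_def)
  qed
  note [measurable] = schwartz_measurable[OF \<theta>s]
  define Bs where "Bs = \<bar>B'\<bar> + \<bar>B\<bar>"
  have Bs: "B' \<le> Bs" "0 \<le> Bs" by (auto simp: Bs_def)
  have bdd_int: "integrable lborel (\<lambda>p. q p * \<theta> p)" if [measurable]: "q \<in> borel_measurable borel" and q: "AE p in lborel. cmod (q p) \<le> Bs" for q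
  proof (rule Bochner_Integration.integrable_bound)
    show "integrable lborel (\<lambda>p. of_real Bs * \<theta> p)" by (intro integrable_mult_right schwartz_integrable \<theta>s)
    show "(\<lambda>p. q p * \<theta> p) \<in> borel_measurable lborel" by measurable
    show "AE p in lborel. norm (q p * \<theta> p) \<le> norm (of_real Bs * \<theta> p)"
      using q by eventually_elim (auto simp: norm_mult intro!: mult_right_mono intro: order_trans[OF _ abs_ge_self])
  qed
  let ?ip = "\<lambda>p::real. indicator {0<..} p *\<^sub>R g1 p" and ?im = "\<lambda>p::real. indicator {..<0} p *\<^sub>R g1 p"
  have ib: "AE p in lborel. cmod (?ip p) \<le> Bs" "AE p in lborel. cmod (?im p) \<le> Bs"
    using g1b by (eventually_elim, use Bs in \<open>auto simp: indicator_def\<close>)+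
  have ii: "integrable lborel (\<lambda>p. ?ip p * \<theta> p)" "integrable lborel (\<lambda>p. ?im p * \<theta> p)"
    by (rule bdd_int; use ib in simp)+
  have "(LINT p|lborel. g1 p * \<theta> p) = (LINT p|lborel. ?ip p * \<theta> p + ?im p * \<theta> p)"
  proof (rule integral_cong_AE)
    have "AE p in lborel. p \<noteq> (0::real)" by (rule AE_lborel_singleton)
    then show "AE p in lborel. g1 p * \<theta> p = ?ip p * \<theta> p + ?im p * \<theta> p"
      by eventually_elim (auto simp: indicator_def)
  qed auto
  also have "\<dots> = (LINT p|lborel. ?ip p * \<theta> p) + (LINT p|lborel. ?im p * \<theta> p)"
    by (rule Bochner_Integration.integral_add[OF ii])
  also have "(LINT p|lborel. ?im p * \<theta> p) = (LINT p|lborel. ?im (- p) * \<theta> (- p))"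
    by (subst lborel_integral_real_affine[of "-1" _ 0]) auto
  also have "\<dots> = (LINT p|lborel. cnj (?ip p * \<theta> p))"
  proof (rule integral_cong_AE)
    show "AE p in lborel. ?im (- p) * \<theta> (- p) = cnj (?ip p * \<theta> p)"
      using sym by eventually_elim (auto simp: indicator_def \<theta>sym)
    have [measurable]: "cnj \<in> borel_measurable borel" by (intro borel_measurable_continuous_onI continuous_on_cnj continuous_on_id)
    show "(\<lambda>p. ?im (- p) * \<theta> (- p)) \<in> borel_measurable lborel" by measurable
    show "(\<lambda>p. cnj (?ip p * \<theta> p)) \<in> borel_measurable lborel" by measurable
  qed
  also have "\<dots> = cnj (LINT p|lborel. ?ip p * \<theta> p)" by (rule LINT_cnj)
  finally have 2: "S ?\<Psi> = of_real (2 * Re (LINT p|lborel. ?ip p * \<theta> p))"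
    unfolding 1 by (simp add: complex_add_cnj)
  define q where "q n p = indicator {0..real n} p *\<^sub>R (iexp (t * p ^ 3) * G p)" for n p
  have cG: "continuous_on {0..b} G" for b using ac_profile_continuous[OF prof] by (rule continuous_on_subset) auto
  have qm [measurable]: "q n \<in> borel_measurable borel" for n
    unfolding q_def by (intro borel_measurable_continuous_on_indicator continuous_intros cG) auto
  have lim1: "(\<lambda>n. LINT p|lborel. q n p * \<theta> p) \<longlonglongrightarrow> (LINT p|lborel. ?ip p * \<theta> p)"
  proof (rule integral_dominated_convergence[where w="\<lambda>p. B * cmod (\<theta> p)"])
    have "AE p in lborel. p \<noteq> (0::real)" by (rule AE_lborel_singleton)
    then show "AE p in lborel. (\<lambda>n. q n p * \<theta> p) \<longlonglongrightarrow> ?ip p * \<theta> p"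
      using gG
    proof eventually_elim
      case (elim p)
      have "\<forall>\<^sub>F n in sequentially. q n p * \<theta> p = ?ip p * \<theta> p"
      proof (cases "p > 0")
        case True
        have "\<forall>\<^sub>F n in sequentially. p < real n"
          using filterlim_real_sequentially unfolding filterlim_at_top_dense by blast
        then show ?thesis by eventually_elim (use True elim in \<open>auto simp: q_def g1_def\<close>)
      qed (use elim in \<open>auto simp: q_def indicator_def\<close>)
      then show ?case by (rule tendsto_eventually)
    qed
    show "integrable lborel (\<lambda>p. B * cmod (\<theta> p))" by (intro integrable_mult_right integrable_norm schwartz_integrable \<theta>s)
    show "AE p in lborel. norm (q n p * \<theta> p) \<le> B * cmod (\<theta> p)" for n
    proof (rule AE_I2)
      fix p
      have "cmod (q n p) \<le> B" using ac_profileD(6)[OF prof, of p] ac_profileD(1)[OF prof] by (auto simp: q_def indicator_def norm_mult)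
      then show "norm (q n p * \<theta> p) \<le> B * cmod (\<theta> p)" unfolding norm_mult by (rule mult_right_mono) simp
    qed
  qed measurable
  have osc_m: "continuous_on A (\<lambda>x. osc G t x 0 N)" for A N
    using osc_has_derivative[OF prof, of t 0 N] by (meson continuous_on_vector_derivative)
  have exch: "(LINT p|lborel. q n p * \<theta> p) = of_real (1 / (2 * pi)) * (LINT x|lborel. osc G t x 0 (real n) * ?\<Psi> x)" for n
  proof -
    have qi: "integrable lborel (q n)"
    proof -
      have "continuous_on {0..real n} (\<lambda>p. iexp (t * p ^ 3) * G p)" by (intro continuous_intros cG)
      from borel_integrable_atLeastAtMost'[OF this] show ?thesis unfolding q_def[abs_def] set_integrable_def .
    qed
    have \<Psi>i: "integrable lborel ?\<Psi>" by (rule schwartz_integrable[OF \<Psi>s])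
    let ?k = "\<lambda>x p. q n p * (iexp (p * x) * ?\<Psi> x)"
    have i: "integrable (lborel \<Otimes>\<^sub>M lborel) (\<lambda>(x, p). ?k x p)"
    proof (rule Bochner_Integration.integrable_bound[OF integrable_pair_mult[OF \<Psi>i qi]])
      note [measurable] = schwartz_measurable[OF \<Psi>s]
      show "(\<lambda>(x, p). ?k x p) \<in> borel_measurable (lborel \<Otimes>\<^sub>M lborel)" by measurable
    qed (auto simp: norm_mult mult.commute)
    have in1: "(LINT x|lborel. ?k x p) = q n p * (LINT x|lborel. exp (- (\<i> * of_real ((- p) * x))) * ?\<Psi> x)" for p
      by (simp only: integral_mult_right_zero) simp
    have in2: "(LINT p|lborel. ?k x p) = osc G t x 0 (real n) * ?\<Psi> x" for x
    proof -
      have c: "continuous_on {0..real n} (\<lambda>p. phase t x p * of_real (p ^ 0) * G p)" by (rule osc_integrand_continuous[OF prof]) simp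
      have "(LINT p|lborel. ?k x p) = (LINT p|lborel. (indicator {0..real n} p *\<^sub>R (phase t x p * of_real (p ^ 0) * G p)) * ?\<Psi> x)"
        by (rule Bochner_Integration.integral_cong) (auto simp: q_def phase_def indicator_def exp_add distrib_left mult_ac)
      also have "\<dots> = (LINT p:{0..real n}|lborel. phase t x p * of_real (p ^ 0) * G p) * ?\<Psi> x"
        unfolding set_lebesgue_integral_def by (rule integral_mult_left_zero)
      also have "(LINT p:{0..real n}|lborel. phase t x p * of_real (p ^ 0) * G p) = osc G t x 0 (real n)"
        unfolding osc_def by (rule set_borel_integral_eq_integral(2)[OF borel_integrable_atLeastAtMost'[OF c]])
      finally show ?thesis .
    qed
    have "(LINT p|lborel. q n p * \<theta> p) = of_real (1 / (2 * pi)) * (LINT p|lborel. LINT x|lborel. ?k x p)"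
      unfolding in1 integral_mult_right_zero[symmetric] \<theta>_def fourier_def
      by (rule Bochner_Integration.integral_cong) (auto simp: mult_ac)
    also have "(LINT p|lborel. LINT x|lborel. ?k x p) = (LINT x|lborel. LINT p|lborel. ?k x p)"
      by (rule lborel_pair.Fubini_integral[OF i])
    finally show ?thesis unfolding in2 .
  qed
  have i\<psi>: "integrable lborel (\<lambda>x. osc G t x 0 N * ?\<Psi> x)" for N
  proof -
    have "set_integrable lborel {-L..L} (\<lambda>x. osc G t x 0 N * ?\<Psi> x)"
      by (intro borel_integrable_atLeastAtMost' continuous_intros osc_m smooth_continuous_on K)
    moreover have "indicator {-L..L} x *\<^sub>R (osc G t x 0 N * ?\<Psi> x) = osc G t x 0 N * ?\<Psi> x" for x
    proof (cases "x \<in> {-L..L}")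
      case False
      then have "\<psi> x = 0" by (intro Lz) auto
      then show ?thesis by simp
    qed auto
    ultimately show ?thesis by (simp only: set_integrable_def)
  qed
  have Reint: "2 * Re (LINT p|lborel. q n p * \<theta> p) = (LINT x|lborel. tkdv G t (real n) 0 x * \<psi> x)" for n
  proof -
    have "2 * Re (LINT p|lborel. q n p * \<theta> p) = (1 / pi) * Re (LINT x|lborel. osc G t x 0 (real n) * ?\<Psi> x)"
      unfolding exch by simp
    also have "Re (LINT x|lborel. osc G t x 0 (real n) * ?\<Psi> x) = (LINT x|lborel. Re (osc G t x 0 (real n) * ?\<Psi> x))"
      by (rule integral_Re[OF i\<psi>, symmetric])
    finally show ?thesis unfolding tkdv_def by simp
  qed
  obtain n0 :: nat where n0: "2 * qq t L \<le> real n0" using real_arch_simple by blast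
  define W where "W = Cosc t * (B + M + 1)"
  have W0: "W \<ge> 0" unfolding W_def using Cosc_ge[OF t] ac_profileD(1,2)[OF prof] by auto
  have "(\<lambda>n. LINT x|lborel. tkdv G t (real (n + n0)) 0 x * \<psi> x) \<longlonglongrightarrow> (LINT x|lborel. kdv G t x * \<psi> x)"
  proof (rule integral_dominated_convergence[where w="\<lambda>x. W * \<bar>\<psi> x\<bar>"])
    have ct: "continuous_on UNIV (tkdv G t N 0)" for N using tkdv_has_derivative[OF prof] by (meson DERIV_continuous_on)
    have ck: "continuous_on UNIV (kdv G t)" using kdv_has_derivative[OF prof t] by (metis DERIV_continuous_on)
    have c\<psi>: "continuous_on UNIV \<psi>" by (rule smooth_continuous_on[OF K(1)])
    show "(\<lambda>x. tkdv G t (real (n + n0)) 0 x * \<psi> x) \<in> borel_measurable lborel" for n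
      using borel_measurable_continuous_onI[OF continuous_on_mult[OF ct c\<psi>]] by simp
    show "(\<lambda>x. kdv G t x * \<psi> x) \<in> borel_measurable lborel"
      using borel_measurable_continuous_onI[OF continuous_on_mult[OF ck c\<psi>]] by simp
    have "integrable lborel \<psi>" using integrable_Re[OF schwartz_integrable[OF \<Psi>s]] by simp
    then show "integrable lborel (\<lambda>x. W * \<bar>\<psi> x\<bar>)" by (intro integrable_mult_right integrable_abs)
    show "AE x in lborel. (\<lambda>n. tkdv G t (real (n + n0)) 0 x * \<psi> x) \<longlonglongrightarrow> kdv G t x * \<psi> x"
      by (intro AE_I2 tendsto_intros LIMSEQ_ignore_initial_segment[OF tkdv_LIMSEQ(1)[OF prof t]])
    show "AE x in lborel. norm (tkdv G t (real (n + n0)) 0 x * \<psi> x) \<le> W * \<bar>\<psi> x\<bar>" for n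
    proof (rule AE_I2)
      fix x
      show "norm (tkdv G t (real (n + n0)) 0 x * \<psi> x) \<le> W * \<bar>\<psi> x\<bar>"
      proof (cases "\<bar>x\<bar> \<le> L")
        case True
        have "qq t x \<le> qq t L" using qq_le[OF t order_refl True] .
        then have N: "2 * qq t x \<le> real (n + n0)" using n0 by simp
        have "\<bar>tkdv G t (real (n + n0)) 0 x\<bar> \<le> W / sqrt (qq t x)" unfolding W_def by (rule tkdv_bound[OF prof t N])
        also have "\<dots> \<le> W / 1" using W0 qq_ge_1[of t x] by (intro divide_left_mono) auto
        finally show ?thesis by (simp add: abs_mult mult_right_mono)
      qed (use Lz[of x] in auto)
    qed
  qed
  moreover have "(\<lambda>n. 2 * Re (LINT p|lborel. q (n + n0) p * \<theta> p)) \<longlonglongrightarrow> 2 * Re (LINT p|lborel. ?ip p * \<theta> p)"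
    by (intro tendsto_intros LIMSEQ_ignore_initial_segment[OF lim1])
  ultimately have "2 * Re (LINT p|lborel. ?ip p * \<theta> p) = (LINT x|lborel. kdv G t x * \<psi> x)"
    unfolding Reint using LIMSEQ_unique by blast
  then show ?thesis unfolding 2 by simp
qed

section \<open>From the equation in space and time to test functions in space\<close>

lemma represents_cong_AE:
  assumes "represents UNIV S f" "AE x in lborel. f x = g x" "g \<in> borel_measurable borel"
  shows "represents UNIV S g"
proof -
  have fl: "locally_integrable UNIV f" using assms(1) by (simp add: represents_def)
  have fm: "f \<in> borel_measurable borel" by (rule represents_measurable[OF assms(1)])
  have "locally_integrable UNIV g"
    unfolding locally_integrable_def set_integrable_def
  proof (intro allI impI)
    fix K :: "real set" assume K: "compact K \<and> K \<subseteq> UNIV"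
    then have [measurable]: "K \<in> sets borel" by (auto intro: compact_imp_closed borel_closed)
    have i: "integrable lborel (\<lambda>x. indicator K x *\<^sub>R f x)" using fl K by (auto simp: locally_integrable_def set_integrable_def)
    note [measurable] = fm assms(3)
    show "integrable lborel (\<lambda>x. indicator K x *\<^sub>R g x)"
    proof (rule integrable_cong_AE_imp[OF i])
      show "AE x in lborel. indicator K x *\<^sub>R f x = indicator K x *\<^sub>R g x" using assms(2) by eventually_elim simp
    qed measurable
  qed
  moreover have "S \<phi> = (LINT x|lborel. g x * \<phi> x)" if \<phi>: "test_fun UNIV \<phi>" for \<phi>
  proof -
    note [measurable] = fm assms(3) schwartz_measurable[OF test_fun_schwartz[OF \<phi>]]
    have "S \<phi> = (LINT x|lborel. f x * \<phi> x)" using assms(1) \<phi> by (simp add: represents_def)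
    also have "\<dots> = (LINT x|lborel. g x * \<phi> x)"
    proof (rule integral_cong_AE)
      show "AE x in lborel. f x * \<phi> x = g x * \<phi> x" using assms(2) by eventually_elim simp
    qed measurable
    finally show ?thesis .
  qed
  ultimately show ?thesis by (simp add: represents_def)
qed

lemma dir_deriv_product:
  fixes \<phi> \<psi> :: "real \<Rightarrow> real"
  assumes "smooth \<phi>" "smooth \<psi>"
  shows "dir_deriv e (\<lambda>z. \<phi> (fst z) * \<psi> (snd z)) =
    (\<lambda>z. fst e * (dir_deriv 1 \<phi> (fst z) * \<psi> (snd z)) + snd e * (\<phi> (fst z) * dir_deriv 1 \<psi> (snd z)))"
proof
  fix z :: "real \<times> real"
  have d: "(f has_derivative (\<lambda>h. h * dir_deriv 1 f x)) (at x)" if "smooth f" for f :: "real \<Rightarrow> real" and x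
    using smooth_has_vector_derivative[OF that, of x UNIV] by (simp add: has_vector_derivative_def)
  have 1: "((\<lambda>z. \<phi> (fst z)) has_derivative (\<lambda>h. fst h * dir_deriv 1 \<phi> (fst z))) (at z)"
    by (rule has_derivative_compose[OF has_derivative_fst[OF has_derivative_ident] d[OF assms(1)]])
  have 2: "((\<lambda>z. \<psi> (snd z)) has_derivative (\<lambda>h. snd h * dir_deriv 1 \<psi> (snd z))) (at z)"
    by (rule has_derivative_compose[OF has_derivative_snd[OF has_derivative_ident] d[OF assms(2)]])
  from dir_deriv_eqI[OF has_derivative_mult[OF 1 2], of e]
  show "dir_deriv e (\<lambda>z. \<phi> (fst z) * \<psi> (snd z)) z = fst e * (dir_deriv 1 \<phi> (fst z) * \<psi> (snd z)) + snd e * (\<phi> (fst z) * dir_deriv 1 \<psi> (snd z))"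
    by (simp add: mult_ac)
qed

lemma smooth_iter: "smooth f \<Longrightarrow> smooth ((dir_deriv 1 ^^ k) f)" for f :: "real \<Rightarrow> real"
  by (induction k) (auto intro: smooth_dir_deriv)

lemma dir_deriv_product_pow:
  fixes \<phi> \<psi> :: "real \<Rightarrow> real"
  assumes "smooth \<phi>" "smooth \<psi>"
  shows "(dir_deriv (0, 1) ^^ k) (\<lambda>z. \<phi> (fst z) * \<psi> (snd z)) = (\<lambda>z. \<phi> (fst z) * (dir_deriv 1 ^^ k) \<psi> (snd z))"
  by (induction k) (auto simp: dir_deriv_product assms smooth_iter)

lemma test_fun_product:
  fixes \<phi> \<psi> :: "real \<Rightarrow> real"
  assumes "test_fun A \<phi>" "test_fun UNIV \<psi>"
  shows "test_fun (A \<times> UNIV) (\<lambda>z. \<phi> (fst z) * \<psi> (snd z))"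
proof -
  obtain K1 where 1: "smooth \<phi>" "compact K1" "K1 \<subseteq> A" "\<And>x. x \<notin> K1 \<Longrightarrow> \<phi> x = 0" using assms(1) unfolding test_fun_def by blast
  obtain K2 where 2: "smooth \<psi>" "compact K2" "\<And>x. x \<notin> K2 \<Longrightarrow> \<psi> x = 0" using assms(2) unfolding test_fun_def by blast
  have "smooth (\<lambda>z::real\<times>real. \<phi> (0 + fst z) * \<psi> (0 + snd z))"
    by (intro smooth_mult smooth_compose_affine[OF bounded_linear_fst] smooth_compose_affine[OF bounded_linear_snd] 1 2)
  moreover have "compact (K1 \<times> K2)" using 1 2 by (intro compact_Times)
  moreover have "K1 \<times> K2 \<subseteq> A \<times> UNIV" using 1 by auto
  moreover have "\<phi> (fst z) * \<psi> (snd z) = 0" if "z \<notin> K1 \<times> K2" for z using that 1(4) 2(3) by (cases z) auto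
  ultimately show ?thesis unfolding test_fun_def add_0 by (intro conjI exI[of _ "K1 \<times> K2"]) blast+
qed

text \<open>On products \<open>\<phi>(t) \<psi>(x)\<close> the equation says that \<open>t \<mapsto> \<integral> u \<psi>\<close> has the weak derivative
  \<open>\<integral> (u \<psi>\<^sub>x\<^sub>x\<^sub>x + \<epsilon> u\<^sup>3 \<psi>\<^sub>x)\<close> in the open interval; both are continuous up to its end points.\<close>

lemma weak_kdv_of_solution:
  fixes U :: "real \<times> real \<Rightarrow> real" and u :: "real \<Rightarrow> real \<Rightarrow> real"
  assumes ab: "a < b" and c: "continuous_on ({a..b} \<times> UNIV) (\<lambda>(t, x). u t x)"
    and Uu: "\<And>t. t \<in> {a..b} \<Longrightarrow> AE x in lborel. U (t, x) = u t x"
    and U1: "locally_integrable ({a<..<b} \<times> UNIV) U" and U3: "locally_integrable ({a<..<b} \<times> UNIV) (\<lambda>z. U z ^ 3)"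
    and eqn: "\<And>\<phi>::real \<times> real \<Rightarrow> real. test_fun ({a<..<b} \<times> UNIV) \<phi> \<Longrightarrow>
        (LINT z|lborel. U z * (dir_deriv (1, 0) \<phi> z + (dir_deriv (0, 1) ^^ 3) \<phi> z) + \<epsilon> * U z ^ 3 * dir_deriv (0, 1) \<phi> z) = 0"
  shows "weak_kdv \<epsilon> a b u"
  unfolding weak_kdv_def
proof (intro allI impI)
  fix \<psi> :: "real \<Rightarrow> real" and L s t :: real
  assume \<psi>: "smooth \<psi>" "L > 0" "\<forall>x. \<bar>x\<bar> \<ge> L \<longrightarrow> \<psi> x = 0" and st: "a \<le> s" "s \<le> t" "t \<le> b"
  have \<psi>z: "\<psi> x = 0" if "x \<notin> {-L..L}" for x
  proof -
    have "\<bar>x\<bar> \<ge> L" using that unfolding atLeastAtMost_iff by linarith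
    then show ?thesis using \<psi>(3) by blast
  qed
  have \<psi>t: "test_fun UNIV \<psi>" unfolding test_fun_def using \<psi>(1) \<psi>z by (auto intro!: exI[of _ "{-L..L}"])
  let ?d = "\<lambda>k. (dir_deriv 1 ^^ k) \<psi>"
  have dz: "?d k x = 0" if "x \<notin> {-L..L}" for k x
  proof (cases k)
    case (Suc j)
    have "open (- {-L..L})" by (intro open_Compl closed_atLeastAtMost)
    then show ?thesis unfolding Suc by (rule iter_deriv_eq_0[of _ _ 0]) (use \<psi>z that in auto)
  qed (use \<psi>z that in simp)
  have dc: "continuous_on A (?d k)" for A k by (rule iter_deriv_continuous[OF \<psi>(1)])
  define m where "m r = integral {-L..L} (\<lambda>y. u r y * \<psi> y)" for r
  define n where "n r = integral {-L..L} (\<lambda>y. u r y * ?d 3 y + \<epsilon> * u r y ^ 3 * dir_deriv 1 \<psi> y)" for r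
  have c1: "continuous_on ({a..b} \<times> cbox (-L) L) (\<lambda>z. u (fst z) (snd z))"
    using continuous_on_subset[OF c, of "{a..b} \<times> cbox (-L) L"] by (auto simp: split_beta)
  have dcs: "continuous_on ({a..b} \<times> cbox (-L) L) (\<lambda>z. ?d k (snd z))" for k
    by (rule continuous_on_compose2[OF dc[of UNIV]]) (auto intro!: continuous_intros)
  have mc: "continuous_on {a..b} m"
  proof -
    have "continuous_on ({a..b} \<times> cbox (-L) L) (\<lambda>(r, y). u r y * \<psi> y)"
      unfolding split_beta using dcs[of 0] by (intro continuous_intros c1) simp
    from integral_continuous_on_param[OF this] show ?thesis unfolding m_def by simp
  qed
  have nc: "continuous_on {a..b} n"
  proof -
    have "continuous_on ({a..b} \<times> cbox (-L) L) (\<lambda>(r, y). u r y * ?d 3 y + \<epsilon> * u r y ^ 3 * dir_deriv 1 \<psi> y)"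
      unfolding split_beta using dcs[of 1] by (intro continuous_intros c1 dcs) simp
    from integral_continuous_on_param[OF this] show ?thesis unfolding n_def by simp
  qed
  have sl: "continuous_on A (u r)" if "r \<in> {a..b}" for r A
    using continuous_on_compose2[OF c continuous_on_Pair[OF continuous_on_const continuous_on_id], of r A] that
    by (auto simp: image_subset_iff)
  have cs: "(LINT y|lborel. f y) = integral {-L..L} f" if "continuous_on {-L..L} f" "\<And>y. y \<notin> {-L..L} \<Longrightarrow> f y = 0" for f :: "real \<Rightarrow> real"
  proof -
    have "(LINT y|lborel. f y) = (LINT y:{-L..L}|lborel. f y)"
      unfolding set_lebesgue_integral_def using that(2)
      by (intro Bochner_Integration.integral_cong) (auto simp: indicator_def)
    then show ?thesis using set_borel_integral_eq_integral(2)[OF borel_integrable_atLeastAtMost'[OF that(1)]] by simp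
  qed
  have wk: "(LINT r|lborel. \<phi> r *\<^sub>R n r) = - (LINT r|lborel. dir_deriv 1 \<phi> r *\<^sub>R m r)" if \<phi>: "test_fun {a<..<b} \<phi>" for \<phi> :: "real \<Rightarrow> real"
  proof -
    obtain K where K: "smooth \<phi>" "compact K" "K \<subseteq> {a<..<b}" "\<And>x. x \<notin> K \<Longrightarrow> \<phi> x = 0" using \<phi> unfolding test_fun_def by blast
    have K': "dir_deriv 1 \<phi> x = 0" if "x \<notin> K" for x
      using iter_deriv_eq_0[of "-K" \<phi> 0 x 0] K(4) that compact_imp_closed[OF K(2)] by auto
    have \<phi>c: "continuous_on A \<phi>" "continuous_on A (dir_deriv 1 \<phi>)" for A
      using smooth_continuous_on[OF K(1)] smooth_continuous_on[OF smooth_dir_deriv[OF K(1)]] by auto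
    let ?f = "\<lambda>z. \<phi> (fst z) * \<psi> (snd z)"
    let ?A = "\<lambda>z. dir_deriv 1 \<phi> (fst z) * \<psi> (snd z) + \<phi> (fst z) * ?d 3 (snd z)"
    let ?B = "\<lambda>z. \<phi> (fst z) * dir_deriv 1 \<psi> (snd z)"
    have d0: "dir_deriv (1, 0) ?f = (\<lambda>z. dir_deriv 1 \<phi> (fst z) * \<psi> (snd z))" using dir_deriv_product[OF K(1) \<psi>(1), of "(1,0)"] by simp
    have d1: "dir_deriv (0, 1) ?f = ?B" using dir_deriv_product[OF K(1) \<psi>(1), of "(0,1)"] by simp
    have d3: "(dir_deriv (0, 1) ^^ 3) ?f = (\<lambda>z. \<phi> (fst z) * ?d 3 (snd z))" by (rule dir_deriv_product_pow[OF K(1) \<psi>(1)])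
    define \<Lambda> where "\<Lambda> z = U z * ?A z + \<epsilon> * U z ^ 3 * ?B z" for z
    have \<Lambda>0: "(LINT z|lborel. \<Lambda> z) = 0"
      using eqn[OF test_fun_product[OF \<phi> \<psi>t]] unfolding d0 d1 d3 \<Lambda>_def .
    let ?K = "K \<times> {-L..L}"
    have KK: "compact ?K" "?K \<subseteq> {a<..<b} \<times> UNIV" using K by (auto intro: compact_Times)
    have \<phi>s: "continuous_on UNIV (\<lambda>z::real\<times>real. \<phi> (fst z))" "continuous_on UNIV (\<lambda>z::real\<times>real. dir_deriv 1 \<phi> (fst z))"
      by (rule continuous_on_compose2[OF \<phi>c(1)[of UNIV]] continuous_on_compose2[OF \<phi>c(2)[of UNIV]]; auto intro!: continuous_intros)+
    have \<psi>s: "continuous_on UNIV (\<lambda>z::real\<times>real. ?d k (snd z))" for k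
      by (rule continuous_on_compose2[OF dc[of UNIV]]) (auto intro!: continuous_intros)
    have cA: "continuous_on UNIV ?A" using \<psi>s[of 0] by (intro continuous_intros \<phi>s \<psi>s) simp
    have cB: "continuous_on UNIV ?B" using \<psi>s[of 1] by (intro continuous_intros \<phi>s) simp
    have zA: "?A z = 0" "?B z = 0" if "z \<notin> ?K" for z
      using that K(4) K' dz[of "snd z" 0] dz[of "snd z" 1] dz[of "snd z" 3] by (cases z; auto)+
    have int: "integrable lborel (\<lambda>z. V z * C z)" if V: "locally_integrable ({a<..<b} \<times> UNIV) V" and C: "continuous_on UNIV C" "\<And>z. z \<notin> ?K \<Longrightarrow> C z = 0"
      for V C :: "real \<times> real \<Rightarrow> real"
      by (rule integrable_times_compact_support[of ?K, OF _ KK(1) C]) (use V KK in \<open>auto simp: locally_integrable_def\<close>)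
    have i1: "integrable lborel (\<lambda>z. U z * ?A z)" by (rule int[OF U1 cA zA(1)])
    have i3: "integrable lborel (\<lambda>z. U z ^ 3 * ?B z)" by (rule int[OF U3 cB zA(2)])
    have i\<Lambda>: "integrable lborel \<Lambda>"
      unfolding \<Lambda>_def mult.assoc by (intro Bochner_Integration.integrable_add i1 integrable_mult_right i3)
    have "(LINT z|lborel. \<Lambda> z) = (LINT r|lborel. LINT y|lborel. \<Lambda> (r, y))"
      using i\<Lambda> unfolding lborel_prod[symmetric] by (subst lborel_pair.integral_fst') auto
    also have "\<dots> = (LINT r|lborel. dir_deriv 1 \<phi> r *\<^sub>R m r + \<phi> r *\<^sub>R n r)"
    proof (rule Bochner_Integration.integral_cong[OF refl])
      fix r
      show "(LINT y|lborel. \<Lambda> (r, y)) = dir_deriv 1 \<phi> r *\<^sub>R m r + \<phi> r *\<^sub>R n r"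
      proof (cases "r \<in> K")
        case False
        then show ?thesis using K(4) K' by (simp add: \<Lambda>_def)
      next
        case True
        then have r: "r \<in> {a..b}" using K(3) by auto
        note cu = sl[OF r]
        have dc1: "continuous_on A \<psi>" "continuous_on A (dir_deriv 1 \<psi>)" for A using dc[of A 0] dc[of A 1] by auto
        let ?g = "\<lambda>y. dir_deriv 1 \<phi> r * (u r y * \<psi> y) + \<phi> r * (u r y * ?d 3 y + \<epsilon> * u r y ^ 3 * dir_deriv 1 \<psi> y)"
        have cg: "continuous_on A ?g" for A by (intro continuous_intros cu dc dc1)
        have gz: "?g y = 0" if "y \<notin> {-L..L}" for y using dz[OF that, of 0] dz[OF that, of 1] dz[OF that, of 3] by simp
        have UA: "AE y in lborel. U (r, y) = u r y" by (rule Uu[OF r])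
        \<comment> \<open>the integrability of the product makes its slices measurable\<close>
        have Ui: "(\<lambda>y. \<Lambda> (r, y)) \<in> borel_measurable lborel"
        proof -
          have "\<Lambda> \<in> borel_measurable (lborel \<Otimes>\<^sub>M lborel)" using i\<Lambda> unfolding lborel_prod by auto
          then show ?thesis by (rule measurable_compose[rotated]) simp
        qed
        have "(LINT y|lborel. \<Lambda> (r, y)) = (LINT y|lborel. ?g y)"
        proof (rule integral_cong_AE[OF Ui])
          show "?g \<in> borel_measurable lborel" using borel_measurable_continuous_onI[OF cg] by simp
          show "AE y in lborel. \<Lambda> (r, y) = ?g y" using UA by eventually_elim (simp add: \<Lambda>_def algebra_simps)
        qed
        also have "\<dots> = integral {-L..L} ?g" by (rule cs[OF cg gz])
        also have "\<dots> = integral {-L..L} (\<lambda>y. dir_deriv 1 \<phi> r * (u r y * \<psi> y)) + integral {-L..L} (\<lambda>y. \<phi> r * (u r y * ?d 3 y + \<epsilon> * u r y ^ 3 * dir_deriv 1 \<psi> y))"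
          by (rule Henstock_Kurzweil_Integration.integral_add) (intro integrable_continuous_interval continuous_intros cu dc dc1)+
        also have "\<dots> = dir_deriv 1 \<phi> r * m r + \<phi> r * n r" unfolding m_def n_def Henstock_Kurzweil_Integration.integral_mult_right ..
        finally show ?thesis by simp
      qed
    qed
    also have "\<dots> = (LINT r|lborel. dir_deriv 1 \<phi> r *\<^sub>R m r) + (LINT r|lborel. \<phi> r *\<^sub>R n r)"
    proof (rule Bochner_Integration.integral_add)
      have *: "integrable lborel (\<lambda>r. k r *\<^sub>R q r)" if "continuous_on {a..b} k" "continuous_on {a..b} q" "\<And>x. x \<notin> K \<Longrightarrow> k x = 0" for k q :: "real \<Rightarrow> real"
      proof -
        have "set_integrable lborel {a..b} (\<lambda>r. k r *\<^sub>R q r)" by (intro borel_integrable_atLeastAtMost' continuous_intros that)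
        moreover have "indicator {a..b} x *\<^sub>R (k x *\<^sub>R q x) = k x *\<^sub>R q x" for x
        proof (cases "x \<in> {a..b}")
          case False
          then have "x \<notin> K" using K(3) by auto
          then show ?thesis using that(3)[of x] by simp
        qed simp
        ultimately show ?thesis by (simp only: set_integrable_def)
      qed
      show "integrable lborel (\<lambda>r. dir_deriv 1 \<phi> r *\<^sub>R m r)" by (rule *[OF \<phi>c(2) mc K'])
      show "integrable lborel (\<lambda>r. \<phi> r *\<^sub>R n r)" by (rule *[OF \<phi>c(1) nc K(4)])
    qed
    finally show ?thesis using \<Lambda>0 by simp
  qed
  define N where "N r = integral {a..r} n" for r
  have ni: "n integrable_on {a..b}" by (rule integrable_continuous_interval[OF nc])
  have Nc: "continuous_on {a..b} N" unfolding N_def by (rule indefinite_integral_continuous_1[OF ni])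
  have Nd: "N t - N s = integral {s..t} n" if "a \<le> s" "s \<le> t" "t \<le> b" for s t
  proof -
    have "n integrable_on {a..t}" by (rule integrable_on_subinterval[OF ni]) (use that in auto)
    from Henstock_Kurzweil_Integration.integral_combine[OF that(1,2) this] show ?thesis unfolding N_def by linarith
  qed
  have inner: "m t - N t = m s - N s" if "a < s" "s < t" "t < b" for s t
  proof -
    have sub: "{s..t} \<subseteq> {a<..<b}" "{s..t} \<subseteq> {a..b}" using that by auto
    have cn: "continuous_on {s..t} n" using nc sub(2) by (rule continuous_on_subset)
    have "m t - m s = (LINT x:{s..t}|lborel. n x)"
      by (rule weak_derivative_FTC[OF sub(1) that(2) continuous_on_subset[OF mc sub(2)] borel_integrable_atLeastAtMost'[OF cn] wk])
    also have "\<dots> = integral {s..t} n" by (rule set_borel_integral_eq_integral(2)[OF borel_integrable_atLeastAtMost'[OF cn]])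
    also have "\<dots> = N t - N s" using Nd[of s t] that by simp
    finally show ?thesis by simp
  qed
  define c0 where "c0 = m ((a + b) / 2) - N ((a + b) / 2)"
  have const: "m x - N x = c0" if "x \<in> {a<..<b}" for x
  proof -
    have h: "a < (a + b) / 2" "(a + b) / 2 < b" "a < x" "x < b" using that ab by auto
    consider "x < (a + b) / 2" | "x = (a + b) / 2" | "(a + b) / 2 < x" by linarith
    then show ?thesis unfolding c0_def
    proof cases
      case 2
      then show "m x - N x = m ((a + b) / 2) - N ((a + b) / 2)" by (simp only:)
    qed (use inner[OF h(3) _ h(2)] inner[OF h(1) _ h(4)] in simp_all)
  qed
  have const': "m x - N x = c0" if "x \<in> {a..b}" for x
  proof (rule continuous_constant_on_closure[of "{a<..<b}" "\<lambda>x. m x - N x"])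
    show "continuous_on (closure {a<..<b}) (\<lambda>x. m x - N x)" unfolding closure_greaterThanLessThan[OF ab] by (intro continuous_on_diff mc Nc)
    show "x \<in> closure {a<..<b}" using that ab by simp
  qed (use const in auto)
  have "m t - m s = N t - N s" using const'[of t] const'[of s] st by auto
  also have "\<dots> = integral {s..t} n" by (rule Nd[OF st])
  finally show "integral {-L..L} (\<lambda>y. u t y * \<psi> y) - integral {-L..L} (\<lambda>y. u s y * \<psi> y) =
     integral {s..t} (\<lambda>r. integral {-L..L} (\<lambda>y. u r y * (dir_deriv 1 ^^ 3) \<psi> y + \<epsilon> * u r y ^ 3 * dir_deriv 1 \<psi> y))"
    unfolding m_def n_def .
qed

section \<open>Uniqueness and persistence of square integrability\<close>

lemma ac_profile_mono:
  assumes "ac_profile B M G h" "B \<le> B'" "M \<le> M'" shows "ac_profile B' M' G h"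
  using assms unfolding ac_profile_def by (meson order_trans)

lemma interval_around_1:
  fixes T :: real
  assumes "T > 1" shows "0 < 1 / T" "1 / T < T" "1 \<in> {1/T..T}"
proof -
  have "0 < T" using assms by linarith
  then show "0 < 1 / T" by (rule divide_pos_pos[OF zero_less_one])
  from assms show "1 \<in> {1/T..T}" by (simp add: divide_le_eq)
  have "1 / T < 1" using assms by (simp add: divide_less_eq)
  then show "1 / T < T" using assms by (rule less_trans)
qed

text \<open>The interface to the analysis: a solution is given by profiles with uniform bounds that depend continuously on time, and satisfies the equation weakly.\<close>

lemma mKdV_solution_is_kdv:
  assumes T: "T > 1" and u: "u \<in> E_interval {1/T..T}" and sol: "mKdV_solution \<epsilon> {1/T..T} u"
  obtains B M G h where "\<forall>t\<in>{1/T..T}. ac_profile B M (G t) (h t)"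
    "\<forall>s\<in>{1/T..T}. uniform_limit {0<..} G (G s) (at s within {1/T..T})"
    "weak_kdv \<epsilon> (1/T) T (\<lambda>t. kdv (G t) t)"
    "\<forall>t\<in>{1/T..T}. represents UNIV (u t) (\<lambda>x. of_real (kdv (G t) t x))"
proof -
  let ?I = "{1/T..T}"
  note T0 = interval_around_1[OF T]
  have pos: "t > 0" if "t \<in> ?I" for t using that T0(1) by (auto simp del: zero_less_divide_iff zero_less_divide_1_iff)
  from u have td: "u t \<in> tempered_distr" "real_distr (u t)" if "t \<in> ?I" for t using that unfolding E_interval_def by auto
  from u obtain F where F: "\<And>t. t \<in> ?I \<Longrightarrow> represents {0<..} (profile t (u t)) (F t)" "\<And>t. t \<in> ?I \<Longrightarrow> continuous_on {0<..} (F t)"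
    and Ful: "\<And>s. s \<in> ?I \<Longrightarrow> uniform_limit {0<..} F (F s) (at s within ?I)" unfolding E_interval_def by blast
  define K where "K = enn2real (E_interval_norm ?I u)"
  have K0: "K \<ge> 0" by (simp add: K_def)
  have fin: "E_interval_norm ?I u < \<infinity>" using u unfolding E_interval_def by blast
  have E: "E_norm t (u t) \<le> ennreal K" if "t \<in> ?I" for t
  proof -
    have "E_norm t (u t) \<le> E_interval_norm ?I u" unfolding E_interval_norm_def by (rule SUP_upper[OF that])
    then show ?thesis using fin by (simp add: K_def ennreal_enn2real_if)
  qed
  let ?B = "K + 1" and ?M = "(K * T powr (1/6) + 1)\<^sup>2"
  define Q where "Q t G h g \<longleftrightarrow> ac_profile ?B ?M G h \<and> (\<forall>p>0. G p = F t p) \<and> represents UNIV (profile t (u t)) g \<and>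
      (AE p in lborel. cmod (g p) \<le> ?B) \<and> (AE p in lborel. p > 0 \<longrightarrow> g p = G p)" for t G h g
  have "\<forall>t\<in>?I. \<exists>z. Q t (fst z) (fst (snd z)) (snd (snd z))"
  proof
    fix t assume t: "t \<in> ?I"
    have tT: "t \<le> T" using t by simp
    show "\<exists>z. Q t (fst z) (fst (snd z)) (snd (snd z))"
    proof (rule E_norm_profile[OF E[OF t] pos[OF t] tT K0 F(1)[OF t] F(2)[OF t]])
      fix G h g assume "ac_profile ?B ?M G h" "\<And>p. p > 0 \<Longrightarrow> G p = F t p" "represents UNIV (profile t (u t)) g"
        "AE p in lborel. cmod (g p) \<le> ?B" "AE p in lborel. p > 0 \<longrightarrow> g p = G p"
      then have "Q t G h g" unfolding Q_def by blast
      then show "\<exists>z. Q t (fst z) (fst (snd z)) (snd (snd z))" by (intro exI[of _ "(G, h, g)"]) simp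
    qed
  qed
  from bchoice[OF this] obtain z where z: "\<forall>t\<in>?I. Q t (fst (z t)) (fst (snd (z t))) (snd (snd (z t)))" by (rule exE)
  define G h g where "G t = fst (z t)" and "h t = fst (snd (z t))" and "g t = snd (snd (z t))" for t
  have Q: "Q t (G t) (h t) (g t)" if "t \<in> ?I" for t using z that unfolding G_def h_def g_def by (rule bspec)
  have G: "ac_profile ?B ?M (G t) (h t)" "p > 0 \<Longrightarrow> G t p = F t p"
    and g: "represents UNIV (profile t (u t)) (g t)" "AE p in lborel. cmod (g t p) \<le> ?B"
      "AE p in lborel. p > 0 \<longrightarrow> g t p = G t p" if "t \<in> ?I" for t p
    using Q[OF that] unfolding Q_def by blast+
  have ul: "uniform_limit {0<..} G (G s) (at s within ?I)" if s: "s \<in> ?I" for s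
  proof -
    have "\<forall>\<^sub>F t in at s within ?I. \<forall>p\<in>{0<..}. F t p = G t p" unfolding eventually_at_filter using G(2) by (auto intro!: always_eventually)
    then show ?thesis using Ful[OF s] G(2)[OF s] by (subst uniform_limit_cong[where g=F and i="F s"]) (auto elim: eventually_mono)
  qed
  have jc: "continuous_on (?I \<times> UNIV) (\<lambda>(t, x). kdv (G t) t x)"
    by (rule kdv_joint_continuous(1)[OF G(1) ul T0(1)]) auto
  have kc: "continuous_on UNIV (kdv (G t) t)" if "t \<in> ?I" for t
    using continuous_on_compose2[OF jc continuous_on_Pair[OF continuous_on_const continuous_on_id], of t UNIV] that by (auto simp: image_subset_iff)
  from sol obtain U where U: "\<And>t. t \<in> ?I \<Longrightarrow> represents UNIV (u t) (\<lambda>x. of_real (U (t, x)))"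
    "locally_integrable ({1/T<..<T} \<times> UNIV) U" "locally_integrable ({1/T<..<T} \<times> UNIV) (\<lambda>z. U z ^ 3)"
    "\<And>\<phi>::real \<times> real \<Rightarrow> real. test_fun ({1/T<..<T} \<times> UNIV) \<phi> \<Longrightarrow>
        (LINT z|lborel. U z * (dir_deriv (1, 0) \<phi> z + (dir_deriv (0, 1) ^^ 3) \<phi> z) + \<epsilon> * U z ^ 3 * dir_deriv (0, 1) \<phi> z) = 0"
    unfolding mKdV_solution_def interior_atLeastAtMost_real by blast
  have eqU: "AE x in lborel. x \<in> UNIV \<longrightarrow> complex_of_real (U (t, x)) = of_real (kdv (G t) t x)" if t: "t \<in> ?I" for t
  proof (rule locally_integrable_eq_AE[OF open_UNIV])
    show "locally_integrable UNIV (\<lambda>x. complex_of_real (U (t, x)))" using U(1)[OF t] by (simp add: represents_def)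
    show "locally_integrable UNIV (\<lambda>x. complex_of_real (kdv (G t) t x))"
      by (intro continuous_locally_integrable continuous_intros kc t)
    fix \<psi> :: "real \<Rightarrow> real" assume \<psi>: "test_fun UNIV \<psi>"
    have "(LINT x|lborel. complex_of_real (U (t, x)) * of_real (\<psi> x)) = u t (\<lambda>x. of_real (\<psi> x))"
      using U(1)[OF t] test_fun_of_real[OF \<psi>] by (simp add: represents_def)
    also have "\<dots> = of_real (LINT x|lborel. kdv (G t) t x * \<psi> x)"
      by (rule kdv_represents_weakly[OF td[OF t] pos[OF t] G(1)[OF t] g(1)[OF t] g(2)[OF t] g(3)[OF t] \<psi>])
    also have "\<dots> = (LINT x|lborel. of_real (kdv (G t) t x) * of_real (\<psi> x))"
      unfolding of_real_mult[symmetric] by (rule integral_complex_of_real[symmetric])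
    finally show "(LINT x|lborel. complex_of_real (U (t, x)) * of_real (\<psi> x)) = (LINT x|lborel. of_real (kdv (G t) t x) * of_real (\<psi> x))" .
  qed
  then have eqC: "AE x in lborel. complex_of_real (U (t, x)) = of_real (kdv (G t) t x)" if "t \<in> ?I" for t
    using that by simp
  show ?thesis
  proof (rule that)
    show "\<forall>t\<in>?I. ac_profile ?B ?M (G t) (h t)" "\<forall>s\<in>?I. uniform_limit {0<..} G (G s) (at s within ?I)"
      using G(1) ul by blast+
    show "weak_kdv \<epsilon> (1/T) T (\<lambda>t. kdv (G t) t)"
    proof (rule weak_kdv_of_solution[OF T0(2) jc _ U(2-4)])
      show "AE x in lborel. U (t, x) = kdv (G t) t x" if "t \<in> ?I" for t
        using eqC[OF that] by eventually_elim (simp only: of_real_eq_iff)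
    qed
    have "represents UNIV (u t) (\<lambda>x. of_real (kdv (G t) t x))" if t: "t \<in> ?I" for t
      by (rule represents_cong_AE[OF U(1)[OF t] eqC[OF t]]) (intro borel_measurable_continuous_onI continuous_intros kc t)
    then show "\<forall>t\<in>?I. represents UNIV (u t) (\<lambda>x. of_real (kdv (G t) t x))" by blast
  qed
qed

lemma kdv_zero: "kdv (\<lambda>p. 0) t = (\<lambda>x. 0)"
  using limI[OF tendsto_const, of "0 :: complex"] by (intro ext) (simp add: kdv_def oscl_def osc_def)

text \<open>For numbers of opposite sign the difference of the signed squares is \<open>a\<^sup>2 + b\<^sup>2\<close>, which the difference of the squares would not control.\<close>

lemma signed_square_diff: "(a - b)\<^sup>2 \<le> 2 * \<bar>a * \<bar>a\<bar> - b * \<bar>b\<bar>\<bar>" for a b :: real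
proof (cases "a * b \<ge> 0")
  case True
  have "(a - b)\<^sup>2 \<le> \<bar>a - b\<bar> * \<bar>a + b\<bar>"
  proof -
    have "\<bar>a - b\<bar> \<le> \<bar>a + b\<bar>" using True by (auto simp: zero_le_mult_iff)
    then have "\<bar>a - b\<bar> * \<bar>a - b\<bar> \<le> \<bar>a - b\<bar> * \<bar>a + b\<bar>" by (intro mult_left_mono) auto
    then show ?thesis by (simp add: power2_eq_square)
  qed
  also have "\<dots> = \<bar>a * \<bar>a\<bar> - b * \<bar>b\<bar>\<bar>"
  proof -
    from True consider "a \<ge> 0" "b \<ge> 0" | "a \<le> 0" "b \<le> 0" by (auto simp: zero_le_mult_iff)
    then have "a * \<bar>a\<bar> - b * \<bar>b\<bar> = (a - b) * (a + b) \<or> a * \<bar>a\<bar> - b * \<bar>b\<bar> = - ((a - b) * (a + b))"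
      by cases (simp_all add: algebra_simps)
    then show ?thesis unfolding abs_mult[symmetric] by (metis abs_minus_cancel)
  qed
  also have "\<dots> \<le> 2 * \<dots>" using mult_right_mono[OF _ abs_ge_zero, of 1 "2::real"] by simp
  finally show ?thesis .
next
  case False
  then have "(0 < a \<and> b < 0) \<or> (a < 0 \<and> 0 < b)" by (auto simp: not_le mult_less_0_iff)
  then have "\<bar>a * \<bar>a\<bar> - b * \<bar>b\<bar>\<bar> = a\<^sup>2 + b\<^sup>2"
  proof
    assume "0 < a \<and> b < 0"
    then show ?thesis by (simp add: power2_eq_square)
  next
    assume "a < 0 \<and> 0 < b"
    then have "a * \<bar>a\<bar> - b * \<bar>b\<bar> = - (a\<^sup>2 + b\<^sup>2)" by (simp add: power2_eq_square)
    then show ?thesis by (simp only: abs_minus_cancel) simp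
  qed
  moreover have "(a - b)\<^sup>2 \<le> 2 * (a\<^sup>2 + b\<^sup>2)" using zero_le_power2[of "a + b"] by (simp add: power2_eq_square algebra_simps)
  ultimately show ?thesis by simp
qed

text \<open>Scheffe's lemma for the signed squares \<open>f \<bar>f\<bar>\<close>.\<close>

lemma L2_convergence:
  fixes F :: "nat \<Rightarrow> real \<Rightarrow> real"
  assumes [measurable]: "\<And>n. F n \<in> borel_measurable borel" "f \<in> borel_measurable borel"
    and fin: "\<And>n. (\<integral>\<^sup>+x. ennreal ((F n x)\<^sup>2) \<partial>lborel) < \<infinity>" "(\<integral>\<^sup>+x. ennreal ((f x)\<^sup>2) \<partial>lborel) < \<infinity>"
    and lim: "\<And>x. (\<lambda>n. F n x) \<longlonglongrightarrow> f x"
    and le: "limsup (\<lambda>n. \<integral>\<^sup>+x. ennreal ((F n x)\<^sup>2) \<partial>lborel) \<le> (\<integral>\<^sup>+x. ennreal ((f x)\<^sup>2) \<partial>lborel)"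
  shows "(\<lambda>n. \<integral>\<^sup>+x. ennreal ((F n x - f x)\<^sup>2) \<partial>lborel) \<longlonglongrightarrow> 0"
proof -
  let ?s = "\<lambda>r::real. r * \<bar>r\<bar>"
  have s: "norm (?s r) = r\<^sup>2" for r :: real by (simp add: abs_mult power2_eq_square)
  have "(\<lambda>n. \<integral>\<^sup>+x. norm (?s (F n x) - ?s (f x)) \<partial>lborel) \<longlonglongrightarrow> 0"
  proof (rule Scheffe_lemma1)
    show "integrable lborel (\<lambda>x. ?s (F n x))" for n
      by (rule integrableI_bounded) (use fin(1)[of n] in \<open>simp_all only: s\<close>, measurable)
    show "integrable lborel (\<lambda>x. ?s (f x))"
      by (rule integrableI_bounded) (use fin(2) in \<open>simp_all only: s\<close>, measurable)
    show "AE x in lborel. (\<lambda>n. ?s (F n x)) \<longlonglongrightarrow> ?s (f x)" by (intro AE_I2 tendsto_intros lim)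
    show "limsup (\<lambda>n. \<integral>\<^sup>+x. ennreal (norm (?s (F n x))) \<partial>lborel) \<le> (\<integral>\<^sup>+x. ennreal (norm (?s (f x))) \<partial>lborel)" unfolding s by (rule le)
  qed
  from ennreal_tendsto_cmult[OF _ this, of 2]
  have z: "(\<lambda>n. 2 * (\<integral>\<^sup>+x. norm (?s (F n x) - ?s (f x)) \<partial>lborel)) \<longlonglongrightarrow> 0" by simp
  have "(\<integral>\<^sup>+x. ennreal ((F n x - f x)\<^sup>2) \<partial>lborel) \<le> 2 * (\<integral>\<^sup>+x. norm (?s (F n x) - ?s (f x)) \<partial>lborel)" for n
  proof -
    have "(\<integral>\<^sup>+x. ennreal ((F n x - f x)\<^sup>2) \<partial>lborel) \<le> (\<integral>\<^sup>+x. ennreal (2 * \<bar>?s (F n x) - ?s (f x)\<bar>) \<partial>lborel)"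
      by (intro nn_integral_mono ennreal_leI signed_square_diff)
    also have "\<dots> = 2 * (\<integral>\<^sup>+x. norm (?s (F n x) - ?s (f x)) \<partial>lborel)"
      by (simp add: ennreal_mult nn_integral_cmult)
    finally show ?thesis .
  qed
  then show ?thesis by (intro tendsto_sandwich[OF _ _ tendsto_const z]) auto
qed

lemma L2_norm_le:
  assumes "represents UNIV S g" "(\<integral>\<^sup>+x. ennreal ((cmod (g x))\<^sup>2) \<partial>lborel) \<le> c\<^sup>2"
  shows "L2_norm UNIV S \<le> c"
  unfolding L2_norm_def by (rule Inf_lower) (use assms in auto)

lemma L2_norm_square_integrable:
  assumes "L2_norm UNIV S < \<infinity>" "represents UNIV S g"
  shows "(\<integral>\<^sup>+x. ennreal ((cmod (g x))\<^sup>2) \<partial>lborel) < \<infinity>"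
proof -
  obtain c f where c: "c < \<infinity>" "represents UNIV S f" "(\<integral>\<^sup>+x. ennreal ((cmod (f x))\<^sup>2) \<partial>lborel) \<le> c\<^sup>2"
    using assms(1) unfolding L2_norm_def Inf_less_iff by auto
  have "(\<integral>\<^sup>+x. ennreal ((cmod (g x))\<^sup>2) \<partial>lborel) = (\<integral>\<^sup>+x. ennreal ((cmod (f x))\<^sup>2) \<partial>lborel)"
    by (rule nn_integral_cong_AE) (use represents_unique_AE[OF open_UNIV c(2) assms(2)] in eventually_elim, simp)
  also have "\<dots> < \<infinity>" using c(3) by (rule le_less_trans) (use c(1) in \<open>simp add: power_less_top_ennreal\<close>)
  finally show ?thesis .
qed

lemma represents_diff:
  assumes "represents UNIV S f" "represents UNIV S' g"
  shows "represents UNIV (\<lambda>\<phi>. S \<phi> - S' \<phi>) (\<lambda>x. f x - g x)"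
  unfolding represents_def
proof (intro conjI allI impI)
  show "locally_integrable UNIV (\<lambda>x. f x - g x)"
    using assms unfolding represents_def locally_integrable_def by (auto intro: set_integral_diff)
  fix \<phi> :: "real \<Rightarrow> complex" assume \<phi>: "test_fun UNIV \<phi>"
  show "S \<phi> - S' \<phi> = (LINT x|lborel. (f x - g x) * \<phi> x)"
    unfolding left_diff_distrib
    by (subst Bochner_Integration.integral_diff) (use assms \<phi> integrable_times_test_fun in \<open>auto simp: represents_def\<close>)
qed

lemma mKdV_uniqueness:
  assumes eps: "\<bar>\<epsilon>\<bar> \<le> 1" and T: "T > 1"
    and u: "u \<in> E_interval {1/T..T}" "mKdV_solution \<epsilon> {1/T..T} u"
    and v: "v \<in> E_interval {1/T..T}" "mKdV_solution \<epsilon> {1/T..T} v"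
    and eq: "u 1 = v 1" and t: "t \<in> {1/T..T}"
  shows "u t = v t"
proof -
  note T0 = interval_around_1[OF T]
  obtain B M G h where H: "\<forall>t\<in>{1/T..T}. ac_profile B M (G t) (h t)"
    "\<forall>s\<in>{1/T..T}. uniform_limit {0<..} G (G s) (at s within {1/T..T})"
    "weak_kdv \<epsilon> (1/T) T (\<lambda>t. kdv (G t) t)"
    "\<forall>t\<in>{1/T..T}. represents UNIV (u t) (\<lambda>x. of_real (kdv (G t) t x))"
    by (rule mKdV_solution_is_kdv[OF T u])
  note G = H(1,2)[rule_format] H(3) H(4)[rule_format]
  obtain B' M' G' h' where H': "\<forall>t\<in>{1/T..T}. ac_profile B' M' (G' t) (h' t)"
    "\<forall>s\<in>{1/T..T}. uniform_limit {0<..} G' (G' s) (at s within {1/T..T})"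
    "weak_kdv \<epsilon> (1/T) T (\<lambda>t. kdv (G' t) t)"
    "\<forall>t\<in>{1/T..T}. represents UNIV (v t) (\<lambda>x. of_real (kdv (G' t) t x))"
    by (rule mKdV_solution_is_kdv[OF T v])
  note G' = H'(1,2)[rule_format] H'(3) H'(4)[rule_format]
  interpret two_kdv \<epsilon> "1/T" T "max B B'" "max M M'" G h G' h'
  proof (rule two_kdv.intro)
    show "ac_profile (max B B') (max M M') (G t) (h t)" if "t \<in> {1/T..T}" for t
      by (rule ac_profile_mono[OF G(1)[OF that]]) auto
    show "ac_profile (max B B') (max M M') (G' t) (h' t)" if "t \<in> {1/T..T}" for t
      by (rule ac_profile_mono[OF G'(1)[OF that]]) auto
  qed (use T0 eps G(2,3) G'(2,3) in auto)
  have wm: "w t \<in> borel_measurable lborel" if "t \<in> {1/T..T}" for t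
    using borel_measurable_continuous_onI[OF slice[OF jc(3) that]] by simp
  have "AE x in lborel. complex_of_real (kdv (G 1) 1 x) = of_real (kdv (G' 1) 1 x)"
    using represents_unique_AE[OF open_UNIV G(4)[OF T0(3), unfolded eq] G'(4)[OF T0(3)]] by simp
  then have "(\<integral>\<^sup>+x. ennreal ((w 1 x)\<^sup>2) \<partial>lborel) = (\<integral>\<^sup>+x. 0 \<partial>(lborel :: real measure))"
    by (intro nn_integral_cong_AE) (auto simp: w_def u1_def u2_def elim: eventually_mono)
  then have "(\<integral>\<^sup>+x. ennreal ((w t x)\<^sup>2) \<partial>lborel) = 0"
    using L2_growth[OF T0(3) t] by simp
  then have "AE x in lborel. ennreal ((w t x)\<^sup>2) = 0"
    by (subst (asm) nn_integral_0_iff_AE) (intro measurable_compose[OF _ measurable_ennreal] borel_measurable_power wm[OF t], simp)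
  then have wz: "AE x in lborel. complex_of_real (kdv (G t) t x) = of_real (kdv (G' t) t x)"
    by eventually_elim (simp add: w_def u1_def u2_def ennreal_eq_0_iff)
  show ?thesis
  proof (rule tempered_eqI)
    show "u t \<in> tempered_distr" "v t \<in> tempered_distr" using u(1) v(1) t unfolding E_interval_def by auto
    fix \<phi> :: "real \<Rightarrow> complex" assume \<phi>: "test_fun UNIV \<phi>"
    have "u t \<phi> = (LINT x|lborel. of_real (kdv (G t) t x) * \<phi> x)" using G(4)[OF t] \<phi> by (simp add: represents_def)
    also have "\<dots> = (LINT x|lborel. of_real (kdv (G' t) t x) * \<phi> x)"
    proof (rule integral_cong_AE)
      show "(\<lambda>x. of_real (kdv (G t) t x) * \<phi> x) \<in> borel_measurable lborel" "(\<lambda>x. of_real (kdv (G' t) t x) * \<phi> x) \<in> borel_measurable lborel"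
        using G(4)[OF t] G'(4)[OF t] unfolding represents_def by (metis borel_measurable_integrable integrable_times_test_fun[OF _ \<phi>])+
      show "AE x in lborel. of_real (kdv (G t) t x) * \<phi> x = of_real (kdv (G' t) t x) * \<phi> x"
        using wz by eventually_elim simp
    qed
    also have "\<dots> = v t \<phi>" using G'(4)[OF t] \<phi> by (simp add: represents_def)
    finally show "u t \<phi> = v t \<phi>" .
  qed
qed

text \<open>The growth estimate from \<open>s\<close> to \<open>t\<close> gives \<open>limsup N(t) \<le> N(s)\<close> for the square norm \<open>N\<close>, which Scheffe's lemma asks for besides pointwise convergence.\<close>

lemma mKdV_L2_persistence:
  assumes eps: "\<bar>\<epsilon>\<bar> \<le> 1" and T: "T > 1"
    and u: "u \<in> E_interval {1/T..T}" "mKdV_solution \<epsilon> {1/T..T} u" and L2: "L2_norm UNIV (u 1) < \<infinity>"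
  shows "continuous_L2 {1/T..T} u"
proof -
  let ?I = "{1/T..T}"
  note T0 = interval_around_1[OF T]
  obtain B M G h where H: "\<forall>t\<in>?I. ac_profile B M (G t) (h t)"
    "\<forall>s\<in>?I. uniform_limit {0<..} G (G s) (at s within ?I)"
    "weak_kdv \<epsilon> (1/T) T (\<lambda>t. kdv (G t) t)"
    "\<forall>t\<in>?I. represents UNIV (u t) (\<lambda>x. of_real (kdv (G t) t x))"
    by (rule mKdV_solution_is_kdv[OF T u])
  note G = H(1,2)[rule_format] H(3) H(4)[rule_format]
  \<comment> \<open>comparison with the zero solution\<close>
  interpret two_kdv \<epsilon> "1/T" T B M G h "\<lambda>_ _. 0" "\<lambda>_ _. 0"
  proof (rule two_kdv.intro)
    show "ac_profile B M (\<lambda>_. 0) (\<lambda>_. 0)" if "t \<in> ?I" for t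
      using ac_profileD(1,2)[OF G(1)[OF that]] by (simp add: ac_profile_def)
    show "weak_kdv \<epsilon> (1/T) T (\<lambda>t. kdv (\<lambda>_. 0) t)" by (simp add: weak_kdv_def kdv_zero)
  qed (use T0 eps G(1-3) in \<open>auto intro: uniform_limit_const\<close>)
  have w: "w t x = kdv (G t) t x" for t x by (simp add: w_def u1_def u2_def kdv_zero)
  have wc: "continuous_on UNIV (w t)" if "t \<in> ?I" for t by (rule slice[OF jc(3) that])
  define N where "N t = (\<integral>\<^sup>+x. ennreal ((w t x)\<^sup>2) \<partial>lborel)" for t
  have "N 1 < \<infinity>" using L2_norm_square_integrable[OF L2 G(4)[OF T0(3)]] by (simp add: N_def w)
  have Nfin: "N t < \<infinity>" if "t \<in> ?I" for t
  proof -
    have "N t \<le> ennreal (exp (C0 * \<bar>t - 1\<bar>)) * N 1" unfolding N_def by (rule L2_growth[OF T0(3) that])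
    also have "\<dots> < \<infinity>" using \<open>N 1 < \<infinity>\<close> by (simp add: ennreal_mult_less_top)
    finally show ?thesis .
  qed
  have conv: "(\<lambda>n. \<integral>\<^sup>+x. ennreal ((w (X n) x - w s x)\<^sup>2) \<partial>lborel) \<longlonglongrightarrow> 0"
    if s: "s \<in> ?I" and X: "\<And>n. X n \<in> ?I" "X \<longlonglongrightarrow> s" for s and X :: "nat \<Rightarrow> real"
  proof (rule L2_convergence)
    show "w (X n) \<in> borel_measurable borel" for n by (rule borel_measurable_continuous_onI[OF wc[OF X(1)]])
    show "w s \<in> borel_measurable borel" by (rule borel_measurable_continuous_onI[OF wc[OF s]])
    show "(\<integral>\<^sup>+x. ennreal ((w (X n) x)\<^sup>2) \<partial>lborel) < \<infinity>" for n using Nfin[OF X(1)] unfolding N_def .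
    show "(\<integral>\<^sup>+x. ennreal ((w s x)\<^sup>2) \<partial>lborel) < \<infinity>" using Nfin[OF s] unfolding N_def .
    show "(\<lambda>n. w (X n) x) \<longlonglongrightarrow> w s x" for x
    proof -
      have "continuous_on ?I (\<lambda>t. w t x)"
        using continuous_on_compose2[OF jc(3) continuous_on_Pair[OF continuous_on_id continuous_on_const], of x ?I] by (auto simp: image_subset_iff)
      then show ?thesis using s X by (auto simp: continuous_on_sequentially comp_def)
    qed
    have "(\<lambda>n. ennreal (exp (C0 * \<bar>X n - s\<bar>))) \<longlonglongrightarrow> ennreal (exp (C0 * \<bar>s - s\<bar>))"
      by (intro tendsto_intros X)
    from ennreal_tendsto_cmult[OF Nfin[OF s, unfolded infinity_ennreal_def] this]
    have "(\<lambda>n. ennreal (exp (C0 * \<bar>X n - s\<bar>)) * N s) \<longlonglongrightarrow> N s" unfolding mult.commute[of "N s"] by simp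
    then have "limsup (\<lambda>n. ennreal (exp (C0 * \<bar>X n - s\<bar>)) * N s) = N s"
      by (subst lim_imp_Limsup) auto
    moreover have "limsup (\<lambda>n. N (X n)) \<le> limsup (\<lambda>n. ennreal (exp (C0 * \<bar>X n - s\<bar>)) * N s)"
      unfolding N_def by (intro Limsup_mono always_eventually allI L2_growth s X)
    ultimately show "limsup (\<lambda>n. \<integral>\<^sup>+x. ennreal ((w (X n) x)\<^sup>2) \<partial>lborel) \<le> (\<integral>\<^sup>+x. ennreal ((w s x)\<^sup>2) \<partial>lborel)"
      unfolding N_def by simp
  qed
  show ?thesis
    unfolding continuous_L2_def
  proof (intro conjI ballI)
    fix t assume t: "t \<in> ?I"
    obtain r where r: "r \<ge> 0" "N t = ennreal r" using Nfin[OF t] by (cases "N t") auto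
    have "L2_norm UNIV (u t) \<le> ennreal (sqrt r)"
    proof (rule L2_norm_le[OF G(4)[OF t]])
      show "(\<integral>\<^sup>+x. ennreal ((cmod (complex_of_real (kdv (G t) t x)))\<^sup>2) \<partial>lborel) \<le> (ennreal (sqrt r))\<^sup>2"
        using r by (simp add: N_def w ennreal_power)
    qed
    then show "L2_norm UNIV (u t) < \<infinity>" by (rule le_less_trans) simp
  next
    fix s assume s: "s \<in> ?I"
    show "((\<lambda>t. L2_norm UNIV (\<lambda>\<phi>. u t \<phi> - u s \<phi>)) \<longlongrightarrow> 0) (at s within ?I)"
      unfolding tendsto_at_iff_sequentially
    proof (intro allI impI)
      fix X :: "nat \<Rightarrow> real" assume X: "\<forall>i. X i \<in> ?I - {s}" "X \<longlonglongrightarrow> s"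
      then have XI: "X n \<in> ?I" for n by auto
      show "((\<lambda>t. L2_norm UNIV (\<lambda>\<phi>. u t \<phi> - u s \<phi>)) \<circ> X) \<longlonglongrightarrow> 0"
        unfolding comp_def
      proof (rule order_tendstoI)
        fix c :: ennreal assume "0 < c"
        then obtain e where e: "0 < ennreal e" "ennreal e < c" "e > 0"
          by (metis dense ennreal_0 ennreal_cases ennreal_less_zero_iff infinity_ennreal_def not_less_iff_gr_or_eq top.not_eq_extremum)
        have "\<forall>\<^sub>F n in sequentially. (\<integral>\<^sup>+x. ennreal ((w (X n) x - w s x)\<^sup>2) \<partial>lborel) < (ennreal e)\<^sup>2"
          by (rule order_tendstoD(2)[OF conv[OF s XI X(2)]]) (use e in \<open>simp add: ennreal_power\<close>)
        then show "\<forall>\<^sub>F n in sequentially. L2_norm UNIV (\<lambda>\<phi>. u (X n) \<phi> - u s \<phi>) < c"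
        proof eventually_elim
          case (elim n)
          have "L2_norm UNIV (\<lambda>\<phi>. u (X n) \<phi> - u s \<phi>) \<le> ennreal e"
          proof (rule L2_norm_le[OF represents_diff[OF G(4)[OF XI] G(4)[OF s]]])
            show "(\<integral>\<^sup>+x. ennreal ((cmod (complex_of_real (kdv (G (X n)) (X n) x) - of_real (kdv (G s) s x)))\<^sup>2) \<partial>lborel) \<le> (ennreal e)\<^sup>2"
              using elim unfolding of_real_diff[symmetric] norm_of_real by (simp add: w)
          qed
          then show ?case using e(2) by (rule le_less_trans)
        qed
      qed simp
    qed
  qed
qed

theorem proposition4:
  fixes \<epsilon> T :: real and u\<^sub>1 :: distr and u :: "real \<Rightarrow> distr"
  assumes "\<epsilon> \<in> {1, -1}"
    and "u\<^sub>1 \<in> E_one" and "L2_norm UNIV u\<^sub>1 < \<infinity>"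
    and "T > 1"
    and "u \<in> E_interval {1/T..T}" and "mKdV_solution \<epsilon> {1/T..T} u" and "u 1 = u\<^sub>1"
  shows "(\<forall>v\<in>E_interval {1/T..T}. mKdV_solution \<epsilon> {1/T..T} v \<and> v 1 = u\<^sub>1 \<longrightarrow>
            (\<forall>t\<in>{1/T..T}. v t = u t))
         \<and> continuous_L2 {1/T..T} u"
proof -
  have eps: "\<bar>\<epsilon>\<bar> \<le> 1" using assms(1) by auto
  have "v t = u t" if "v \<in> E_interval {1/T..T}" "mKdV_solution \<epsilon> {1/T..T} v" "v 1 = u\<^sub>1" "t \<in> {1/T..T}" for v t
    by (rule mKdV_uniqueness[OF eps assms(4) that(1,2) assms(5,6) _ that(4)]) (use that(3) assms(7) in simp)
  moreover have "continuous_L2 {1/T..T} u"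
    by (rule mKdV_L2_persistence[OF eps assms(4-6)]) (use assms(3,7) in simp)
  ultimately show ?thesis by blast
qed

end
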